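(* Let $0<s<1$ and let $\Omega\subset\mathbb R^n$ be a nonempty bounded open set with Lipschitz continuous boundary, $\Omega_e:=\mathbb R^n\setminus\Omega$. Let $\theta_0>0$, let $\theta\in L^\infty(\Omega_e)$ with $\theta\ge\theta_0$ a.e. in $\Omega_e$, and let $\theta'\in L^\infty(\Omega_e)$ with $\theta-\theta'\ne0$ a.e. in $\Omega_e$. Let $q\in C(\overline\Omega)$ satisfy $q\ge q_0>0$ for some constant $q_0$, let $f\in L^2(\Omega_e)$, and let $u\in V$ be the unique $L^\infty$-weak solution of the Robin problem $$(-\Delta)^su+qu=0\ \text{ in }\Omega,\qquad\mathcal N_su+\theta u=f\ \text{ in }\Omega_e.$$ Let $R f:=R^{q,\infty}_{\theta,\theta'}f=f+(\theta'-\theta)u|_{\Omega_e}$. Suppose that either (i) $0<s<1/2$, or (ii) $1/2\le s<1$, the Robin-to-Robin data $(f,Rf)$ are of $H^s$ regularity in a neighborhood of $\Omega$, and $\frac1{\theta'-\theta}$ is bounded and Lipschitz continuous near $\partial\Omega$. Then $u|_\Omega$ can be reconstructed from (i.e. is determined by) the knowledge of $(f,Rf)\in(L^2(\Omega_e))^2$, and $$q(x)=-\frac{(-\Delta)^su(x)}{u(x)},\qquad\forall x\in\Omega.$$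
   Context: $(-\Delta)^su(x)=C_{n,s}\,\mathrm{P.V.}\int_{\mathbb R^n}\frac{u(x)-u(y)}{|x-y|^{n+2s}}dy$, $C_{n,s}=\frac{s2^{2s}\Gamma((2s+n)/2)}{\pi^{n/2}\Gamma(1-s)}$. Nonlocal normal derivative: $\mathcal N_su(x)=C_{n,s}\int_\Omega\frac{u(x)-u(y)}{|x-y|^{n+2s}}dy$ for $x\in\Omega_e$. Energy form: $$\mathcal E(u,v)=\frac{C_{n,s}}2\iint_{(\mathbb R^n\times\mathbb R^n)\setminus\Omega_e^2}\frac{(u(x)-u(y))(v(x)-v(y))}{|x-y|^{n+2s}}dy\,dx.$$ $V=\{u\in L^2(\mathbb R^n):\mathcal E(u,u)<\infty\}$ with $\|u\|_V^2=\|u\|_{L^2(\mathbb R^n)}^2+\mathcal E(u,u)$. An $L^\infty$-weak solution of the Robin problem is $u\in V$ with $\mathcal E(u,v)+(qu,v)_{L^2(\Omega)}+(\theta u,v)_{L^2(\Omega_e)}=(f,v)_{L^2(\Omega_e)}$ for all $v\in V$. The $L^\infty$-Robin-to-Robin map is $R^{q,\infty}_{\theta,\theta'}:L^2(\Omega_e)\to L^2(\Omega_e)$, $f=\mathcal N_su+\theta u\mapsto\mathcal N_su+\theta'u=f+(\theta'-\theta)u$. Condition (ii) means: there is an open set $\Omega_0$ with $\overline\Omega\subset\Omega_0$ such that $f,Rf\in H^s(\Omega_0\setminus\overline\Omega)$ and $\frac1{\theta'-\theta}$ is bounded and Lipschitz continuous on $\Omega_0\setminus\Omega$. "Determined by $(f,Rf)$"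 means: with $n,s,\Omega,\theta,\theta'$ fixed and known and $q$ unknown, $u|_\Omega$ is a function of the pair $(f,Rf)$.
   Formalization: The formula for q(x) is asserted only at x in Ω where u(x) ≠ 0 (u being its representative continuous in Ω), since the quotient is undefined at zeros, e.g. everywhere if f = 0; for f ≠ 0 the set where u ≠ 0 is shown to be dense in Ω. *)

theory Defs
  imports "HOL-Analysis.Analysis"
begin

text \<open>
  \<open>\<real>\<^sup>n\<close> is \<open>real^'n\<close> with \<open>n = CARD('n)\<close>. All functions are real-valued; elements of
  \<open>L\<^sup>2\<close> and \<open>L\<^sup>\<infinity>\<close> are given by Borel representatives (every class has one), and
  equality of classes is equality almost everywhere. Functions on a subset are total functions of
  which only the values on that subset matter. The exterior \<open>\<Omega>\<^sub>e = \<real>\<^sup>n - \<Omega>\<close> is \<open>- \<Omega>\<close>.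
\<close>

definition L2_fun :: "(real^'n) set \<Rightarrow> (real^'n \<Rightarrow> real) \<Rightarrow> bool" where
  "L2_fun A f \<longleftrightarrow>
     set_borel_measurable lborel A f \<and> set_integrable lborel A (\<lambda>x. (f x)\<^sup>2)"

definition Linf_fun :: "(real^'n) set \<Rightarrow> (real^'n \<Rightarrow> real) \<Rightarrow> bool" where
  "Linf_fun A f \<longleftrightarrow>
     set_borel_measurable lborel A f \<and> (\<exists>M. AE x in lborel. x \<in> A \<longrightarrow> \<bar>f x\<bar> \<le> M)"

text \<open>
  Near each boundary point the set is the strict hypograph, in some direction \<open>e\<close>, of a Lipschitz
  function on the hyperplane orthogonal to \<open>e\<close>.
\<close>

definition lipschitz_boundary :: "(real^'n) set \<Rightarrow> bool" where
  "lipschitz_boundary \<Omega> \<longleftrightarrow>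
     (\<forall>z\<in>frontier \<Omega>. \<exists>r>0. \<exists>e L \<gamma>. norm e = 1 \<and> L-lipschitz_on {y. y \<bullet> e = 0} \<gamma> \<and>
        \<Omega> \<inter> ball z r = {x \<in> ball z r. x \<bullet> e < \<gamma> (x - (x \<bullet> e) *\<^sub>R e)})"

definition frac_const :: "nat \<Rightarrow> real \<Rightarrow> real" where
  "frac_const n s =
     s * 2 powr (2 * s) * Gamma ((2 * s + real n) / 2) / (pi powr (real n / 2) * Gamma (1 - s))"

text \<open>The principal value is the limit of the integrals over complements of small balls.\<close>

definition has_frac_laplacian ::
  "real \<Rightarrow> (real^'n \<Rightarrow> real) \<Rightarrow> real^'n \<Rightarrow> real \<Rightarrow> bool" where
  "has_frac_laplacian s u x l \<longleftrightarrow>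
     ((\<lambda>\<epsilon>. frac_const CARD('n) s *
         (LINT y:(- ball x \<epsilon>)|lborel. (u x - u y) / norm (x - y) powr (real CARD('n) + 2 * s)))
      \<longlongrightarrow> l) (at_right 0)"

definition frac_laplacian :: "real \<Rightarrow> (real^'n \<Rightarrow> real) \<Rightarrow> real^'n \<Rightarrow> real" where
  "frac_laplacian s u x = (THE l. has_frac_laplacian s u x l)"

definition energy_integrand ::
  "real \<Rightarrow> (real^'n \<Rightarrow> real) \<Rightarrow> (real^'n \<Rightarrow> real) \<Rightarrow> (real^'n) \<times> (real^'n) \<Rightarrow> real" where
  "energy_integrand s u v =
     (\<lambda>(x, y). (u x - u y) * (v x - v y) / norm (x - y) powr (real CARD('n) + 2 * s))"

definition energy ::
  "real \<Rightarrow> (real^'n) set \<Rightarrow> (real^'n \<Rightarrow> real) \<Rightarrow> (real^'n \<Rightarrow> real) \<Rightarrow> real" where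
  "energy s \<Omega> u v =
     frac_const CARD('n) s / 2 * (LINT z:(- ((- \<Omega>) \<times> (- \<Omega>)))|lborel. energy_integrand s u v z)"

text \<open>
  The condition \<open>\<E>(u,u) < \<infinity>\<close> is integrability of the nonnegative integrand; the real-valued
  \<^const>\<open>energy\<close> alone could not express it.
\<close>

definition energy_space :: "real \<Rightarrow> (real^'n) set \<Rightarrow> (real^'n \<Rightarrow> real) set" where
  "energy_space s \<Omega> =
     {u. L2_fun UNIV u \<and> set_integrable lborel (- ((- \<Omega>) \<times> (- \<Omega>))) (energy_integrand s u u)}"

definition robin_weak_solution ::
  "real \<Rightarrow> (real^'n) set \<Rightarrow> (real^'n \<Rightarrow> real) \<Rightarrow> (real^'n \<Rightarrow> real) \<Rightarrow>
   (real^'n \<Rightarrow> real) \<Rightarrow> (real^'n \<Rightarrow> real) \<Rightarrow> bool" where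
  "robin_weak_solution s \<Omega> q \<theta> f u \<longleftrightarrow>
     u \<in> energy_space s \<Omega> \<and>
     (\<forall>v\<in>energy_space s \<Omega>.
        energy s \<Omega> u v + (LINT x:\<Omega>|lborel. q x * u x * v x)
          + (LINT x:(- \<Omega>)|lborel. \<theta> x * u x * v x)
        = (LINT x:(- \<Omega>)|lborel. f x * v x))"

text \<open>
  The graph of the Robin-to-Robin map: \<open>g\<close> is a representative of the class \<open>R f\<close>.
\<close>

definition robin_to_robin ::
  "real \<Rightarrow> (real^'n) set \<Rightarrow> (real^'n \<Rightarrow> real) \<Rightarrow> (real^'n \<Rightarrow> real) \<Rightarrow> (real^'n \<Rightarrow> real) \<Rightarrow>
   (real^'n \<Rightarrow> real) \<Rightarrow> (real^'n \<Rightarrow> real) \<Rightarrow> bool" where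
  "robin_to_robin s \<Omega> q \<theta> \<theta>' f g \<longleftrightarrow>
     L2_fun (- \<Omega>) g \<and>
     (\<exists>u. robin_weak_solution s \<Omega> q \<theta> f u \<and>
        (AE x in lborel. x \<in> - \<Omega> \<longrightarrow> g x = f x + (\<theta>' x - \<theta> x) * u x))"

text \<open>
  \<open>H\<^sup>s(A)\<close>, \<open>0 < s < 1\<close>, with the Gagliardo seminorm. Every restriction to \<open>A\<close> of an element of
  \<open>H\<^sup>s(\<real>\<^sup>n)\<close> belongs to it.
\<close>

definition Hs_fun :: "real \<Rightarrow> (real^'n) set \<Rightarrow> (real^'n \<Rightarrow> real) \<Rightarrow> bool" where
  "Hs_fun s A f \<longleftrightarrow> L2_fun A f \<and> set_integrable lborel (A \<times> A) (energy_integrand s f f)"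

text \<open>
  Since \<open>\<theta>\<close> and \<open>\<theta>'\<close> are classes, \<open>1 / (\<theta>' - \<theta>)\<close> is bounded and Lipschitz if it agrees
  almost everywhere with such a function \<open>h\<close>.
\<close>

definition robin_data_regular ::
  "real \<Rightarrow> (real^'n) set \<Rightarrow> (real^'n \<Rightarrow> real) \<Rightarrow> (real^'n \<Rightarrow> real) \<Rightarrow>
   (real^'n \<Rightarrow> real) \<Rightarrow> (real^'n \<Rightarrow> real) \<Rightarrow> bool" where
  "robin_data_regular s \<Omega> \<theta> \<theta>' f g \<longleftrightarrow>
     (\<exists>\<Omega>\<^sub>0. open \<Omega>\<^sub>0 \<and> closure \<Omega> \<subseteq> \<Omega>\<^sub>0 \<and>
        Hs_fun s (\<Omega>\<^sub>0 - closure \<Omega>) f \<and> Hs_fun s (\<Omega>\<^sub>0 - closure \<Omega>) g \<and>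
        (\<exists>h L. (AE x in lborel. x \<in> \<Omega>\<^sub>0 - \<Omega> \<longrightarrow> h x = 1 / (\<theta>' x - \<theta> x)) \<and>
           bounded (h ` (\<Omega>\<^sub>0 - \<Omega>)) \<and> L-lipschitz_on (\<Omega>\<^sub>0 - \<Omega>) h))"

end

theory Submission
  imports Defs "HOL-Complex_Analysis.Cauchy_Integral_Formula"
begin

text \<open>
 The data give \<open>u = (Rf - f) / (\<theta>' - \<theta>)\<close> a.e. in \<open>- \<Omega>\<close>. If two solutions with
 the same data belong to potentials \<open>q\<^sub>1\<close>, \<open>q\<^sub>2\<close>, their difference \<open>d\<close> vanishes outside \<open>\<Omega>\<close>, and
 testing the two equations with bumps supported far from \<open>\<Omega>\<close>, where both have the same right-hand
 side, shows that \<open>(-\<Delta>)\<^sup>s d\<close> vanishes in a ball as well. By unique continuation \<open>d = 0\<close>.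
 The same principle gives that \<open>u\<close> vanishes on no open subset of \<open>\<Omega>\<close> unless \<open>f = 0\<close>.

 Unique continuation: if \<open>d\<close> and \<open>(-\<Delta>)\<^sup>s d\<close> vanish on a ball, then the integral of \<open>d\<close> against
 \<open>|y - x|\<^bsup>-n-2s\<^esup>\<close> vanishes for \<open>x\<close> near the centre. Applying \<open>\<Delta>\<close> raises the exponent by 2 each
 time, and by Weierstrass approximation in \<open>|y - x|\<^bsup>-2\<^esup>\<close> the powers may be replaced by Gaussians. The
 Gaussian integrals are real analytic in \<open>x\<close>, so they vanish everywhere, for all widths, whence \<open>d = 0\<close>.

 Pointwise validity of the equation: dilated bumps superposed with weight \<open>r\<^bsup>2s-1-n\<^esup>\<close> form a
 truncated fundamental solution, whose fractional Laplacian is a multiple of an approximate identity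
 minus a smooth kernel. So \<open>u\<close> is locally a smooth function plus the Riesz potential of \<open>-q u\<close>. A
 Morrey bootstrap makes \<open>u\<close> continuous, and the truncated integrals defining the principal value have
 a modulus of continuity that is uniform in the truncation; since they converge weakly, they converge
 pointwise.
\<close>

text \<open>Scaling takes the place of Fourier analysis: apart from the uniqueness of weak
  solutions, the equation is tested only with dilated translates \<open>bumpd\<close> of one radial
  profile, and the operator enters through one function, its value \<open>lapb\<close> on that
  profile. The dilate by r is sent to r^(-2s) lapb(x/r), so the weight r^(2s-1-n) is the one that
  produces r^(-n-1) lapb(x/r), a family of constant L^1 norm integrated against dr/r; its integrals
  between two scales telescope to a difference of mollifiers. The energy form omits the pairs in
  \<Omega>_e x \<Omega>_e, so integration by parts over the whole space is available only if the
  integrand vanishes there. This happens for bumps supported in \<Omega>, and for the difference of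
  two solutions with equal exterior values. A solution is a class of functions whereas the formula
  for q is pointwise. The conclusion therefore concerns a continuous representative, and the
  quotient is taken where it is nonzero. The reconstruction map may be any function of the data, so
  a choice among all solutions compatible with them is legitimate; uniqueness makes it correct up to
  null sets.\<close>

lemmas bochner_bound = Bochner_Integration.integrable_bound
 and bochner_mono = Bochner_Integration.integral_mono
 and bochner_cong = Bochner_Integration.integral_cong
 and bochner_integrable_add = Bochner_Integration.integrable_add
 and bochner_integrable_diff = Bochner_Integration.integrable_diff
 and bochner_add = Bochner_Integration.integral_add
 and bochner_diff = Bochner_Integration.integral_diff

lemma dominated:
 fixes f g :: "'a \<Rightarrow> real"
 assumes g: "integrable M g" and f: "f \<in> borel_measurable M" and le: "\<And>x. \<bar>f x\<bar> \<le> g x"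
 shows "integrable M f" and "\<bar>\<integral>x. f x \<partial>M\<bar> \<le> (\<integral>x. g x \<partial>M)"
proof -
 show i: "integrable M f"
  by (rule bochner_bound[OF g f]) (use order_trans[OF le abs_ge_self] in auto)
 show "\<bar>\<integral>x. f x \<partial>M\<bar> \<le> (\<integral>x. g x \<partial>M)"
  by (rule order_trans[OF integral_abs_bound bochner_mono[OF integrable_abs[OF i] g le]])
qed

abbreviation lborel2 :: "('a::euclidean_space \<times> 'b::euclidean_space) measure" where
 "lborel2 \<equiv> lborel \<Otimes>\<^sub>M lborel"

abbreviation L1 :: "('a::euclidean_space \<Rightarrow> real) \<Rightarrow> bool" where
 "L1 \<equiv> integrable lborel"

abbreviation L2 :: "('a::euclidean_space \<Rightarrow> real) \<Rightarrow> bool" where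
 "L2 f \<equiv> L1 (\<lambda>x. (f x)\<^sup>2)"

text \<open>One shell of a superposition over dilations, with the scale integral cut at
  \<open>d\<close> and \<open>R\<close>. Integrating r^(2s-1-n) bump(x/r) over all r formally gives
  a multiple of |x|^(2s-n), the kernel of the inverse operator.\<close>

abbreviation layer :: "real \<Rightarrow> real \<Rightarrow> real \<Rightarrow> real \<Rightarrow> (real^'n \<Rightarrow> real) \<Rightarrow> real^'n \<Rightarrow> real" where
 "layer s d R r F x \<equiv> indicator {d<..R} r * (r powr (2 * s - 1 - real CARD('n)) * F x)"

section \<open>Lebesgue integrals under affine and orthogonal changes of variables\<close>

lemma nn_integral_lborel_affine:
 fixes f :: "'a::euclidean_space \<Rightarrow> ennreal"
 assumes [measurable]: "f \<in> borel_measurable borel" and c: "c \<noteq> 0"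
 shows "(\<integral>\<^sup>+x. f x \<partial>lborel) = ennreal (\<bar>c\<bar> ^ DIM('a)) * (\<integral>\<^sup>+x. f (t + c *\<^sub>R x) \<partial>lborel)"
 by (subst lborel_affine[OF c, of t])
   (simp add: nn_integral_density nn_integral_distr nn_integral_cmult)

lemma integrable_lborel_affine:
 fixes f :: "'a::euclidean_space \<Rightarrow> real"
 assumes f: "L1 f" and c: "c \<noteq> 0"
 shows "L1 (\<lambda>x. f (t + c *\<^sub>R x))"
proof -
 have [measurable]: "f \<in> borel_measurable borel" using f by auto
 show ?thesis
  using f c zero_less_power[of "\<bar>c\<bar>" "DIM('a)"] unfolding integrable_iff_bounded
  by (subst (asm) nn_integral_lborel_affine[where c=c and t=t])
    (auto simp: ennreal_mult_less_top simp del: zero_less_power)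
qed

lemma integrable_lborel_affine_iff:
 fixes f :: "'a::euclidean_space \<Rightarrow> real"
 assumes c: "c \<noteq> 0"
 shows "L1 (\<lambda>x. f (t + c *\<^sub>R x)) \<longleftrightarrow> L1 f"
 using integrable_lborel_affine[of f c t]
  integrable_lborel_affine[of "\<lambda>x. f (t + c *\<^sub>R x)" "1/c" "- (1/c) *\<^sub>R t"] c
 by (auto simp: algebra_simps)

lemma integral_lborel_affine:
 fixes f :: "'a::euclidean_space \<Rightarrow> real"
 assumes c: "c \<noteq> 0"
 shows "(LBINT x. f x) = \<bar>c\<bar> ^ DIM('a) * (LBINT x. f (t + c *\<^sub>R x))"
proof (cases "L1 f")
 case True
 then have [measurable]: "f \<in> borel_measurable borel" by auto
 show ?thesis
  by (subst lborel_affine[OF c, of t])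
    (simp add: integral_density integral_distr)
next
 case False
 then show ?thesis
  by (simp add: not_integrable_integral_eq integrable_lborel_affine_iff[OF c])
qed

lemma integral_lborel_translate: "(LBINT x. f (t + x)) = (LBINT x. f x)"
 for f :: "'a::euclidean_space \<Rightarrow> real"
 using integral_lborel_affine[of 1 f t] by simp

lemma integral_lborel_reflect: "(LBINT x. f (t - x)) = (LBINT x. f x)"
 for f :: "'a::euclidean_space \<Rightarrow> real"
 using integral_lborel_affine[of "-1" f t] by simp

lemma integrable_lborel_translate: "L1 (\<lambda>x. f (t + x)) \<longleftrightarrow> L1 f"
 for f :: "'a::euclidean_space \<Rightarrow> real"
 using integrable_lborel_affine_iff[of 1 f t] by simp

lemma integrable_lborel_reflect: "L1 (\<lambda>x. f (t - x)) \<longleftrightarrow> L1 f"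
 for f :: "'a::euclidean_space \<Rightarrow> real"
 using integrable_lborel_affine_iff[of "-1" f t] by simp

text \<open>Uniqueness of translation-invariant measures: both iterated integrals of \<open>f x * g (x + T y)\<close>
 are evaluated by translation invariance, with \<open>g\<close> the indicator of a ball.\<close>

lemma nn_integral_lborel_orthogonal:
 fixes f :: "'a::euclidean_space \<Rightarrow> ennreal" and T :: "'a \<Rightarrow> 'a"
 assumes T: "orthogonal_transformation T" and [measurable]: "f \<in> borel_measurable borel"
 shows "(\<integral>\<^sup>+x. f (T x) \<partial>lborel) = (\<integral>\<^sup>+x. f x \<partial>lborel)"
proof -
 have lin: "linear T" using T by (rule orthogonal_transformation_linear)
 have [measurable]: "T \<in> borel_measurable borel"
  by (intro borel_measurable_continuous_onI linear_continuous_on linear_conv_bounded_linear[THEN iffD1] lin)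
 have surj: "surj T"
  using linear_injective_imp_surjective[OF lin orthogonal_transformation_inj[OF T]] by simp
 have tr: "(\<integral>\<^sup>+x. h (t + x) \<partial>lborel) = (\<integral>\<^sup>+x. h x \<partial>lborel)"
  if [measurable]: "h \<in> borel_measurable borel" for h :: "'a \<Rightarrow> ennreal" and t
  using nn_integral_lborel_affine[of h 1 t] by simp
 have refl: "(\<integral>\<^sup>+x. h (- x) \<partial>lborel) = (\<integral>\<^sup>+x. h x \<partial>lborel)"
  if [measurable]: "h \<in> borel_measurable borel" for h :: "'a \<Rightarrow> ennreal"
  using nn_integral_lborel_affine[of h "-1" 0] by simp
 have trT: "(\<integral>\<^sup>+w. h (x + T w) \<partial>lborel) = (\<integral>\<^sup>+w. h (T w) \<partial>lborel)"
  if [measurable]: "h \<in> borel_measurable borel" for h :: "'a \<Rightarrow> ennreal" and x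
 proof -
  obtain x' where "x = T x'" using surj by auto
  then have "x + T w = T (x' + w)" for w by (simp add: linear_add[OF lin])
  then show ?thesis using tr[of "\<lambda>w. h (T w)" x'] by simp
 qed
 define g :: "'a \<Rightarrow> ennreal" where "g = indicator (ball 0 1)"
 have [measurable]: "g \<in> borel_measurable borel" unfolding g_def by (intro borel_measurable_indicator) simp
 have gT: "g (T w) = g w" for w
  by (simp add: g_def indicator_def orthogonal_transformation_norm[OF T])
 have "(\<integral>\<^sup>+x. f x \<partial>lborel) * (\<integral>\<^sup>+x. g x \<partial>lborel)
   = (\<integral>\<^sup>+x. f x * (\<integral>\<^sup>+w. g (T w) \<partial>lborel) \<partial>lborel)"
  by (simp add: nn_integral_multc gT)
 also have "\<dots> = (\<integral>\<^sup>+x. (\<integral>\<^sup>+w. f x * g (x + T w) \<partial>lborel) \<partial>lborel)"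
  by (simp add: nn_integral_cmult trT)
 also have "\<dots> = (\<integral>\<^sup>+w. (\<integral>\<^sup>+x. f x * g (x + T w) \<partial>lborel) \<partial>lborel)"
  by (rule lborel_pair.Fubini') measurable
 also have "\<dots> = (\<integral>\<^sup>+w. (\<integral>\<^sup>+x. f (x - T w) * g x \<partial>lborel) \<partial>lborel)"
  using tr[of "\<lambda>x. f x * g (x + T w)" "- T w" for w] by simp
 also have "\<dots> = (\<integral>\<^sup>+x. (\<integral>\<^sup>+w. f (x - T w) * g x \<partial>lborel) \<partial>lborel)"
  by (rule lborel_pair.Fubini') measurable
 also have "\<dots> = (\<integral>\<^sup>+x. (\<integral>\<^sup>+w. f (x + T w) \<partial>lborel) * g x \<partial>lborel)"
  using refl[of "\<lambda>w. f (x - T w)" for x] by (simp add: nn_integral_multc linear_neg[OF lin])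
 also have "\<dots> = (\<integral>\<^sup>+x. f (T x) \<partial>lborel) * (\<integral>\<^sup>+x. g x \<partial>lborel)"
  by (simp add: trT nn_integral_cmult)
 finally have eq: "(\<integral>\<^sup>+x. f x \<partial>lborel) * (\<integral>\<^sup>+x. g x \<partial>lborel) = (\<integral>\<^sup>+x. f (T x) \<partial>lborel) * (\<integral>\<^sup>+x. g x \<partial>lborel)" .
 have "(\<integral>\<^sup>+x. g x \<partial>lborel) = emeasure lborel (ball 0 1 :: 'a set)"
  by (simp add: g_def)
 moreover have "emeasure lborel (ball 0 1 :: 'a set) \<noteq> \<infinity>" "emeasure lborel (ball 0 1 :: 'a set) \<noteq> 0"
  using emeasure_lborel_ball_finite[of 0 1] by (auto simp: emeasure_ball unit_ball_vol_pos less_imp_neq[symmetric])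
 ultimately show ?thesis using eq
  by (metis mult_divide_eq_ennreal infinity_ennreal_def)
qed

lemma integral_lborel_orthogonal:
 fixes f :: "'a::euclidean_space \<Rightarrow> real" and T :: "'a \<Rightarrow> 'a"
 assumes T: "orthogonal_transformation T" and [measurable]: "f \<in> borel_measurable borel"
 shows "(LBINT x. f (T x)) = (LBINT x. f x)"
proof -
 have lin: "linear T" using T by (rule orthogonal_transformation_linear)
 have [measurable]: "T \<in> borel_measurable borel"
  by (intro borel_measurable_continuous_onI linear_continuous_on linear_conv_bounded_linear[THEN iffD1] lin)
 have "distr lborel borel T = lborel"
 proof (rule measure_eqI)
  fix A :: "'a set" assume "A \<in> sets (distr lborel borel T)"
  then have [measurable]: "A \<in> sets borel" by simp
  have "emeasure (distr lborel borel T) A = (\<integral>\<^sup>+x. indicator A x \<partial>distr lborel borel T)"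
   by simp
  also have "\<dots> = (\<integral>\<^sup>+x. indicator A (T x) \<partial>lborel)" by (rule nn_integral_distr) measurable
  also have "\<dots> = emeasure lborel A" by (subst nn_integral_lborel_orthogonal[OF T]) auto
  finally show "emeasure (distr lborel borel T) A = emeasure lborel A" .
 qed simp
 then show ?thesis
  using integral_distr[of T lborel borel f] by simp
qed

text \<open>Both one-dimensional integrals are restricted to an open half-line so that \<open>t powr p\<close> is
 not evaluated at \<open>t \<le> 0\<close>.\<close>

lemma powr_integral_at_0:
 fixes p R :: real
 assumes p: "p > 0" and R: "R \<ge> 0"
 shows "has_bochner_integral lborel (\<lambda>t. indicator {0<..<R} t * t powr (p - 1)) (R powr p / p)"
proof -
 have "((\<lambda>t. t powr (p - 1)) has_integral (R powr p / p)) {0..R}"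
  using has_integral_powr_from_0[of "p - 1" R] assms by simp
 then have hi: "((\<lambda>t. t powr (p - 1)) has_integral (R powr p / p)) {0<..<R}"
  by (simp add: has_integral_Icc_iff_Ioo)
 then have ai: "(\<lambda>t. t powr (p - 1)) absolutely_integrable_on {0<..<R}"
  by (intro nonnegative_absolutely_integrable_1) (auto simp: integrable_on_def)
 then have si: "set_integrable lborel {0<..<R} (\<lambda>t. t powr (p - 1))"
  by (subst (asm) absolutely_integrable_measurable_real[symmetric] |
    simp add: set_integrable_def integrable_completion)+
 then have "(LINT t:{0<..<R}|lborel. t powr (p - 1)) = R powr p / p"
  using set_borel_integral_eq_integral(2)[OF si] hi by (simp add: integral_unique)
 with si show ?thesis
  unfolding set_integrable_def set_lebesgue_integral_def by (simp add: has_bochner_integral_iff)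
qed

lemma powr_integral_at_top:
 fixes p r :: real
 assumes p: "p > 0" and r: "r > 0"
 shows "has_bochner_integral lborel (\<lambda>t. indicator {r<..} t * t powr (- p - 1)) (r powr (-p) / p)"
proof -
 have "((\<lambda>t. t powr (- p - 1)) has_integral (r powr (-p) / p)) {r..}"
  using has_integral_powr_to_inf[of "- p - 1" r] assms by simp
 moreover have "negligible {x \<in> {r..} - {r<..}. x powr (- p - 1) \<noteq> 0}"
  by (rule negligible_subset[of "{r}"]) auto
 moreover have "negligible {x \<in> {r<..} - {r..}. x powr (- p - 1) \<noteq> 0}"
  by (rule negligible_subset[of "{}"]) auto
 ultimately have hi: "((\<lambda>t. t powr (- p - 1)) has_integral (r powr (-p) / p)) {r<..}"
  by (rule has_integral_spike_set_eq[THEN iffD1, rotated 2])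
 then have ai: "(\<lambda>t. t powr (- p - 1)) absolutely_integrable_on {r<..}"
  by (intro nonnegative_absolutely_integrable_1) (auto simp: integrable_on_def)
 then have si: "set_integrable lborel {r<..} (\<lambda>t. t powr (- p - 1))"
  by (simp add: set_integrable_def integrable_completion)
 then have "(LINT t:{r<..}|lborel. t powr (- p - 1)) = r powr (-p) / p"
  using set_borel_integral_eq_integral(2)[OF si] hi by (simp add: integral_unique)
 with si show ?thesis
  unfolding set_integrable_def set_lebesgue_integral_def by (simp add: has_bochner_integral_iff)
qed

subsection \<open>The kernel and its decay at infinity\<close>

text \<open>For \<open>e = 0\<close> this is the full kernel; its value at the origin is \<open>1 / 0 = 0\<close>.\<close>

definition kern :: "real \<Rightarrow> real \<Rightarrow> real^'n \<Rightarrow> real" where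
 "kern s e z = (if e \<le> norm z then 1 / norm z powr (real CARD('n) + 2 * s) else 0)"

text \<open>The rate n + 2s at which the fractional Laplacian of a compactly supported function
  decays. Unlike \<open>kern\<close> it is bounded, so it serves as the common majorant for
  convolutions with L^2 functions.\<close>

definition decay :: "real \<Rightarrow> real^'n \<Rightarrow> real" where
 "decay s x = (1 + norm x) powr - (real CARD('n) + 2 * s)"

lemma decay_eq: "decay s (x :: real^'n) = 1 / (1 + norm x) powr (real CARD('n) + 2 * s)"
 unfolding decay_def by (subst powr_minus) (simp add: divide_simps)

lemma kern_measurable [measurable]: "kern s e \<in> borel_measurable borel"
 unfolding kern_def[abs_def] by measurable

lemma decay_measurable [measurable]: "decay s \<in> borel_measurable borel"
 unfolding decay_def[abs_def] by measurable

lemma kern_nonneg: "0 \<le> kern s e z" by (simp add: kern_def)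

lemma kern_minus: "kern s e (- z) = kern s e z" by (simp add: kern_def)

lemma decay_pos: "0 < decay s (x :: real^'n)"
proof -
 have "1 + norm x > 0" using norm_ge_zero[of x] by linarith
 then show ?thesis by (simp add: decay_def)
qed

lemma decay_le_1: "0 < s \<Longrightarrow> decay s x \<le> 1"
 unfolding decay_def by (subst powr_minus) (auto intro!: inverse_le_1_iff[THEN iffD2] ge_one_powr_ge_zero)

lemma decay_minus: "decay s (- x) = decay s x" by (simp add: decay_def)

lemma decay_translate:
 fixes x y :: "real^'n"
 assumes "0 < s"
 shows "decay s (x + y) \<le> (1 + norm y) powr (real CARD('n) + 2 * s) * decay s x"
proof -
 let ?a = "real CARD('n) + 2 * s"
 have n: "norm x \<le> norm (x + y) + norm y"
  using norm_triangle_ineq4[of "x + y" y] by simp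
 have "1 + norm x \<le> (1 + norm y) * (1 + norm (x + y))"
  using n mult_nonneg_nonneg[OF norm_ge_zero[of y] norm_ge_zero[of "x + y"]]
  unfolding distrib_left distrib_right mult_1 mult_1_right by linarith
 then have "(1 + norm x) powr ?a \<le> ((1 + norm y) * (1 + norm (x + y))) powr ?a"
  using assms by (intro powr_mono2) auto
 also have "\<dots> = (1 + norm y) powr ?a * (1 + norm (x + y)) powr ?a"
  by (rule powr_mult)
 finally have le: "(1 + norm x) powr ?a \<le> (1 + norm y) powr ?a * (1 + norm (x + y)) powr ?a" .
 have "1 + norm x > 0" "1 + norm (x + y) > 0"
  using norm_ge_zero[of x] norm_ge_zero[of "x + y"] by linarith+
 then have "(1 + norm x) powr ?a > 0" "(1 + norm (x + y)) powr ?a > 0" by auto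
 with le show ?thesis unfolding decay_eq by (simp add: field_simps)
qed

lemma decay_scale:
 fixes x :: "real^'n"
 assumes "0 < s" "0 < t" "t \<le> T" "1 \<le> T"
 shows "decay s (x /\<^sub>R t) \<le> T powr (real CARD('n) + 2 * s) * decay s x"
proof -
 let ?a = "real CARD('n) + 2 * s"
 have "norm x = t * norm (x /\<^sub>R t)" using assms by simp
 also have "\<dots> \<le> T * norm (x /\<^sub>R t)" by (intro mult_right_mono assms) simp
 finally have "1 + norm x \<le> T * (1 + norm (x /\<^sub>R t))"
  using assms by (simp add: algebra_simps)
 then have "(1 + norm x) powr ?a \<le> (T * (1 + norm (x /\<^sub>R t))) powr ?a"
  using assms by (intro powr_mono2) auto
 also have "\<dots> = T powr ?a * (1 + norm (x /\<^sub>R t)) powr ?a"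
  using assms by (intro powr_mult)
 finally have le: "(1 + norm x) powr ?a \<le> T powr ?a * (1 + norm (x /\<^sub>R t)) powr ?a" .
 have "1 + norm x > 0" "1 + norm (x /\<^sub>R t) > 0"
  using norm_ge_zero[of x] norm_ge_zero[of "x /\<^sub>R t"] by linarith+
 then have "(1 + norm x) powr ?a > 0" "(1 + norm (x /\<^sub>R t)) powr ?a > 0" by auto
 with le show ?thesis unfolding decay_eq by (simp add: field_simps)
qed

text \<open>A substitute for polar coordinates: a function dominated by a superposition of ball
  indicators with density \<open>w\<close> is handled by Tonelli, which leaves \<open>w\<close>
  times the volume of the ball of radius t, a one-dimensional question.\<close>

lemma integrable_layer_cake:
 fixes f :: "real^'n \<Rightarrow> real" and w :: "real \<Rightarrow> real"
 assumes [measurable]: "f \<in> borel_measurable borel" "w \<in> borel_measurable borel"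
  and w: "\<And>t. 0 \<le> w t" and int: "L1 (\<lambda>t. indicator {0<..} t * (w t * t ^ CARD('n)))"
  and le: "\<And>x. x \<noteq> 0 \<Longrightarrow> ennreal \<bar>f x\<bar> \<le> ennreal C * (\<integral>\<^sup>+t. ennreal (if norm x \<le> t then w t else 0) \<partial>lborel)"
 shows "L1 f"
proof (rule integrableI_bounded)
 have "(\<integral>\<^sup>+x. ennreal (norm (f x)) \<partial>lborel)
   \<le> (\<integral>\<^sup>+x. ennreal C * (\<integral>\<^sup>+t. ennreal (if norm (x::real^'n) \<le> t then w t else 0) \<partial>lborel) \<partial>lborel)"
 proof (rule nn_integral_mono_AE)
  show "AE x in lborel. ennreal (norm (f x)) \<le> ennreal C * (\<integral>\<^sup>+t. ennreal (if norm x \<le> t then w t else 0) \<partial>lborel)"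
   using AE_lborel_singleton[of 0] by eventually_elim (use le in auto)
 qed
 also have "\<dots> = ennreal C * (\<integral>\<^sup>+x. (\<integral>\<^sup>+t. ennreal (if norm (x::real^'n) \<le> t then w t else 0) \<partial>lborel) \<partial>lborel)"
  by (rule nn_integral_cmult) measurable
 also have "(\<integral>\<^sup>+x. (\<integral>\<^sup>+t. ennreal (if norm (x::real^'n) \<le> t then w t else 0) \<partial>lborel) \<partial>lborel)
   = (\<integral>\<^sup>+t. (\<integral>\<^sup>+x. ennreal (if norm (x::real^'n) \<le> t then w t else 0) \<partial>lborel) \<partial>lborel)"
  by (rule lborel_pair.Fubini') measurable
 also have "\<dots> = (\<integral>\<^sup>+t. ennreal (unit_ball_vol CARD('n)) * ennreal (indicator {0<..} t * (w t * t ^ CARD('n))) \<partial>lborel)"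
 proof (rule nn_integral_cong_AE)
  have eq: "(\<integral>\<^sup>+x. ennreal (if norm (x::real^'n) \<le> t then w t else 0) \<partial>lborel)
    = ennreal (unit_ball_vol CARD('n)) * ennreal (indicator {0<..} t * (w t * t ^ CARD('n)))" if "t \<noteq> 0" for t
  proof -
   have "(\<integral>\<^sup>+x. ennreal (if norm (x::real^'n) \<le> t then w t else 0) \<partial>lborel)
     = (\<integral>\<^sup>+x. ennreal (w t) * indicator (cball 0 t) (x::real^'n) \<partial>lborel)"
    by (intro nn_integral_cong) (auto simp: indicator_def)
   also have "\<dots> = ennreal (w t) * emeasure lborel (cball 0 t :: (real^'n) set)"
    by (subst nn_integral_cmult_indicator) auto
   also have "\<dots> = ennreal (unit_ball_vol CARD('n)) * ennreal (indicator {0<..} t * (w t * t ^ CARD('n)))"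
    using that w[of t]
    by (cases "t > 0") (auto simp: emeasure_cball ennreal_mult'[symmetric] mult_ac unit_ball_vol_nonneg)
   finally show ?thesis .
  qed
  show "AE t in lborel. (\<integral>\<^sup>+x. ennreal (if norm (x::real^'n) \<le> t then w t else 0) \<partial>lborel)
    = ennreal (unit_ball_vol CARD('n)) * ennreal (indicator {0<..} t * (w t * t ^ CARD('n)))"
   using AE_lborel_singleton[of "0::real"] by eventually_elim (use eq in auto)
 qed
 also have "\<dots> = ennreal (unit_ball_vol CARD('n)) * (\<integral>\<^sup>+t. ennreal (indicator {0<..} t * (w t * t ^ CARD('n))) \<partial>lborel)"
  by (rule nn_integral_cmult) measurable
 also have "(\<integral>\<^sup>+t. ennreal (indicator {0<..} t * (w t * t ^ CARD('n))) \<partial>lborel)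
   = ennreal (LBINT t. indicator {0<..} t * (w t * t ^ CARD('n)))"
  using w by (intro nn_integral_eq_integral int) (auto simp: indicator_def)
 also have "ennreal C * (ennreal (unit_ball_vol (real CARD('n))) * \<dots>) < \<infinity>"
  by (simp add: ennreal_mult_less_top)
 finally show "(\<integral>\<^sup>+x. ennreal (norm (f x)) \<partial>lborel) < \<infinity>" .
qed simp

lemma decay_integrable:
 assumes s: "0 < s"
 shows "L1 (decay s :: real^'n \<Rightarrow> real)"
proof (rule integrable_layer_cake[where C="2 powr (real CARD('n) + 2 * s + 1)" and w="\<lambda>t. (1 + \<bar>t\<bar>) powr (- (real CARD('n) + 2 * s + 1))"])
 let ?b = "real CARD('n) + 2 * s + 1"
 show "L1 (\<lambda>t. indicator {0<..} t * ((1 + \<bar>t\<bar>) powr - ?b * t ^ CARD('n)))"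
 proof (rule bochner_bound)
  show "L1 (\<lambda>t::real. indicator {1<..} (1 + t) * (1 + t) powr (- (2 * s) - 1))"
   using powr_integral_at_top[of "2 * s" 1] s
   by (subst integrable_lborel_translate) (auto simp: has_bochner_integral_iff)
  have "(1 + t) powr - ?b * t ^ CARD('n) \<le> (1 + t) powr (- (2 * s) - 1)" if "t > 0" for t :: real
  proof -
   have "t ^ CARD('n) \<le> (1 + t) ^ CARD('n)" using that by (intro power_mono) auto
   then have "(1 + t) powr - ?b * t ^ CARD('n) \<le> (1 + t) powr - ?b * (1 + t) powr (real CARD('n))"
    using that by (intro mult_left_mono) (auto simp: powr_realpow)
   also have "\<dots> = (1 + t) powr (- (2 * s) - 1)" by (simp add: powr_add[symmetric])
   finally show ?thesis .
  qed
  then show "AE t in lborel. norm (indicator {0<..} t * ((1 + \<bar>t\<bar>) powr - ?b * t ^ CARD('n)))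
    \<le> norm (indicator {1<..} (1 + t) * (1 + t) powr (- (2 * s) - 1))"
   by (intro AE_I2) (auto simp: indicator_def abs_mult)
 qed measurable
 fix x :: "real^'n"
 let ?r = "norm x"
 \<comment> \<open>The layers t in [|x|, 1 + 2|x|] suffice: this interval has length 1 + |x| and 1 +
   t \<le> 2 + 2|x| on it, so they contribute at least (2 + 2|x|)^(-b) (1 + |x|), which is 2^(-b)
   times \<open>decay\<close>.\<close>
 have eq: "ennreal (decay s x) = ennreal (2 powr ?b) * (ennreal ((2 + 2 * ?r) powr - ?b) * ennreal (1 + ?r))"
 proof -
  have "2 + 2 * ?r = 2 * (1 + ?r)" by simp
  then have "(2 + 2 * ?r) powr - ?b = 2 powr (- ?b) * (1 + ?r) powr - ?b"
   by (simp only: powr_mult)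
  moreover have "(1 + ?r) powr - ?b * (1 + ?r) = decay s x"
  proof -
   have "1 + ?r > 0" using norm_ge_zero[of x] by linarith
   then have "(1 + ?r) powr - ?b * (1 + ?r) = (1 + ?r) powr - ?b * (1 + ?r) powr 1" by simp
   also have "\<dots> = decay s x" unfolding decay_def powr_add[symmetric] by simp
   finally show ?thesis .
  qed
  moreover have "2 powr ?b * (2 powr (- ?b) * X) = X" for X :: real
   by (simp add: mult.assoc[symmetric] powr_add[symmetric])
  ultimately have "decay s x = 2 powr ?b * ((2 + 2 * ?r) powr - ?b * (1 + ?r))"
   by (simp only: mult.assoc)
  then show ?thesis by (simp only: ennreal_mult' powr_ge_zero)
 qed
 have "ennreal ((2 + 2 * ?r) powr - ?b) * ennreal (1 + ?r)
   = (\<integral>\<^sup>+t. ennreal ((2 + 2 * ?r) powr - ?b) * indicator {?r..1 + 2 * ?r} t \<partial>lborel)"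
  by (subst nn_integral_cmult_indicator) (auto simp: add.commute)
 also have "\<dots> \<le> (\<integral>\<^sup>+t. ennreal (if ?r \<le> t then (1 + \<bar>t\<bar>) powr - ?b else 0) \<partial>lborel)"
 proof (rule nn_integral_mono)
  fix t :: real
  have "(2 + 2 * ?r) powr - ?b \<le> (1 + \<bar>t\<bar>) powr - ?b" if "?r \<le> t" "t \<le> 1 + 2 * ?r"
   using that s norm_ge_zero[of x] by (intro powr_mono2') linarith+
  then show "ennreal ((2 + 2 * ?r) powr - ?b) * indicator {?r..1 + 2 * ?r} t
    \<le> ennreal (if ?r \<le> t then (1 + \<bar>t\<bar>) powr - ?b else 0)"
   by (auto simp: indicator_def)
 qed
 finally show "ennreal \<bar>decay s x\<bar> \<le> ennreal (2 powr ?b) * (\<integral>\<^sup>+t. ennreal (if ?r \<le> t then (1 + \<bar>t\<bar>) powr - ?b else 0) \<partial>lborel)"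
  unfolding abs_of_pos[OF decay_pos] eq by (rule mult_left_mono) simp
qed (use s in \<open>auto\<close>)

lemma decay_sq_integrable:
 assumes s: "0 < s"
 shows "L1 (\<lambda>x::real^'n. (decay s x)\<^sup>2)"
proof (rule bochner_bound[OF decay_integrable[OF s]])
 show "AE x in lborel. norm ((decay s x)\<^sup>2) \<le> norm (decay s (x::real^'n))"
 proof (rule AE_I2)
  fix x :: "real^'n"
  have "(decay s x)\<^sup>2 \<le> decay s x"
   unfolding power2_eq_square using decay_le_1[OF s, of x] decay_pos[of s x] by (intro mult_left_le) auto
  then show "norm ((decay s x)\<^sup>2) \<le> norm (decay s x)" using decay_pos[of s x] by simp
 qed
qed measurable

lemma kern_le_decay:
 assumes s: "0 < s" and e: "0 < e" "e \<le> 1"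
 shows "kern s e z \<le> (2 / e) powr (real CARD('n) + 2 * s) * decay s (z :: real^'n)"
proof (cases "e \<le> norm z")
 case True
 let ?a = "real CARD('n) + 2 * s"
 have pos: "norm z > 0" "1 + norm z > 0" using True e by linarith+
 have "1 + norm z \<le> 2 / e * norm z"
 proof -
  have "1 \<le> norm z / e" "norm z \<le> norm z / e" using True e mult_left_le_one_le[of "norm z" e]
   by (simp_all add: le_divide_eq mult.commute)
  then show ?thesis by simp
 qed
 then have "(1 + norm z) powr ?a \<le> (2 / e * norm z) powr ?a"
  using s pos by (intro powr_mono2) auto
 also have "\<dots> = (2 / e) powr ?a * norm z powr ?a" by (rule powr_mult)
 finally have "(1 + norm z) powr ?a \<le> (2 / e) powr ?a * norm z powr ?a" .
 moreover have "norm z powr ?a > 0" "(1 + norm z) powr ?a > 0" using pos by auto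
 ultimately show ?thesis using True unfolding kern_def decay_eq by (simp add: field_simps)
qed (use decay_pos[of s z] in \<open>simp add: kern_def\<close>)

lemma kern_antimono: "e \<le> e' \<Longrightarrow> kern s e' z \<le> kern s e z"
 by (auto simp: kern_def)

lemma kern_integrable:
 assumes s: "0 < s" and e: "0 < e"
 shows "L1 (kern s e :: real^'n \<Rightarrow> real)"
proof (rule bochner_bound)
 let ?e = "min 1 e"
 show "L1 (\<lambda>z::real^'n. (2 / ?e) powr (real CARD('n) + 2 * s) * decay s z)"
  by (intro integrable_mult_right decay_integrable s)
 show "AE z in lborel. norm (kern s e z) \<le> norm ((2 / ?e) powr (real CARD('n) + 2 * s) * decay s (z::real^'n))"
 proof (rule AE_I2)
  fix z :: "real^'n"
  have "kern s e z \<le> kern s ?e z" by (rule kern_antimono) simp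
  also have "\<dots> \<le> (2 / ?e) powr (real CARD('n) + 2 * s) * decay s z"
   using e by (intro kern_le_decay s) auto
  finally show "norm (kern s e z) \<le> norm ((2 / ?e) powr (real CARD('n) + 2 * s) * decay s z)"
   using kern_nonneg[of s e z] by simp
 qed
qed measurable

text \<open>Second differences are O(min 1 |z|^2), and |z|^2 times the kernel is |z|^(2-2s-n),
  integrable at the origin because s < 1; outside the unit ball the kernel itself is integrable.
  Near the origin the power is dominated by the layers t in [|x|, 2|x|).\<close>

lemma kern_min_integrable:
 assumes s: "0 < s" "s < 1"
 shows "L1 (\<lambda>z::real^'n. min 1 ((norm z)\<^sup>2) * kern s 0 z)"
proof -
 let ?b = "real CARD('n) + 2 * s - 2"
 have near: "L1 (\<lambda>z::real^'n. indicator (ball 0 1) z * ((norm z)\<^sup>2 * kern s 0 z))"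
 proof (rule integrable_layer_cake[where C="2 powr (?b + 1)" and w="\<lambda>t. indicator {0<..<2} t * t powr (- ?b - 1)"])
  have "indicator {0<..} t * (indicator {0<..<2} t * t powr (- ?b - 1) * t ^ CARD('n))
    = indicator {0<..<2} t * t powr ((2 - 2 * s) - 1)" for t :: real
   by (cases "t > 0") (auto simp: indicator_def powr_realpow[symmetric] powr_add[symmetric])
  then have "L1 (\<lambda>t::real. indicator {0<..} t * (indicator {0<..<2} t * t powr (- ?b - 1) * t ^ CARD('n)))
    = L1 (\<lambda>t. indicator {0<..<2} t * t powr ((2 - 2 * s) - 1))"
   by (simp only:)
  then show "L1 (\<lambda>t. indicator {0<..} t * (indicator {0<..<2} t * t powr (- ?b - 1) * t ^ CARD('n)))"
   using powr_integral_at_0[of "2 - 2 * s" 2] s by (simp add: has_bochner_integral_iff)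
  fix x :: "real^'n" assume x: "x \<noteq> 0"
  let ?r = "norm x"
  show "ennreal \<bar>indicator (ball 0 1) x * (?r\<^sup>2 * kern s 0 x)\<bar>
    \<le> ennreal (2 powr (?b + 1)) * (\<integral>\<^sup>+t. ennreal (if ?r \<le> t then indicator {0<..<2} t * t powr (- ?b - 1) else 0) \<partial>lborel)"
  proof (cases "?r < 1")
   case True
   have r: "?r > 0" using x by simp
   have "?r\<^sup>2 * kern s 0 x = ?r powr (- ?b)"
   proof -
    have "?r\<^sup>2 = ?r powr 2" using r by simp
    moreover have "kern s 0 x = ?r powr - (real CARD('n) + 2 * s)"
     unfolding kern_def powr_minus_divide by simp
    ultimately have "?r\<^sup>2 * kern s 0 x = ?r powr (2 + - (real CARD('n) + 2 * s))"
     by (simp only: powr_add)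
    moreover have "2 + - (real CARD('n) + 2 * s) = - ?b" by simp
    ultimately show ?thesis by (simp only:)
   qed
   also have "\<dots> = 2 powr (?b + 1) * ((2 * ?r) powr (- ?b - 1) * ?r)"
   proof -
    have "(2 * ?r) powr (- ?b - 1) * ?r = 2 powr (- ?b - 1) * (?r powr (- ?b - 1) * ?r powr 1)"
     using r by (simp add: powr_mult)
    also have "?r powr (- ?b - 1) * ?r powr 1 = ?r powr (- ?b)"
     by (simp only: powr_add[symmetric] diff_add_cancel)
    finally show ?thesis by (simp add: mult.assoc[symmetric] powr_add[symmetric])
   qed
   finally have eq: "ennreal (?r\<^sup>2 * kern s 0 x) = ennreal (2 powr (?b + 1)) * (ennreal ((2 * ?r) powr (- ?b - 1)) * ennreal ?r)"
    by (simp add: ennreal_mult'[symmetric])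
   have "ennreal ((2 * ?r) powr (- ?b - 1)) * ennreal ?r
     = (\<integral>\<^sup>+t. ennreal ((2 * ?r) powr (- ?b - 1)) * indicator {?r..<2 * ?r} t \<partial>lborel)"
    by (simp add: nn_integral_cmult)
   also have "\<dots> \<le> (\<integral>\<^sup>+t. ennreal (if ?r \<le> t then indicator {0<..<2} t * t powr (- ?b - 1) else 0) \<partial>lborel)"
   proof (rule nn_integral_mono)
    fix t :: real
    have "real CARD('n) \<ge> 1" by (simp add: Suc_leI)
    then have b: "- ?b - 1 \<le> 0" using s by linarith
    have "(2 * ?r) powr (- ?b - 1) \<le> t powr (- ?b - 1)" if "?r \<le> t" "t < 2 * ?r"
     using that r b by (intro powr_mono2') auto
    then show "ennreal ((2 * ?r) powr (- ?b - 1)) * indicator {?r..<2 * ?r} t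
      \<le> ennreal (if ?r \<le> t then indicator {0<..<2} t * t powr (- ?b - 1) else 0)"
     using r True by (auto simp: indicator_def)
   qed
   finally have "ennreal (2 powr (?b + 1)) * (ennreal ((2 * ?r) powr (- ?b - 1)) * ennreal ?r)
     \<le> ennreal (2 powr (?b + 1)) * (\<integral>\<^sup>+t. ennreal (if ?r \<le> t then indicator {0<..<2} t * t powr (- ?b - 1) else 0) \<partial>lborel)"
    by (rule mult_left_mono) simp
   then show ?thesis unfolding eq[symmetric] using True kern_nonneg[of s 0 x] by simp
  qed simp
 qed (auto simp: indicator_def)
 show ?thesis
 proof (rule bochner_bound[OF bochner_integrable_add[OF near kern_integrable[of s 1]]])
  show "AE z in lborel. norm (min 1 ((norm z)\<^sup>2) * kern s 0 z)
    \<le> norm (indicator (ball 0 1) z * ((norm z)\<^sup>2 * kern s 0 z) + kern s 1 (z::real^'n))"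
  proof (rule AE_I2)
   fix z :: "real^'n"
   have "min 1 ((norm z)\<^sup>2) * kern s 0 z \<le> indicator (ball 0 1) z * ((norm z)\<^sup>2 * kern s 0 z) + kern s 1 z"
    by (cases "norm z < 1") (auto simp: kern_def min_def divide_right_mono)
   moreover have "0 \<le> min 1 ((norm z)\<^sup>2) * kern s 0 z"
    by (intro mult_nonneg_nonneg kern_nonneg) auto
   ultimately show "norm (min 1 ((norm z)\<^sup>2) * kern s 0 z)
     \<le> norm (indicator (ball 0 1) z * ((norm z)\<^sup>2 * kern s 0 z) + kern s 1 z)"
    unfolding real_norm_def by linarith
  qed
 qed (use s in \<open>auto\<close>)
qed

lemma kern_scale:
 fixes z :: "real^'n"
 assumes "0 < t"
 shows "kern s e (t *\<^sub>R z) = t powr - (real CARD('n) + 2 * s) * kern s (e / t) z"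
proof -
 have "t powr - a = 1 / t powr a" for a by (simp add: powr_minus divide_simps)
 then show ?thesis using assms by (auto simp: kern_def powr_mult divide_le_eq mult.commute simp del: minus_add_distrib)
qed

lemma kern_mass:
 fixes e :: real
 assumes e: "0 < e"
 shows "(LBINT z::real^'n. kern s e z) = e powr (- 2 * s) * (LBINT z::real^'n. kern s 1 z)"
proof -
 have "(LBINT z::real^'n. kern s e z) = \<bar>e\<bar> ^ CARD('n) * (LBINT z::real^'n. kern s e (0 + e *\<^sub>R z))"
  using integral_lborel_affine[of e "kern s e :: real^'n \<Rightarrow> real" 0] e by simp
 also have "\<dots> = (e powr real CARD('n) * e powr - (real CARD('n) + 2 * s)) * (LBINT z::real^'n. kern s 1 z)"
  using e by (simp add: kern_scale powr_realpow)
 also have "e powr real CARD('n) * e powr - (real CARD('n) + 2 * s) = e powr (- 2 * s)"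
  by (simp add: powr_add[symmetric])
 finally show ?thesis .
qed

subsection \<open>Second differences and truncated fractional Laplacians\<close>

text \<open>Symmetrising about the centre cancels the first-order term, which makes the singular
  integral of a twice differentiable function absolutely convergent for every s in (0,1).\<close>

definition sdiff :: "('a::real_vector \<Rightarrow> real) \<Rightarrow> 'a \<Rightarrow> 'a \<Rightarrow> real" where
 "sdiff f z x = f (x + z) + f (x - z) - 2 * f x"

text \<open>The fractional Laplacian without the constant \<open>frac_const\<close>, the principal value being
 replaced by truncation at \<open>e\<close> of the symmetrised integral; \<open>e = 0\<close> means no truncation.\<close>

definition tlap :: "real \<Rightarrow> real \<Rightarrow> (real^'n \<Rightarrow> real) \<Rightarrow> real^'n \<Rightarrow> real" where
 "tlap s e f x = - (1 / 2) * (LBINT z. sdiff f z x * kern s e z)"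

text \<open>A radially decreasing profile supported in the unit ball. The exponent 5 lets four
  successive line derivatives exist everywhere, each of them still carrying a positive power of the
  positive part; all four are used in \<open>sdiff_sdiff_bump_bound\<close>.\<close>

definition bump :: "real^'n \<Rightarrow> real" where
 "bump x = (max 0 (1 - (norm x)\<^sup>2)) ^ 5"

lemma sdiff_measurable [measurable (raw)]:
 fixes f :: "'a::euclidean_space \<Rightarrow> real"
 assumes [measurable]: "f \<in> borel_measurable borel" "g \<in> borel_measurable M" "h \<in> borel_measurable M"
 shows "(\<lambda>x. sdiff f (g x) (h x)) \<in> borel_measurable M"
 unfolding sdiff_def by measurable

lemma kern_measurable_raw [measurable (raw)]:
 assumes [measurable]: "g \<in> borel_measurable M"
 shows "(\<lambda>x. kern s e (g x :: real^'n)) \<in> borel_measurable M"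
 by measurable

lemma bump_continuous: "continuous_on UNIV (bump :: real^'n \<Rightarrow> real)"
 unfolding bump_def[abs_def] by (intro continuous_intros)

lemma bump_measurable [measurable]: "bump \<in> borel_measurable borel"
 by (rule borel_measurable_continuous_onI[OF bump_continuous])

lemma bump_nonneg: "0 \<le> bump x" by (simp add: bump_def)

lemma bump_le_1: "bump x \<le> 1" unfolding bump_def by (rule power_le_one) auto

lemma bump_outside: "1 \<le> norm x \<Longrightarrow> bump x = 0"
 using power_mono[of 1 "norm x" 2] by (simp add: bump_def)

lemma bump_minus: "bump (- x) = bump x" by (simp add: bump_def)

lemma bump_0: "bump 0 = 1" by (simp add: bump_def)

lemma bump_pos: "norm x < 1 \<Longrightarrow> 0 < bump x"
 using power_strict_mono[of "norm x" 1 2] by (simp add: bump_def)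

lemma bump_antimono: "norm x \<le> norm y \<Longrightarrow> bump y \<le> bump x"
 unfolding bump_def by (intro power_mono max.mono diff_mono) auto

section \<open>Four derivatives of the bump along lines\<close>

lemma second_difference_bound:
 fixes f f' f'' :: "real \<Rightarrow> real"
 assumes h: "0 \<le> h" and f: "\<And>t. \<bar>t\<bar> \<le> h \<Longrightarrow> (f has_real_derivative f' t) (at t)"
  and f': "\<And>t. \<bar>t\<bar> \<le> h \<Longrightarrow> (f' has_real_derivative f'' t) (at t)"
  and M: "\<And>t. \<bar>t\<bar> \<le> h \<Longrightarrow> \<bar>f'' t\<bar> \<le> M"
 shows "\<bar>f h + f (- h) - 2 * f 0\<bar> \<le> 2 * M * h\<^sup>2"
proof (cases "h = 0")
 case False
 with h have h: "0 < h" by simp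
 have "((\<lambda>t. f t + f (- t)) has_real_derivative (f' t - f' (- t))) (at t)" if "\<bar>t\<bar> \<le> h" for t
 proof -
  have "((\<lambda>t. f (- t)) has_real_derivative f' (- t) * (- 1)) (at t)"
   using that by (intro DERIV_chain'[OF _ f]) (auto intro!: derivative_eq_intros)
  then show ?thesis using f[OF that] by (auto intro!: derivative_eq_intros)
 qed
 then obtain u where u: "0 < u" "u < h" "(f h + f (- h)) - (f 0 + f (- 0)) = (h - 0) * (f' u - f' (- u))"
  using MVT2[of 0 h "\<lambda>t. f t + f (- t)" "\<lambda>t. f' t - f' (- t)"] h by auto
 obtain v where v: "- u < v" "v < u" "f' u - f' (- u) = (u - (- u)) * f'' v"
  using MVT2[of "- u" u f' f''] u f' by auto
 have "\<bar>f h + f (- h) - 2 * f 0\<bar> = h * (2 * u) * \<bar>f'' v\<bar>"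
  using u v h by (simp add: abs_mult)
 also have "\<dots> \<le> h * (2 * h) * M"
  using u v h by (intro mult_mono M) auto
 finally show ?thesis by (simp add: power2_eq_square mult_ac)
qed simp

text \<open>The delicate point is 0, where the difference quotient is \<open>max 0 h ^ k\<close>
  itself; \<open>1 \<le> k\<close> makes it tend to 0.\<close>

lemma pos_part_power_deriv:
 assumes "1 \<le> k"
 shows "((\<lambda>r::real. max 0 r ^ Suc k) has_real_derivative (1 + real k) * max 0 r ^ k) (at r)"
proof -
 consider "r < 0" | "r = 0" | "r > 0" by linarith
 then show ?thesis
 proof cases
  case 1
  have "((\<lambda>r::real. 0) has_real_derivative (1 + real k) * max 0 r ^ k) (at r)"
   using 1 assms by (auto intro!: derivative_eq_intros simp: max_def)
  then show ?thesis
   by (rule has_field_derivative_transform_within_open[where S="{..<0}"]) (use 1 in \<open>auto simp: max_def\<close>)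
 next
  case 3
  have "((\<lambda>r::real. r ^ Suc k) has_real_derivative (1 + real k) * max 0 r ^ k) (at r)"
   using DERIV_pow[of "Suc k" r] 3 by (simp add: max_def)
  then show ?thesis
   by (rule has_field_derivative_transform_within_open[where S="{0<..}"]) (use 3 in \<open>auto simp: max_def\<close>)
 next
  case 2
  have "((\<lambda>h::real. max 0 h ^ k) \<longlongrightarrow> max 0 0 ^ k) (at 0)"
   by (intro tendsto_intros)
  then have lim: "((\<lambda>h::real. max 0 h ^ k) \<longlongrightarrow> 0) (at 0)" using assms by (simp add: power_0_left)
  have "\<forall>\<^sub>F h::real in at 0. max 0 h ^ k = (max 0 (0 + h) ^ Suc k - max 0 0 ^ Suc k) / h"
   using assms unfolding eventually_at_filter by (intro always_eventually) (auto simp: max_def)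
  from Lim_transform_eventually[OF lim this]
  have "((\<lambda>h::real. (max 0 (0 + h) ^ Suc k - max 0 0 ^ Suc k) / h) \<longlongrightarrow> 0) (at 0)" .
  then show ?thesis using 2 assms unfolding DERIV_def by (simp add: power_0_left)
 qed
qed

lemma pos_part_power_deriv_chain:
 assumes "1 \<le> k" "(g has_real_derivative g') (at t)"
 shows "((\<lambda>t. max 0 (g t) ^ Suc k) has_real_derivative (1 + real k) * max 0 (g t) ^ k * g') (at t)"
 using DERIV_chain'[OF assms(2) pos_part_power_deriv[OF assms(1), of "g t"]] by (simp add: mult_ac)

text \<open>\<open>bump1\<close> to \<open>bump4\<close> are successive line derivatives of
  \<open>bump\<close>: two in direction z, then two in direction y.\<close>

definition bump2 :: "real^'n \<Rightarrow> real^'n \<Rightarrow> real" where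
 "bump2 z x = 80 * max 0 (1 - (norm x)\<^sup>2) ^ 3 * (x \<bullet> z)\<^sup>2 - 10 * max 0 (1 - (norm x)\<^sup>2) ^ 4 * (z \<bullet> z)"

lemma norm_sq_line_deriv:
 fixes x z :: "'a::real_inner"
 shows "((\<lambda>t. 1 - (norm (x + t *\<^sub>R z))\<^sup>2) has_real_derivative (- 2 * ((x + t *\<^sub>R z) \<bullet> z))) (at t)"
 unfolding power2_norm_eq_inner inner_add_left inner_add_right inner_scaleR_left inner_scaleR_right
 by (auto intro!: derivative_eq_intros simp: inner_commute algebra_simps)

lemma inner_line_deriv:
 fixes x y z :: "'a::real_inner"
 shows "((\<lambda>t. (x + t *\<^sub>R y) \<bullet> z) has_real_derivative (y \<bullet> z)) (at t)"
 unfolding inner_add_left inner_scaleR_left by (auto intro!: derivative_eq_intros)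

definition bump1 :: "real^'n \<Rightarrow> real^'n \<Rightarrow> real" where
 "bump1 z x = - 10 * max 0 (1 - (norm x)\<^sup>2) ^ 4 * (x \<bullet> z)"

lemma bump_line_deriv:
 "((\<lambda>t. bump (x + t *\<^sub>R z)) has_real_derivative bump1 z (x + t *\<^sub>R z)) (at t)"
 using pos_part_power_deriv_chain[OF _ norm_sq_line_deriv, of 4 x z t]
 by (simp add: bump_def bump1_def eval_nat_numeral mult_ac)

lemma bump1_line_deriv:
 "((\<lambda>t. bump1 z (x + t *\<^sub>R z)) has_real_derivative bump2 z (x + t *\<^sub>R z)) (at t)"
proof -
 have "((\<lambda>t. max 0 (1 - (norm (x + t *\<^sub>R z))\<^sup>2) ^ 4) has_real_derivative
   4 * max 0 (1 - (norm (x + t *\<^sub>R z))\<^sup>2) ^ 3 * (- 2 * ((x + t *\<^sub>R z) \<bullet> z))) (at t)"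
  using pos_part_power_deriv_chain[OF _ norm_sq_line_deriv, of 3 x z t]
  by (simp add: eval_nat_numeral)
 from DERIV_mult[OF DERIV_cmult[OF this, of "-10"] inner_line_deriv[of x z z t]]
 show ?thesis unfolding bump1_def bump2_def by (simp add: power2_eq_square mult_ac)
qed

definition bump3 :: "real^'n \<Rightarrow> real^'n \<Rightarrow> real^'n \<Rightarrow> real" where
 "bump3 z y x = 160 * max 0 (1 - (norm x)\<^sup>2) ^ 3 * (x \<bullet> z) * (y \<bullet> z)
   - 480 * max 0 (1 - (norm x)\<^sup>2) ^ 2 * (x \<bullet> y) * (x \<bullet> z)\<^sup>2
   + 80 * max 0 (1 - (norm x)\<^sup>2) ^ 3 * (x \<bullet> y) * (z \<bullet> z)"

definition bump4 :: "real^'n \<Rightarrow> real^'n \<Rightarrow> real^'n \<Rightarrow> real" where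
 "bump4 z y x = 160 * max 0 (1 - (norm x)\<^sup>2) ^ 3 * (y \<bullet> z)\<^sup>2
   - 1920 * max 0 (1 - (norm x)\<^sup>2) ^ 2 * (x \<bullet> y) * (x \<bullet> z) * (y \<bullet> z)
   + 1920 * max 0 (1 - (norm x)\<^sup>2) * (x \<bullet> y)\<^sup>2 * (x \<bullet> z)\<^sup>2
   - 480 * max 0 (1 - (norm x)\<^sup>2) ^ 2 * (y \<bullet> y) * (x \<bullet> z)\<^sup>2
   - 480 * max 0 (1 - (norm x)\<^sup>2) ^ 2 * (x \<bullet> y)\<^sup>2 * (z \<bullet> z)
   + 80 * max 0 (1 - (norm x)\<^sup>2) ^ 3 * (y \<bullet> y) * (z \<bullet> z)"

lemma bump2_line_deriv:
 "((\<lambda>t. bump2 z (x + t *\<^sub>R y)) has_real_derivative bump3 z y (x + t *\<^sub>R y)) (at t)"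
proof -
 let ?P = "\<lambda>t. max 0 (1 - (norm (x + t *\<^sub>R y))\<^sup>2)"
 have P3: "((\<lambda>t. ?P t ^ 3) has_real_derivative 3 * ?P t ^ 2 * (- 2 * ((x + t *\<^sub>R y) \<bullet> y))) (at t)"
  using pos_part_power_deriv_chain[OF _ norm_sq_line_deriv, of 2 x y t] by (simp add: eval_nat_numeral)
 have P4: "((\<lambda>t. ?P t ^ 4) has_real_derivative 4 * ?P t ^ 3 * (- 2 * ((x + t *\<^sub>R y) \<bullet> y))) (at t)"
  using pos_part_power_deriv_chain[OF _ norm_sq_line_deriv, of 3 x y t] by (simp add: eval_nat_numeral)
 have Q: "((\<lambda>t. ((x + t *\<^sub>R y) \<bullet> z)\<^sup>2) has_real_derivative 2 * ((x + t *\<^sub>R y) \<bullet> z) * (y \<bullet> z)) (at t)"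
  using DERIV_power[OF inner_line_deriv[of x y z t], of 2] by (simp add: mult_ac)
 show ?thesis unfolding bump2_def bump3_def
  by (rule DERIV_cong[OF DERIV_diff[OF DERIV_mult[OF DERIV_cmult[OF P3, of 80] Q]
     DERIV_cmult_right[OF DERIV_cmult[OF P4, of 10], of "z \<bullet> z"]]])
    (simp only: power2_eq_square, algebra)
qed

lemma bump3_line_deriv:
 "((\<lambda>t. bump3 z y (x + t *\<^sub>R y)) has_real_derivative bump4 z y (x + t *\<^sub>R y)) (at t)"
proof -
 let ?P = "\<lambda>t. max 0 (1 - (norm (x + t *\<^sub>R y))\<^sup>2)"
 have P2: "((\<lambda>t. ?P t ^ 2) has_real_derivative 2 * ?P t * (- 2 * ((x + t *\<^sub>R y) \<bullet> y))) (at t)"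
  using pos_part_power_deriv_chain[OF _ norm_sq_line_deriv, of 1 x y t] by (simp add: eval_nat_numeral)
 have P3: "((\<lambda>t. ?P t ^ 3) has_real_derivative 3 * ?P t ^ 2 * (- 2 * ((x + t *\<^sub>R y) \<bullet> y))) (at t)"
  using pos_part_power_deriv_chain[OF _ norm_sq_line_deriv, of 2 x y t] by (simp add: eval_nat_numeral)
 note q = inner_line_deriv[of x y z t] and r = inner_line_deriv[of x y y t]
 have Q: "((\<lambda>t. ((x + t *\<^sub>R y) \<bullet> z)\<^sup>2) has_real_derivative 2 * ((x + t *\<^sub>R y) \<bullet> z) * (y \<bullet> z)) (at t)"
  using DERIV_power[OF q, of 2] by (simp add: mult_ac)
 show ?thesis unfolding bump3_def bump4_def
  by (rule DERIV_cong[OF DERIV_add[OF DERIV_diff[OF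
     DERIV_cmult_right[OF DERIV_mult[OF DERIV_cmult[OF P3, of 160] q], of "y \<bullet> z"]
     DERIV_mult[OF DERIV_mult[OF DERIV_cmult[OF P2, of 480] r] Q]]
     DERIV_cmult_right[OF DERIV_mult[OF DERIV_cmult[OF P3, of 80] r], of "z \<bullet> z"]]])
    (simp only: power2_eq_square, algebra)
qed

lemma bump2_bound: "\<bar>bump2 z x\<bar> \<le> 90 * (norm z)\<^sup>2"
proof (cases "norm x < 1")
 case True
 let ?P = "max 0 (1 - (norm x)\<^sup>2)"
 have P: "0 \<le> ?P" "?P \<le> 1" by auto
 have q: "(x \<bullet> z)\<^sup>2 \<le> (norm z)\<^sup>2"
 proof -
  have "\<bar>x \<bullet> z\<bar> \<le> norm x * norm z" by (rule Cauchy_Schwarz_ineq2)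
  also have "\<dots> \<le> norm z" using True by (simp add: mult_left_le_one_le)
  finally show ?thesis by (intro abs_le_square_iff[THEN iffD1]) simp
 qed
 have P': "?P ^ 3 \<le> 1" "?P ^ 4 \<le> 1" "0 \<le> ?P ^ 3" "0 \<le> ?P ^ 4" using P by (auto intro!: power_le_one)
 have "\<bar>?P ^ 3 * (x \<bullet> z)\<^sup>2\<bar> \<le> 1 * (norm z)\<^sup>2"
  unfolding abs_mult by (intro mult_mono) (use P' q in auto)
 moreover have "0 \<le> ?P ^ 3 * (x \<bullet> z)\<^sup>2" using P' by (intro mult_nonneg_nonneg) auto
 moreover have "\<bar>?P ^ 4 * (z \<bullet> z)\<bar> \<le> 1 * (norm z)\<^sup>2"
  unfolding abs_mult by (intro mult_mono) (use P' in \<open>auto simp: power2_norm_eq_inner\<close>)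
 moreover have "0 \<le> ?P ^ 4 * (z \<bullet> z)" using P' by (intro mult_nonneg_nonneg) auto
 ultimately show ?thesis unfolding bump2_def mult.assoc by linarith
next
 case False
 then have "1 - (norm x)\<^sup>2 \<le> 0" using power_mono[of 1 "norm x" 2] by simp
 then show ?thesis by (simp add: bump2_def max_absorb1)
qed

text \<open>Inside the unit ball Cauchy-Schwarz bounds every inner product, so the six coefficients
  simply add up: 160 + 1920 + 1920 + 480 + 480 + 80 = 5040.\<close>

lemma bump4_bound: "\<bar>bump4 z y x\<bar> \<le> 5040 * ((norm y)\<^sup>2 * (norm z)\<^sup>2)"
proof (cases "norm x < 1")
 case True
 let ?A = "norm y" and ?B = "norm z"
 define P where "P = max 0 (1 - (norm x)\<^sup>2)"
 have P: "0 \<le> P" "P \<le> 1" "0 \<le> P^2" "P^2 \<le> 1" "0 \<le> P^3" "P^3 \<le> 1"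
  by (auto intro!: power_le_one simp: P_def)
 have ip: "\<bar>x \<bullet> v\<bar> \<le> norm v" for v :: "real^'a"
 proof -
  have "\<bar>x \<bullet> v\<bar> \<le> norm x * norm v" by (rule Cauchy_Schwarz_ineq2)
  also have "\<dots> \<le> norm v" using True by (simp add: mult_left_le_one_le)
  finally show ?thesis .
 qed
 have yz: "\<bar>y \<bullet> z\<bar> \<le> ?A * ?B" by (rule Cauchy_Schwarz_ineq2)
 have sq: "(x \<bullet> y)\<^sup>2 \<le> ?A\<^sup>2" "(x \<bullet> z)\<^sup>2 \<le> ?B\<^sup>2" "(y \<bullet> z)\<^sup>2 \<le> ?A\<^sup>2 * ?B\<^sup>2"
  using ip[of y] ip[of z] yz by (auto intro!: abs_le_square_iff[THEN iffD1] simp flip: power_mult_distrib)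
 let ?Q = "?A\<^sup>2 * ?B\<^sup>2"
 have 1: "\<bar>P ^ 3 * (y \<bullet> z)\<^sup>2\<bar> \<le> 1 * ?Q"
  unfolding abs_mult by (intro mult_mono) (use P sq in auto)
 have 2: "\<bar>P ^ 2 * ((x \<bullet> y) * ((x \<bullet> z) * (y \<bullet> z)))\<bar> \<le> 1 * (?A * (?B * (?A * ?B)))"
  unfolding abs_mult by (intro mult_mono) (use P ip yz in auto)
 have 3: "\<bar>P * ((x \<bullet> y)\<^sup>2 * (x \<bullet> z)\<^sup>2)\<bar> \<le> 1 * ?Q"
  unfolding abs_mult by (intro mult_mono) (use P sq in auto)
 have 4: "\<bar>P ^ 2 * ((y \<bullet> y) * (x \<bullet> z)\<^sup>2)\<bar> \<le> 1 * ?Q"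
  unfolding abs_mult by (intro mult_mono) (use P sq in \<open>auto simp: power2_norm_eq_inner\<close>)
 have 5: "\<bar>P ^ 2 * ((x \<bullet> y)\<^sup>2 * (z \<bullet> z))\<bar> \<le> 1 * ?Q"
  unfolding abs_mult by (intro mult_mono) (use P sq in \<open>auto simp: power2_norm_eq_inner\<close>)
 have 6: "\<bar>P ^ 3 * ((y \<bullet> y) * (z \<bullet> z))\<bar> \<le> 1 * ?Q"
  unfolding abs_mult by (intro mult_mono) (use P in \<open>auto simp: power2_norm_eq_inner\<close>)
 have "?A * (?B * (?A * ?B)) = ?Q" by (simp add: power2_eq_square)
 with 1 2 3 4 5 6 show ?thesis
  unfolding bump4_def P_def[symmetric] mult.assoc abs_le_iff by (intro conjI; linarith)
next
 case False
 then have "1 - (norm x)\<^sup>2 \<le> 0" using power_mono[of 1 "norm x" 2] by simp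
 then show ?thesis by (simp add: bump4_def max_absorb1)
qed

lemma sdiff_bump_bound: "\<bar>sdiff bump z x\<bar> \<le> 180 * (norm z)\<^sup>2"
 using second_difference_bound[OF _ bump_line_deriv[of x z] bump1_line_deriv[of z x] bump2_bound, of 1]
 by (simp add: sdiff_def)

lemma sdiff_bump2_bound: "\<bar>sdiff (bump2 z) y x\<bar> \<le> 10080 * ((norm y)\<^sup>2 * (norm z)\<^sup>2)"
 using second_difference_bound[OF _ bump2_line_deriv[of z x y] bump3_line_deriv[of z y x] bump4_bound, of 1]
 by (simp add: sdiff_def)

lemma sdiff_commute: "sdiff (sdiff f y) z x = sdiff (sdiff f z) y x"
 by (simp add: sdiff_def algebra_simps)

text \<open>The second-difference estimate is applied in direction z to the function
  \<open>sdiff bump y\<close>, whose second line derivative is \<open>sdiff (bump2 z) y\<close>; the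
  latter is bounded by the same estimate in direction y. This is the source of smoothness for
  \<open>lapb\<close>.\<close>

lemma sdiff_sdiff_bump_bound:
 "\<bar>sdiff (sdiff bump z) y x\<bar> \<le> 20160 * (norm z)\<^sup>2 * (norm y)\<^sup>2"
proof -
 have d1: "((\<lambda>t. sdiff bump y (x + t *\<^sub>R z)) has_real_derivative sdiff (bump1 z) y (x + t *\<^sub>R z)) (at t)" for t
  unfolding sdiff_def
  using bump_line_deriv[of "x + y" z t] bump_line_deriv[of "x - y" z t] bump_line_deriv[of x z t]
  by (auto intro!: derivative_eq_intros simp: algebra_simps)
 have d2: "((\<lambda>t. sdiff (bump1 z) y (x + t *\<^sub>R z)) has_real_derivative sdiff (bump2 z) y (x + t *\<^sub>R z)) (at t)" for t
  unfolding sdiff_def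
  using bump1_line_deriv[of z "x + y" t] bump1_line_deriv[of z "x - y" t] bump1_line_deriv[of z x t]
  by (auto intro!: derivative_eq_intros simp: algebra_simps)
 have "\<bar>sdiff (sdiff bump y) z x\<bar> \<le> 2 * (10080 * ((norm y)\<^sup>2 * (norm z)\<^sup>2))"
  using second_difference_bound[OF _ d1 d2 sdiff_bump2_bound, of 1] by (simp add: sdiff_def)
 then show ?thesis by (simp add: sdiff_commute[of bump y z] mult_ac)
qed

section \<open>Truncated fractional Laplacians: bounds, decay, limits and scaling\<close>

lemma sdiff_kern_integrable:
 fixes f :: "real^'n \<Rightarrow> real"
 assumes s: "0 < s" "s < 1" and e: "0 \<le> e" and [measurable]: "f \<in> borel_measurable borel"
  and B: "\<And>z. \<bar>sdiff f z x\<bar> \<le> B * min 1 ((norm z)\<^sup>2)"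
 shows "L1 (\<lambda>z. sdiff f z x * kern s e z)"
  and "\<bar>sdiff f z x * kern s e z\<bar> \<le> B * (min 1 ((norm z)\<^sup>2) * kern s 0 z)"
proof -
 have *: "\<bar>sdiff f z x * kern s e z\<bar> \<le> B * (min 1 ((norm z)\<^sup>2) * kern s 0 z)" for z
 proof -
  have "\<bar>sdiff f z x * kern s e z\<bar> = \<bar>sdiff f z x\<bar> * kern s e z"
   using kern_nonneg[of s e z] by (simp add: abs_mult)
  also have "\<dots> \<le> (B * min 1 ((norm z)\<^sup>2)) * kern s 0 z"
   using order_trans[OF abs_ge_zero B] by (intro mult_mono B kern_antimono e kern_nonneg)
  finally show ?thesis by (simp add: mult_ac)
 qed
 then show "\<bar>sdiff f z x * kern s e z\<bar> \<le> B * (min 1 ((norm z)\<^sup>2) * kern s 0 z)" .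
 show "L1 (\<lambda>z. sdiff f z x * kern s e z)"
 proof (rule bochner_bound[OF integrable_mult_right[OF kern_min_integrable[OF s], of B]])
  show "AE z in lborel. norm (sdiff f z x * kern s e z) \<le> norm (B * (min 1 ((norm z)\<^sup>2) * kern s 0 z))"
   using * by (intro AE_I2) (auto intro: order_trans[OF _ abs_ge_self])
 qed measurable
qed

lemma tlap_measurable [measurable (raw)]:
 assumes [measurable]: "f \<in> borel_measurable borel" "g \<in> borel_measurable M"
 shows "(\<lambda>x. tlap s e f (g x :: real^'n)) \<in> borel_measurable M"
proof -
 have "tlap s e f \<in> borel_measurable borel" unfolding tlap_def[abs_def] by measurable
 from measurable_compose[OF assms(2) this] show ?thesis .
qed

lemma tlap_bound:
 fixes f :: "real^'n \<Rightarrow> real"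
 assumes s: "0 < s" "s < 1" and e: "0 \<le> e" and f: "f \<in> borel_measurable borel"
  and B: "\<And>z. \<bar>sdiff f z x\<bar> \<le> B * min 1 ((norm z)\<^sup>2)"
 shows "\<bar>tlap s e f x\<bar> \<le> B * (LBINT z::real^'n. min 1 ((norm z)\<^sup>2) * kern s 0 z)"
proof -
 let ?I = "LBINT z::real^'n. min 1 ((norm z)\<^sup>2) * kern s 0 z"
 have "\<bar>LBINT z. sdiff f z x * kern s e z\<bar> \<le> (LBINT z. \<bar>sdiff f z x * kern s e z\<bar>)"
  by (rule integral_abs_bound)
 also have "\<dots> \<le> (LBINT z::real^'n. B * (min 1 ((norm z)\<^sup>2) * kern s 0 z))"
  by (intro bochner_mono integrable_abs sdiff_kern_integrable[OF s e f B] integrable_mult_right kern_min_integrable s)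
 also have "\<dots> = B * ?I" by simp
 finally have *: "\<bar>LBINT z. sdiff f z x * kern s e z\<bar> \<le> B * ?I" .
 have "\<bar>tlap s e f x\<bar> = \<bar>LBINT z. sdiff f z x * kern s e z\<bar> / 2"
  by (simp add: tlap_def abs_mult)
 then show ?thesis using * by linarith
qed

lemma sdiff_min_bound:
 assumes "\<And>x. \<bar>f x\<bar> \<le> A" "\<And>x z. \<bar>sdiff f z x\<bar> \<le> A * (norm z)\<^sup>2"
 shows "\<bar>sdiff f z x\<bar> \<le> 4 * A * min 1 ((norm z)\<^sup>2)"
proof -
 have "0 \<le> A" using assms(1)[of undefined] by linarith
 then have "A * (norm z)\<^sup>2 \<le> 4 * A * (norm z)\<^sup>2" by (intro mult_right_mono) auto
 moreover have "\<bar>sdiff f z x\<bar> \<le> 4 * A"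
  using assms(1)[of "x + z"] assms(1)[of "x - z"] assms(1)[of x] unfolding sdiff_def by linarith
 ultimately show ?thesis using assms(2)[of z x] by (auto simp: min_def)
qed

text \<open>Far from the support only the kernel at distance about \<open>norm x\<close> contributes.\<close>

lemma tlap_decay:
 assumes s: "0 < s" "s < 1"
 obtains C where "0 \<le> C"
  "\<And>(f :: real^'n \<Rightarrow> real) A e x. \<lbrakk>0 \<le> e; f \<in> borel_measurable borel; \<And>x. \<bar>f x\<bar> \<le> A; \<And>x. 2 < norm x \<Longrightarrow> f x = 0;
    \<And>x z. \<bar>sdiff f z x\<bar> \<le> A * (norm z)\<^sup>2\<rbrakk> \<Longrightarrow> \<bar>tlap s e f x\<bar> \<le> C * A * decay s x"
proof
 let ?a = "real CARD('n) + 2 * s"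
 define I where "I = (LBINT z::real^'n. min 1 ((norm z)\<^sup>2) * kern s 0 z)"
 define V where "V = measure lborel (cball 0 2 :: (real^'n) set)"
 have I: "0 \<le> I" unfolding I_def by (intro integral_nonneg_AE AE_I2 mult_nonneg_nonneg kern_nonneg) auto
 have V: "0 \<le> V" by (simp add: V_def)
 define C where "C = 4 * I * 7 powr ?a + 2 powr ?a * V"
 show "0 \<le> C" using I V by (simp add: C_def)
 fix f :: "real^'n \<Rightarrow> real" and A e :: real and x :: "real^'n"
 assume e: "0 \<le> e" and [measurable]: "f \<in> borel_measurable borel" and A: "\<And>x. \<bar>f x\<bar> \<le> A"
  and supp: "\<And>x. 2 < norm x \<Longrightarrow> f x = 0" and d2: "\<And>x z. \<bar>sdiff f z x\<bar> \<le> A * (norm z)\<^sup>2"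
 have A0: "0 \<le> A" using A[of 0] by linarith
 note d = sdiff_min_bound[OF A d2]
 show "\<bar>tlap s e f x\<bar> \<le> C * A * decay s x"
 proof (cases "norm x \<le> 6")
  case True
  have "1 \<le> 7 powr ?a * decay s x"
  proof -
   have "(1 + norm x) powr ?a \<le> 7 powr ?a" using True s by (intro powr_mono2) auto
   moreover have "1 + norm x > 0" using norm_ge_zero[of x] by linarith
   ultimately show ?thesis unfolding decay_eq by (simp add: field_simps)
  qed
  then have "4 * A * I * 1 \<le> 4 * A * I * (7 powr ?a * decay s x)"
   using A0 I by (intro mult_left_mono) auto
  moreover have "\<bar>tlap s e f x\<bar> \<le> 4 * A * I"
   unfolding I_def by (rule tlap_bound[OF s e _ d]) simp
  moreover have "C * A * decay s x = 4 * A * I * (7 powr ?a * decay s x) + 2 powr ?a * V * A * decay s x"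
   by (simp add: C_def algebra_simps)
  moreover have "0 \<le> 2 powr ?a * V * A * decay s x"
   using V A0 decay_pos[of s x] by simp
  ultimately show ?thesis by linarith
 next
  case False
  let ?D = "2 powr ?a * decay s x"
  have D: "0 \<le> ?D" using decay_pos[of s x] by simp
  have k: "kern s e z \<le> ?D" if "norm z \<ge> norm x - 2" for z :: "real^'n"
  proof -
   have pos: "norm z > 0" "1 + norm x > 0" and le: "1 + norm x \<le> 2 * norm z" using that False by linarith+
   have "(1 + norm x) powr ?a \<le> (2 * norm z) powr ?a" using le pos s by (intro powr_mono2) auto
   also have "\<dots> = 2 powr ?a * norm z powr ?a" by (rule powr_mult)
   finally have "(1 + norm x) powr ?a \<le> 2 powr ?a * norm z powr ?a" .
   moreover have "norm z powr ?a > 0" "(1 + norm x) powr ?a > 0" using pos by auto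
   ultimately show ?thesis unfolding kern_def decay_eq by (simp add: field_simps)
  qed
  let ?i = "\<lambda>z. indicator (cball 0 2) z :: real"
  have tm: "\<bar>f (x + w)\<bar> * kern s e w \<le> A * ?D * ?i (x + w)" for w
  proof (cases "norm (x + w) \<le> 2")
   case True
   have "norm x - 2 \<le> norm w" using True norm_triangle_ineq4[of "x + w" w] by simp
   then show ?thesis using True A0 D by (auto intro!: mult_mono A k kern_nonneg)
  qed (simp add: supp)
  have bd: "\<bar>sdiff f z x * kern s e z\<bar> \<le> A * ?D * (?i (x + z) + ?i (x - z))" for z
  proof -
   have "f x = 0" using False supp by simp
   then have "\<bar>sdiff f z x * kern s e z\<bar> \<le> \<bar>f (x + z)\<bar> * kern s e z + \<bar>f (x + - z)\<bar> * kern s e (- z)"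
    using kern_nonneg[of s e z] abs_triangle_ineq[of "f (x + z)" "f (x - z)"]
    by (simp add: sdiff_def abs_mult kern_minus flip: distrib_right) (intro mult_right_mono; simp)
   also have "\<dots> \<le> A * ?D * ?i (x + z) + A * ?D * ?i (x + - z)"
    by (intro add_mono tm)
   finally show ?thesis by (simp add: algebra_simps)
  qed
  have i: "L1 (?i :: real^'n \<Rightarrow> real)"
   using emeasure_lborel_cball_finite[of "0 :: real^'n" 2] by (simp add: integrable_real_indicator)
  have "\<bar>LBINT z. sdiff f z x * kern s e z\<bar> \<le> (LBINT z. \<bar>sdiff f z x * kern s e z\<bar>)"
   by (rule integral_abs_bound)
  also have "\<dots> \<le> (LBINT z. A * ?D * (?i (x + z) + ?i (x - z)))"
  proof (rule bochner_mono)
   show "L1 (\<lambda>z. A * ?D * (?i (x + z) + ?i (x - z)))"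
    by (intro integrable_mult_right bochner_integrable_add
      integrable_lborel_translate[THEN iffD2] integrable_lborel_reflect[THEN iffD2] i)
  qed (intro integrable_abs sdiff_kern_integrable[OF s e _ d] bd; simp)+
  also have "\<dots> = A * ?D * (V + V)"
  proof -
   have "(LBINT z. (?i (x + z) + ?i (x - z))) = (LBINT z. ?i (x + z)) + (LBINT z. ?i (x - z))"
    by (intro bochner_add
      integrable_lborel_translate[THEN iffD2] integrable_lborel_reflect[THEN iffD2] i)
   also have "\<dots> = V + V"
    unfolding integral_lborel_translate integral_lborel_reflect by (simp add: V_def)
   finally show ?thesis by simp
  qed
  finally have "\<bar>LBINT z. sdiff f z x * kern s e z\<bar> \<le> 2 * (A * ?D * V)" by simp
  then have "\<bar>tlap s e f x\<bar> \<le> A * ?D * V" by (simp add: tlap_def abs_mult)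
  moreover have "C * A * decay s x = A * ?D * V + 4 * I * 7 powr ?a * A * decay s x"
   by (simp add: C_def algebra_simps)
  moreover have "0 \<le> 4 * I * 7 powr ?a * A * decay s x"
   using I A0 decay_pos[of s x] by simp
  ultimately show ?thesis by linarith
 qed
qed

lemma tlap_tendsto:
 fixes f :: "real^'n \<Rightarrow> real"
 assumes s: "0 < s" "s < 1" and e: "\<And>k. 0 \<le> e k" "e \<longlonglongrightarrow> 0" and f[measurable]: "f \<in> borel_measurable borel"
  and B: "\<And>z. \<bar>sdiff f z x\<bar> \<le> B * min 1 ((norm z)\<^sup>2)"
 shows "(\<lambda>k. tlap s (e k) f x) \<longlonglongrightarrow> tlap s 0 f x"
 unfolding tlap_def
proof (intro tendsto_mult tendsto_const integral_dominated_convergence)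
 show "L1 (\<lambda>z::real^'n. B * (min 1 ((norm z)\<^sup>2) * kern s 0 z))"
  by (intro integrable_mult_right kern_min_integrable s)
 show "AE z in lborel. norm (sdiff f z x * kern s (e k) z) \<le> B * (min 1 ((norm z)\<^sup>2) * kern s 0 z)" for k
  using sdiff_kern_integrable(2)[OF s e(1) f B] by (intro AE_I2) simp
 show "AE z in lborel. (\<lambda>k. sdiff f z x * kern s (e k) z) \<longlonglongrightarrow> sdiff f z x * kern s 0 z"
 proof (intro AE_I2 tendsto_mult tendsto_const)
  fix z :: "real^'n"
  show "(\<lambda>k. kern s (e k) z) \<longlonglongrightarrow> kern s 0 z"
  proof (cases "z = 0")
   case False
   then have "\<forall>\<^sub>F k in sequentially. e k < norm z"
    using e(2) by (intro order_tendstoD(2)) auto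
   then have "\<forall>\<^sub>F k in sequentially. kern s 0 z = kern s (e k) z"
    by eventually_elim (simp add: kern_def)
   then show ?thesis by (rule Lim_transform_eventually[OF tendsto_const])
  qed (simp add: kern_def cong: if_cong)
 qed
qed measurable

lemma tlap_continuous:
 fixes f :: "real^'n \<Rightarrow> real"
 assumes s: "0 < s" "s < 1" and e: "0 \<le> e" and f: "continuous_on UNIV f"
  and B: "\<And>x z. \<bar>sdiff f z x\<bar> \<le> B * min 1 ((norm z)\<^sup>2)"
 shows "continuous_on UNIV (tlap s e f)"
proof -
 have [measurable]: "f \<in> borel_measurable borel" using f by (rule borel_measurable_continuous_onI)
 have "tlap s e f \<midarrow>x\<rightarrow> tlap s e f x" for x
 proof (unfold tendsto_at_iff_sequentially, intro allI impI)
  fix X :: "nat \<Rightarrow> real^'n" assume "\<forall>i. X i \<in> UNIV - {x}" and X: "X \<longlonglongrightarrow> x"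
  have fc: "(\<lambda>k. f (g k)) \<longlonglongrightarrow> f l" if "g \<longlonglongrightarrow> l" for g l
   using f that by (intro continuous_on_tendsto_compose[OF f that]) auto
  show "(tlap s e f \<circ> X) \<longlonglongrightarrow> tlap s e f x"
   unfolding tlap_def comp_def
  proof (intro tendsto_mult tendsto_const integral_dominated_convergence)
   show "L1 (\<lambda>z::real^'n. B * (min 1 ((norm z)\<^sup>2) * kern s 0 z))"
    by (intro integrable_mult_right kern_min_integrable s)
   show "AE z in lborel. norm (sdiff f z (X k) * kern s e z) \<le> B * (min 1 ((norm z)\<^sup>2) * kern s 0 z)" for k
    using sdiff_kern_integrable(2)[OF s e _ B] by (intro AE_I2) simp
   show "AE z in lborel. (\<lambda>k. sdiff f z (X k) * kern s e z) \<longlonglongrightarrow> sdiff f z x * kern s e z"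
    unfolding sdiff_def by (intro AE_I2 tendsto_intros fc X)
  qed measurable
 qed
 then show ?thesis by (simp add: continuous_on_def)
qed

text \<open>The change of variables contributes t^n and the kernel t^(-n-2s); the truncation radius
  is measured in units of t.\<close>

lemma tlap_scale:
 fixes f :: "real^'n \<Rightarrow> real"
 assumes t: "0 < t"
 shows "tlap s e (\<lambda>y. f ((y - c) /\<^sub>R t)) x = t powr (- 2 * s) * tlap s (e / t) f ((x - c) /\<^sub>R t)"
proof -
 have "(LBINT z. sdiff (\<lambda>y. f ((y - c) /\<^sub>R t)) z x * kern s e z)
   = t ^ CARD('n) * (LBINT z. sdiff (\<lambda>y. f ((y - c) /\<^sub>R t)) (0 + t *\<^sub>R z) x * kern s e (0 + t *\<^sub>R z))"
  using integral_lborel_affine[of t "\<lambda>z. sdiff (\<lambda>y. f ((y - c) /\<^sub>R t)) z x * kern s e z" 0] t by simp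
 also have "(\<lambda>z. sdiff (\<lambda>y. f ((y - c) /\<^sub>R t)) (0 + t *\<^sub>R z) x * kern s e (0 + t *\<^sub>R z))
   = (\<lambda>z. t powr - (real CARD('n) + 2 * s) * (sdiff f z ((x - c) /\<^sub>R t) * kern s (e / t) z))"
 proof
  fix z :: "real^'n"
  have "(x + t *\<^sub>R z - c) /\<^sub>R t = (x - c) /\<^sub>R t + z" "(x - t *\<^sub>R z - c) /\<^sub>R t = (x - c) /\<^sub>R t - z"
   using t by (auto simp: algebra_simps)
  then show "sdiff (\<lambda>y. f ((y - c) /\<^sub>R t)) (0 + t *\<^sub>R z) x * kern s e (0 + t *\<^sub>R z)
    = t powr - (real CARD('n) + 2 * s) * (sdiff f z ((x - c) /\<^sub>R t) * kern s (e / t) z)"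
   unfolding add_0 kern_scale[OF t] sdiff_def by simp
 qed
 also have "t ^ CARD('n) * (LBINT z. t powr - (real CARD('n) + 2 * s) * (sdiff f z ((x - c) /\<^sub>R t) * kern s (e / t) z))
   = (t powr real CARD('n) * t powr - (real CARD('n) + 2 * s)) * (LBINT z. sdiff f z ((x - c) /\<^sub>R t) * kern s (e / t) z)"
  using t by (simp add: powr_realpow)
 also have "t powr real CARD('n) * t powr - (real CARD('n) + 2 * s) = t powr (- 2 * s)"
  by (simp add: powr_add[symmetric])
 finally show ?thesis by (simp add: tlap_def)
qed

lemma integrable_pair_bound:
 fixes F :: "'a::euclidean_space \<times> 'b::euclidean_space \<Rightarrow> real"
 assumes [measurable]: "F \<in> borel_measurable lborel2"
  and f: "L1 f" and g: "L1 g"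
  and le: "\<And>x y. \<bar>F (x, y)\<bar> \<le> f x * g y"
 shows "integrable lborel2 F"
proof -
 have [measurable]: "f \<in> borel_measurable borel" "g \<in> borel_measurable borel" using f g by auto
 have "integrable lborel2 (\<lambda>(x, y). f x * g y)"
 proof (rule lborel_pair.Fubini_integrable)
  have "L1 (\<lambda>x. \<bar>f x\<bar> * (LBINT y. \<bar>g y\<bar>))"
   by (intro integrable_mult_left integrable_abs f)
  then show "L1 (\<lambda>x. LBINT y. norm (case (x, y) of (x, y) \<Rightarrow> f x * g y))"
   by (simp add: abs_mult)
 qed (use f g in \<open>auto intro!: integrable_mult_right\<close>)
 then show ?thesis
 proof (rule bochner_bound)
  show "AE p in lborel2. norm (F p) \<le> norm (case p of (x, y) \<Rightarrow> f x * g y)"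
   using le by (intro AE_I2) (auto intro: order_trans[OF _ abs_ge_self])
 qed measurable
qed

subsection \<open>The fractional Laplacian of the bump function\<close>

text \<open>The fractional Laplacian of the bump without the factor \<open>frac_const\<close>. By
  \<open>tlap_scale\<close> its dilates give the fractional Laplacians of all test functions
  \<open>bumpd\<close>.\<close>

definition lapb :: "real \<Rightarrow> real^'n \<Rightarrow> real" where "lapb s = tlap s 0 bump"

lemma lapb_measurable [measurable]: "lapb s \<in> borel_measurable borel"
 unfolding lapb_def by measurable

lemma lapb_measurable_raw [measurable (raw)]:
 assumes [measurable]: "g \<in> borel_measurable M"
 shows "(\<lambda>x. lapb s (g x :: real^'n)) \<in> borel_measurable M"
 by measurable

lemma bump_measurable_raw [measurable (raw)]:
 assumes [measurable]: "g \<in> borel_measurable M"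
 shows "(\<lambda>x. bump (g x :: real^'n)) \<in> borel_measurable M"
 by measurable

lemma abs_bump: "\<bar>bump x\<bar> \<le> 180"
 using bump_nonneg[of x] bump_le_1[of x] by simp

lemma tlap_bump_decay:
 assumes s: "0 < s" "s < 1"
 obtains C where "0 < C" "\<And>e x. 0 \<le> e \<Longrightarrow> \<bar>tlap s e (bump :: real^'n \<Rightarrow> real) x\<bar> \<le> C * decay s x"
proof -
 obtain C where C: "0 \<le> C" "\<And>(f :: real^'n \<Rightarrow> real) A e x. \<lbrakk>0 \<le> e; f \<in> borel_measurable borel; \<And>x. \<bar>f x\<bar> \<le> A; \<And>x. 2 < norm x \<Longrightarrow> f x = 0;
    \<And>x z. \<bar>sdiff f z x\<bar> \<le> A * (norm z)\<^sup>2\<rbrakk> \<Longrightarrow> \<bar>tlap s e f x\<bar> \<le> C * A * decay s x"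
  using tlap_decay[OF s] by metis
 have "\<bar>tlap s e (bump :: real^'n \<Rightarrow> real) x\<bar> \<le> (C * 180 + 1) * decay s x" if "0 \<le> e" for e and x :: "real^'n"
 proof -
  have "\<bar>tlap s e bump x\<bar> \<le> C * 180 * decay s x"
   by (rule C(2)[OF that _ abs_bump _ sdiff_bump_bound]) (auto simp: bump_outside)
  also have "\<dots> \<le> (C * 180 + 1) * decay s x" using decay_pos[of s x] by (intro mult_right_mono) auto
  finally show ?thesis .
 qed
 then show thesis using C(1) that[of "C * 180 + 1"] by simp
qed

lemma lapb_decay:
 assumes s: "0 < s" "s < 1"
 obtains C where "0 < C" "\<And>x :: real^'n. \<bar>lapb s x\<bar> \<le> C * decay s x"
 using tlap_bump_decay[OF s] unfolding lapb_def by (metis order_refl)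

lemma lapb_le:
 fixes x :: "real^'n"
 assumes "0 < s" "0 < C" "\<And>x :: real^'n. \<bar>lapb s x\<bar> \<le> C * decay s x"
 shows "\<bar>lapb s x\<bar> \<le> C"
 using assms(3)[of x] mult_left_le[OF decay_le_1[OF assms(1)], of C x] assms(2) by linarith

lemma lapb_integrable:
 assumes s: "0 < s" "s < 1"
 shows "L1 (lapb s :: real^'n \<Rightarrow> real)"
proof -
 obtain C where C: "0 < C" "\<And>x :: real^'n. \<bar>lapb s x\<bar> \<le> C * decay s x" using lapb_decay[OF s] by blast
 show ?thesis
  by (rule bochner_bound[OF integrable_mult_right[OF decay_integrable[OF s(1)], of C]])
    (use C in \<open>auto intro: order_trans[OF _ abs_ge_self]\<close>)
qed

lemma bump_sdiff_min: "\<bar>sdiff bump z x\<bar> \<le> 720 * min 1 ((norm z)\<^sup>2)"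
 using sdiff_min_bound[of bump 180 z x] abs_bump sdiff_bump_bound by auto

lemma lapb_continuous:
 assumes s: "0 < s" "s < 1"
 shows "continuous_on UNIV (lapb s :: real^'n \<Rightarrow> real)"
 unfolding lapb_def by (rule tlap_continuous[OF s _ bump_continuous bump_sdiff_min]) simp

lemma lapb_radial:
 fixes x y :: "real^'n"
 assumes "norm x = norm y"
 shows "lapb s x = lapb s y"
proof -
 obtain T where T: "orthogonal_transformation T" "T x = y"
  using orthogonal_transformation_exists[OF assms] .
 have lin: "linear T" using T(1) by (rule orthogonal_transformation_linear)
 have nT: "norm (T v) = norm v" for v using orthogonal_transformation_norm[OF T(1)] .
 have bT: "bump (T v) = bump v" for v by (simp add: bump_def nT)
 have "sdiff bump (T z) y * kern s 0 (T z) = sdiff bump z x * kern s 0 z" for z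
 proof -
  have "bump (y + T z) = bump (x + z)" "bump (y - T z) = bump (x - z)" "bump y = bump x"
   using bT[of "x + z"] bT[of "x - z"] bT[of x] by (simp_all add: linear_add[OF lin] linear_diff[OF lin] T(2))
  then show ?thesis by (simp add: sdiff_def kern_def nT)
 qed
 moreover have "(LBINT z. sdiff bump (T z) y * kern s 0 (T z)) = (LBINT z. sdiff bump z y * kern s 0 z)"
  by (rule integral_lborel_orthogonal[OF T(1)]) measurable
 ultimately show ?thesis by (simp add: lapb_def tlap_def)
qed

lemma bump_integrable: "L1 (bump :: real^'n \<Rightarrow> real)"
proof (rule bochner_bound)
 show "L1 (indicator (cball 0 1) :: real^'n \<Rightarrow> real)"
  using emeasure_lborel_cball_finite[of "0 :: real^'n" 1] by (simp add: integrable_real_indicator)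
 show "AE x in lborel. norm (bump x) \<le> norm (indicator (cball 0 1) (x :: real^'n) :: real)"
 proof (rule AE_I2)
  fix x :: "real^'n"
  show "norm (bump x) \<le> norm (indicator (cball 0 1) x :: real)"
   using bump_le_1[of x] bump_nonneg[of x] bump_outside[of x] by (cases "norm x \<le> 1") auto
 qed
qed measurable

lemma sdiff_integrable:
 fixes f :: "real^'n \<Rightarrow> real"
 assumes "L1 f"
 shows "L1 (\<lambda>x. sdiff f z x)"
 unfolding sdiff_def
 using assms integrable_lborel_translate[of f z] integrable_lborel_translate[of f "- z"]
 by (auto intro!: bochner_integrable_add bochner_integrable_diff simp: add.commute)

text \<open>For steps up to 1 the second difference is supported in the ball of radius 2, so the
  pointwise bound integrates. The L^1 form allows Fubini in \<open>lapb_integral_0\<close> and later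
  yields estimates for averages of a density that use only its supremum.\<close>

lemma sdiff_bump_norm1:
 obtains C where "0 < C" "\<And>z :: real^'n. (LBINT x. \<bar>sdiff bump z x\<bar>) \<le> C * min 1 ((norm z)\<^sup>2)"
proof -
 define V where "V = measure lborel (cball 0 2 :: (real^'n) set)"
 define b where "b = (LBINT x::real^'n. bump x)"
 have V: "0 \<le> V" by (simp add: V_def)
 have b: "0 \<le> b" unfolding b_def by (intro integral_nonneg_AE AE_I2 bump_nonneg)
 have i2: "L1 (indicator (cball 0 2) :: real^'n \<Rightarrow> real)"
  using emeasure_lborel_cball_finite[of "0 :: real^'n" 2] by (simp add: integrable_real_indicator)
 have "(LBINT x. \<bar>sdiff bump z x\<bar>) \<le> (4 * b + 180 * V + 1) * min 1 ((norm z)\<^sup>2)" for z :: "real^'n"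
 proof (cases "norm z \<le> 1")
  case True
  have "(LBINT x. \<bar>sdiff bump z x\<bar>) \<le> (LBINT x::real^'n. 180 * (norm z)\<^sup>2 * indicator (cball 0 2) x)"
  proof (rule bochner_mono)
   show "\<bar>sdiff bump z x\<bar> \<le> 180 * (norm z)\<^sup>2 * indicator (cball 0 2) x" for x :: "real^'n"
   proof (cases "norm x \<le> 2")
    case False
    have "norm (x + z) \<ge> 1" "norm (x - z) \<ge> 1" "norm x \<ge> 1"
     using False True norm_triangle_ineq4[of "x + z" z] norm_triangle_ineq[of "x - z" z] by auto
    then show ?thesis by (simp add: sdiff_def bump_outside)
   qed (use sdiff_bump_bound[of z x] in simp)
  qed (intro integrable_abs sdiff_integrable bump_integrable integrable_mult_right i2)+
  also have "\<dots> = 180 * V * (norm z)\<^sup>2" by (simp add: V_def)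
  also have "\<dots> \<le> (4 * b + 180 * V + 1) * (norm z)\<^sup>2" using b by (intro mult_right_mono) auto
  finally show ?thesis using True power_le_one[of "norm z" 2] by (simp add: min_absorb2)
 next
  case False
  have i: "L1 (\<lambda>x. bump (z + x))" "L1 (\<lambda>x. bump (- z + x))"
   using bump_integrable by (auto simp only: integrable_lborel_translate)
  have "(LBINT x. \<bar>sdiff bump z x\<bar>) \<le> (LBINT x::real^'n. (bump (z + x) + bump (- z + x)) + 2 * bump x)"
  proof (rule bochner_mono)
   show "\<bar>sdiff bump z x\<bar> \<le> (bump (z + x) + bump (- z + x)) + 2 * bump x" for x :: "real^'n"
    using bump_nonneg[of "x + z"] bump_nonneg[of "x - z"] bump_nonneg[of x]
    by (simp add: sdiff_def add.commute)
  qed (intro integrable_abs sdiff_integrable bump_integrable bochner_integrable_add integrable_mult_right i)+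
  also have "\<dots> = ((LBINT x. bump (z + x)) + (LBINT x. bump (- z + x))) + 2 * b"
   using bochner_add[OF bochner_integrable_add[OF i] integrable_mult_right[OF bump_integrable, of 2]]
    bochner_add[OF i] by (simp add: b_def)
  also have "\<dots> = (b + b) + 2 * b"
   unfolding integral_lborel_translate b_def ..
  also have "\<dots> \<le> (4 * b + 180 * V + 1) * 1" using V by simp
  finally show ?thesis using False power_mono[of 1 "norm z" 2] by (simp add: min_absorb1)
 qed
 then show thesis using b V that[of "4 * b + 180 * V + 1"] by simp
qed

lemma sdiff_bump_kern_integrable:
 assumes s: "0 < s" "s < 1" and e: "0 \<le> e"
 shows "integrable lborel2 (\<lambda>(z, x). sdiff bump z x * kern s e (z :: real^'n))"
proof (rule lborel_pair.Fubini_integrable)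
 obtain C where C: "0 < C" "\<And>z :: real^'n. (LBINT x. \<bar>sdiff bump z x\<bar>) \<le> C * min 1 ((norm z)\<^sup>2)"
  using sdiff_bump_norm1 by blast
 have "L1 (\<lambda>z :: real^'n. (LBINT x. \<bar>sdiff bump z x\<bar>) * kern s e z)"
 proof (rule bochner_bound[OF integrable_mult_right[OF kern_min_integrable[OF s], of C]])
  show "AE z in lborel. norm ((LBINT x. \<bar>sdiff bump z x\<bar>) * kern s e z) \<le> norm (C * (min 1 ((norm z)\<^sup>2) * kern s 0 (z :: real^'n)))"
  proof (rule AE_I2)
   fix z :: "real^'n"
   have 0: "0 \<le> (LBINT x. \<bar>sdiff bump z x\<bar>)" by (intro integral_nonneg_AE AE_I2) simp
   then have "(LBINT x. \<bar>sdiff bump z x\<bar>) * kern s e z \<le> (C * min 1 ((norm z)\<^sup>2)) * kern s 0 z"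
    using C by (intro mult_mono kern_antimono e kern_nonneg) auto
   then show "norm ((LBINT x. \<bar>sdiff bump z x\<bar>) * kern s e z) \<le> norm (C * (min 1 ((norm z)\<^sup>2) * kern s 0 z))"
    using 0 kern_nonneg[of s e z] C(1) kern_nonneg[of s 0 z] by (simp add: abs_mult mult.assoc)
  qed
 qed measurable
 then show "L1 (\<lambda>z :: real^'n. LBINT x. norm (case (z, x) of (z, x) \<Rightarrow> sdiff bump z x * kern s e z))"
  by (simp add: abs_mult abs_of_nonneg[OF kern_nonneg])
qed (auto intro!: integrable_mult_left sdiff_integrable bump_integrable)

lemma integral_sdiff:
 fixes f :: "real^'n \<Rightarrow> real"
 assumes f: "L1 f"
 shows "(LBINT x. sdiff f z x) = 0"
proof -
 have i: "L1 (\<lambda>x. f (z + x))" "L1 (\<lambda>x. f (- z + x))"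
  using f by (auto simp only: integrable_lborel_translate)
 have "(LBINT x. sdiff f z x) = (LBINT x. (f (z + x) + f (- z + x)) - 2 * f x)"
  by (simp add: sdiff_def add.commute)
 also have "\<dots> = ((LBINT x. f (z + x)) + (LBINT x. f (- z + x))) - 2 * (LBINT x. f x)"
  using i f by (simp add: bochner_diff bochner_add)
 finally show ?thesis by (simp only: integral_lborel_translate)
qed

text \<open>Every second difference integrates to 0 by translation invariance; Fubini exchanges the
  point and the step.\<close>

lemma lapb_integral_0:
 assumes s: "0 < s" "s < 1"
 shows "(LBINT x::real^'n. lapb s x) = 0"
proof -
 have "(LBINT x::real^'n. (LBINT z. sdiff bump z x * kern s 0 z))
   = (LBINT z. (LBINT x. sdiff bump z x * kern s 0 (z :: real^'n)))"
  using lborel_pair.Fubini_integral[OF sdiff_bump_kern_integrable[OF s, of 0]] by simp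
 also have "\<dots> = 0" by (simp add: integral_sdiff bump_integrable)
 finally show ?thesis by (simp add: lapb_def tlap_def)
qed

text \<open>Second differences commute with the operator, so this is \<open>tlap_decay\<close>
  applied to \<open>sdiff bump z\<close>, a function of size 20160|z|^2 supported in radius
  2.\<close>

lemma sdiff_lapb_bound:
 assumes s: "0 < s" "s < 1"
 obtains C where "0 < C" "\<And>z x :: real^'n. norm z \<le> 1 \<Longrightarrow> \<bar>sdiff (lapb s) z x\<bar> \<le> C * (norm z)\<^sup>2 * decay s x"
proof -
 obtain C where C: "0 \<le> C" "\<And>(f :: real^'n \<Rightarrow> real) A e x. \<lbrakk>0 \<le> e; f \<in> borel_measurable borel; \<And>x. \<bar>f x\<bar> \<le> A; \<And>x. 2 < norm x \<Longrightarrow> f x = 0;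
    \<And>x z. \<bar>sdiff f z x\<bar> \<le> A * (norm z)\<^sup>2\<rbrakk> \<Longrightarrow> \<bar>tlap s e f x\<bar> \<le> C * A * decay s x"
  using tlap_decay[OF s] by metis
 have "\<bar>sdiff (lapb s) z x\<bar> \<le> (C * 20160 + 1) * (norm z)\<^sup>2 * decay s x" if z: "norm z \<le> 1" for z x :: "real^'n"
 proof -
  note ib = sdiff_kern_integrable(1)[OF s order_refl bump_measurable bump_sdiff_min]
  have "sdiff (lapb s) z x = tlap s 0 (sdiff bump z) x"
  proof -
   have "(LBINT y. sdiff (sdiff bump z) y x * kern s 0 y)
     = (LBINT y. (sdiff bump y (x + z) * kern s 0 y + sdiff bump y (x - z) * kern s 0 y) - 2 * (sdiff bump y x * kern s 0 y))"
    by (intro bochner_cong) (auto simp: sdiff_def algebra_simps)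
   also have "\<dots> = ((LBINT y. sdiff bump y (x + z) * kern s 0 y) + (LBINT y. sdiff bump y (x - z) * kern s 0 y))
     - 2 * (LBINT y. sdiff bump y x * kern s 0 y)"
    by (simp add: bochner_diff bochner_add ib)
   finally show ?thesis by (simp add: lapb_def tlap_def sdiff_def[of "\<lambda>x. _ x"] sdiff_def[of "\<lambda>x. - _ / _" z x] algebra_simps)
  qed
  also have "\<bar>\<dots>\<bar> \<le> C * (20160 * (norm z)\<^sup>2) * decay s x"
  proof (rule C(2))
   show "\<bar>sdiff bump z x\<bar> \<le> 20160 * (norm z)\<^sup>2" for x
    using sdiff_bump_bound[of z x] by (rule order_trans) simp
   show "sdiff bump z x = 0" if "2 < norm x" for x
   proof -
    have "norm (x + z) \<ge> 1" "norm (x - z) \<ge> 1" "norm x \<ge> 1"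
     using that z norm_triangle_ineq4[of "x + z" z] norm_triangle_ineq[of "x - z" z] by auto
    then show ?thesis by (simp add: sdiff_def bump_outside)
   qed
  qed (use sdiff_sdiff_bump_bound in auto)
  also have "\<dots> \<le> (C * 20160 + 1) * (norm z)\<^sup>2 * decay s x"
   using decay_pos[of s x] by (simp add: algebra_simps)
  finally show ?thesis .
 qed
 then show thesis using C(1) that[of "C * 20160 + 1"] by simp
qed

subsection \<open>A mollifier\<close>

text \<open>Formally \<open>moll s t\<close> is the fractional Laplacian of
 the superposition over \<open>r > t\<close> of the dilated bumps \<open>r powr (2 * s - 1 - n) * bump (x / r)\<close>;
 it is the dilation of \<open>moll s 1\<close> by \<open>t\<close>, hence an approximate identity up to a
 constant factor. This replaces the fundamental solution.\<close>

definition moll :: "real \<Rightarrow> real \<Rightarrow> real^'n \<Rightarrow> real" where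
 "moll s t x = (LBINT r. indicator {t<..} r * (r powr (- real CARD('n) - 1) * lapb s (x /\<^sub>R r)))"

lemma moll_measurable [measurable (raw)]:
 assumes [measurable]: "g \<in> borel_measurable M"
 shows "(\<lambda>x. moll s t (g x :: real^'n)) \<in> borel_measurable M"
proof -
 have "moll s t \<in> borel_measurable borel" unfolding moll_def[abs_def] by measurable
 from measurable_compose[OF assms this] show ?thesis .
qed

lemma card_pos: "0 < real CARD('n::finite)" by simp

lemma moll_integrable:
 fixes x :: "real^'n"
 assumes s: "0 < s" "s < 1" and t: "0 < t"
 shows "L1 (\<lambda>r. indicator {t<..} r * (r powr (- real CARD('n) - 1) * lapb s (x /\<^sub>R r)))"
proof -
 obtain C where C: "0 < C" "\<And>x :: real^'n. \<bar>lapb s x\<bar> \<le> C * decay s x" using lapb_decay[OF s] by blast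
 have i: "L1 (\<lambda>r. indicator {t<..} r * r powr (- real CARD('n) - 1))"
  using powr_integral_at_top[OF card_pos[where 'n='n] t] by (simp add: has_bochner_integral_iff)
 show ?thesis
 proof (rule bochner_bound[OF integrable_mult_right[OF i, of C]])
  have "\<bar>lapb s y\<bar> \<le> C" for y :: "real^'n"
   by (rule lapb_le[OF s(1) C])
  then show "AE r in lborel. norm (indicator {t<..} r * (r powr (- real CARD('n) - 1) * lapb s (x /\<^sub>R r)))
    \<le> norm (C * (indicator {t<..} r * r powr (- real CARD('n) - 1)))"
   using C(1) by (intro AE_I2) (auto simp: indicator_def abs_mult mult_ac intro!: mult_right_mono)
 qed measurable
qed

lemma moll_scale:
 fixes x :: "real^'n"
 assumes t: "0 < t"
 shows "moll s t x = t powr (- real CARD('n)) * moll s 1 (x /\<^sub>R t)"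
proof -
 have "moll s t x = t * (LBINT r. indicator {t<..} (t * r) * ((t * r) powr (- real CARD('n) - 1) * lapb s (x /\<^sub>R (t * r))))"
  unfolding moll_def
  using integral_lborel_affine[of t "\<lambda>r. indicator {t<..} r * (r powr (- real CARD('n) - 1) * lapb s (x /\<^sub>R r))" 0] t
  by simp
 also have "(\<lambda>r. indicator {t<..} (t * r) * ((t * r) powr (- real CARD('n) - 1) * lapb s (x /\<^sub>R (t * r))))
   = (\<lambda>r. t powr (- real CARD('n) - 1) * (indicator {1<..} r * (r powr (- real CARD('n) - 1) * lapb s ((x /\<^sub>R t) /\<^sub>R r))))"
  using t by (auto simp: fun_eq_iff indicator_def powr_mult mult.commute)
 also have "t * (LBINT r. t powr (- real CARD('n) - 1) * (indicator {1<..} r * (r powr (- real CARD('n) - 1) * lapb s ((x /\<^sub>R t) /\<^sub>R r))))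
   = (t powr 1 * t powr (- real CARD('n) - 1)) * moll s 1 (x /\<^sub>R t)"
  using t by (simp add: moll_def)
 also have "t powr 1 * t powr (- real CARD('n) - 1) = t powr (- real CARD('n))"
  by (simp only: powr_add[symmetric]) simp
 finally show ?thesis .
qed

lemma moll_diff:
 fixes x :: "real^'n"
 assumes s: "0 < s" "s < 1" and d: "0 < d" "d \<le> R"
 shows "(LBINT r. indicator {d<..R} r * (r powr (- real CARD('n) - 1) * lapb s (x /\<^sub>R r))) = moll s d x - moll s R x"
proof -
 have "(LBINT r. indicator {d<..R} r * (r powr (- real CARD('n) - 1) * lapb s (x /\<^sub>R r)))
   = (LBINT r. indicator {d<..} r * (r powr (- real CARD('n) - 1) * lapb s (x /\<^sub>R r))
     - indicator {R<..} r * (r powr (- real CARD('n) - 1) * lapb s (x /\<^sub>R r)))"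
  using d by (intro bochner_cong) (auto simp: indicator_def)
 then show ?thesis
  using d by (simp add: moll_def moll_integrable[OF s] bochner_diff)
qed

text \<open>The decay of \<open>lapb\<close> at x/r supplies a factor r^(n+2s), which beats the
  singular weight r^(-n-1) and leaves r^(2s-1), integrable at 0.\<close>

lemma lapb_dilation_bound:
 fixes x :: "real^'n"
 assumes s: "0 < s" and C: "0 < C" "\<And>x :: real^'n. \<bar>lapb s x\<bar> \<le> C * decay s x" and x: "1 \<le> norm x" and r: "0 < r"
 shows "r powr (- real CARD('n) - 1) * \<bar>lapb s (x /\<^sub>R r)\<bar> \<le> C * norm x powr - (real CARD('n) + 2 * s) * r powr (2 * s - 1)"
proof -
 let ?a = "real CARD('n) + 2 * s"
 have nx: "norm x > 0" using x by linarith
 have "decay s (x /\<^sub>R r) \<le> (norm x / r) powr - ?a"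
  unfolding decay_def using nx r s by (intro powr_mono2') (auto simp: field_simps)
 also have "\<dots> = norm x powr - ?a * r powr ?a"
  using nx r by (simp add: powr_divide powr_minus_divide del: minus_add_distrib)
 finally have "\<bar>lapb s (x /\<^sub>R r)\<bar> \<le> C * (norm x powr - ?a * r powr ?a)"
  using C(2)[of "x /\<^sub>R r"] C(1) by (meson mult_left_mono less_imp_le order_trans)
 then have "r powr (- real CARD('n) - 1) * \<bar>lapb s (x /\<^sub>R r)\<bar> \<le> r powr (- real CARD('n) - 1) * (C * (norm x powr - ?a * r powr ?a))"
  by (intro mult_left_mono) auto
 also have "\<dots> = C * norm x powr - ?a * (r powr (- real CARD('n) - 1) * r powr ?a)" by (simp add: mult_ac)
 also have "r powr (- real CARD('n) - 1) * r powr ?a = r powr (2 * s - 1)"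
  by (simp only: powr_add[symmetric]) (simp add: algebra_simps)
 finally show ?thesis .
qed

text \<open>A majorant in the dilation parameter for |x| \<ge> 1: the decay of \<open>lapb\<close>
  is used for small r, its boundedness for large r.\<close>

definition dil_weight :: "real \<Rightarrow> real \<Rightarrow> real \<Rightarrow> real" where
 "dil_weight n s r = indicator {0<..<2} r * r powr (2 * s - 1) + indicator {1<..} r * r powr (- n - 1)"

lemma dil_weight_measurable [measurable]: "dil_weight n s \<in> borel_measurable borel"
 unfolding dil_weight_def[abs_def] by measurable

lemma dil_weight_integrable: "0 < s \<Longrightarrow> 0 < n \<Longrightarrow> L1 (dil_weight n s)"
 unfolding dil_weight_def[abs_def]
 using powr_integral_at_0[of "2 * s" 2] powr_integral_at_top[of n 1]
 by (auto simp: has_bochner_integral_iff)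

lemma lapb_dilation_dominated:
 fixes x :: "real^'n"
 assumes s: "0 < s" and C: "0 < C" "\<And>x :: real^'n. \<bar>lapb s x\<bar> \<le> C * decay s x" and x: "1 \<le> norm x"
 shows "\<bar>indicator {0<..} r * (r powr (- real CARD('n) - 1) * lapb s (x /\<^sub>R r))\<bar> \<le> C * dil_weight (real CARD('n)) s r"
proof -
 consider "r \<le> 0" | "0 < r" "r \<le> 1" | "1 < r" by linarith
 then show ?thesis
 proof cases
  case 1 then show ?thesis using C by (simp add: dil_weight_def)
 next
  case 2
  have "norm x powr - (real CARD('n) + 2 * s) \<le> 1 powr - (real CARD('n) + 2 * s)"
   using x s by (intro powr_mono2') auto
  then have "C * norm x powr - (real CARD('n) + 2 * s) * r powr (2 * s - 1) \<le> C * 1 * r powr (2 * s - 1)"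
   using C(1) by (intro mult_right_mono mult_left_mono) auto
  then show ?thesis
   using 2 lapb_dilation_bound[OF s C x, of r] by (simp add: dil_weight_def abs_mult)
 next
  case 3
  have "\<bar>lapb s (x /\<^sub>R r)\<bar> \<le> C"
   by (rule lapb_le[OF s C])
  then have "r powr (- real CARD('n) - 1) * \<bar>lapb s (x /\<^sub>R r)\<bar> \<le> C * r powr (- real CARD('n) - 1)"
   by (subst mult.commute) (intro mult_right_mono; simp)
  moreover have "0 \<le> C * (indicator {0<..<2} r * r powr (2 * s - 1))" using C(1) by simp
  moreover have "C * dil_weight (real CARD('n)) s r
    = C * (indicator {0<..<2} r * r powr (2 * s - 1)) + C * r powr (- real CARD('n) - 1)"
   using 3 by (simp add: dil_weight_def distrib_left)
  moreover have "\<bar>indicator {0<..} r * (r powr (- real CARD('n) - 1) * lapb s (x /\<^sub>R r))\<bar>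
    = r powr (- real CARD('n) - 1) * \<bar>lapb s (x /\<^sub>R r)\<bar>"
   using 3 by (simp add: abs_mult)
  ultimately show ?thesis by linarith
 qed
qed

text \<open>The left-hand side is radial and homogeneous of degree \<open>-n\<close>; its integral over an annulus is
 a multiple of the integral of \<open>lapb s\<close>, which vanishes.\<close>

lemma lapb_dilation_integral_0:
 fixes x :: "real^'n"
 assumes s: "0 < s" "s < 1" and x: "x \<noteq> 0"
 shows "(LBINT r. indicator {0<..} r * (r powr (- real CARD('n) - 1) * lapb s (x /\<^sub>R r))) = 0"
proof -
 let ?n = "real CARD('n)"
 define G where "G x = (LBINT r. indicator {0<..} r * (r powr (- ?n - 1) * lapb s (x /\<^sub>R r)))" for x :: "real^'n"
 define i1 :: "real \<Rightarrow> real" where "i1 = indicator {1..2}"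
 have [measurable]: "i1 \<in> borel_measurable borel" unfolding i1_def by measurable
 define w :: "real \<Rightarrow> real" where "w r = r powr - 1" for r
 have [measurable]: "w \<in> borel_measurable borel" unfolding w_def by measurable
 have w0: "0 \<le> w r" for r by (simp add: w_def)
 obtain C where C: "0 < C" "\<And>x :: real^'n. \<bar>lapb s x\<bar> \<le> C * decay s x" using lapb_decay[OF s] by blast
 obtain e :: "real^'n" where e: "norm e = 1" using vector_choose_size[of 1] by auto
 have hom: "G x = norm x powr (- ?n) * G e" if "x \<noteq> 0" for x :: "real^'n"
 proof -
  let ?t = "norm x"
  have t: "?t > 0" using that by simp
  have "G x = ?t * (LBINT r. indicator {0<..} (?t * r) * ((?t * r) powr (- ?n - 1) * lapb s (x /\<^sub>R (?t * r))))"
   unfolding G_def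
   using integral_lborel_affine[of ?t "\<lambda>r. indicator {0<..} r * (r powr (- ?n - 1) * lapb s (x /\<^sub>R r))" 0] t
   by simp
  also have "(\<lambda>r. indicator {0<..} (?t * r) * ((?t * r) powr (- ?n - 1) * lapb s (x /\<^sub>R (?t * r))))
    = (\<lambda>r. ?t powr (- ?n - 1) * (indicator {0<..} r * (r powr (- ?n - 1) * lapb s (e /\<^sub>R r))))"
  proof
   fix r :: real
   have "lapb s (x /\<^sub>R (?t * r)) = lapb s (e /\<^sub>R r)" by (rule lapb_radial) (use e t in \<open>cases "r = 0"; simp add: abs_mult field_simps\<close>)
   then show "indicator {0<..} (?t * r) * ((?t * r) powr (- ?n - 1) * lapb s (x /\<^sub>R (?t * r)))
     = ?t powr (- ?n - 1) * (indicator {0<..} r * (r powr (- ?n - 1) * lapb s (e /\<^sub>R r)))"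
    using t by (auto simp: indicator_def powr_mult zero_less_mult_iff)
  qed
  also have "?t * (LBINT r. ?t powr (- ?n - 1) * (indicator {0<..} r * (r powr (- ?n - 1) * lapb s (e /\<^sub>R r))))
    = (?t powr 1 * ?t powr (- ?n - 1)) * G e"
   using t by (simp add: G_def)
  also have "?t powr 1 * ?t powr (- ?n - 1) = ?t powr (- ?n)" by (simp only: powr_add[symmetric]) simp
  finally show ?thesis .
 qed
 have iA: "L1 (\<lambda>x :: real^'n. i1 (norm x))"
 proof (rule bochner_bound)
  show "L1 (indicator (cball 0 2) :: real^'n \<Rightarrow> real)"
   using emeasure_lborel_cball_finite[of "0 :: real^'n" 2] by (simp add: integrable_real_indicator)
 qed (auto simp: i1_def indicator_def)
 have F1: "integrable lborel2
   (\<lambda>(x :: real^'n, r). i1 (norm x) * (indicator {0<..} r * (r powr (- ?n - 1) * lapb s (x /\<^sub>R r))))"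
 proof (rule integrable_pair_bound[OF _ iA integrable_mult_right[OF dil_weight_integrable[of s ?n], of C]])
  show "\<bar>case (x, r) of (x :: real^'n, r) \<Rightarrow> i1 (norm x) * (indicator {0<..} r * (r powr (- ?n - 1) * lapb s (x /\<^sub>R r)))\<bar>
    \<le> i1 (norm x) * (C * dil_weight ?n s r)" for x r
   using lapb_dilation_dominated[OF s(1) C, of x r] unfolding prod.case abs_mult[of "i1 _"]
   by (cases "1 \<le> norm x \<and> norm x \<le> 2") (auto simp: i1_def)
 qed (use s in measurable)
 let ?c = "LBINT t. w t * i1 t"
 have ic: "L1 (\<lambda>t. w t * i1 t)"
  by (rule bochner_bound[of _ "i1"]) (auto simp: i1_def indicator_def w_def powr_minus field_simps)
 \<comment> \<open>The measure dr/r is invariant under dilations, so integrating the annulus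
   condition on r|z| against it gives the same constant for every z other than 0. This constant
   factors out of the integral of \<open>lapb\<close>.\<close>
 have inner: "L1 (\<lambda>r. w r * i1 (r * t)) \<and> (LBINT r. w r * i1 (r * t)) = ?c" if "t > 0" for t
 proof -
  have eq: "(\<lambda>r. w (r / t) * i1 r) = (\<lambda>r. t * (w r * i1 r))"
   using that by (auto simp: fun_eq_iff i1_def indicator_def w_def powr_divide powr_minus divide_inverse)
  have e: "0 + inverse t *\<^sub>R r = r / t" "r / t * t = r" for r
   using that by (simp_all add: divide_inverse)
  have i: "L1 (\<lambda>r. w (0 + inverse t *\<^sub>R r) * i1 ((0 + inverse t *\<^sub>R r) * t))"
   unfolding e eq by (intro integrable_mult_right ic)
  have "(LBINT r. w r * i1 (r * t))
    = inverse t * (LBINT r. w (0 + inverse t *\<^sub>R r) * i1 ((0 + inverse t *\<^sub>R r) * t))"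
   using integral_lborel_affine[of "inverse t" "\<lambda>r. w r * i1 (r * t)" 0] that by simp
  also have "\<dots> = inverse t * (t * ?c)"
   unfolding e eq by (simp only: integral_mult_right_zero)
  also have "\<dots> = ?c" using that by simp
  finally have "(LBINT r. w r * i1 (r * t)) = ?c" .
  moreover have "inverse t \<noteq> 0" using that by simp
  note iffD1[OF integrable_lborel_affine_iff[OF this, of "\<lambda>r. w r * i1 (r * t)" 0] i]
  ultimately show ?thesis by simp
 qed
 have F2: "integrable lborel2 (\<lambda>(z :: real^'n, r). lapb s z * (w r * i1 (r * norm z)))"
 proof (rule lborel_pair.Fubini_integrable)
  have nn: "norm (lapb s z * (w r * i1 (r * norm z))) = \<bar>lapb s z\<bar> * (w r * i1 (r * norm z))" for z :: "real^'n" and r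
   by (simp add: abs_mult i1_def abs_of_nonneg[OF w0])
  have "AE z :: real^'n in lborel. \<bar>lapb s z\<bar> * ?c = (LBINT r. norm (lapb s z * (w r * i1 (r * norm z))))"
   using AE_lborel_singleton[of "0 :: real^'n"]
  proof eventually_elim
   case (elim z)
   then show ?case unfolding nn using inner[of "norm z"] by simp
  qed
  then show "L1 (\<lambda>z :: real^'n. LBINT r. norm (case (z, r) of (z, r) \<Rightarrow> lapb s z * (w r * i1 (r * norm z))))"
   using integrable_mult_left[OF integrable_abs[OF lapb_integrable[OF s, where 'n='n]], of ?c]
   by (subst integrable_cong_AE[symmetric]) auto
  show "AE z :: real^'n in lborel. L1 (\<lambda>r. case (z, r) of (z, r) \<Rightarrow> lapb s z * (w r * i1 (r * norm z)))"
   using AE_lborel_singleton[of "0 :: real^'n"]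
  proof eventually_elim
   case (elim z)
   then show ?case using inner[of "norm z"] by simp
  qed
 qed measurable
 have "(LBINT x. i1 (norm x) * G x) = (LBINT x. LBINT r. i1 (norm (x :: real^'n)) * (indicator {0<..} r * (r powr (- ?n - 1) * lapb s (x /\<^sub>R r))))"
  by (simp add: G_def)
 also have "\<dots> = (LBINT r. LBINT x. i1 (norm (x :: real^'n)) * (indicator {0<..} r * (r powr (- ?n - 1) * lapb s (x /\<^sub>R r))))"
  using lborel_pair.Fubini_integral[OF F1] by simp
 also have "\<dots> = (LBINT r. LBINT z. lapb s (z :: real^'n) * (w r * i1 (r * norm z)))"
 proof (rule bochner_cong[OF refl])
  fix r :: real
  show "(LBINT x. i1 (norm (x :: real^'n)) * (indicator {0<..} r * (r powr (- ?n - 1) * lapb s (x /\<^sub>R r))))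
    = (LBINT z. lapb s (z :: real^'n) * (w r * i1 (r * norm z)))"
  proof (cases "r > 0")
   case True
   have "(LBINT x. i1 (norm (x :: real^'n)) * (indicator {0<..} r * (r powr (- ?n - 1) * lapb s (x /\<^sub>R r))))
     = r ^ CARD('n) * (LBINT x. i1 (norm (0 + r *\<^sub>R x :: real^'n)) * (indicator {0<..} r * (r powr (- ?n - 1) * lapb s ((0 + r *\<^sub>R x) /\<^sub>R r))))"
    using integral_lborel_affine[of r "\<lambda>x :: real^'n. i1 (norm x) * (indicator {0<..} r * (r powr (- ?n - 1) * lapb s (x /\<^sub>R r)))" 0] True
    by simp
   also have "(\<lambda>x :: real^'n. i1 (norm (0 + r *\<^sub>R x)) * (indicator {0<..} r * (r powr (- ?n - 1) * lapb s ((0 + r *\<^sub>R x) /\<^sub>R r))))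
     = (\<lambda>x. r powr (- ?n - 1) * (i1 (r * norm x) * lapb s x))"
    using True by (auto simp: fun_eq_iff)
   also have "r ^ CARD('n) * (LBINT x. r powr (- ?n - 1) * (i1 (r * norm (x :: real^'n)) * lapb s x))
     = (r powr ?n * r powr (- ?n - 1)) * (LBINT x. i1 (r * norm (x :: real^'n)) * lapb s x)"
    using True by (simp add: powr_realpow)
   also have "r powr ?n * r powr (- ?n - 1) = w r" unfolding w_def by (simp only: powr_add[symmetric]) simp
   finally show ?thesis by (simp add: mult_ac)
  next
   case False
   have "r * norm z \<notin> {1..2}" for z :: "real^'n"
    using False mult_nonpos_nonneg[of r "norm z"] by auto
   then show ?thesis using False by (simp add: i1_def)
  qed
 qed
 also have "\<dots> = (LBINT z. LBINT r. lapb s (z :: real^'n) * (w r * i1 (r * norm z)))"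
  using lborel_pair.Fubini_integral[OF F2] by simp
 also have "\<dots> = (LBINT z. lapb s (z :: real^'n) * ?c)"
 proof (rule integral_cong_AE)
  show "AE z :: real^'n in lborel. (LBINT r. lapb s z * (w r * i1 (r * norm z))) = lapb s z * ?c"
   using AE_lborel_singleton[of "0 :: real^'n"]
  proof eventually_elim
   case (elim z)
   then show ?case using inner[of "norm z"] by simp
  qed
 qed measurable
 also have "\<dots> = 0" using lapb_integral_0[OF s, where 'n='n] by simp
 finally have zero: "(LBINT x. i1 (norm (x :: real^'n)) * G x) = 0" .
 have iAn: "L1 (\<lambda>x :: real^'n. i1 (norm x) * norm x powr (- ?n))"
 proof (rule bochner_bound[OF iA])
  have "norm x powr (- ?n) \<le> 1" if "1 \<le> norm x" for x :: "real^'n"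
   using powr_mono2'[of "- ?n" 1 "norm x"] that by simp
  then show "AE x :: real^'n in lborel. norm (i1 (norm x) * norm x powr (- ?n)) \<le> norm (i1 (norm x))"
   by (intro AE_I2) (auto simp: i1_def indicator_def)
 qed measurable
 have "(LBINT x. i1 (norm (x :: real^'n)) * G x) = (LBINT x. i1 (norm (x :: real^'n)) * norm x powr (- ?n)) * G e"
 proof -
  have "i1 (norm x) * G x = (i1 (norm x) * norm x powr (- ?n)) * G e" for x :: "real^'n"
   using hom[of x] by (cases "x = 0") (auto simp: i1_def)
  then show ?thesis by (simp only: integral_mult_left_zero)
 qed
 moreover have "(LBINT x. i1 (norm (x :: real^'n)) * norm x powr (- ?n)) > 0"
 proof -
  \<comment> \<open>A ball inside the annulus 1 \<le> |x| \<le> 2, on which the homogeneous factor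
    is at least 2^(-n).\<close>
  let ?B = "ball ((3 / 2) *\<^sub>R e) (1 / 2)"
  have iB: "L1 (indicator ?B :: real^'n \<Rightarrow> real)"
   using emeasure_lborel_ball_finite[of "(3 / 2) *\<^sub>R e" "1 / 2"] by (simp add: integrable_real_indicator)
  have "0 < 2 powr (- ?n) * measure lborel ?B"
   by (simp add: content_ball_pos)
  also have "\<dots> = (LBINT x. 2 powr (- ?n) * indicator ?B x)" by simp
  also have "\<dots> \<le> (LBINT x. i1 (norm (x :: real^'n)) * norm x powr (- ?n))"
  proof (rule bochner_mono)
   show "2 powr (- ?n) * indicator ?B x \<le> i1 (norm x) * norm x powr (- ?n)" for x :: "real^'n"
   proof (cases "x \<in> ?B")
    case True
    have "norm ((3 / 2) *\<^sub>R e) = 3 / 2" using e by simp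
    then have b: "1 \<le> norm x" "norm x \<le> 2"
     using True norm_triangle_ineq2[of "(3 / 2) *\<^sub>R e" x] norm_triangle_ineq2[of x "(3 / 2) *\<^sub>R e"]
     by (simp_all add: dist_norm norm_minus_commute)
    then have "2 powr (- ?n) \<le> norm x powr (- ?n)" by (intro powr_mono2') auto
    then show ?thesis using True b by (simp add: i1_def)
   qed (simp add: i1_def)
  qed (intro integrable_mult_right iB iAn)+
  finally show ?thesis .
 qed
 ultimately have "G e = 0" using zero by simp
 then show ?thesis using hom[OF x] by (simp add: G_def)
qed

text \<open>The integral over all r > 0 vanishes away from the origin, so for |x| \<ge> 1 the
  integral over r > 1 is minus the one over r \<le> 1, where \<open>lapb_dilation_bound\<close>
  gives the full decay. Estimating the range r > 1 in absolute value would only give |x|^(-n), which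
  is not integrable.\<close>

lemma moll_decay:
 assumes s: "0 < s" "s < 1"
 obtains C where "0 < C" "\<And>x :: real^'n. \<bar>moll s 1 x\<bar> \<le> C * decay s x"
proof -
 let ?n = "real CARD('n)" and ?a = "real CARD('n) + 2 * s"
 obtain C where C: "0 < C" "\<And>x :: real^'n. \<bar>lapb s x\<bar> \<le> C * decay s x" using lapb_decay[OF s] by blast
 have "\<bar>moll s 1 x\<bar> \<le> 2 powr ?a * (C / (2 * s) + C / ?n) * decay s x" for x :: "real^'n"
 proof (cases "1 \<le> norm x")
  case False
  note pt = powr_integral_at_top[OF card_pos[where 'n='n] zero_less_one]
  have "\<bar>moll s 1 x\<bar> \<le> (LBINT r. \<bar>indicator {1<..} r * (r powr (- ?n - 1) * lapb s (x /\<^sub>R r))\<bar>)"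
   unfolding moll_def by (rule integral_abs_bound)
  also have "\<dots> \<le> (LBINT r. C * (indicator {1<..} r * r powr (- ?n - 1)))"
  proof (rule bochner_mono)
   show "\<bar>indicator {1<..} r * (r powr (- ?n - 1) * lapb s (x /\<^sub>R r))\<bar> \<le> C * (indicator {1<..} r * r powr (- ?n - 1))" for r
   proof -
    have "\<bar>lapb s (x /\<^sub>R r)\<bar> \<le> C"
     by (rule lapb_le[OF s(1) C])
    then show ?thesis by (auto simp: indicator_def abs_mult mult.commute[of C] intro!: mult_left_mono)
   qed
  qed (use pt in \<open>auto simp: has_bochner_integral_iff intro!: moll_integrable[OF s]\<close>)
  also have "\<dots> = C / ?n" using pt by (simp add: has_bochner_integral_iff)
  finally have le: "\<bar>moll s 1 x\<bar> \<le> C / ?n" .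
  have "(1 + norm x) powr ?a \<le> 2 powr ?a" using False s by (intro powr_mono2) auto
  moreover have "1 + norm x > 0" using norm_ge_zero[of x] by linarith
  ultimately have "1 \<le> 2 powr ?a * decay s x" unfolding decay_eq by (simp add: field_simps)
  then have "C / ?n * 1 \<le> (C / (2 * s) + C / ?n) * (2 powr ?a * decay s x)"
   using C(1) s by (intro mult_mono) auto
  with le show ?thesis by (simp add: mult_ac)
 next
  case True
  have x: "x \<noteq> 0" using True by auto
  note p0 = powr_integral_at_0[of "2 * s" 2]
  let ?f = "\<lambda>r. r powr (- ?n - 1) * lapb s (x /\<^sub>R r)"
  have i0: "L1 (\<lambda>r. indicator {0<..} r * ?f r)"
   by (rule bochner_bound[OF integrable_mult_right[OF dil_weight_integrable[of s ?n], of C]])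
     (use lapb_dilation_dominated[OF s(1) C True] s in \<open>auto intro: order_trans[OF _ abs_ge_self]\<close>)
  have i1: "L1 (\<lambda>r. indicator {1<..} r * ?f r)" by (rule moll_integrable[OF s]) simp
  let ?X = "norm x powr - ?a"
  have bd: "\<bar>indicator {0<..} r * ?f r - indicator {1<..} r * ?f r\<bar> \<le> C * ?X * (indicator {0<..<1} r * r powr (2 * s - 1))" if "r \<noteq> 1" for r
   using lapb_dilation_bound[OF s(1) C True, of r] that by (auto simp: indicator_def abs_mult)
  note p1 = powr_integral_at_0[of "2 * s" 1]
  have "moll s 1 x = - (LBINT r. indicator {0<..} r * ?f r - indicator {1<..} r * ?f r)"
   using lapb_dilation_integral_0[OF s x] i0 i1 by (simp add: moll_def bochner_diff)
  then have "\<bar>moll s 1 x\<bar> = \<bar>LBINT r. indicator {0<..} r * ?f r - indicator {1<..} r * ?f r\<bar>" by simp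
  also have "\<dots> \<le> (LBINT r. \<bar>indicator {0<..} r * ?f r - indicator {1<..} r * ?f r\<bar>)"
   by (rule integral_abs_bound)
  also have "\<dots> \<le> (LBINT r. C * ?X * (indicator {0<..<1} r * r powr (2 * s - 1)))"
  proof (rule integral_mono_AE)
   show "AE r in lborel. \<bar>indicator {0<..} r * ?f r - indicator {1<..} r * ?f r\<bar> \<le> C * ?X * (indicator {0<..<1} r * r powr (2 * s - 1))"
    using AE_lborel_singleton[of "1 :: real"] by eventually_elim (rule bd)
  qed (use p1 s i0 i1 in \<open>auto simp: has_bochner_integral_iff\<close>)
  also have "\<dots> = C * ?X * (1 / (2 * s))" using p1 s by (simp add: has_bochner_integral_iff)
  finally have le: "\<bar>moll s 1 x\<bar> \<le> C / (2 * s) * ?X" by simp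
  have "?X \<le> 2 powr ?a * decay s x"
  proof -
   have pos: "norm x > 0" "1 + norm x > 0" and l: "1 + norm x \<le> 2 * norm x" using True by linarith+
   have "(1 + norm x) powr ?a \<le> (2 * norm x) powr ?a" using l pos s by (intro powr_mono2) auto
   also have "\<dots> = 2 powr ?a * norm x powr ?a" by (rule powr_mult)
   finally have "(1 + norm x) powr ?a \<le> 2 powr ?a * norm x powr ?a" .
   moreover have "norm x powr ?a > 0" "(1 + norm x) powr ?a > 0" using pos by auto
   ultimately show ?thesis unfolding powr_minus_divide decay_eq by (simp add: field_simps)
  qed
  then have "C / (2 * s) * ?X \<le> (C / (2 * s) + C / ?n) * (2 powr ?a * decay s x)"
   using C(1) s by (intro mult_mono) auto
  with le show ?thesis by (simp add: mult_ac)
 qed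
 moreover have "0 < 2 powr ?a * (C / (2 * s) + C / ?n)"
  using C(1) s by (intro mult_pos_pos add_pos_pos) auto
 ultimately show thesis using that by blast
qed

text \<open>Undoing the dilation costs r^(n+2s) in the decay, and the step z/r gains r^(-2).
  Together with r^(-n-1) this is r^(2s-3), integrable at infinity because s < 1.\<close>

lemma moll_sdiff_bound:
 assumes s: "0 < s" "s < 1"
 obtains C where "0 < C" "\<And>z x :: real^'n. norm z \<le> 1 \<Longrightarrow> \<bar>sdiff (moll s 1) z x\<bar> \<le> C * (norm z)\<^sup>2 * decay s x"
proof -
 let ?n = "real CARD('n)" and ?a = "real CARD('n) + 2 * s"
 obtain C where C: "0 < C" "\<And>z x :: real^'n. norm z \<le> 1 \<Longrightarrow> \<bar>sdiff (lapb s) z x\<bar> \<le> C * (norm z)\<^sup>2 * decay s x"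
  using sdiff_lapb_bound[OF s] by blast
 note pt = powr_integral_at_top[of "2 - 2 * s" 1]
 have "\<bar>sdiff (moll s 1) z x\<bar> \<le> (C / (2 - 2 * s)) * (norm z)\<^sup>2 * decay s x" if z: "norm z \<le> 1" for z x :: "real^'n"
 proof -
  let ?f = "\<lambda>x r. indicator {1<..} r * (r powr (- ?n - 1) * lapb s (x /\<^sub>R r))"
  have i: "L1 (?f x)" for x :: "real^'n" by (rule moll_integrable[OF s]) simp
  have i': "L1 (\<lambda>r. (?f (x + z) r + ?f (x - z) r) - 2 * ?f x r)"
   by (intro bochner_integrable_diff bochner_integrable_add integrable_mult_right i)
  have "sdiff (moll s 1) z x = (LBINT r. (?f (x + z) r + ?f (x - z) r) - 2 * ?f x r)"
   unfolding sdiff_def moll_def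
   using i[of "x + z"] i[of "x - z"] i[of x] by (simp add: bochner_diff bochner_add)
  then have "\<bar>sdiff (moll s 1) z x\<bar> \<le> (LBINT r. \<bar>(?f (x + z) r + ?f (x - z) r) - 2 * ?f x r\<bar>)"
   by (simp only: integral_abs_bound)
  also have "\<dots> \<le> (LBINT r. C * (norm z)\<^sup>2 * decay s x * (indicator {1<..} r * r powr (- (2 - 2 * s) - 1)))"
  proof (rule bochner_mono)
   show "\<bar>(?f (x + z) r + ?f (x - z) r) - 2 * ?f x r\<bar> \<le> C * (norm z)\<^sup>2 * decay s x * (indicator {1<..} r * r powr (- (2 - 2 * s) - 1))" for r
   proof (cases "1 < r")
    case True
    have "(?f (x + z) r + ?f (x - z) r) - 2 * ?f x r = r powr (- ?n - 1) * sdiff (lapb s) (z /\<^sub>R r) (x /\<^sub>R r)"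
     using True by (simp add: sdiff_def algebra_simps)
    then have "\<bar>(?f (x + z) r + ?f (x - z) r) - 2 * ?f x r\<bar> = r powr (- ?n - 1) * \<bar>sdiff (lapb s) (z /\<^sub>R r) (x /\<^sub>R r)\<bar>"
     by (simp add: abs_mult)
    also have "\<dots> \<le> r powr (- ?n - 1) * (C * (norm (z /\<^sub>R r))\<^sup>2 * decay s (x /\<^sub>R r))"
    proof (intro mult_left_mono C(2))
     have "norm (z /\<^sub>R r) \<le> norm z" using True by (simp add: mult_left_le_one_le inverse_le_1_iff)
     then show "norm (z /\<^sub>R r) \<le> 1" using z by linarith
    qed simp
    also have "\<dots> \<le> r powr (- ?n - 1) * (C * (norm (z /\<^sub>R r))\<^sup>2 * (r powr ?a * decay s x))"
     using True s C(1) by (intro mult_left_mono decay_scale) auto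
    also have "\<dots> = C * (norm z)\<^sup>2 * decay s x * (r powr (- ?n - 1) * r powr - 2 * r powr ?a)"
     using True by (simp add: power_mult_distrib powr_minus power_inverse mult_ac)
    also have "r powr (- ?n - 1) * r powr - 2 * r powr ?a = r powr (- (2 - 2 * s) - 1)"
     by (simp only: powr_add[symmetric]) (simp add: algebra_simps)
    finally show ?thesis using True by simp
   qed simp
  qed (use pt s i' in \<open>auto simp: has_bochner_integral_iff\<close>)
  also have "\<dots> = (C / (2 - 2 * s)) * (norm z)\<^sup>2 * decay s x"
   using pt s by (simp add: has_bochner_integral_iff)
  finally show ?thesis .
 qed
 then show thesis using C(1) s that[of "C / (2 - 2 * s)"] by simp
qed

lemma moll_continuous:
 assumes s: "0 < s" "s < 1" and t: "0 < t"
 shows "continuous_on UNIV (moll s t :: real^'n \<Rightarrow> real)"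
proof -
 let ?n = "real CARD('n)"
 obtain C where C: "0 < C" "\<And>x :: real^'n. \<bar>lapb s x\<bar> \<le> C * decay s x" using lapb_decay[OF s] by blast
 have bd: "\<bar>lapb s y\<bar> \<le> C" for y :: "real^'n"
  by (rule lapb_le[OF s(1) C])
 have "moll s t \<midarrow>x\<rightarrow> moll s t x" for x :: "real^'n"
 proof (unfold tendsto_at_iff_sequentially, intro allI impI)
  fix X :: "nat \<Rightarrow> real^'n" assume X: "X \<longlonglongrightarrow> x"
  show "(moll s t \<circ> X) \<longlonglongrightarrow> moll s t x"
   unfolding moll_def comp_def
  proof (rule integral_dominated_convergence)
   show "L1 (\<lambda>r. C * (indicator {t<..} r * r powr (- ?n - 1)))"
    using powr_integral_at_top[OF card_pos[where 'n='n] t] by (simp add: has_bochner_integral_iff)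
   show "AE r in lborel. norm (indicator {t<..} r * (r powr (- ?n - 1) * lapb s (X k /\<^sub>R r)))
     \<le> C * (indicator {t<..} r * r powr (- ?n - 1))" for k
    using bd by (intro AE_I2) (auto simp: indicator_def abs_mult mult.commute[of C] intro!: mult_left_mono)
   show "AE r in lborel. (\<lambda>k. indicator {t<..} r * (r powr (- ?n - 1) * lapb s (X k /\<^sub>R r)))
     \<longlonglongrightarrow> indicator {t<..} r * (r powr (- ?n - 1) * lapb s (x /\<^sub>R r))"
   proof (intro AE_I2 tendsto_mult tendsto_const)
    fix r :: real
    have "(\<lambda>k. X k /\<^sub>R r) \<longlonglongrightarrow> x /\<^sub>R r" by (intro tendsto_intros X)
    then show "(\<lambda>k. lapb s (X k /\<^sub>R r)) \<longlonglongrightarrow> lapb s (x /\<^sub>R r)"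
     by (intro continuous_on_tendsto_compose[OF lapb_continuous[OF s]]) auto
   qed
  qed measurable
 qed
 then show ?thesis by (simp add: continuous_on_def)
qed

subsection \<open>Integration by parts\<close>

lemma abs_kern: "\<bar>kern s e z\<bar> = kern s e z"
 by (simp add: kern_nonneg)

text \<open>From |ab| \<le> a^2 + b^2. With the kernel on pairs as weight, finite energies give an
  integrable energy pairing.\<close>

lemma integrable_mult_weight:
 fixes a b k :: "'a \<Rightarrow> real"
 assumes [measurable]: "a \<in> borel_measurable M" "b \<in> borel_measurable M" "k \<in> borel_measurable M"
  and k: "\<And>x. 0 \<le> k x"
  and i: "integrable M (\<lambda>x. (a x)\<^sup>2 * k x)" "integrable M (\<lambda>x. (b x)\<^sup>2 * k x)"
 shows "integrable M (\<lambda>x. a x * b x * k x)"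
proof (rule bochner_bound[OF bochner_integrable_add[OF i]])
 have "\<bar>a x * b x * k x\<bar> \<le> (a x)\<^sup>2 * k x + (b x)\<^sup>2 * k x" for x
 proof -
  have "2 * (\<bar>a x\<bar> * \<bar>b x\<bar>) \<le> \<bar>a x\<bar>\<^sup>2 + \<bar>b x\<bar>\<^sup>2" using sum_squares_bound[of "\<bar>a x\<bar>" "\<bar>b x\<bar>"] by simp
  then have "\<bar>a x\<bar> * \<bar>b x\<bar> \<le> (a x)\<^sup>2 + (b x)\<^sup>2"
   using mult_nonneg_nonneg[OF abs_ge_zero[of "a x"] abs_ge_zero[of "b x"]] unfolding power2_abs by linarith
  then have "\<bar>a x\<bar> * \<bar>b x\<bar> * k x \<le> ((a x)\<^sup>2 + (b x)\<^sup>2) * k x" by (intro mult_right_mono k)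
  then show ?thesis by (simp add: abs_mult abs_of_nonneg[OF k] distrib_right)
 qed
 then show "AE x in M. norm (a x * b x * k x) \<le> norm ((a x)\<^sup>2 * k x + (b x)\<^sup>2 * k x)"
  by (intro AE_I2) (auto intro: order_trans[OF _ abs_ge_self])
qed measurable

lemma L2_mult_integrable:
 fixes a b :: "'a \<Rightarrow> real"
 assumes "a \<in> borel_measurable M" "b \<in> borel_measurable M"
  and "integrable M (\<lambda>x. (a x)\<^sup>2)" "integrable M (\<lambda>x. (b x)\<^sup>2)"
 shows "integrable M (\<lambda>x. a x * b x)"
 using integrable_mult_weight[of a M b "\<lambda>_. 1"] assms by simp

lemma integrable_dilation_iff:
 fixes f :: "real^'n \<Rightarrow> real"
 assumes t: "0 < t"
 shows "L1 (\<lambda>y. f ((y - c) /\<^sub>R t)) \<longleftrightarrow> L1 f"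
  and "L1 (\<lambda>y. f ((c - y) /\<^sub>R t)) \<longleftrightarrow> L1 f"
proof -
 have "(\<lambda>y. f ((y - c) /\<^sub>R t)) = (\<lambda>y. f (- (c /\<^sub>R t) + inverse t *\<^sub>R y))"
  "(\<lambda>y. f ((c - y) /\<^sub>R t)) = (\<lambda>y. f (c /\<^sub>R t + (- inverse t) *\<^sub>R y))"
  by (auto simp: algebra_simps)
 then show "L1 (\<lambda>y. f ((y - c) /\<^sub>R t)) \<longleftrightarrow> L1 f"
  "L1 (\<lambda>y. f ((c - y) /\<^sub>R t)) \<longleftrightarrow> L1 f"
  using integrable_lborel_affine_iff[of "inverse t" f "- (c /\<^sub>R t)"]
   integrable_lborel_affine_iff[of "- inverse t" f "c /\<^sub>R t"] t by (simp_all only:) auto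
qed

lemma integral_dilation:
 fixes f :: "real^'n \<Rightarrow> real"
 assumes t: "0 < t"
 shows "(LBINT y. f ((y - c) /\<^sub>R t)) = t ^ CARD('n) * (LBINT y. f y)"
  and "(LBINT y. f ((c - y) /\<^sub>R t)) = t ^ CARD('n) * (LBINT y. f y)"
 using integral_lborel_affine[of t "\<lambda>y. f ((y - c) /\<^sub>R t)" c]
  integral_lborel_affine[of "- t" "\<lambda>y. f ((c - y) /\<^sub>R t)" c] t
 by simp_all

lemma L2_decay_integrable:
 fixes u F :: "real^'n \<Rightarrow> real"
 assumes s: "0 < s" and t: "0 < t"
  and [measurable]: "u \<in> borel_measurable borel" and u: "L2 u"
  and [measurable]: "F \<in> borel_measurable borel" and F: "\<And>y. \<bar>F y\<bar> \<le> C * decay s y"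
 shows "L1 (\<lambda>y. u y * F ((x - y) /\<^sub>R t))"
proof (rule L2_mult_integrable)
 have "L2 F"
 proof (rule bochner_bound[OF integrable_mult_right[OF decay_sq_integrable[OF s], of "C\<^sup>2"]])
  show "AE y in lborel. norm ((F y)\<^sup>2) \<le> norm (C\<^sup>2 * (decay s (y::real^'n))\<^sup>2)"
  proof (rule AE_I2)
   fix y :: "real^'n"
   have "\<bar>F y\<bar>\<^sup>2 \<le> (C * decay s y)\<^sup>2" using F by (intro power_mono) auto
   then show "norm ((F y)\<^sup>2) \<le> norm (C\<^sup>2 * (decay s y)\<^sup>2)" by (simp add: power_mult_distrib)
  qed
 qed measurable
 then show "L1 (\<lambda>y. (F ((x - y) /\<^sub>R t))\<^sup>2)"
  by (subst integrable_dilation_iff(2)[OF t, of "\<lambda>y. (F y)\<^sup>2"])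
qed (use u in auto)

lemma integrable_convolution_pair:
 fixes f k :: "'a::euclidean_space \<Rightarrow> real"
 assumes f: "L1 f" and k: "L1 k"
 shows "integrable lborel2 (\<lambda>(x, y). f x * k (x - y))"
  and "integrable lborel2 (\<lambda>(x, y). f y * k (x - y))"
proof -
 have [measurable]: "f \<in> borel_measurable borel" "k \<in> borel_measurable borel" using f k by auto
 have k': "L1 (\<lambda>y. k (x - y))" "(LBINT y. \<bar>k (x - y)\<bar>) = (LBINT y. \<bar>k y\<bar>)"
  "L1 (\<lambda>y. k (y - x))" "(LBINT y. \<bar>k (y - x)\<bar>) = (LBINT y. \<bar>k y\<bar>)" for x
  using k integral_lborel_reflect[of "\<lambda>y. \<bar>k y\<bar>" x] integral_lborel_translate[of "\<lambda>y. \<bar>k y\<bar>" "- x"]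
   integrable_lborel_reflect[of k x] integrable_lborel_translate[of k "- x"] by auto
 show "integrable lborel2 (\<lambda>(x, y). f x * k (x - y))"
 proof (rule lborel_pair.Fubini_integrable)
  show "L1 (\<lambda>x. LBINT y. norm (case (x, y) of (x, y) \<Rightarrow> f x * k (x - y)))"
   using f by (simp add: abs_mult k')
 qed (auto simp: k')
 have "integrable lborel2 (\<lambda>(y, x). f y * k (x - y))"
 proof (rule lborel_pair.Fubini_integrable)
  show "L1 (\<lambda>y. LBINT x. norm (case (y, x) of (y, x) \<Rightarrow> f y * k (x - y)))"
   using f by (simp add: abs_mult k')
 qed (auto simp: k')
 from lborel_pair.integrable_product_swap[OF this]
 show "integrable lborel2 (\<lambda>(x, y). f y * k (x - y))" by (simp add: case_prod_unfold)
qed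

lemma tlap_eq:
 fixes f :: "real^'n \<Rightarrow> real"
 assumes s: "0 < s" and e: "0 < e" and i: "L1 (\<lambda>z. f (x + z) * kern s e z)"
 shows "tlap s e f x = (LBINT z. (f x - f (x + z)) * kern s e z)"
proof -
 have i': "L1 (\<lambda>z. f (x - z) * kern s e z)"
  using integrable_lborel_reflect[of "\<lambda>z. f (x + z) * kern s e z" 0] i by (simp add: kern_minus)
 have eq: "(LBINT z. f (x - z) * kern s e z) = (LBINT z. f (x + z) * kern s e z)"
  using integral_lborel_reflect[of "\<lambda>z. f (x + z) * kern s e z" 0] by (simp add: kern_minus)
 have ik: "L1 (\<lambda>z::real^'n. f x * kern s e z)" by (intro integrable_mult_right kern_integrable s e)
 have "(LBINT z. sdiff f z x * kern s e z)
   = (LBINT z. (f (x + z) * kern s e z + f (x - z) * kern s e z) - 2 * (f x * kern s e z))"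
  by (simp add: sdiff_def algebra_simps)
 also have "\<dots> = ((LBINT z. f (x + z) * kern s e z) + (LBINT z. f (x - z) * kern s e z)) - 2 * (LBINT z::real^'n. f x * kern s e z)"
  using bochner_diff[OF bochner_integrable_add[OF i i'] integrable_mult_right[OF ik, of 2]]
   bochner_add[OF i i'] by simp
 finally have "tlap s e f x = (LBINT z::real^'n. f x * kern s e z) - (LBINT z. f (x + z) * kern s e z)"
  using eq unfolding tlap_def by linarith
 also have "\<dots> = (LBINT z. f x * kern s e z - f (x + z) * kern s e z)"
  using bochner_diff[OF ik i] by simp
 finally show ?thesis by (simp add: left_diff_distrib)
qed

lemma norm_dilate: "0 < t \<Longrightarrow> norm (v /\<^sub>R t) = norm v / t"
 by (simp add: divide_inverse mult.commute)

definition bumpd :: "real^'n \<Rightarrow> real \<Rightarrow> real^'n \<Rightarrow> real" where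
 "bumpd c t y = bump ((y - c) /\<^sub>R t)"

lemma bumpd_measurable [measurable]: "bumpd c t \<in> borel_measurable borel"
 unfolding bumpd_def[abs_def] by measurable

lemma bumpd_bounds: "0 \<le> bumpd c t y" "bumpd c t y \<le> 1"
 by (simp_all add: bumpd_def bump_nonneg bump_le_1)

lemma bumpd_outside: "0 < t \<Longrightarrow> y \<notin> cball c t \<Longrightarrow> bumpd c t y = 0"
 unfolding bumpd_def by (rule bump_outside, subst norm_dilate) (auto simp: dist_norm norm_minus_commute)

lemma bumpd_integrable: "0 < t \<Longrightarrow> L1 (bumpd c t :: real^'n \<Rightarrow> real)"
 unfolding bumpd_def[abs_def] by (simp add: integrable_dilation_iff bump_integrable)

lemma bumpd_sq_integrable: "0 < t \<Longrightarrow> L1 (\<lambda>y. (bumpd c t (y :: real^'n))\<^sup>2)"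
proof (rule bochner_bound[OF bumpd_integrable])
 show "AE y in lborel. norm ((bumpd c t y)\<^sup>2) \<le> norm (bumpd c t (y::real^'n))"
  using bumpd_bounds[of c t] by (intro AE_I2) (simp add: power2_eq_square mult_left_le abs_of_nonneg)
qed auto

lemma kern_tendsto:
 assumes "\<And>k. 0 \<le> e k" "e \<longlonglongrightarrow> 0"
 shows "(\<lambda>k. kern s (e k) z) \<longlonglongrightarrow> kern s 0 z"
proof (cases "z = 0")
 case False
 then have "\<forall>\<^sub>F k in sequentially. e k < norm z"
  using assms(2) by (intro order_tendstoD(2)) auto
 then have "\<forall>\<^sub>F k in sequentially. kern s 0 z = kern s (e k) z"
  by eventually_elim (simp add: kern_def)
 then show ?thesis by (rule Lim_transform_eventually[OF tendsto_const])
qed (simp add: kern_def cong: if_cong)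

lemma tlap_bumpd_weak_tendsto:
 fixes u :: "real^'n \<Rightarrow> real"
 assumes s: "0 < s" "s < 1" and t: "0 < t"
  and [measurable]: "u \<in> borel_measurable borel" and u: "L2 u"
  and e: "\<And>k. 0 \<le> e k" "e \<longlonglongrightarrow> 0"
 shows "(\<lambda>k. LBINT x. u x * tlap s (e k) (bumpd c t) x) \<longlonglongrightarrow> t powr (- 2 * s) * (LBINT x. u x * lapb s ((x - c) /\<^sub>R t))"
proof -
 let ?v = "bumpd c t"
 obtain C where C: "0 < C" "\<And>e x. 0 \<le> e \<Longrightarrow> \<bar>tlap s e (bump :: real^'n \<Rightarrow> real) x\<bar> \<le> C * decay s x"
  using tlap_bump_decay[OF s] by blast
 have tl: "tlap s d ?v x = t powr (- 2 * s) * tlap s (d / t) bump ((x - c) /\<^sub>R t)" for d x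
  unfolding bumpd_def[abs_def] by (rule tlap_scale[OF t])
 have "(\<lambda>k. LBINT x. u x * tlap s (e k) ?v x) \<longlonglongrightarrow> (LBINT x. u x * tlap s 0 ?v x)"
 proof (rule integral_dominated_convergence)
  show "L1 (\<lambda>x. t powr (- 2 * s) * (\<bar>u x\<bar> * (C * decay s ((c - x) /\<^sub>R t))))"
   by (intro integrable_mult_right L2_decay_integrable[OF s(1) t, where C=C]) (use u C less_imp_le[OF decay_pos] in \<open>auto simp: abs_mult\<close>)
  show "AE x in lborel. norm (u x * tlap s (e k) ?v x) \<le> t powr (- 2 * s) * (\<bar>u x\<bar> * (C * decay s ((c - x) /\<^sub>R t)))" for k
  proof (rule AE_I2)
   fix x
   have "\<bar>tlap s (e k) ?v x\<bar> \<le> t powr (- 2 * s) * (C * decay s ((x - c) /\<^sub>R t))"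
    unfolding tl abs_mult using e(1)[of k] t by (simp add: mult_left_mono C(2))
   moreover have "decay s ((x - c) /\<^sub>R t) = decay s ((c - x) /\<^sub>R t)"
    by (simp add: decay_def norm_minus_commute)
   ultimately have "\<bar>u x\<bar> * \<bar>tlap s (e k) ?v x\<bar> \<le> \<bar>u x\<bar> * (t powr (- 2 * s) * (C * decay s ((c - x) /\<^sub>R t)))"
    by (intro mult_left_mono) auto
   then show "norm (u x * tlap s (e k) ?v x) \<le> t powr (- 2 * s) * (\<bar>u x\<bar> * (C * decay s ((c - x) /\<^sub>R t)))"
    by (simp add: abs_mult mult_ac)
  qed
  show "AE x in lborel. (\<lambda>k. u x * tlap s (e k) ?v x) \<longlonglongrightarrow> u x * tlap s 0 ?v x"
  proof (intro AE_I2 tendsto_mult tendsto_const)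
   fix x
   have "(\<lambda>k. e k / t) \<longlonglongrightarrow> 0 / t" by (intro tendsto_intros e(2)) (use t in simp)
   then have "(\<lambda>k. tlap s (e k / t) bump ((x - c) /\<^sub>R t)) \<longlonglongrightarrow> tlap s 0 bump ((x - c) /\<^sub>R t)"
    using t e(1) by (intro tlap_tendsto[OF s _ _ bump_measurable bump_sdiff_min]) auto
   then show "(\<lambda>k. tlap s (e k) ?v x) \<longlonglongrightarrow> tlap s 0 ?v x" unfolding tl by (auto intro!: tendsto_intros)
  qed
 qed measurable
 moreover have "(LBINT x. u x * tlap s 0 ?v x) = (LBINT x. t powr (- 2 * s) * (u x * lapb s ((x - c) /\<^sub>R t)))"
  by (simp add: tl lapb_def mult_ac)
 ultimately show ?thesis by simp
qed

text \<open>With the singular kernel the halves u(x)(v(x) - v(y)) and u(y)(v(y) - v(x)) need not be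
  integrable separately. With the kernel cut off at \<open>e k\<close> they are; the swap of
  variables exchanges them, and each integrates to a pairing of u with a truncated Laplacian of the
  bump. Both sides then pass to the limit by dominated convergence.\<close>

lemma green_bump:
 fixes u :: "real^'n \<Rightarrow> real"
 assumes s: "0 < s" "s < 1" and t: "0 < t"
  and [measurable]: "u \<in> borel_measurable borel" and u: "L2 u"
  and full: "integrable lborel2
   (\<lambda>(x, y). (u x - u y) * (bumpd c t x - bumpd c t y) * kern s 0 (x - y))"
 shows "(\<integral>p. (case p of (x, y) \<Rightarrow> (u x - u y) * (bumpd c t x - bumpd c t y) * kern s 0 (x - y)) \<partial>lborel2)
  = 2 * t powr (- 2 * s) * (LBINT x. u x * lapb s ((x - c) /\<^sub>R t))"
proof -
 let ?v = "bumpd c t"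
 define e :: "nat \<Rightarrow> real" where "e k = inverse (real (Suc k))" for k
 have e: "0 < e k" "0 \<le> e k" for k by (auto simp: e_def)
 have e0: "e \<longlonglongrightarrow> 0" unfolding e_def using LIMSEQ_inverse_real_of_nat by simp
 define F where "F k p = (case p of (x, y) \<Rightarrow> (u x - u y) * (?v x - ?v y) * kern s (e k) (x - y))" for k and p :: "(real^'n) \<times> (real^'n)"
 define D where "D k p = (case p of (x, y) \<Rightarrow> u x * (?v x - ?v y) * kern s (e k) (x - y))" for k and p :: "(real^'n) \<times> (real^'n)"
 have Dint: "integrable lborel2 (D k)" for k
 proof -
  have 1: "integrable lborel2 (\<lambda>(x, y). (u x)\<^sup>2 * kern s (e k) (x - y))"
   by (rule integrable_convolution_pair[OF u kern_integrable[OF s(1) e(1)]])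
  have 2: "integrable lborel2 (\<lambda>(x, y). (?v x)\<^sup>2 * kern s (e k) (x - y))"
   by (rule integrable_convolution_pair(1)[OF bumpd_sq_integrable[OF t] kern_integrable[OF s(1) e(1)]])
  have 3: "integrable lborel2 (\<lambda>(x, y). (?v y)\<^sup>2 * kern s (e k) (x - y))"
   by (rule integrable_convolution_pair(2)[OF bumpd_sq_integrable[OF t] kern_integrable[OF s(1) e(1)]])
  have "integrable lborel2 (\<lambda>p. (u (fst p) * ?v (fst p) * kern s (e k) (fst p - snd p)) - (u (fst p) * ?v (snd p) * kern s (e k) (fst p - snd p)))"
   using 1 2 3 by (intro bochner_integrable_diff integrable_mult_weight kern_nonneg; simp add: case_prod_unfold)
  then show ?thesis by (simp add: D_def[abs_def] case_prod_unfold algebra_simps)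
 qed
 have Dsw: "integrable lborel2 (\<lambda>(x, y). D k (y, x))"
  "(\<integral>p. (case p of (x, y) \<Rightarrow> D k (y, x)) \<partial>lborel2) = integral\<^sup>L lborel2 (D k)" for k
  using lborel_pair.integrable_product_swap[OF Dint[of k]] lborel_pair.integral_product_swap[of "D k"] Dint[of k]
  by auto
 have FD: "F k = (\<lambda>p. D k p + (case p of (x, y) \<Rightarrow> D k (y, x)))" for k
 proof
  fix p :: "(real^'n) \<times> (real^'n)"
  have "kern s (e k) (snd p - fst p) = kern s (e k) (fst p - snd p)"
   using kern_minus[of s "e k" "fst p - snd p"] by simp
  then show "F k p = D k p + (case p of (x, y) \<Rightarrow> D k (y, x))"
   by (simp add: F_def D_def case_prod_unfold algebra_simps)
 qed
 have Fk: "integral\<^sup>L lborel2 (F k) = 2 * (LBINT x. u x * tlap s (e k) ?v x)" for k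
 proof -
  have inner: "(LBINT y. D k (x, y)) = u x * tlap s (e k) ?v x" for x
  proof -
   have "L1 (\<lambda>z. ?v (x + z) * kern s (e k) z)"
   proof (rule bochner_bound[OF kern_integrable[OF s(1) e(1)[of k]]])
    show "AE z in lborel. norm (?v (x + z) * kern s (e k) z) \<le> norm (kern s (e k) z)"
     using bumpd_bounds[of c t] kern_nonneg[of s "e k"]
     by (intro AE_I2) (simp add: abs_mult mult_left_le_one_le)
   qed measurable
   from tlap_eq[OF s(1) e(1) this]
   have "tlap s (e k) ?v x = (LBINT z. (?v x - ?v (x + z)) * kern s (e k) z)" .
   also have "\<dots> = (LBINT y. (?v x - ?v y) * kern s (e k) (x - y))"
    using integral_lborel_translate[of "\<lambda>y. (?v x - ?v y) * kern s (e k) (x - y)" x] by (simp add: kern_minus)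
   finally show ?thesis by (simp add: D_def mult.assoc)
  qed
  have "integral\<^sup>L lborel2 (F k) = 2 * integral\<^sup>L lborel2 (D k)"
   unfolding FD using bochner_add[OF Dint Dsw(1)] Dsw(2) by simp
  also have "integral\<^sup>L lborel2 (D k) = (LBINT x. LBINT y. D k (x, y))"
   using lborel_pair.integral_fst'[OF Dint] by simp
  finally show ?thesis by (simp add: inner)
 qed
 have L1: "(\<lambda>k. integral\<^sup>L lborel2 (F k))
   \<longlonglongrightarrow> (\<integral>p. (case p of (x, y) \<Rightarrow> (u x - u y) * (?v x - ?v y) * kern s 0 (x - y)) \<partial>lborel2)"
 proof (rule integral_dominated_convergence[where w="\<lambda>p. \<bar>case p of (x, y) \<Rightarrow> (u x - u y) * (?v x - ?v y) * kern s 0 (x - y)\<bar>"])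
  show "AE p in lborel2. (\<lambda>k. F k p) \<longlonglongrightarrow> (case p of (x, y) \<Rightarrow> (u x - u y) * (?v x - ?v y) * kern s 0 (x - y))"
   by (intro AE_I2) (auto simp: F_def intro!: tendsto_intros kern_tendsto e e0)
  show "AE p in lborel2. norm (F k p) \<le> \<bar>case p of (x, y) \<Rightarrow> (u x - u y) * (?v x - ?v y) * kern s 0 (x - y)\<bar>" for k
   using kern_antimono[OF e(2)[of k]]
   by (intro AE_I2) (auto simp: F_def abs_mult abs_kern intro!: mult_left_mono)
  show "F k \<in> borel_measurable lborel2" for k unfolding F_def[abs_def] by measurable
 qed (use full in auto)
 have L2: "(\<lambda>k. 2 * (LBINT x. u x * tlap s (e k) ?v x)) \<longlonglongrightarrow> 2 * (t powr (- 2 * s) * (LBINT x. u x * lapb s ((x - c) /\<^sub>R t)))"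
  by (intro tendsto_mult_left tlap_bumpd_weak_tendsto s t u e0 less_imp_le[OF e(1)]) simp
 show ?thesis using LIMSEQ_unique[OF L1, unfolded Fk, OF L2] by simp
qed

lemma bump_lipschitz: "\<bar>bump x - bump y\<bar> \<le> 10 * norm (x - y)"
proof -
 have b1: "\<bar>bump1 z x\<bar> \<le> 10 * norm z" for z x :: "real^'n"
 proof (cases "norm x < 1")
  case True
  let ?P = "max 0 (1 - (norm x)\<^sup>2)"
  have "\<bar>x \<bullet> z\<bar> \<le> norm x * norm z" by (rule Cauchy_Schwarz_ineq2)
  also have "\<dots> \<le> norm z" using True by (simp add: mult_left_le_one_le)
  finally have "\<bar>?P ^ 4 * (x \<bullet> z)\<bar> \<le> 1 * norm z"
   unfolding abs_mult by (intro mult_mono) (auto intro!: power_le_one)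
  then show ?thesis unfolding bump1_def mult.assoc by linarith
 next
  case False
  then have "1 - (norm x)\<^sup>2 \<le> 0" using power_mono[of 1 "norm x" 2] by simp
  then show ?thesis by (simp add: bump1_def max_absorb1)
 qed
 obtain v where "bump (y + 1 *\<^sub>R (x - y)) - bump (y + 0 *\<^sub>R (x - y)) = (1 - 0) * bump1 (x - y) (y + v *\<^sub>R (x - y))"
  using MVT2[of 0 1 "\<lambda>t. bump (y + t *\<^sub>R (x - y))" "\<lambda>t. bump1 (x - y) (y + t *\<^sub>R (x - y))"] bump_line_deriv by auto
 then show ?thesis using b1[of "x - y" "y + v *\<^sub>R (x - y)"] by simp
qed

text \<open>The bump is bounded and Lipschitz, so its squared increment is O(min 1 |x - y|^2), and
  it vanishes unless x or y lies in the ball. The pair integral is thus dominated by a convolution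
  of an indicator with an integrable kernel.\<close>

lemma bumpd_energy_integrable:
 fixes c :: "real^'n"
 assumes s: "0 < s" "s < 1" and t: "0 < t"
 shows "integrable lborel2 (\<lambda>(x, y). (bumpd c t x - bumpd c t y)\<^sup>2 * kern s 0 (x - y))"
proof -
 let ?B = "indicator (cball c t) :: real^'n \<Rightarrow> real" and ?M = "max 1 ((10 / t)\<^sup>2)"
 have iB: "L1 ?B"
  using emeasure_lborel_cball_finite[of c t] by (simp add: integrable_real_indicator)
 note ic = integrable_convolution_pair[OF iB kern_min_integrable[OF s]]
 have "integrable lborel2 (\<lambda>p. ?M * ((case p of (x, y) \<Rightarrow> ?B x * (min 1 ((norm (x - y))\<^sup>2) * kern s 0 (x - y)))
   + (case p of (x, y) \<Rightarrow> ?B y * (min 1 ((norm (x - y))\<^sup>2) * kern s 0 (x - y)))))"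
  by (intro integrable_mult_right bochner_integrable_add ic)
 then show ?thesis
 proof (rule bochner_bound)
  have le: "(bumpd c t x - bumpd c t y)\<^sup>2 * kern s 0 (x - y)
    \<le> ?M * (?B x * (min 1 ((norm (x - y))\<^sup>2) * kern s 0 (x - y)) + ?B y * (min 1 ((norm (x - y))\<^sup>2) * kern s 0 (x - y)))" for x y
  proof -
   have 1: "(bumpd c t x - bumpd c t y)\<^sup>2 \<le> ?M * min 1 ((norm (x - y))\<^sup>2)"
   proof (cases "norm (x - y) \<le> 1")
    case True
    have "\<bar>bumpd c t x - bumpd c t y\<bar> \<le> 10 * norm ((x - c) /\<^sub>R t - (y - c) /\<^sub>R t)"
     unfolding bumpd_def by (rule bump_lipschitz)
    also have "(x - c) /\<^sub>R t - (y - c) /\<^sub>R t = (x - y) /\<^sub>R t" by (simp add: algebra_simps)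
    also have "10 * norm ((x - y) /\<^sub>R t) = 10 / t * norm (x - y)" unfolding norm_dilate[OF t] by simp
    finally have "\<bar>bumpd c t x - bumpd c t y\<bar>\<^sup>2 \<le> (10 / t * norm (x - y))\<^sup>2" by (intro power_mono) auto
    also have "\<dots> \<le> ?M * (norm (x - y))\<^sup>2" unfolding power_mult_distrib by (intro mult_right_mono) auto
    finally show ?thesis using True power_le_one[of "norm (x - y)" 2] by (simp add: min_absorb2)
   next
    case False
    have "\<bar>bumpd c t x - bumpd c t y\<bar>\<^sup>2 \<le> 1"
     using bumpd_bounds[of c t x] bumpd_bounds[of c t y] by (intro power_le_one) auto
    then show ?thesis using False power_mono[of 1 "norm (x - y)" 2] by (simp add: min_absorb1)
   qed
   show ?thesis
   proof (cases "x \<in> cball c t \<or> y \<in> cball c t")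
    case True
    have "1 \<le> ?B x + ?B y" using True by (auto simp: indicator_def)
    then have "(bumpd c t x - bumpd c t y)\<^sup>2 * kern s 0 (x - y) * 1 \<le> ?M * min 1 ((norm (x - y))\<^sup>2) * kern s 0 (x - y) * (?B x + ?B y)"
     using kern_nonneg[of s 0 "x - y"] 1 by (intro mult_mono mult_right_mono) auto
    then show ?thesis by (simp add: algebra_simps)
   next
    case False
    then show ?thesis using bumpd_outside[OF t, of x c] bumpd_outside[OF t, of y c] by simp
   qed
  qed
  then show "AE p in lborel2. norm (case p of (x, y) \<Rightarrow> (bumpd c t x - bumpd c t y)\<^sup>2 * kern s 0 (x - y))
    \<le> norm (?M * ((case p of (x, y) \<Rightarrow> ?B x * (min 1 ((norm (x - y))\<^sup>2) * kern s 0 (x - y)))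
   + (case p of (x, y) \<Rightarrow> ?B y * (min 1 ((norm (x - y))\<^sup>2) * kern s 0 (x - y)))))"
   by (intro AE_I2) (auto simp: abs_mult abs_kern intro!: order_trans[OF le] mult_left_mono[OF abs_ge_self])
 qed measurable
qed

subsection \<open>The mass of the mollifier\<close>

text \<open>The \<open>itself\<close> argument fixes the dimension, which no value argument
  determines.\<close>

definition moll_mass :: "'n::finite itself \<Rightarrow> real \<Rightarrow> real" where
 "moll_mass _ s = (LBINT x::real^'n. moll s 1 x)"

lemma moll_1_integrable:
 assumes s: "0 < s" "s < 1"
 shows "L1 (moll s 1 :: real^'n \<Rightarrow> real)"
proof -
 obtain C where C: "0 < C" "\<And>x :: real^'n. \<bar>moll s 1 x\<bar> \<le> C * decay s x" using moll_decay[OF s] by blast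
 show ?thesis
  by (rule bochner_bound[OF integrable_mult_right[OF decay_integrable[OF s(1)], of C]])
    (use C in \<open>auto intro: order_trans[OF _ abs_ge_self]\<close>)
qed

lemma moll_convolution:
 fixes f :: "real^'n \<Rightarrow> real"
 assumes d: "0 < d"
 shows "(LBINT y. moll s d (x - y) * f y) = (LBINT z. moll s 1 z * f (x - d *\<^sub>R z))"
proof -
 have "(LBINT y. moll s d (x - y) * f y)
   = d ^ CARD('n) * (LBINT z. moll s d (x - (x + (- d) *\<^sub>R z)) * f (x + (- d) *\<^sub>R z))"
  using integral_lborel_affine[of "- d" "\<lambda>y. moll s d (x - y) * f y" x] d by simp
 also have "(\<lambda>z. moll s d (x - (x + (- d) *\<^sub>R z)) * f (x + (- d) *\<^sub>R z))
   = (\<lambda>z. d powr (- real CARD('n)) * (moll s 1 z * f (x - d *\<^sub>R z)))"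
  using d by (auto simp: fun_eq_iff moll_scale[OF d, of s "d *\<^sub>R _"])
 also have "d ^ CARD('n) * (LBINT z. d powr (- real CARD('n)) * (moll s 1 z * f (x - d *\<^sub>R z)))
   = (d powr real CARD('n) * d powr (- real CARD('n))) * (LBINT z. moll s 1 z * f (x - d *\<^sub>R z))"
  using d by (simp add: powr_realpow)
 also have "d powr real CARD('n) * d powr (- real CARD('n)) = 1" using d by (simp add: powr_add[symmetric])
 finally show ?thesis by simp
qed

text \<open>Continuity is assumed only at the point x because the lemma is also applied to
  indicators of boxes, off their boundary. \<open>g\<close> may change sign, and its mass stays as a
  factor.\<close>

lemma approximate_identity:
 fixes f g :: "real^'n \<Rightarrow> real"
 assumes g: "L1 g" and [measurable]: "f \<in> borel_measurable borel" and B: "\<And>y. \<bar>f y\<bar> \<le> B"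
  and cont: "isCont f x" and d: "d \<longlonglongrightarrow> 0"
 shows "(\<lambda>k. LBINT z. g z * f (x - d k *\<^sub>R z)) \<longlonglongrightarrow> (LBINT z. g z) * f x"
proof -
 have [measurable]: "g \<in> borel_measurable borel" using g by auto
 have "(\<lambda>k. LBINT z. g z * f (x - d k *\<^sub>R z)) \<longlonglongrightarrow> (LBINT z. g z * f x)"
 proof (rule integral_dominated_convergence[where w="\<lambda>z. \<bar>g z\<bar> * B"])
  show "L1 (\<lambda>z. \<bar>g z\<bar> * B)" using g by auto
  show "AE z in lborel. norm (g z * f (x - d k *\<^sub>R z)) \<le> \<bar>g z\<bar> * B" for k
   by (intro AE_I2) (auto simp: abs_mult intro!: mult_left_mono B)
  show "AE z in lborel. (\<lambda>k. g z * f (x - d k *\<^sub>R z)) \<longlonglongrightarrow> g z * f x"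
  proof (intro AE_I2 tendsto_mult tendsto_const)
   fix z :: "real^'n"
   have "(\<lambda>k. x - d k *\<^sub>R z) \<longlonglongrightarrow> x - 0 *\<^sub>R z" by (intro tendsto_intros d)
   then show "(\<lambda>k. f (x - d k *\<^sub>R z)) \<longlonglongrightarrow> f x" using isCont_tendsto_compose[OF cont] by simp
  qed
 qed measurable
 then show ?thesis by simp
qed

text \<open>By \<open>green_bump\<close> the integral is a positive multiple of the energy pairing
  of two concentric bumps. Both decrease radially, so their increments have the same sign and the
  integrand is nonnegative; it is positive when x is near the centre and y outside both
  supports.\<close>

lemma bumpd_energy_pos:
 fixes c :: "real^'n"
 assumes s: "0 < s" "s < 1" and r: "0 < r"
 shows "0 < (LBINT x. bump (x :: real^'n) * lapb s (x /\<^sub>R r))"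
proof -
 let ?F = "\<lambda>p. (case p of (x, y) \<Rightarrow> (bumpd 0 1 x - bumpd 0 1 y) * (bumpd 0 r x - bumpd 0 r y) * kern s 0 (x - y :: real^'n))"
 have i: "integrable lborel2 ?F"
 proof -
  have "integrable lborel2 (\<lambda>p. (bumpd 0 1 (fst p) - bumpd 0 1 (snd p)) * (bumpd 0 r (fst p) - bumpd 0 r (snd p)) * kern s 0 (fst p - snd p :: real^'n))"
   using bumpd_energy_integrable[OF s, of 1 0] bumpd_energy_integrable[OF s r, of 0]
   by (intro integrable_mult_weight kern_nonneg; simp add: case_prod_unfold)
  then show ?thesis by (simp add: case_prod_unfold)
 qed
 have nn: "0 \<le> ?F p" for p
 proof -
  obtain x y where p: "p = (x, y)" by fastforce
  have n1: "bumpd 0 t v = bump (v /\<^sub>R t)" for t and v :: "real^'n" by (simp add: bumpd_def)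
  have "0 \<le> (bumpd 0 1 x - bumpd 0 1 y) * (bumpd 0 r x - bumpd 0 r y)"
  proof (cases "norm x \<le> norm y")
   case True
   then have "bumpd 0 1 y \<le> bumpd 0 1 x" "bumpd 0 r y \<le> bumpd 0 r x"
    unfolding n1 using r by (auto intro!: bump_antimono mult_left_mono)
   then show ?thesis by simp
  next
   case False
   then have "bumpd 0 1 x \<le> bumpd 0 1 y" "bumpd 0 r x \<le> bumpd 0 r y"
    unfolding n1 using r by (auto intro!: bump_antimono mult_left_mono)
   then show ?thesis by (simp add: mult_nonpos_nonpos)
  qed
  then show ?thesis using kern_nonneg[of s 0 "x - y"] p by simp
 qed
 have pos: "integral\<^sup>L lborel2 ?F \<noteq> 0"
 proof
  assume "integral\<^sup>L lborel2 ?F = 0"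
  then have ae: "AE p in lborel2. ?F p = 0"
   using integral_nonneg_eq_0_iff_AE[OF i] nn by simp
  obtain e :: "real^'n" where e: "norm e = 2 + r" using vector_choose_size[of "2 + r"] r by auto
  let ?A = "ball (0 :: real^'n) (min 1 r)" and ?B = "ball e 1"
  have ne: "?F (x, y) \<noteq> 0" if "x \<in> ?A" "y \<in> ?B" for x y
  proof -
   have x: "norm x < 1" "norm x < r" using that by auto
   have y: "norm y > 1 + r" using that(2) e norm_triangle_ineq2[of e y] by (simp add: dist_norm)
   have "bumpd 0 1 x > 0" "bumpd 0 r x > 0"
    using x r by (auto simp: bumpd_def field_simps intro!: bump_pos)
   moreover have "bumpd 0 1 y = 0" "bumpd 0 r y = 0"
    using y r by (auto intro!: bumpd_outside)
   moreover have "kern s 0 (x - y) > 0" using x y by (auto simp: kern_def)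
   ultimately show ?thesis by simp
  qed
  have "AE p in lborel2. p \<notin> ?A \<times> ?B"
  proof (rule eventually_mono[OF ae])
   fix p assume "?F p = 0"
   then show "p \<notin> ?A \<times> ?B" using ne[of "fst p" "snd p"] by (cases p) auto
  qed
  then have "emeasure lborel2 (?A \<times> ?B) = 0"
   by (subst (asm) AE_iff_measurable[OF _ refl]) (auto simp: space_pair_measure)
  then have "emeasure lborel ?A * emeasure lborel ?B = 0"
   by (simp add: lborel.emeasure_pair_measure_Times)
  moreover have "emeasure lborel (ball v d) \<noteq> 0" if "0 < d" for v :: "real^'n" and d
   using content_ball_pos[OF that, of v] by (auto simp: measure_def)
  ultimately show False using r by simp
 qed
 have "0 < integral\<^sup>L lborel2 ?F"
  using pos Bochner_Integration.integral_nonneg[of "lborel2" ?F, OF nn] by linarith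
 moreover have "integral\<^sup>L lborel2 ?F = 2 * r powr (- 2 * s) * (LBINT x. bumpd 0 1 x * lapb s ((x - 0 :: real^'n) /\<^sub>R r))"
  by (rule green_bump[OF s r _ bumpd_sq_integrable i]) auto
 ultimately show ?thesis using r by (simp add: bumpd_def zero_less_mult_iff)
qed

text \<open>\<open>moll\<close> has no evident sign, so it is paired with the bump. The pairing with
  \<open>moll s d - moll s R\<close> is an integral of positive energies over d < r \<le> R, hence
  at least the share \<open>c0\<close> of 1 < r \<le> 2. As d tends to 0 the first part tends to the
  mass times \<open>bump 0\<close>, which is 1, and as R tends to infinity the second is
  O(R^(-n)).\<close>

lemma moll_mass_pos:
 assumes s: "0 < s" "s < 1"
 shows "0 < moll_mass TYPE('n::finite) s"
proof -
 let ?n = "real CARD('n)"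
 define w where "w r = r powr (- ?n - 1)" for r :: real
 have [measurable]: "w \<in> borel_measurable borel" unfolding w_def by measurable
 define E where "E r = (LBINT x. bump (x :: real^'n) * lapb s (x /\<^sub>R r))" for r
 define c0 where "c0 = (LBINT r. indicator {1<..2} r * (w r * E r))"
 obtain C where C: "0 < C" "\<And>x :: real^'n. \<bar>lapb s x\<bar> \<le> C * decay s x" using lapb_decay[OF s] by blast
 obtain D where D: "0 < D" "\<And>x :: real^'n. \<bar>moll s 1 x\<bar> \<le> D * decay s x" using moll_decay[OF s] by blast
 have Epos: "0 < E r" if "0 < r" for r using bumpd_energy_pos[OF s that] by (simp add: E_def)
 have iw: "L1 (\<lambda>r. indicator {d<..} r * w r)" if "0 < d" for d
  using powr_integral_at_top[OF card_pos[where 'n='n] that] by (simp add: w_def has_bochner_integral_iff)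
 have key: "L1 (\<lambda>r. indicator {d<..R} r * (w r * E r)) \<and>
   (LBINT x. bump (x :: real^'n) * (moll s d x - moll s R x)) = (LBINT r. indicator {d<..R} r * (w r * E r))"
  if d: "0 < d" "d \<le> R" for d R
 proof -
  have F: "integrable lborel2 (\<lambda>(x :: real^'n, r). bump x * (indicator {d<..R} r * (w r * lapb s (x /\<^sub>R r))))"
  proof (rule integrable_pair_bound[OF _ bump_integrable integrable_mult_right[OF iw[OF d(1)], of C]])
   show "\<bar>case (x, r) of (x :: real^'n, r) \<Rightarrow> bump x * (indicator {d<..R} r * (w r * lapb s (x /\<^sub>R r)))\<bar>
     \<le> bump x * (C * (indicator {d<..} r * w r))" for x r
   proof -
    have w: "0 \<le> w r" by (simp add: w_def)
    have "bump x * (w r * \<bar>lapb s (x /\<^sub>R r)\<bar>) \<le> bump x * (w r * C)"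
     by (intro mult_left_mono lapb_le[OF s(1) C] w bump_nonneg)
    then show ?thesis using w bump_nonneg[of x] C(1)
     by (auto simp: indicator_def abs_mult abs_of_nonneg mult.commute[of C])
   qed
  qed measurable
  have 1: "(LBINT x. bump (x :: real^'n) * (moll s d x - moll s R x))
    = (LBINT x. LBINT r. bump (x :: real^'n) * (indicator {d<..R} r * (w r * lapb s (x /\<^sub>R r))))"
   unfolding moll_diff[OF s d, symmetric] w_def by simp
  have 2: "(LBINT x. bump (x :: real^'n) * (indicator {d<..R} r * (w r * lapb s (x /\<^sub>R r)))) = indicator {d<..R} r * (w r * E r)" for r
  proof -
   have "(\<lambda>x :: real^'n. bump x * (indicator {d<..R} r * (w r * lapb s (x /\<^sub>R r)))) = (\<lambda>x. indicator {d<..R} r * w r * (bump x * lapb s (x /\<^sub>R r)))"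
    by (simp add: fun_eq_iff mult_ac)
   then show ?thesis by (simp add: E_def mult.assoc)
  qed
  show ?thesis
   using lborel_pair.Fubini_integral[OF F] lborel_pair.integrable_snd[OF F] unfolding 1 2 by simp
 qed
 have c0: "0 < c0"
 proof -
  have i: "L1 (\<lambda>r. indicator {1<..2} r * (w r * E r))" using key[of 1 2] by simp
  have nn: "0 \<le> indicator {1<..2} r * (w r * E r)" for r
   using Epos[of r] by (cases "1 < r") (auto simp: w_def less_imp_le)
  have "c0 \<noteq> 0"
  proof
   assume "c0 = 0"
   then have "AE r in lborel. indicator {1<..2} r * (w r * E r) = 0"
    using integral_nonneg_eq_0_iff_AE[OF i] nn by (simp add: c0_def)
   then have "AE r in lborel. r \<notin> {1<..2::real}"
   proof eventually_elim
    case (elim r)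
    then show ?case using Epos[of r] by (auto simp: w_def)
   qed
   then have "{1<..2::real} \<in> null_sets lborel"
    by (subst AE_iff_null_sets) auto
   then show False by (simp add: null_sets_def)
  qed
  moreover have "0 \<le> c0" unfolding c0_def by (intro integral_nonneg_AE AE_I2 nn)
  ultimately show ?thesis by simp
 qed
 have lower: "c0 \<le> (LBINT x. bump (x :: real^'n) * (moll s d x - moll s R x))" if d: "0 < d" "d \<le> 1" "2 \<le> R" for d R
 proof -
  have "c0 \<le> (LBINT r. indicator {d<..R} r * (w r * E r))"
   unfolding c0_def
  proof (rule bochner_mono)
   show "indicator {1<..2} r * (w r * E r) \<le> indicator {d<..R} r * (w r * E r)" for r
    using Epos[of r] d by (cases "d < r") (auto simp: indicator_def w_def less_imp_le)
  qed (use key[of 1 2] key[of d R] d in auto)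
  then show ?thesis using key[of d R] d by simp
 qed
 have mi: "L1 (\<lambda>x :: real^'n. bump x * moll s d x)"
  and mb: "\<bar>LBINT x. bump (x :: real^'n) * moll s d x\<bar> \<le> d powr (- ?n) * (D * (LBINT x::real^'n. bump x))" if d: "0 < d" for d
 proof -
  have bd: "\<bar>bump x * moll s d x\<bar> \<le> d powr (- ?n) * (D * bump x)" for x :: "real^'n"
  proof -
   have "\<bar>moll s 1 (x /\<^sub>R d)\<bar> \<le> D"
    using D(2)[of "x /\<^sub>R d"] mult_left_le[OF decay_le_1[OF s(1)], of D "x /\<^sub>R d"] D(1) by linarith
   then have "bump x * (d powr (- ?n) * \<bar>moll s 1 (x /\<^sub>R d)\<bar>) \<le> bump x * (d powr (- ?n) * D)"
    by (intro mult_left_mono bump_nonneg) auto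
   then show ?thesis by (simp add: moll_scale[OF d] abs_mult abs_of_nonneg[OF bump_nonneg] mult_ac)
  qed
  have ib: "L1 (\<lambda>x :: real^'n. d powr (- ?n) * (D * bump x))"
   by (intro integrable_mult_right bump_integrable)
  show i: "L1 (\<lambda>x :: real^'n. bump x * moll s d x)"
   by (rule bochner_bound[OF ib]) (use bd in \<open>auto intro: order_trans[OF _ abs_ge_self]\<close>)
  have "\<bar>LBINT x. bump (x :: real^'n) * moll s d x\<bar> \<le> (LBINT x. \<bar>bump (x :: real^'n) * moll s d x\<bar>)"
   by (rule integral_abs_bound)
  also have "\<dots> \<le> (LBINT x::real^'n. d powr (- ?n) * (D * bump x))"
   by (intro bochner_mono integrable_abs i ib bd)
  finally show "\<bar>LBINT x. bump (x :: real^'n) * moll s d x\<bar> \<le> d powr (- ?n) * (D * (LBINT x::real^'n. bump x))"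
   by simp
 qed
 define e :: "nat \<Rightarrow> real" where "e k = inverse (real (Suc k))" for k
 have e: "0 < e k" "e k \<le> 1" for k by (auto simp: e_def field_simps)
 have e0: "e \<longlonglongrightarrow> 0" unfolding e_def using LIMSEQ_inverse_real_of_nat by simp
 have "(\<lambda>k. LBINT z. moll s 1 z * bump ((0::real^'n) - e k *\<^sub>R z)) \<longlonglongrightarrow> (LBINT z. moll s 1 (z :: real^'n)) * bump (0 :: real^'n)"
  using bump_continuous by (intro approximate_identity[OF moll_1_integrable[OF s] _ abs_bump _ e0])
   (auto simp: continuous_on_eq_continuous_at)
 then have lim1: "(\<lambda>k. LBINT x. bump (x :: real^'n) * moll s (e k) x) \<longlonglongrightarrow> moll_mass TYPE('n) s"
 proof -
  have "(LBINT x. bump (x :: real^'n) * moll s (e k) x) = (LBINT z. moll s 1 z * bump ((0::real^'n) - e k *\<^sub>R z))" for k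
   using moll_convolution[OF e(1)[of k], where x="0 :: real^'n" and f=bump and s=s] integral_lborel_reflect[of "\<lambda>x :: real^'n. bump x * moll s (e k) x" 0]
   by (simp add: bump_minus mult.commute)
  then show ?thesis using \<open>_ \<longlonglongrightarrow> _ * bump 0\<close> by (simp add: moll_mass_def bump_0)
 qed
 let ?R = "\<lambda>k. real k + 2"
 have lim2: "(\<lambda>k. LBINT x. bump (x :: real^'n) * moll s (?R k) x) \<longlonglongrightarrow> 0"
 proof (rule Lim_null_comparison)
  have "filterlim (\<lambda>k. real k + 2) at_top sequentially"
   by (rule filterlim_tendsto_add_at_top[of "\<lambda>_. 2", simplified add.commute]) (auto intro: filterlim_real_sequentially)
  then have "(\<lambda>k. ?R k powr (- ?n)) \<longlonglongrightarrow> 0"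
   by (intro tendsto_neg_powr) auto
  then show "(\<lambda>k. ?R k powr (- ?n) * (D * (LBINT x::real^'n. bump x))) \<longlonglongrightarrow> 0"
   by (rule tendsto_mult_left_zero)
  show "\<forall>\<^sub>F k in sequentially. norm (LBINT x. bump (x :: real^'n) * moll s (?R k) x)
    \<le> ?R k powr (- ?n) * (D * (LBINT x::real^'n. bump x))"
   using mb[of "?R _"] by (intro always_eventually allI) simp
 qed
 have "c0 \<le> (LBINT x. bump (x :: real^'n) * moll s (e k) x) - (LBINT x. bump (x :: real^'n) * moll s (?R k) x)" for k
 proof -
  have "c0 \<le> (LBINT x. bump (x :: real^'n) * moll s (e k) x - bump x * moll s (?R k) x)"
   using lower[OF e, of "?R k" k] by (simp add: right_diff_distrib)
  then show ?thesis using mi[OF e(1)[of k]] mi[of "?R k"] by (simp add: bochner_diff)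
 qed
 then have "c0 \<le> moll_mass TYPE('n) s - 0"
  by (intro LIMSEQ_le_const[OF tendsto_diff[OF lim1 lim2]]) auto
 then show ?thesis using c0 by simp
qed

subsection \<open>Functions orthogonal to all bumps\<close>

text \<open>Boxes form an intersection-stable generator of the Borel sets; the whole space, which is
  not a box, is reached as an increasing union.\<close>

lemma AE_zero_of_box_integrals:
 fixes g :: "'a::euclidean_space \<Rightarrow> real"
 assumes g: "L1 g" and box: "\<And>a b. (LBINT x. indicator (box a b) x * g x) = 0"
 shows "AE x in lborel. g x = 0"
proof (rule sigma_finite_measure.density_zero[OF sigma_finite_lborel g])
 have si: "set_integrable lborel A g" if "A \<in> sets borel" for A
  using integrable_mult_indicator[OF _ g, of A] that by (simp add: set_integrable_def)
 let ?E = "range (\<lambda>(a, b). box a b :: 'a set)"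
 have UN: "(\<Union>n::nat. box (- (real n *\<^sub>R One)) (real n *\<^sub>R One)) = (UNIV :: 'a set)"
  by (rule UN_box_eq_UNIV)
 have inc: "incseq (\<lambda>n::nat. box (- (real n *\<^sub>R One)) (real n *\<^sub>R One :: 'a))"
  unfolding incseq_def
  by (intro allI impI subset_box_imp) (auto simp: inner_diff_left)
 have gU: "set_lebesgue_integral lborel UNIV g = 0"
 proof -
  have "(\<lambda>n::nat. set_lebesgue_integral lborel (box (- (real n *\<^sub>R One)) (real n *\<^sub>R One)) g) \<longlonglongrightarrow>
    set_lebesgue_integral lborel (\<Union>n::nat. box (- (real n *\<^sub>R One)) (real n *\<^sub>R One)) g"
   by (rule set_integral_cont_up[OF _ inc]) (auto intro!: si)
  then show ?thesis unfolding UN using box by (simp add: set_lebesgue_integral_def LIMSEQ_const_iff)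
 qed
 fix A :: "'a set" assume "A \<in> sets lborel"
 then have A: "A \<in> sigma_sets UNIV ?E" by (simp add: borel_eq_box)
 have "Int_stable ?E" by (auto simp: Int_stable_def box_Int_box)
 then show "set_lebesgue_integral lborel A g = 0"
 proof (induction rule: sigma_sets_induct_disjoint[of ?E UNIV, consumes 0, case_names stable closed sig basic empty compl union])
  case (compl B)
  then have B: "B \<in> sets borel" by (simp add: borel_eq_box)
  have "set_lebesgue_integral lborel (B \<union> (UNIV - B)) g = set_lebesgue_integral lborel B g + set_lebesgue_integral lborel (UNIV - B) g"
   using B by (intro set_integral_Un si) auto
  then show ?case using compl gU by simp
 next
  case (union B)
  then have B: "B i \<in> sets lborel" for i by (auto simp: borel_eq_box)
  have "set_lebesgue_integral lborel (\<Union>i. B i) g = (\<Sum>i. set_lebesgue_integral lborel (B i) g)"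
   using union B by (intro lebesgue_integral_countable_add si) (auto simp: disjoint_family_on_def)
  moreover have "set_lebesgue_integral lborel (B i) g = 0" for i using union by blast
  ultimately show ?case by simp
 qed (use box A in \<open>auto simp: set_lebesgue_integral_def Int_stable_def box_Int_box\<close>)
qed

lemma AE_zero_on_open:
 fixes D :: "'a::euclidean_space \<Rightarrow> real"
 assumes U: "open U"
  and i: "\<And>a b. box a b \<subseteq> U \<Longrightarrow> L1 (\<lambda>x. indicator (box a b) x * D x)"
  and z: "\<And>a b. box a b \<subseteq> U \<Longrightarrow> (LBINT x. indicator (box a b) x * D x) = 0"
 shows "AE x in lborel. x \<in> U \<longrightarrow> D x = 0"
proof -
 obtain \<D> where \<D>: "countable \<D>" "\<D> \<subseteq> Pow U" "\<And>X. X \<in> \<D> \<Longrightarrow> \<exists>a b. X = box a b" "\<Union>\<D> = U"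
  using open_countable_Union_open_box[OF U] by metis
 have "AE x in lborel. x \<in> X \<longrightarrow> D x = 0" if X: "X \<in> \<D>" for X
 proof -
  obtain a b where ab: "X = box a b" "box a b \<subseteq> U" using \<D> X by blast
  have "AE x in lborel. indicator (box a b) x * D x = 0"
  proof (rule AE_zero_of_box_integrals[OF i[OF ab(2)]])
   fix a' b'
   obtain c d where cd: "box a' b' \<inter> box a b = box c d" unfolding box_Int_box by blast
   have "(\<lambda>x. indicator (box a' b') x * (indicator (box a b) x * D x)) = (\<lambda>x. indicator (box c d) x * D x)"
    unfolding cd[symmetric] by (auto simp: fun_eq_iff indicator_def)
   moreover have "box c d \<subseteq> U" using cd ab(2) by blast
   ultimately show "(LBINT x. indicator (box a' b') x * (indicator (box a b) x * D x)) = 0" using z by simp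
  qed
  then show ?thesis by eventually_elim (auto simp: ab(1) indicator_def)
 qed
 then have "AE x in lborel. \<forall>X\<in>\<D>. x \<in> X \<longrightarrow> D x = 0" by (subst AE_ball_countable[OF \<D>(1)]) blast
 then show ?thesis by eventually_elim (use \<D>(4) in blast)
qed

lemma isCont_indicator_box:
 "AE x in lborel. isCont (indicator (box a b) :: 'a::euclidean_space \<Rightarrow> real) x"
proof -
 have "AE x in lborel. x \<notin> cbox a b - box a b"
  using null_sets_cbox_Diff_box[of a b] by (rule AE_not_in)
 then show ?thesis
 proof eventually_elim
  case (elim x)
  consider "x \<in> box a b" | "x \<in> - cbox a b" using elim by blast
  then show ?case
  proof cases
   case 1
   have "isCont (\<lambda>_. 1 :: real) x" by simp
   then show ?thesis
    by (rule isCont_cong[THEN iffD2, rotated])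
      (use 1 in \<open>auto simp: eventually_nhds indicator_def intro!: exI[of _ "box a b"] open_box\<close>)
  next
   case 2
   have "isCont (\<lambda>_. 0 :: real) x" by simp
   then show ?thesis
    by (rule isCont_cong[THEN iffD2, rotated])
      (use 2 box_subset_cbox[of a b] in \<open>auto simp: eventually_nhds indicator_def intro!: exI[of _ "- cbox a b"] open_Compl closed_cbox\<close>)
  qed
 qed
qed

lemma L2_set_integrable:
 fixes F :: "real^'n \<Rightarrow> real"
 assumes [measurable]: "F \<in> borel_measurable borel" and F: "L2 F"
  and [measurable]: "A \<in> sets borel" and A: "emeasure lborel A < \<infinity>"
 shows "L1 (\<lambda>x. indicator A x * F x)"
proof (rule L2_mult_integrable[OF _ _ _ F])
 have "(\<lambda>x. (indicator A x)\<^sup>2) = (indicator A :: real^'n \<Rightarrow> real)" by (auto simp: indicator_def fun_eq_iff)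
 then show "L1 (\<lambda>x. (indicator A x :: real)\<^sup>2)" using A by (simp add: integrable_real_indicator)
qed measurable

lemma bump_integral_pos: "0 < (LBINT x::real^'n. bump x)"
proof -
 have "(LBINT x::real^'n. bump x) \<noteq> 0"
 proof
  assume "(LBINT x::real^'n. bump x) = 0"
  then have "AE x :: real^'n in lborel. bump x = 0"
   using integral_nonneg_eq_0_iff_AE[OF bump_integrable] bump_nonneg by auto
  then have "AE x :: real^'n in lborel. x \<notin> ball 0 1"
   by eventually_elim (use bump_pos in \<open>fastforce\<close>)
  then have "ball (0 :: real^'n) 1 \<in> null_sets lborel" by (subst AE_iff_null_sets) auto
  then show False using content_ball_pos[of 1 "0 :: real^'n"] by (simp add: null_sets_def measure_def)
 qed
 moreover have "0 \<le> (LBINT x::real^'n. bump x)"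
  by (intro integral_nonneg_AE AE_I2 bump_nonneg)
 ultimately show ?thesis by simp
qed

text \<open>Integrating the hypothesis over all centres in a box gives, by Fubini, orthogonality to
  the mollified indicator of that box. As the radius shrinks, the mollified indicator converges off
  the boundary of the box, so the box integrals of \<open>F\<close> vanish.\<close>

lemma AE_zero_of_bump_integrals:
 fixes F :: "real^'n \<Rightarrow> real"
 assumes [measurable]: "F \<in> borel_measurable borel" and F: "L2 F"
  and z: "\<And>c t. 0 < t \<Longrightarrow> (LBINT x. F x * bumpd c t x) = 0"
 shows "AE x in lborel. F x = 0"
proof -
 have fin: "emeasure lborel (box a b :: (real^'n) set) < \<infinity>" for a b by (rule emeasure_lborel_box_finite)
 have finb: "emeasure lborel (ball (0 :: real^'n) r) < \<infinity>" for r by (rule emeasure_lborel_ball_finite)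
 have "AE x in lborel. x \<in> UNIV \<longrightarrow> F x = 0"
 proof (rule AE_zero_on_open[OF open_UNIV L2_set_integrable[OF _ F _ fin]])
  fix a b :: "real^'n"
  let ?i = "indicator (box a b) :: real^'n \<Rightarrow> real"
  obtain M where M: "0 < M" "box a b \<subseteq> ball 0 M"
   using bounded_box[of a b] bounded_subset_ballD by blast
  let ?b = "LBINT x::real^'n. bump x"
  define e :: "nat \<Rightarrow> real" where "e k = inverse (real (Suc k))" for k
  have e: "0 < e k" "e k \<le> 1" for k by (auto simp: e_def field_simps)
  have e0: "e \<longlonglongrightarrow> 0" unfolding e_def using LIMSEQ_inverse_real_of_nat by simp
  have sc: "(LBINT c. ?i c * bumpd c t y) = t ^ CARD('n) * (LBINT z. bump z * ?i (y - t *\<^sub>R z))" if "0 < t" for t y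
   using integral_lborel_affine[of "- t" "\<lambda>c. ?i c * bumpd c t y" y] that
   by (simp add: bumpd_def mult.commute)
  have zero: "(LBINT y. F y * (LBINT z. bump z * ?i (y - t *\<^sub>R z))) = 0" if t: "0 < t" "t \<le> 1" for t
  proof -
   have iF: "L1 (\<lambda>x. indicator (ball 0 (M + 1)) x * F x)"
    by (rule L2_set_integrable[OF _ F _ finb]) auto
   have ii: "L1 ?i" using fin by (simp add: integrable_real_indicator)
   have P: "integrable lborel2 (\<lambda>(y, c). F y * (?i c * bumpd c t y))"
   proof (rule integrable_pair_bound[OF _ integrable_abs[OF iF] ii])
    show "(\<lambda>(y, c). F y * (?i c * bumpd c t y)) \<in> borel_measurable lborel2"
     unfolding bumpd_def by measurable
    show "\<bar>case (y, c) of (y, c) \<Rightarrow> F y * (?i c * bumpd c t y)\<bar> \<le> \<bar>indicator (ball 0 (M + 1)) y * F y\<bar> * ?i c" for y c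
    proof (cases "c \<in> box a b \<and> y \<in> cball c t")
     case True
     then have "norm c < M" using M(2) by auto
     then have "y \<in> ball 0 (M + 1)"
      using True t norm_triangle_ineq2[of y c] by (auto simp: dist_norm norm_minus_commute)
     then show ?thesis using True bumpd_bounds[of c t y] by (simp add: abs_mult mult_left_le)
    qed (use bumpd_outside[OF t(1), of y c] in \<open>auto simp: indicator_def\<close>)
   qed
   have "(LBINT y. LBINT c. F y * (?i c * bumpd c t y)) = (LBINT c. LBINT y. F y * (?i c * bumpd c t y))"
    using lborel_pair.Fubini_integral[OF P] by simp
   also have "\<dots> = (LBINT c. ?i c * (LBINT y. F y * bumpd c t y))"
    by (simp only: mult.left_commute[of "F _" "?i _"] integral_mult_right_zero)
   also have "\<dots> = 0" by (simp add: z[OF t(1)])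
   finally have "t ^ CARD('n) * (LBINT y. F y * (LBINT z. bump z * ?i (y - t *\<^sub>R z))) = 0"
    by (simp only: sc[OF t(1)] mult.left_commute[of "F _" "t ^ _"] mult.left_commute[of "?i _" "F _"]
      integral_mult_right_zero)
   then show ?thesis using t by simp
  qed
  have "(\<lambda>k. LBINT y. F y * (LBINT z. bump z * ?i (y - e k *\<^sub>R z))) \<longlonglongrightarrow> (LBINT y. F y * (?b * ?i y))"
  proof (rule integral_dominated_convergence[where w="\<lambda>y. ?b * \<bar>indicator (ball 0 (M + 1)) y * F y\<bar>"])
   show "L1 (\<lambda>y. ?b * \<bar>indicator (ball 0 (M + 1)) y * F y\<bar>)"
    by (intro integrable_mult_right integrable_abs L2_set_integrable F finb) auto
   show "AE y in lborel. norm (F y * (LBINT z. bump z * ?i (y - e k *\<^sub>R z))) \<le> ?b * \<bar>indicator (ball 0 (M + 1)) y * F y\<bar>" for k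
   proof (rule AE_I2)
    fix y :: "real^'n"
    show "norm (F y * (LBINT z. bump z * ?i (y - e k *\<^sub>R z))) \<le> ?b * \<bar>indicator (ball 0 (M + 1)) y * F y\<bar>"
    proof (cases "y \<in> ball 0 (M + 1)")
     case True
     have "\<bar>LBINT z. bump z * ?i (y - e k *\<^sub>R z)\<bar> \<le> (LBINT z. \<bar>bump z * ?i (y - e k *\<^sub>R z)\<bar>)"
      by (rule integral_abs_bound)
     also have "\<dots> \<le> ?b"
     proof (rule bochner_mono[OF _ bump_integrable])
      show bb: "\<bar>bump z * ?i (y - e k *\<^sub>R z)\<bar> \<le> bump z" for z :: "real^'n"
       using bump_nonneg[of z] by (auto simp: indicator_def)
      show "L1 (\<lambda>z. \<bar>bump z * ?i (y - e k *\<^sub>R z)\<bar>)"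
       by (rule bochner_bound[OF bump_integrable])
         (use bb in \<open>auto intro: order_trans[OF _ abs_ge_self]\<close>)
     qed
     finally have "\<bar>F y\<bar> * \<bar>LBINT z. bump z * ?i (y - e k *\<^sub>R z)\<bar> \<le> \<bar>F y\<bar> * ?b"
      by (intro mult_left_mono) auto
     then show ?thesis using True by (simp add: abs_mult mult.commute)
    next
     case False
     have "bump z * ?i (y - e k *\<^sub>R z) = 0" for z :: "real^'n"
     proof (cases "norm z \<le> 1")
      case True
      have "norm (e k *\<^sub>R z) \<le> 1 * 1" unfolding norm_scaleR using e[of k] True by (intro mult_mono) auto
      then have "norm (y - e k *\<^sub>R z) \<ge> M" using False norm_triangle_ineq2[of y "e k *\<^sub>R z"] by simp
      then show ?thesis using M(2) by (auto simp: indicator_def)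
     qed (simp add: bump_outside)
     then have "(LBINT z. bump z * ?i (y - e k *\<^sub>R z)) = 0"
      by (simp only: Bochner_Integration.integral_zero)
     then show ?thesis using False by simp
    qed
   qed
   show "AE y in lborel. (\<lambda>k. F y * (LBINT z. bump z * ?i (y - e k *\<^sub>R z))) \<longlonglongrightarrow> F y * (?b * ?i y)"
    using isCont_indicator_box[of a b]
   proof eventually_elim
    case (elim y)
    have "(\<lambda>k. LBINT z. bump z * ?i (y - e k *\<^sub>R z)) \<longlonglongrightarrow> ?b * ?i y"
     by (rule approximate_identity[OF bump_integrable _ _ elim e0, of 1]) (auto simp: indicator_def)
    then show ?case by (intro tendsto_intros)
   qed
  qed measurable
  then have "(LBINT y. F y * (?b * ?i y)) = 0"
   using zero[OF e] by (simp add: LIMSEQ_const_iff)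
  moreover have "(LBINT y. F y * (?b * ?i y)) = ?b * (LBINT y. ?i y * F y)"
   by (simp only: mult.left_commute[of "F _" ?b] integral_mult_right_zero mult.commute[of "?i _" "F _"])
  ultimately show "(LBINT x. ?i x * F x) = 0" using bump_integral_pos[where 'n='n] by simp
 qed auto
 then show ?thesis by simp
qed

subsection \<open>Weak solutions\<close>

lemma frac_const_pos: "0 < s \<Longrightarrow> s < 1 \<Longrightarrow> 0 < frac_const n s"
 unfolding frac_const_def by (intro divide_pos_pos mult_pos_pos Gamma_real_pos) auto

lemma AE_lborel_pair_both:
 fixes P :: "'a::euclidean_space \<Rightarrow> bool"
 assumes "AE x in lborel. P x"
 shows "AE p in lborel2. P (fst p) \<and> P (snd p)"
proof -
 obtain N where N: "N \<in> null_sets lborel" "{x. \<not> P x} \<subseteq> N"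
  using assms by (auto elim!: AE_E simp: null_sets_def)
 have "N \<times> UNIV \<in> null_sets (lborel \<Otimes>\<^sub>M (lborel :: 'a measure))" "UNIV \<times> N \<in> null_sets ((lborel :: 'a measure) \<Otimes>\<^sub>M lborel)"
  using N by (auto simp: null_sets_def lborel.emeasure_pair_measure_Times)
 then have "N \<times> UNIV \<union> UNIV \<times> N \<in> null_sets lborel2" by blast
 then show ?thesis by (rule AE_I') (use N in auto)
qed

lemma energy_integrand_eq:
 "energy_integrand s u v p = (u (fst p) - u (snd p)) * (v (fst p) - v (snd p)) * kern s 0 (fst p - snd p)"
 by (simp add: energy_integrand_def kern_def case_prod_unfold)

text \<open>Absorbing the restricted domain into the kernel turns the energy form into a weighted
  L^2 pairing on the whole product space.\<close>

definition eweight :: "real \<Rightarrow> (real^'n) set \<Rightarrow> (real^'n) \<times> (real^'n) \<Rightarrow> real" where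
 "eweight s \<Omega> p = indicator (- ((- \<Omega>) \<times> (- \<Omega>))) p * kern s 0 (fst p - snd p)"

lemma eweight_measurable:
 assumes "open \<Omega>" shows "eweight s \<Omega> \<in> borel_measurable lborel2"
proof -
 have "closed ((- \<Omega>) \<times> (- \<Omega>))" using assms by (intro closed_Times) auto
 then have [measurable]: "- ((- \<Omega>) \<times> (- \<Omega>)) \<in> sets lborel2"
  unfolding lborel_prod by auto
 show ?thesis unfolding eweight_def[abs_def] by measurable
qed

lemma eweight_nonneg: "0 \<le> eweight s \<Omega> p"
 by (simp add: eweight_def kern_nonneg)

lemma energy_space_iff:
 "u \<in> energy_space s \<Omega> \<longleftrightarrow> u \<in> borel_measurable borel \<and> L2 u \<and>
   integrable lborel2 (\<lambda>p. (u (fst p) - u (snd p))\<^sup>2 * eweight s \<Omega> p)"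
proof -
 have "(\<lambda>p. indicator (- ((- \<Omega>) \<times> (- \<Omega>))) p *\<^sub>R energy_integrand s u u p) = (\<lambda>p. (u (fst p) - u (snd p))\<^sup>2 * eweight s \<Omega> p)"
  by (simp add: fun_eq_iff energy_integrand_eq eweight_def power2_eq_square mult_ac)
 then show ?thesis
  by (simp add: energy_space_def L2_fun_def set_integrable_def set_borel_measurable_def lborel_prod)
qed

lemma energy_eq:
 "energy s \<Omega> u v = frac_const CARD('n) s / 2 *
  (\<integral>p. (u (fst p) - u (snd p)) * (v (fst p) - v (snd p)) * eweight s \<Omega> p \<partial>(lborel \<Otimes>\<^sub>M (lborel :: (real^'n) measure)))"
proof -
 have "(\<lambda>p. indicator (- ((- \<Omega>) \<times> (- \<Omega>))) p *\<^sub>R energy_integrand s u v p) = (\<lambda>p. (u (fst p) - u (snd p)) * (v (fst p) - v (snd p)) * eweight s \<Omega> p)"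
  by (simp add: fun_eq_iff energy_integrand_eq eweight_def mult_ac)
 then show ?thesis by (simp add: energy_def set_lebesgue_integral_def lborel_prod)
qed

lemma energy_pair_integrable:
 assumes \<Omega>: "open \<Omega>" and uv: "u \<in> energy_space s \<Omega>" "v \<in> energy_space s \<Omega>"
 shows "integrable lborel2 (\<lambda>p. (u (fst p) - u (snd p)) * (v (fst p) - v (snd p)) * eweight s \<Omega> p)"
proof -
 have [measurable]: "u \<in> borel_measurable borel" "v \<in> borel_measurable borel" using uv by (auto simp: energy_space_iff)
 note [measurable] = eweight_measurable[OF \<Omega>]
 show ?thesis using uv by (intro integrable_mult_weight eweight_nonneg) (auto simp: energy_space_iff)
qed

lemma energy_space_diff:
 assumes \<Omega>: "open \<Omega>" and uv: "u \<in> energy_space s \<Omega>" "v \<in> energy_space s \<Omega>"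
 shows "(\<lambda>x. u x - v x) \<in> energy_space s \<Omega>"
proof -
 have [measurable]: "u \<in> borel_measurable borel" "v \<in> borel_measurable borel" using uv by (auto simp: energy_space_iff)
 have "L1 (\<lambda>x. ((u x)\<^sup>2 + (v x)\<^sup>2) - 2 * (u x * v x))"
  using uv by (intro bochner_integrable_diff bochner_integrable_add integrable_mult_right L2_mult_integrable)
   (auto simp: energy_space_iff)
 moreover have "integrable lborel2 (\<lambda>p. ((u (fst p) - u (snd p))\<^sup>2 * eweight s \<Omega> p + (v (fst p) - v (snd p))\<^sup>2 * eweight s \<Omega> p)
   - 2 * ((u (fst p) - u (snd p)) * (v (fst p) - v (snd p)) * eweight s \<Omega> p))"
  using uv by (intro bochner_integrable_diff bochner_integrable_add integrable_mult_right
    energy_pair_integrable[OF \<Omega> uv]) (auto simp: energy_space_iff)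
 ultimately show ?thesis
  unfolding energy_space_iff by (auto simp: power2_eq_square algebra_simps)
qed

lemma energy_diff:
 assumes \<Omega>: "open \<Omega>" and u: "u \<in> energy_space s \<Omega>" "u' \<in> energy_space s \<Omega>" "v \<in> energy_space s \<Omega>"
 shows "energy s \<Omega> (\<lambda>x. u x - u' x) v = energy s \<Omega> u v - energy s \<Omega> u' v"
proof -
 have "(\<lambda>p. ((u (fst p) - u' (fst p)) - (u (snd p) - u' (snd p))) * (v (fst p) - v (snd p)) * eweight s \<Omega> p)
   = (\<lambda>p. (u (fst p) - u (snd p)) * (v (fst p) - v (snd p)) * eweight s \<Omega> p
     - (u' (fst p) - u' (snd p)) * (v (fst p) - v (snd p)) * eweight s \<Omega> p)"
  by (simp add: fun_eq_iff algebra_simps)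
 then have "(\<integral>p. ((u (fst p) - u' (fst p)) - (u (snd p) - u' (snd p))) * (v (fst p) - v (snd p)) * eweight s \<Omega> p \<partial>lborel2)
   = (\<integral>p. (u (fst p) - u (snd p)) * (v (fst p) - v (snd p)) * eweight s \<Omega> p \<partial>lborel2)
    - (\<integral>p. (u' (fst p) - u' (snd p)) * (v (fst p) - v (snd p)) * eweight s \<Omega> p \<partial>lborel2)"
  by (simp only: bochner_diff[OF energy_pair_integrable[OF \<Omega> u(1,3)] energy_pair_integrable[OF \<Omega> u(2,3)]])
 then show ?thesis unfolding energy_eq by (simp only: right_diff_distrib[of "_ / 2"])
qed

lemma energy_self_nonneg: "0 < s \<Longrightarrow> s < 1 \<Longrightarrow> 0 \<le> energy s \<Omega> u u"
 unfolding energy_eq by (intro mult_nonneg_nonneg integral_nonneg_AE AE_I2 eweight_nonneg zero_le_square divide_nonneg_nonneg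
   less_imp_le[OF frac_const_pos]) auto

lemma bumpd_energy_space:
 assumes s: "0 < s" "s < 1" and \<Omega>: "open \<Omega>" and t: "0 < t"
 shows "bumpd c t \<in> energy_space s \<Omega>"
 unfolding energy_space_iff
proof (intro conjI bumpd_measurable bumpd_sq_integrable t)
 note [measurable] = eweight_measurable[OF \<Omega>]
 show "integrable lborel2 (\<lambda>p. (bumpd c t (fst p) - bumpd c t (snd p))\<^sup>2 * eweight s \<Omega> p)"
 proof (rule bochner_bound[OF bumpd_energy_integrable[OF s t, of c]])
  show "AE p in lborel2. norm ((bumpd c t (fst p) - bumpd c t (snd p))\<^sup>2 * eweight s \<Omega> p)
    \<le> norm (case p of (x, y) \<Rightarrow> (bumpd c t x - bumpd c t y)\<^sup>2 * kern s 0 (x - y))"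
   by (intro AE_I2) (auto simp: eweight_def indicator_def)
 qed measurable
qed

text \<open>Assumption \<open>z\<close> says that the integrand vanishes on the pairs which the
  energy form omits, so the form may be completed to all pairs and integrated by parts. It holds
  when the bump vanishes outside \<Omega>, and also when u vanishes there almost everywhere.\<close>

lemma energy_bumpd:
 fixes u :: "real^'n \<Rightarrow> real"
 assumes s: "0 < s" "s < 1" and \<Omega>: "open \<Omega>" and t: "0 < t" and u: "u \<in> energy_space s \<Omega>"
  and z: "AE p in lborel2. p \<in> (- \<Omega>) \<times> (- \<Omega>) \<longrightarrow>
   (u (fst p) - u (snd p)) * (bumpd c t (fst p) - bumpd c t (snd p)) = 0"
 shows "energy s \<Omega> u (bumpd c t) = frac_const CARD('n) s * t powr (- 2 * s) * (LBINT x. u x * lapb s ((x - c) /\<^sub>R t))"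
proof -
 have [measurable]: "u \<in> borel_measurable borel" using u by (auto simp: energy_space_iff)
 note [measurable] = eweight_measurable[OF \<Omega>]
 have eq: "AE p in lborel2. (u (fst p) - u (snd p)) * (bumpd c t (fst p) - bumpd c t (snd p)) * eweight s \<Omega> p
   = (case p of (x, y) \<Rightarrow> (u x - u y) * (bumpd c t x - bumpd c t y) * kern s 0 (x - y))"
  using z by eventually_elim (auto simp: eweight_def indicator_def case_prod_unfold)
 have "integrable lborel2 (\<lambda>(x, y). (u x - u y) * (bumpd c t x - bumpd c t y) * kern s 0 (x - y))"
  using energy_pair_integrable[OF \<Omega> u bumpd_energy_space[OF s \<Omega> t, of c]]
  by (subst integrable_cong_AE[OF _ _ eq, symmetric]) measurable
 from green_bump[OF s t _ _ this]
 have "(\<integral>p. (case p of (x, y) \<Rightarrow> (u x - u y) * (bumpd c t x - bumpd c t y) * kern s 0 (x - y)) \<partial>lborel2)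
  = 2 * t powr (- 2 * s) * (LBINT x. u x * lapb s ((x - c) /\<^sub>R t))"
  using u by (auto simp: energy_space_iff)
 moreover have "(\<integral>p. (u (fst p) - u (snd p)) * (bumpd c t (fst p) - bumpd c t (snd p)) * eweight s \<Omega> p \<partial>lborel2)
   = (\<integral>p. (case p of (x, y) \<Rightarrow> (u x - u y) * (bumpd c t x - bumpd c t y) * kern s 0 (x - y)) \<partial>lborel2)"
  by (rule integral_cong_AE[OF _ _ eq]) measurable
 ultimately show ?thesis unfolding energy_eq by simp
qed

text \<open>The coefficients are global functions, cut off by indicators beforehand, so that all
  integrals run over the whole space and the interior and exterior terms are treated alike.\<close>

definition wsol :: "real \<Rightarrow> (real^'n) set \<Rightarrow> (real^'n \<Rightarrow> real) \<Rightarrow> (real^'n \<Rightarrow> real) \<Rightarrow> (real^'n \<Rightarrow> real) \<Rightarrow> (real^'n \<Rightarrow> real) \<Rightarrow> bool" where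
 "wsol s \<Omega> Q T F u \<longleftrightarrow> u \<in> energy_space s \<Omega> \<and>
   (\<forall>v\<in>energy_space s \<Omega>. energy s \<Omega> u v + (LBINT x. Q x * u x * v x) + (LBINT x. T x * u x * v x) = (LBINT x. F x * v x))"

lemma robin_weak_solution_wsol:
 "robin_weak_solution s \<Omega> q \<theta> f u \<longleftrightarrow>
  wsol s \<Omega> (\<lambda>x. indicator \<Omega> x * q x) (\<lambda>x. indicator (- \<Omega>) x * \<theta> x) (\<lambda>x. indicator (- \<Omega>) x * f x) u"
 by (simp add: robin_weak_solution_def wsol_def set_lebesgue_integral_def mult.assoc)

lemma bounded_L2_mult_integrable:
 fixes T u v :: "'a \<Rightarrow> real"
 assumes [measurable]: "T \<in> borel_measurable M" "u \<in> borel_measurable M" "v \<in> borel_measurable M"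
  and T: "AE x in M. \<bar>T x\<bar> \<le> B" and uv: "integrable M (\<lambda>x. (u x)\<^sup>2)" "integrable M (\<lambda>x. (v x)\<^sup>2)"
 shows "integrable M (\<lambda>x. T x * u x * v x)"
proof (rule bochner_bound[OF integrable_mult_right[OF L2_mult_integrable[OF assms(2,3) uv], of B]])
 show "AE x in M. norm (T x * u x * v x) \<le> norm (B * (u x * v x))"
  using T
 proof eventually_elim
  case (elim x)
  have "\<bar>T x\<bar> * \<bar>u x * v x\<bar> \<le> \<bar>B\<bar> * \<bar>u x * v x\<bar>" using elim by (intro mult_right_mono) auto
  then show ?case by (simp add: abs_mult mult.assoc)
 qed
qed measurable

text \<open>Testing the difference with itself makes a sum of three nonnegative terms vanish; where
  \<open>Q\<close> or \<open>T\<close> is nonzero, the corresponding term forces the difference to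
  be 0.\<close>

lemma wsol_unique:
 assumes s: "0 < s" "s < 1" and \<Omega>: "open \<Omega>"
  and [measurable]: "Q \<in> borel_measurable borel" "T \<in> borel_measurable borel"
  and B: "AE x in lborel. \<bar>Q x\<bar> \<le> B" "AE x in lborel. \<bar>T x\<bar> \<le> B"
  and nn: "AE x in lborel. 0 \<le> Q x" "AE x in lborel. 0 \<le> T x" and pos: "AE x in lborel. Q x \<noteq> 0 \<or> T x \<noteq> 0"
  and u: "wsol s \<Omega> Q T F u" "wsol s \<Omega> Q T F u'"
 shows "AE x in lborel. u x = u' x"
proof -
 define d where "d x = u x - u' x" for x
 have V: "u \<in> energy_space s \<Omega>" "u' \<in> energy_space s \<Omega>" using u by (auto simp: wsol_def)
 have d: "d \<in> energy_space s \<Omega>" unfolding d_def[abs_def] by (rule energy_space_diff[OF \<Omega> V])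
 have [measurable]: "u \<in> borel_measurable borel" "u' \<in> borel_measurable borel" "d \<in> borel_measurable borel"
  using V d by (auto simp: energy_space_iff)
 have L2: "L2 u" "L2 u'" "L2 d"
  using V d by (auto simp: energy_space_iff)
 have lin: "(LBINT x. W x * u x * d x) - (LBINT x. W x * u' x * d x) = (LBINT x. W x * d x * d x)"
  "L1 (\<lambda>x. W x * d x * d x)"
  if [measurable]: "W \<in> borel_measurable borel" and W: "AE x in lborel. \<bar>W x\<bar> \<le> B" for W
 proof -
  note i = bounded_L2_mult_integrable[OF _ _ _ W]
  show "L1 (\<lambda>x. W x * d x * d x)" by (rule i) (use L2 in auto)
  have "L1 (\<lambda>x. W x * u x * d x)" "L1 (\<lambda>x. W x * u' x * d x)"
   by (rule i; use L2 in auto)+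
  then have "(LBINT x. W x * u x * d x) - (LBINT x. W x * u' x * d x) = (LBINT x. W x * u x * d x - W x * u' x * d x)"
   by simp
  then show "(LBINT x. W x * u x * d x) - (LBINT x. W x * u' x * d x) = (LBINT x. W x * d x * d x)"
   by (simp add: d_def algebra_simps)
 qed
 have "energy s \<Omega> u d + (LBINT x. Q x * u x * d x) + (LBINT x. T x * u x * d x)
   = energy s \<Omega> u' d + (LBINT x. Q x * u' x * d x) + (LBINT x. T x * u' x * d x)"
  using u d by (auto simp: wsol_def)
 then have "energy s \<Omega> d d + (LBINT x. Q x * d x * d x) + (LBINT x. T x * d x * d x) = 0"
  using lin(1)[OF _ B(1)] lin(1)[OF _ B(2)] energy_diff[OF \<Omega> V d] by (simp add: d_def[abs_def, symmetric])
 moreover have nn': "AE x in lborel. 0 \<le> Q x * d x * d x" "AE x in lborel. 0 \<le> T x * d x * d x"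
  using nn by (auto simp: mult.assoc)
 then have "0 \<le> (LBINT x. Q x * d x * d x)" "0 \<le> (LBINT x. T x * d x * d x)"
  by (auto intro: integral_nonneg_AE)
 ultimately have "(LBINT x. Q x * d x * d x) = 0" "(LBINT x. T x * d x * d x) = 0"
  using energy_self_nonneg[OF s, of \<Omega> d] by linarith+
 then have "AE x in lborel. Q x * d x * d x = 0" "AE x in lborel. T x * d x * d x = 0"
  using integral_nonneg_eq_0_iff_AE[OF lin(2)[OF _ B(1)] nn'(1)] integral_nonneg_eq_0_iff_AE[OF lin(2)[OF _ B(2)] nn'(2)] by auto
 with pos show ?thesis by eventually_elim (auto simp: d_def)
qed

text \<open>For a bump supported in \<Omega> the exterior terms drop out and the energy form
  completes to the whole space. This is the equation in \<Omega> with the singular integral moved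
  onto the bump.\<close>

lemma wsol_interior:
 fixes u :: "real^'n \<Rightarrow> real"
 assumes s: "0 < s" "s < 1" and \<Omega>: "open \<Omega>" and t: "0 < t" and c: "cball c t \<subseteq> \<Omega>"
  and TF: "\<And>x. x \<in> \<Omega> \<Longrightarrow> T x = 0" "\<And>x. x \<in> \<Omega> \<Longrightarrow> F x = 0" and u: "wsol s \<Omega> Q T F u"
 shows "frac_const CARD('n) s * t powr (- 2 * s) * (LBINT x. u x * lapb s ((x - c) /\<^sub>R t))
   = - (LBINT x. Q x * u x * bumpd c t x)"
proof -
 have out: "bumpd c t x = 0" if "x \<notin> \<Omega>" for x using that c by (intro bumpd_outside[OF t]) auto
 have TF': "T x * u x * bumpd c t x = 0" "F x * bumpd c t x = 0" for x
  using TF[of x] out[of x] by (cases "x \<in> \<Omega>"; simp)+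
 have "energy s \<Omega> u (bumpd c t) = frac_const CARD('n) s * t powr (- 2 * s) * (LBINT x. u x * lapb s ((x - c) /\<^sub>R t))"
  using u out by (intro energy_bumpd[OF s \<Omega> t] AE_I2) (auto simp: wsol_def)
 moreover have "energy s \<Omega> u (bumpd c t) + (LBINT x. Q x * u x * bumpd c t x) = 0"
  using u bumpd_energy_space[OF s \<Omega> t, of c] unfolding wsol_def by (auto simp: TF')
 ultimately show ?thesis by simp
qed

text \<open>A bump outside \<Omega> never meets the potentials, which may therefore differ, and the
  remaining terms of the two equations agree. The difference of the solutions vanishes a.e. outside
  \<Omega>, so its energy pairing completes to the whole space.\<close>

lemma wsol_exterior:
 fixes u u' :: "real^'n \<Rightarrow> real"
 assumes s: "0 < s" "s < 1" and \<Omega>: "open \<Omega>" and t: "0 < t" and c: "cball c t \<inter> \<Omega> = {}"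
  and Q: "\<And>x. x \<notin> \<Omega> \<Longrightarrow> Q x = 0" "\<And>x. x \<notin> \<Omega> \<Longrightarrow> Q' x = 0"
  and [measurable]: "T \<in> borel_measurable borel"
  and u: "wsol s \<Omega> Q T F u" "wsol s \<Omega> Q' T F u'" and eq: "AE x in lborel. x \<notin> \<Omega> \<longrightarrow> u x = u' x"
 shows "(LBINT x. (u x - u' x) * lapb s ((x - c) /\<^sub>R t)) = 0"
proof -
 have V: "u \<in> energy_space s \<Omega>" "u' \<in> energy_space s \<Omega>" using u by (auto simp: wsol_def)
 have [measurable]: "u \<in> borel_measurable borel" "u' \<in> borel_measurable borel" using V by (auto simp: energy_space_iff)
 note b = bumpd_energy_space[OF s \<Omega> t, of c]
 have out: "bumpd c t x = 0" if "x \<in> \<Omega>" for x using that c by (intro bumpd_outside[OF t]) auto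
 have Q': "Q x * u x * bumpd c t x = 0" "Q' x * u' x * bumpd c t x = 0" for x
  using Q[of x] out[of x] by (cases "x \<in> \<Omega>"; simp)+
 have "(LBINT x. T x * u x * bumpd c t x) = (LBINT x. T x * u' x * bumpd c t x)"
 proof (rule integral_cong_AE)
  show "AE x in lborel. T x * u x * bumpd c t x = T x * u' x * bumpd c t x"
   using eq by eventually_elim (use out in auto)
 qed measurable
 note eqT = this
 have "energy s \<Omega> u (bumpd c t) = energy s \<Omega> u' (bumpd c t)"
 proof -
  have "energy s \<Omega> u (bumpd c t) + (LBINT x. Q x * u x * bumpd c t x) + (LBINT x. T x * u x * bumpd c t x)
    = energy s \<Omega> u' (bumpd c t) + (LBINT x. Q' x * u' x * bumpd c t x) + (LBINT x. T x * u' x * bumpd c t x)"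
   using u b unfolding wsol_def by simp
  with eqT show ?thesis by (simp add: Q')
 qed
 then have "energy s \<Omega> (\<lambda>x. u x - u' x) (bumpd c t) = 0" by (simp add: energy_diff[OF \<Omega> V b])
 moreover have "energy s \<Omega> (\<lambda>x. u x - u' x) (bumpd c t)
   = frac_const CARD('n) s * t powr (- 2 * s) * (LBINT x. (u x - u' x) * lapb s ((x - c) /\<^sub>R t))"
 proof (rule energy_bumpd[OF s \<Omega> t energy_space_diff[OF \<Omega> V]])
  show "AE p in lborel2. p \<in> (- \<Omega>) \<times> (- \<Omega>) \<longrightarrow>
   ((u (fst p) - u' (fst p)) - (u (snd p) - u' (snd p))) * (bumpd c t (fst p) - bumpd c t (snd p)) = 0"
   using AE_lborel_pair_both[OF eq] by eventually_elim (auto simp: mem_Times_iff)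
 qed
 ultimately show ?thesis using frac_const_pos[OF s, of "CARD('n)"] t by simp
qed

lemma wsol_zero_data:
 fixes u :: "real^'n \<Rightarrow> real"
 assumes s: "0 < s" "s < 1" and \<Omega>: "open \<Omega>" and [measurable]: "F \<in> borel_measurable borel"
  and F: "L2 F" and u: "wsol s \<Omega> Q T F u" "AE x in lborel. u x = 0"
 shows "AE x in lborel. F x = 0"
proof (rule AE_zero_of_bump_integrals[OF _ F])
 fix c t assume t: "0 < (t :: real)"
 have "energy s \<Omega> u (bumpd c t) = 0"
 proof -
  have "(\<integral>p. (u (fst p) - u (snd p)) * (bumpd c t (fst p) - bumpd c t (snd p)) * eweight s \<Omega> p \<partial>lborel2) = 0"
   by (rule integral_eq_zero_AE) (use AE_lborel_pair_both[OF u(2)] in \<open>eventually_elim, auto\<close>)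
  then show ?thesis by (simp add: energy_eq)
 qed
 moreover have "(LBINT x. Q x * u x * bumpd c t x) = 0" "(LBINT x. T x * u x * bumpd c t x) = 0"
  by (rule integral_eq_zero_AE, use u(2) in \<open>eventually_elim, auto\<close>)+
 ultimately show "(LBINT x. F x * bumpd c t x) = 0"
  using u(1) bumpd_energy_space[OF s \<Omega> t, of c] unfolding wsol_def by auto
qed measurable

subsection \<open>Unique continuation\<close>

text \<open>The left-hand side is (t + |z|)^(-n-2s). The point is a majorant for rescaled decaying
  functions that does not depend on the scale t.\<close>

lemma kern_le_abs:
 fixes z :: "real^'n"
 assumes s: "0 < s" and t: "0 < t" and z: "z \<noteq> 0"
 shows "t powr - (real CARD('n) + 2 * s) * decay s (z /\<^sub>R t) \<le> kern s 0 z"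
proof -
 let ?a = "real CARD('n) + 2 * s"
 have z: "0 < norm z" using z by simp
 have "t powr - ?a * decay s (z /\<^sub>R t) = (t * (1 + norm z / t)) powr - ?a"
  unfolding decay_def norm_dilate[OF t] using t by (simp add: powr_mult)
 also have "t * (1 + norm z / t) = t + norm z" using t by (simp add: field_simps)
 also have "(t + norm z) powr - ?a \<le> norm z powr - ?a" using t z s by (intro powr_mono2') auto
 also have "\<dots> = kern s 0 z" unfolding kern_def powr_minus_divide by simp
 finally show ?thesis .
qed

text \<open>From |z| \<ge> 2, steps shorter than 1 do not reach the support, so the kernel may be
  cut off at 1. The singularity disappears, and what remains is minus the convolution of the bump
  with the kernel.\<close>

lemma lapb_far:
 fixes z :: "real^'n"
 assumes s: "0 < s" "s < 1" and z: "2 \<le> norm z"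
 shows "lapb s z = - (LBINT v. bump v * kern s 1 (z - v))"
proof -
 have "sdiff bump w z * kern s 0 w = sdiff bump w z * kern s 1 w" for w
 proof (cases "1 \<le> norm w")
  case False
  have "1 \<le> norm (z + w)" "1 \<le> norm (z - w)" "1 \<le> norm z"
   using z False norm_triangle_ineq4[of "z + w" w] norm_triangle_ineq[of "z - w" w] by auto
  then show ?thesis by (simp add: sdiff_def bump_outside)
 qed (simp add: kern_def)
 then have "lapb s z = tlap s 1 bump z" by (simp only: lapb_def tlap_def)
 also have "\<dots> = (LBINT w. (bump z - bump (z + w)) * kern s 1 w)"
 proof (rule tlap_eq[OF s(1)])
  show "L1 (\<lambda>w. bump (z + w) * kern s 1 w)"
  proof (rule bochner_bound[OF kern_integrable[OF s(1), of 1]])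
   show "AE w in lborel. norm (bump (z + w) * kern s 1 w) \<le> norm (kern s 1 (w :: real^'n))"
    by (intro AE_I2) (simp add: abs_mult abs_kern abs_of_nonneg[OF bump_nonneg] mult_left_le_one_le kern_nonneg bump_nonneg bump_le_1)
  qed auto
 qed simp
 also have "\<dots> = (LBINT w. - (bump (z + w) * kern s 1 (z - (z + w))))"
  using z by (simp add: bump_outside kern_minus)
 also have "\<dots> = (LBINT v. - (bump v * kern s 1 (z - v)))"
  by (rule integral_lborel_translate[of "\<lambda>v. - (bump v * kern s 1 (z - v))"])
 finally show ?thesis by simp
qed

lemma kern_isCont:
 assumes "r < norm z" "0 \<le> r"
 shows "isCont (kern s r) z"
proof (rule isCont_cong[THEN iffD2])
 have "\<forall>\<^sub>F w in nhds z. r < norm w"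
  using assms(1) by (intro order_tendstoD(1)[OF tendsto_norm[OF filterlim_ident]])
 then show "\<forall>\<^sub>F w in nhds z. kern s r w = 1 / norm w powr (real CARD('a) + 2 * s)"
  by eventually_elim (simp add: kern_def)
 show "isCont (\<lambda>w. 1 / norm w powr (real CARD('a) + 2 * s)) z"
  using assms by (intro continuous_intros) auto
qed

lemma kern_bounded: "0 < r \<Longrightarrow> 0 < s \<Longrightarrow> \<bar>kern s r z\<bar> \<le> r powr - (real CARD('n) + 2 * s)" for z :: "real^'n"
 unfolding kern_def by (auto simp: powr_minus_divide[symmetric] simp del: minus_add_distrib intro!: powr_mono2')

text \<open>t^(-n-2s) lapb((y - x)/t) is minus the bump-weighted integral of the kernel at scale t,
  and tends to minus the bump mass times |y - x|^(-n-2s) as t tends to 0. Since d vanishes for |y -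
  x| < 2r, the kernel is only evaluated where it is bounded and continuous.\<close>

lemma uc_kernel:
 fixes d :: "real^'n \<Rightarrow> real"
 assumes s: "0 < s" "s < 1" and r: "0 < r"
  and [measurable]: "d \<in> borel_measurable borel" and d: "L2 d"
  and d0: "AE y in lborel. y \<in> ball x (2 * r) \<longrightarrow> d y = 0"
  and L: "\<And>t. 0 < t \<Longrightarrow> t < r \<Longrightarrow> (LBINT y. d y * lapb s ((y - x) /\<^sub>R t)) = 0"
 shows "(LBINT y. d y * kern s r (x - y)) = 0"
proof -
 let ?a = "real CARD('n) + 2 * s" and ?b = "LBINT x::real^'n. bump x"
 obtain C where C: "0 < C" "\<And>x :: real^'n. \<bar>lapb s x\<bar> \<le> C * decay s x" using lapb_decay[OF s] by blast
 \<comment> \<open>Radii at most r/2: for |y - x| \<ge> 2r the point (y - x)/\<open>e k\<close> has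
   norm at least 2, as \<open>lapb_far\<close> requires, and the kernel is evaluated at distance at
   least r, where cutting it off at r changes nothing.\<close>
 define e :: "nat \<Rightarrow> real" where "e k = r / 2 * inverse (real (Suc k))" for k
 have l: "e k \<le> r / 2 * 1" for k unfolding e_def using r by (intro mult_left_mono) (auto simp: inverse_le_1_iff)
 have p: "0 < e k" for k using r by (simp add: e_def)
 have e: "0 < e k" "e k < r" "e k \<le> r" for k using l[of k] p[of k] r by linarith+
 have e0: "e \<longlonglongrightarrow> 0" unfolding e_def using LIMSEQ_inverse_real_of_nat by (intro tendsto_mult_right_zero) simp
 have far: "e k powr - ?a * lapb s ((y - x) /\<^sub>R e k) = - (LBINT v. bump v * kern s r ((x - y) - (- e k) *\<^sub>R v))"
  if y: "2 * r \<le> norm (y - x)" for y k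
 proof -
  have "2 \<le> norm ((y - x) /\<^sub>R e k)" unfolding norm_dilate[OF e(1)] using y e[of k] by (simp add: field_simps)
  then have "e k powr - ?a * lapb s ((y - x) /\<^sub>R e k) = - (LBINT v. bump v * (e k powr - ?a * kern s 1 ((y - x) /\<^sub>R e k - v)))"
   by (simp only: lapb_far[OF s] mult.left_commute[of "bump _"] integral_mult_right_zero mult_minus_right)
  also have "(\<lambda>v. bump v * (e k powr - ?a * kern s 1 ((y - x) /\<^sub>R e k - v))) = (\<lambda>v. bump v * kern s r ((x - y) - (- e k) *\<^sub>R v))"
  proof
   fix v :: "real^'n"
   show "bump v * (e k powr - ?a * kern s 1 ((y - x) /\<^sub>R e k - v)) = bump v * kern s r ((x - y) - (- e k) *\<^sub>R v)"
   proof (cases "norm v < 1")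
    case True
    have eq: "e k *\<^sub>R ((y - x) /\<^sub>R e k - v) = - ((x - y) - (- e k) *\<^sub>R v)"
     using e(1)[of k] by (simp add: algebra_simps)
    have "norm (e k *\<^sub>R v) \<le> r * 1" unfolding norm_scaleR using e[of k] True r by (intro mult_mono) auto
    then have n: "r \<le> norm ((x - y) - (- e k) *\<^sub>R v)"
     using y norm_diff_ineq[of "x - y" "e k *\<^sub>R v"] by (simp add: norm_minus_commute)
    have "e k powr - ?a * kern s 1 ((y - x) /\<^sub>R e k - v) = kern s (e k) (e k *\<^sub>R ((y - x) /\<^sub>R e k - v))"
     using kern_scale[OF e(1)[of k], of s "e k" "(y - x) /\<^sub>R e k - v"] e(1)[of k] by simp
    also have "\<dots> = kern s r ((x - y) - (- e k) *\<^sub>R v)"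
     unfolding eq kern_minus using n e(3)[of k] by (simp add: kern_def)
    finally show ?thesis by simp
   qed (simp add: bump_outside)
  qed
  finally show ?thesis .
 qed
 have "(\<lambda>k. LBINT y. d y * (e k powr - ?a * lapb s ((y - x) /\<^sub>R e k))) \<longlonglongrightarrow> (LBINT y. d y * (- (?b * kern s r (x - y))))"
 proof (rule integral_dominated_convergence[where w="\<lambda>y. C * \<bar>d y * kern s r ((x - y) /\<^sub>R 1)\<bar>"])
  have "kern s r y \<le> (2 / min 1 r) powr ?a * decay s y" for y :: "real^'n"
   using kern_antimono[of "min 1 r" r s y] kern_le_decay[OF s(1), of "min 1 r" y] r by simp
  then show "L1 (\<lambda>y. C * \<bar>d y * kern s r ((x - y) /\<^sub>R 1)\<bar>)"
   by (intro integrable_mult_right integrable_abs L2_decay_integrable[OF s(1) _ _ d]) (auto simp: abs_kern)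
  show "AE y in lborel. norm (d y * (e k powr - ?a * lapb s ((y - x) /\<^sub>R e k))) \<le> C * \<bar>d y * kern s r ((x - y) /\<^sub>R 1)\<bar>" for k
   using d0
  proof eventually_elim
   case (elim y)
   show ?case
   proof (cases "y \<in> ball x (2 * r)")
    case False
    then have y: "2 * r \<le> norm (y - x)" by (simp add: dist_norm norm_minus_commute)
    have "e k powr - ?a * \<bar>lapb s ((y - x) /\<^sub>R e k)\<bar> \<le> e k powr - ?a * (C * decay s ((y - x) /\<^sub>R e k))"
     by (intro mult_left_mono C) simp
    also have "\<dots> = C * (e k powr - ?a * decay s ((y - x) /\<^sub>R e k))" by simp
    also have "\<dots> \<le> C * kern s 0 (y - x)"
     using C(1) y r by (intro mult_left_mono kern_le_abs[OF s(1) e(1)]) auto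
    also have "kern s 0 (y - x) = kern s r (x - y)" using y r by (simp add: kern_def norm_minus_commute)
    finally have "\<bar>d y\<bar> * (e k powr - ?a * \<bar>lapb s ((y - x) /\<^sub>R e k)\<bar>) \<le> \<bar>d y\<bar> * (C * kern s r (x - y))"
     by (intro mult_left_mono) auto
    then show ?thesis by (simp add: abs_mult abs_kern mult_ac)
   qed (use elim in simp)
  qed
  show "AE y in lborel. (\<lambda>k. d y * (e k powr - ?a * lapb s ((y - x) /\<^sub>R e k))) \<longlonglongrightarrow> d y * (- (?b * kern s r (x - y)))"
   using d0
  proof eventually_elim
   case (elim y)
   show ?case
   proof (cases "y \<in> ball x (2 * r)")
    case False
    then have y: "2 * r \<le> norm (y - x)" by (simp add: dist_norm norm_minus_commute)
    have "(\<lambda>k. - e k) \<longlonglongrightarrow> 0" using tendsto_minus[OF e0] by simp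
    then have "(\<lambda>k. LBINT v. bump v * kern s r ((x - y) - (- e k) *\<^sub>R v)) \<longlonglongrightarrow> ?b * kern s r (x - y)"
     using y r by (intro approximate_identity[OF bump_integrable _ kern_bounded[OF r s(1)] kern_isCont])
      (auto simp: norm_minus_commute)
    then show ?thesis unfolding far[OF y] by (intro tendsto_intros)
   qed (use elim in simp)
  qed
 qed measurable
 moreover have "(LBINT y. d y * (e k powr - ?a * lapb s ((y - x) /\<^sub>R e k))) = 0" for k
  by (simp only: mult.left_commute[of "d _"] integral_mult_right_zero L[OF e(1,2)] mult_zero_right)
 ultimately have "(LBINT y. d y * (- (?b * kern s r (x - y)))) = 0"
  by (simp add: LIMSEQ_const_iff)
 moreover have "(LBINT y. d y * (- (?b * kern s r (x - y)))) = (- ?b) * (LBINT y. d y * kern s r (x - y))"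
  by (simp only: mult_minus_left[symmetric] mult.left_commute[of "d _"] integral_mult_right_zero)
 ultimately show ?thesis using bump_integral_pos[where 'n='n] by simp
qed

section \<open>Unique continuation: from the kernel to its raised powers\<close>

lemma second_difference_limit:
 fixes f f' f'' :: "real \<Rightarrow> real"
 assumes R: "0 < R" and f: "\<And>t. \<bar>t\<bar> \<le> R \<Longrightarrow> (f has_real_derivative f' t) (at t)"
  and f': "\<And>t. \<bar>t\<bar> \<le> R \<Longrightarrow> (f' has_real_derivative f'' t) (at t)"
  and c: "isCont f'' 0" and h: "\<And>k. 0 < h k" "h \<longlonglongrightarrow> 0"
 shows "(\<lambda>k. (f (h k) + f (- h k) - 2 * f 0) / (h k)\<^sup>2) \<longlonglongrightarrow> f'' 0"
proof (rule LIMSEQ_I)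
 fix \<epsilon> :: real assume \<epsilon>: "0 < \<epsilon>"
 obtain \<delta> where \<delta>: "0 < \<delta>" "\<And>t. \<bar>t\<bar> < \<delta> \<Longrightarrow> \<bar>f'' t - f'' 0\<bar> < \<epsilon> / 4"
  using c[unfolded continuous_at_eps_delta, rule_format, of "\<epsilon> / 4"] \<epsilon> by (auto simp: dist_real_def)
 have "\<forall>\<^sub>F k in sequentially. h k < min \<delta> R" using h(2) \<delta> R by (intro order_tendstoD) auto
 then obtain N where N: "\<And>k. N \<le> k \<Longrightarrow> h k < min \<delta> R" by (auto simp: eventually_sequentially)
 have "norm ((f (h k) + f (- h k) - 2 * f 0) / (h k)\<^sup>2 - f'' 0) < \<epsilon>" if "N \<le> k" for k
 proof -
  \<comment> \<open>Removing the quadratic part leaves a function whose second derivative is at most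
    \<epsilon>/4 near 0, to which \<open>second_difference_bound\<close> applies.\<close>
  let ?h = "h k" and ?g = "\<lambda>t. f t - f'' 0 * (t\<^sup>2 / 2)"
  have "\<bar>?g ?h + ?g (- ?h) - 2 * ?g 0\<bar> \<le> 2 * (\<epsilon> / 4) * ?h\<^sup>2"
  proof (rule second_difference_bound)
   fix t assume t: "\<bar>t\<bar> \<le> ?h"
   then have "\<bar>t\<bar> \<le> R" "\<bar>t\<bar> < \<delta>" using N[OF that] by auto
   show "(?g has_real_derivative f' t - f'' 0 * t) (at t)"
    using f[OF \<open>\<bar>t\<bar> \<le> R\<close>] by (auto intro!: derivative_eq_intros)
   show "((\<lambda>t. f' t - f'' 0 * t) has_real_derivative f'' t - f'' 0) (at t)"
    using f'[OF \<open>\<bar>t\<bar> \<le> R\<close>] by (auto intro!: derivative_eq_intros)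
   show "\<bar>f'' t - f'' 0\<bar> \<le> \<epsilon> / 4" using \<delta>(2)[OF \<open>\<bar>t\<bar> < \<delta>\<close>] by simp
  qed (use h(1)[of k] in simp)
  then have "\<bar>(f ?h + f (- ?h) - 2 * f 0) - f'' 0 * ?h\<^sup>2\<bar> \<le> \<epsilon> / 2 * ?h\<^sup>2"
   by (simp add: algebra_simps)
  moreover have "(f ?h + f (- ?h) - 2 * f 0) / ?h\<^sup>2 - f'' 0 = ((f ?h + f (- ?h) - 2 * f 0) - f'' 0 * ?h\<^sup>2) / ?h\<^sup>2"
   using h(1)[of k] by (simp add: diff_divide_distrib)
  ultimately have "\<bar>(f ?h + f (- ?h) - 2 * f 0) / ?h\<^sup>2 - f'' 0\<bar> \<le> \<epsilon> / 2"
   using h(1)[of k] by (simp add: abs_divide divide_le_eq)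
  then show ?thesis using \<epsilon> by simp
 qed
 then show "\<exists>N. \<forall>k\<ge>N. norm ((f (h k) + f (- h k) - 2 * f 0) / (h k)\<^sup>2 - f'' 0) < \<epsilon>" by blast
qed

text \<open>|z|^(-b), written through \<open>z \<bullet> z\<close> because this is a polynomial
  along lines; the chain rule then gives \<open>npow1\<close> and \<open>npow2\<close>, the first
  and second derivatives in direction v.\<close>

definition npow :: "real \<Rightarrow> real^'n \<Rightarrow> real" where "npow b z = (z \<bullet> z) powr (- b / 2)"

lemma npow_measurable [measurable (raw)]:
 assumes [measurable]: "g \<in> borel_measurable M"
 shows "(\<lambda>x. npow b (g x :: real^'n)) \<in> borel_measurable M"
 unfolding npow_def by measurable

lemma npow_norm: "z \<noteq> 0 \<Longrightarrow> npow b z = norm z powr (- b)"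
proof -
 assume "z \<noteq> 0"
 then have "z \<bullet> z = norm z powr 2" by (simp add: power2_norm_eq_inner)
 then show ?thesis unfolding npow_def by (simp only: powr_powr) simp
qed

definition npow1 :: "real \<Rightarrow> real^'n \<Rightarrow> real^'n \<Rightarrow> real" where
 "npow1 b v z = - b * (z \<bullet> v) * npow (b + 2) z"

definition npow2 :: "real \<Rightarrow> real^'n \<Rightarrow> real^'n \<Rightarrow> real" where
 "npow2 b v z = b * (b + 2) * (z \<bullet> v)\<^sup>2 * npow (b + 4) z - b * (v \<bullet> v) * npow (b + 2) z"

lemma npow_line_deriv:
 assumes "x + t *\<^sub>R v \<noteq> 0"
 shows "((\<lambda>t. npow b (x + t *\<^sub>R v)) has_real_derivative npow1 b v (x + t *\<^sub>R v)) (at t)"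
proof -
 have pos: "0 < (x + t *\<^sub>R v) \<bullet> (x + t *\<^sub>R v)" using assms by simp
 have "((\<lambda>t. (x + t *\<^sub>R v) \<bullet> (x + t *\<^sub>R v)) has_real_derivative 2 * ((x + t *\<^sub>R v) \<bullet> v)) (at t)"
  using DERIV_diff[OF DERIV_const[of 1] norm_sq_line_deriv[of x v t]] by (simp add: power2_norm_eq_inner)
 note ch = DERIV_chain'[OF this has_real_derivative_powr[OF pos, of "- b / 2"]]
 have "- b / 2 - 1 = - (b + 2) / 2" by (simp add: field_simps)
 note e = this
 show ?thesis unfolding npow_def npow1_def by (rule DERIV_cong[OF ch]) (simp only: e, simp)
qed

lemma npow1_line_deriv:
 assumes "x + t *\<^sub>R v \<noteq> 0"
 shows "((\<lambda>t. npow1 b v (x + t *\<^sub>R v)) has_real_derivative npow2 b v (x + t *\<^sub>R v)) (at t)"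
proof -
 have "((\<lambda>t. - b * ((x + t *\<^sub>R v) \<bullet> v) * npow (b + 2) (x + t *\<^sub>R v)) has_real_derivative
   (- b * (v \<bullet> v)) * npow (b + 2) (x + t *\<^sub>R v) + npow1 (b + 2) v (x + t *\<^sub>R v) * (- b * ((x + t *\<^sub>R v) \<bullet> v))) (at t)"
  by (intro DERIV_mult DERIV_cmult inner_line_deriv npow_line_deriv assms)
 moreover have "b + 2 + 2 = b + 4" by simp
 ultimately show ?thesis unfolding npow1_def npow2_def by (simp add: power2_eq_square algebra_simps)
qed

lemma npow2_bound:
 assumes b: "0 \<le> b" and z: "z \<noteq> 0" and v: "norm v = 1"
 shows "\<bar>npow2 b v z\<bar> \<le> b * (b + 3) * norm z powr (- b - 2)"
proof -
 have nz: "0 < norm z" using z by simp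
 have "(z \<bullet> v)\<^sup>2 \<le> (norm z)\<^sup>2"
  using Cauchy_Schwarz_ineq2[of z v] v by (intro abs_le_square_iff[THEN iffD1]) simp
 then have "(z \<bullet> v)\<^sup>2 * npow (b + 4) z \<le> (norm z)\<^sup>2 * npow (b + 4) z"
  by (intro mult_right_mono) (auto simp: npow_def)
 also have "\<dots> = norm z powr 2 * norm z powr (- (b + 4))" using nz by (simp add: npow_norm[OF z])
 also have "\<dots> = norm z powr (- b - 2)" by (simp only: powr_add[symmetric]) (simp add: algebra_simps)
 finally have 1: "(z \<bullet> v)\<^sup>2 * npow (b + 4) z \<le> norm z powr (- b - 2)" .
 have 2: "npow (b + 2) z = norm z powr (- b - 2)" by (simp add: npow_norm[OF z])
 have vv: "v \<bullet> v = 1" using v by (simp add: dot_square_norm)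
 have "\<bar>b * (b + 2) * ((z \<bullet> v)\<^sup>2 * npow (b + 4) z)\<bar> \<le> b * (b + 2) * norm z powr (- b - 2)"
  using b 1 by (simp add: abs_mult mult_left_mono npow_def)
 moreover have "\<bar>b * norm z powr (- b - 2)\<bar> = b * norm z powr (- b - 2)" using b by simp
 moreover have "npow2 b v z = b * (b + 2) * ((z \<bullet> v)\<^sup>2 * npow (b + 4) z) - b * norm z powr (- b - 2)"
  unfolding npow2_def vv 2 by simp
 moreover have "b * (b + 3) * norm z powr (- b - 2) = b * (b + 2) * norm z powr (- b - 2) + b * norm z powr (- b - 2)"
  by algebra
 ultimately show ?thesis by linarith
qed

text \<open>Away from the origin \<open>\<Delta>|z|^(-b) = b (b + 2 - n) |z|^(-b-2)\<close>, and the factor does not vanish for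
 \<open>b > n\<close>; so the exponent can be raised by \<open>2\<close> indefinitely.\<close>

lemma uc_raise_power:
 fixes d :: "real^'n \<Rightarrow> real"
 assumes r: "0 < r" and b: "real CARD('n) < b"
  and [measurable]: "d \<in> borel_measurable borel"
  and d: "L1 (\<lambda>y. d y * npow b (y - x))"
  and d0: "AE y in lborel. y \<in> ball x (2 * r) \<longrightarrow> d y = 0"
  and Z: "\<And>x'. x' \<in> ball x r \<Longrightarrow> (LBINT y. d y * npow b (y - x')) = 0"
  and I: "\<And>x'. x' \<in> ball x r \<Longrightarrow> L1 (\<lambda>y. d y * npow b (y - x'))"
 shows "(LBINT y. d y * npow (b + 2) (y - x)) = 0"
proof -
 define h :: "nat \<Rightarrow> real" where "h k = r / 2 * inverse (real (Suc k))" for k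
 have l: "h k \<le> r / 2 * 1" for k unfolding h_def using r by (intro mult_left_mono) (auto simp: inverse_le_1_iff)
 have p: "0 < h k" for k using r by (simp add: h_def)
 have h: "0 < h k" "h k < r" for k using l[of k] p[of k] r by linarith+
 have h0: "h \<longlonglongrightarrow> 0" unfolding h_def using LIMSEQ_inverse_real_of_nat by (intro tendsto_mult_right_zero) simp
 \<comment> \<open>The discrete Laplacian of |y - x|^(-b) with step \<open>h k\<close>. Its pairing
   with d is a combination of pairings centred at x and at the neighbours of x along the axes, all
   of which vanish; in the limit it becomes the pairing with the Laplacian.\<close>
 define D where "D k y = (\<Sum>v\<in>Basis. (npow b ((y - x) + h k *\<^sub>R v) + npow b ((y - x) - h k *\<^sub>R v) - 2 * npow b (y - x)) / (h k)\<^sup>2)" for k and y :: "real^'n"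
 have b0: "0 \<le> b" using b by (rule order_trans[OF _ less_imp_le, rotated]) simp
 have ne: "(y - x) + t *\<^sub>R v \<noteq> 0" "norm (y - x) \<le> 2 * norm ((y - x) + t *\<^sub>R v)"
  if "2 * r \<le> norm (y - x)" "\<bar>t\<bar> \<le> r" "v \<in> Basis" for y t and v :: "real^'n"
 proof -
  have "norm (t *\<^sub>R v) \<le> r" using that by simp
  then show "norm (y - x) \<le> 2 * norm ((y - x) + t *\<^sub>R v)"
   using norm_diff_ineq[of "y - x" "t *\<^sub>R v"] that(1) by simp
  then show "(y - x) + t *\<^sub>R v \<noteq> 0" using that(1) r by auto
 qed
 have zero: "(LBINT y. d y * D k y) = 0" for k
 proof -
  have xin: "x + h k *\<^sub>R v \<in> ball x r" "x - h k *\<^sub>R v \<in> ball x r" "x \<in> ball x r" if "v \<in> Basis" for v :: "real^'n"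
   using that h[of k] r by (auto simp: dist_norm)
  have i: "L1 (\<lambda>y. d y * npow b ((y - x) - h k *\<^sub>R v))" "(LBINT y. d y * npow b ((y - x) - h k *\<^sub>R v)) = 0"
   "L1 (\<lambda>y. d y * npow b ((y - x) + h k *\<^sub>R v))" "(LBINT y. d y * npow b ((y - x) + h k *\<^sub>R v)) = 0"
   if "v \<in> Basis" for v
   using I[OF xin(1)[OF that]] Z[OF xin(1)[OF that]] I[OF xin(2)[OF that]] Z[OF xin(2)[OF that]] by (simp_all add: algebra_simps)
  have j: "has_bochner_integral lborel (\<lambda>y. d y * npow b ((y - x) + h k *\<^sub>R v) + d y * npow b ((y - x) - h k *\<^sub>R v) - 2 * (d y * npow b (y - x))) (0 + 0 - 2 * 0)"
   if "v \<in> Basis" for v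
   using i[OF that] d Z[OF xin(3)[OF that]]
   by (intro has_bochner_integral_add has_bochner_integral_diff has_bochner_integral_mult_right) (auto simp: has_bochner_integral_iff)
  have "has_bochner_integral lborel (\<lambda>y. \<Sum>v\<in>Basis. inverse ((h k)\<^sup>2) * (d y * npow b ((y - x) + h k *\<^sub>R v) + d y * npow b ((y - x) - h k *\<^sub>R v) - 2 * (d y * npow b (y - x)))) (\<Sum>v\<in>(Basis :: (real^'n) set). inverse ((h k)\<^sup>2) * (0 + 0 - 2 * 0))"
   by (intro has_bochner_integral_sum has_bochner_integral_mult_right j)
  moreover have "d y * D k y = (\<Sum>v\<in>Basis. inverse ((h k)\<^sup>2) * (d y * npow b ((y - x) + h k *\<^sub>R v) + d y * npow b ((y - x) - h k *\<^sub>R v) - 2 * (d y * npow b (y - x))))" for y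
   unfolding D_def sum_distrib_left by (intro sum.cong) (auto simp: field_simps)
  ultimately show ?thesis by (simp add: has_bochner_integral_iff)
 qed
 let ?K = "b * (b + 2 - real CARD('n))"
 have "(\<lambda>k. LBINT y. d y * D k y) \<longlonglongrightarrow> (LBINT y. d y * (?K * npow (b + 2) (y - x)))"
 proof (rule integral_dominated_convergence[where w="\<lambda>y. real CARD('n) * (2 * (b * (b + 3) * (2 powr (b + 2) * r powr - 2))) * \<bar>d y * npow b (y - x)\<bar>"])
  show "L1 (\<lambda>y. real CARD('n) * (2 * (b * (b + 3) * (2 powr (b + 2) * r powr - 2))) * \<bar>d y * npow b (y - x)\<bar>)"
   by (intro integrable_mult_right integrable_abs d)
  show "AE y in lborel. norm (d y * D k y) \<le> real CARD('n) * (2 * (b * (b + 3) * (2 powr (b + 2) * r powr - 2))) * \<bar>d y * npow b (y - x)\<bar>" for k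
   using d0
  proof eventually_elim
   case (elim y)
   show ?case
   proof (cases "y \<in> ball x (2 * r)")
    case False
    then have y: "2 * r \<le> norm (y - x)" by (simp add: dist_norm norm_minus_commute)
    then have y0: "y - x \<noteq> 0" "0 < norm (y - x)" using r by auto
    let ?M = "b * (b + 3) * (2 powr (b + 2) * r powr - 2 * npow b (y - x))"
    have bd: "\<bar>npow2 b v ((y - x) + t *\<^sub>R v)\<bar> \<le> ?M" if "\<bar>t\<bar> \<le> h k" and v: "v \<in> Basis" for t v
    proof -
     have t: "\<bar>t\<bar> \<le> r" using that h(2)[of k] by simp
     have "\<bar>npow2 b v ((y - x) + t *\<^sub>R v)\<bar> \<le> b * (b + 3) * norm ((y - x) + t *\<^sub>R v) powr (- b - 2)"
      using v by (intro npow2_bound b0 ne(1)[OF y t v]) auto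
     also have "\<dots> \<le> b * (b + 3) * (norm (y - x) / 2) powr (- b - 2)"
      using ne(2)[OF y t v] y0 b0 by (intro mult_left_mono powr_mono2') auto
     also have "(norm (y - x) / 2) powr (- b - 2) = 2 powr (b + 2) * (norm (y - x) powr - b * norm (y - x) powr - 2)"
     proof -
      have "(norm (y - x) / 2) powr (- b - 2) = norm (y - x) powr (- b + - 2) / 2 powr (- (b + 2))"
       using y0 by (simp add: powr_divide)
      then show ?thesis by (simp only: powr_add powr_minus_divide[of 2]) simp
     qed
     also have "b * (b + 3) * \<dots> \<le> b * (b + 3) * (2 powr (b + 2) * (norm (y - x) powr - b * r powr - 2))"
      using y r b0 by (intro mult_left_mono powr_mono2') auto
     finally show ?thesis by (simp add: npow_norm[OF y0(1)] mult_ac)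
    qed
    have "\<bar>D k y\<bar> \<le> (\<Sum>v\<in>(Basis :: (real^'n) set). 2 * ?M)"
     unfolding D_def
    proof (rule order_trans[OF sum_abs sum_mono])
     fix v :: "real^'n" assume v: "v \<in> Basis"
     have "\<bar>npow b ((y - x) + h k *\<^sub>R v) + npow b ((y - x) + (- h k) *\<^sub>R v) - 2 * npow b ((y - x) + 0 *\<^sub>R v)\<bar> \<le> 2 * ?M * (h k)\<^sup>2"
     proof (rule second_difference_bound[where f'="\<lambda>t. npow1 b v ((y - x) + t *\<^sub>R v)" and f''="\<lambda>t. npow2 b v ((y - x) + t *\<^sub>R v)"])
      fix t assume t: "\<bar>t\<bar> \<le> h k"
      then have t': "\<bar>t\<bar> \<le> r" using h(2)[of k] by simp
      note ne(1)[OF y t' v]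
      then show "((\<lambda>t. npow b ((y - x) + t *\<^sub>R v)) has_real_derivative npow1 b v ((y - x) + t *\<^sub>R v)) (at t)"
       "((\<lambda>t. npow1 b v ((y - x) + t *\<^sub>R v)) has_real_derivative npow2 b v ((y - x) + t *\<^sub>R v)) (at t)"
       by (rule npow_line_deriv npow1_line_deriv)+
     qed (use bd v h(1)[of k] in auto)
     then show "\<bar>(npow b ((y - x) + h k *\<^sub>R v) + npow b ((y - x) - h k *\<^sub>R v) - 2 * npow b (y - x)) / (h k)\<^sup>2\<bar> \<le> 2 * ?M"
      using h(1)[of k] by (simp add: abs_divide divide_le_eq)
    qed
    then have "\<bar>d y\<bar> * \<bar>D k y\<bar> \<le> \<bar>d y\<bar> * (real CARD('n) * (2 * ?M))" by (intro mult_left_mono) auto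
    moreover have "0 \<le> npow b (y - x)" by (simp add: npow_def)
    ultimately show ?thesis by (simp add: abs_mult mult_ac)
   qed (use elim in simp)
  qed
  show "AE y in lborel. (\<lambda>k. d y * D k y) \<longlonglongrightarrow> d y * (?K * npow (b + 2) (y - x))"
   using d0
  proof eventually_elim
   case (elim y)
   show ?case
   proof (cases "y \<in> ball x (2 * r)")
    case False
    then have y: "2 * r \<le> norm (y - x)" by (simp add: dist_norm norm_minus_commute)
    then have y0: "y - x \<noteq> 0" "0 < norm (y - x)" using r by auto
    have "(\<lambda>k. D k y) \<longlonglongrightarrow> (\<Sum>v\<in>Basis. npow2 b v (y - x))"
     unfolding D_def
    proof (intro tendsto_sum)
     fix v :: "real^'n" assume v: "v \<in> Basis"
     have "(\<lambda>k. (npow b ((y - x) + h k *\<^sub>R v) + npow b ((y - x) + (- h k) *\<^sub>R v) - 2 * npow b ((y - x) + 0 *\<^sub>R v)) / (h k)\<^sup>2) \<longlonglongrightarrow> npow2 b v ((y - x) + 0 *\<^sub>R v)"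
     proof (rule second_difference_limit[OF r _ _ _ h(1) h0, where f'="\<lambda>t. npow1 b v ((y - x) + t *\<^sub>R v)" and f''="\<lambda>t. npow2 b v ((y - x) + t *\<^sub>R v)"])
      show "isCont (\<lambda>t. npow2 b v ((y - x) + t *\<^sub>R v)) 0"
       unfolding npow2_def npow_def using y0 by (intro continuous_intros) auto
      fix t assume t: "\<bar>t\<bar> \<le> r"
      note ne(1)[OF y t v]
      then show "((\<lambda>t. npow b ((y - x) + t *\<^sub>R v)) has_real_derivative npow1 b v ((y - x) + t *\<^sub>R v)) (at t)"
       "((\<lambda>t. npow1 b v ((y - x) + t *\<^sub>R v)) has_real_derivative npow2 b v ((y - x) + t *\<^sub>R v)) (at t)"
       by (rule npow_line_deriv npow1_line_deriv)+
     qed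
     then show "(\<lambda>k. (npow b ((y - x) + h k *\<^sub>R v) + npow b ((y - x) - h k *\<^sub>R v) - 2 * npow b (y - x)) / (h k)\<^sup>2) \<longlonglongrightarrow> npow2 b v (y - x)"
      by simp
    qed
    also have "(\<Sum>v\<in>Basis. npow2 b v (y - x)) = ?K * npow (b + 2) (y - x)"
    proof -
     have "(\<Sum>v\<in>Basis. npow2 b v (y - x)) = (\<Sum>v\<in>Basis. b * (b + 2) * npow (b + 4) (y - x) * ((y - x) \<bullet> v)\<^sup>2 - b * npow (b + 2) (y - x))"
      by (intro sum.cong) (auto simp: npow2_def)
     also have "\<dots> = b * (b + 2) * npow (b + 4) (y - x) * (\<Sum>v\<in>Basis. ((y - x) \<bullet> v)\<^sup>2) - real CARD('n) * (b * npow (b + 2) (y - x))"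
      by (simp add: sum_subtractf sum_distrib_left)
     also have "(\<Sum>v\<in>Basis. ((y - x) \<bullet> v)\<^sup>2) = (norm (y - x))\<^sup>2"
      unfolding power2_norm_eq_inner by (subst euclidean_inner) (simp add: power2_eq_square)
     also have "b * (b + 2) * npow (b + 4) (y - x) * (norm (y - x))\<^sup>2 = b * (b + 2) * npow (b + 2) (y - x)"
     proof -
      have "npow (b + 4) (y - x) * (norm (y - x))\<^sup>2 = norm (y - x) powr (- (b + 4)) * norm (y - x) powr 2"
       using y0 by (simp add: npow_norm)
      also have "\<dots> = norm (y - x) powr (- (b + 2))"
       by (simp only: powr_add[symmetric]) (simp add: algebra_simps)
      finally show ?thesis by (simp add: npow_norm[OF y0(1)] mult.assoc)
     qed
     finally show ?thesis by (simp add: algebra_simps)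
    qed
    finally show ?thesis by (intro tendsto_intros)
   qed (use elim in simp)
  qed
  show "(\<lambda>y. d y * D k y) \<in> borel_measurable lborel" for k unfolding D_def by measurable
 qed measurable
 then have "(LBINT y. d y * (?K * npow (b + 2) (y - x))) = 0"
  by (simp add: zero LIMSEQ_const_iff)
 moreover have "(LBINT y. d y * (?K * npow (b + 2) (y - x))) = ?K * (LBINT y. d y * npow (b + 2) (y - x))"
  by (simp only: mult.left_commute[of "d _"] integral_mult_right_zero)
 moreover have "?K \<noteq> 0" using b b0 by (auto simp: not_less)
 ultimately show ?thesis by simp
qed

text \<open>The induction runs over all centres in the ball at once, since raising the exponent at x
  uses the vanishing at neighbouring centres. Integrability is carried along: where d is nonzero, |y
  - x| \<ge> 2r bounds each power by a multiple of the previous one.\<close>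

lemma uc_all_powers:
 fixes d :: "real^'n \<Rightarrow> real"
 assumes s: "0 < s" "s < 1" and r: "0 < r"
  and [measurable]: "d \<in> borel_measurable borel" and d: "L2 d"
  and d0: "AE y in lborel. y \<in> ball x0 (3 * r) \<longrightarrow> d y = 0"
  and L: "\<And>x t. x \<in> ball x0 r \<Longrightarrow> 0 < t \<Longrightarrow> t < r \<Longrightarrow> (LBINT y. d y * lapb s ((y - x) /\<^sub>R t)) = 0"
  and x: "x \<in> ball x0 r"
 shows "L1 (\<lambda>y. d y * npow (real CARD('n) + 2 * s + 2 * real k) (y - x))
  \<and> (LBINT y. d y * npow (real CARD('n) + 2 * s + 2 * real k) (y - x)) = 0"
 using x
proof (induction k arbitrary: x)
 have d0': "AE y in lborel. y \<in> ball x (2 * r) \<longrightarrow> d y = 0" if "x \<in> ball x0 r" for x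
  using d0
 proof eventually_elim
  case (elim y)
  have "y \<in> ball x0 (3 * r)" if "y \<in> ball x (2 * r)"
   using that \<open>x \<in> ball x0 r\<close> dist_triangle[of x0 y x] by (simp add: dist_commute)
  then show ?case using elim by blast
 qed
 {
  case 0
  have eq: "AE y in lborel. d y * kern s r (x - y) = d y * npow (real CARD('n) + 2 * s) (y - x)"
   using d0'[OF 0]
  proof eventually_elim
   case (elim y)
   show ?case
   proof (cases "y \<in> ball x (2 * r)")
    case False
    then have "2 * r \<le> norm (y - x)" by (simp add: dist_norm norm_minus_commute)
    moreover from this have "y - x \<noteq> 0" using r by auto
    ultimately show ?thesis using r
     by (simp add: npow_norm kern_def norm_minus_commute powr_minus_divide del: minus_add_distrib)
   qed (use elim in simp)
  qed
  have "kern s r y \<le> (2 / min 1 r) powr (real CARD('n) + 2 * s) * decay s y" for y :: "real^'n"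
   using kern_antimono[of "min 1 r" r s y] kern_le_decay[OF s(1), of "min 1 r" y] r by simp
  then have "L1 (\<lambda>y. d y * kern s r ((x - y) /\<^sub>R 1))"
   by (intro L2_decay_integrable[OF s(1) _ _ d]) (auto simp: abs_kern)
  then have "L1 (\<lambda>y. d y * npow (real CARD('n) + 2 * s) (y - x))"
   by (subst integrable_cong_AE[OF _ _ eq, symmetric]) auto
  moreover have "(LBINT y. d y * kern s r (x - y)) = 0"
   using L[OF 0] by (intro uc_kernel[OF s r _ d d0'[OF 0]]) auto
  then have "(LBINT y. d y * npow (real CARD('n) + 2 * s) (y - x)) = 0"
   by (subst integral_cong_AE[OF _ _ eq, symmetric]) auto
  ultimately show ?case by simp
 next
  case (Suc k)
  let ?b = "real CARD('n) + 2 * s + 2 * real k"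
  have b2: "real CARD('n) + 2 * s + 2 * real (Suc k) = ?b + 2" by simp
  \<comment> \<open>The largest radius for which every centre near x is still covered by the
    induction hypothesis.\<close>
  define r' where "r' = r - dist x0 x"
  have r': "0 < r'" "r' \<le> r" using Suc.prems by (auto simp: r'_def)
  have sub: "ball x r' \<subseteq> ball x0 r"
  proof
   fix y assume "y \<in> ball x r'"
   then show "y \<in> ball x0 r" using dist_triangle[of x0 y x] by (simp add: r'_def)
  qed
  have "L1 (\<lambda>y. (1 / (2 * r)\<^sup>2) * (d y * npow ?b (y - x)))"
   by (intro integrable_mult_right) (use Suc in auto)
  then have "L1 (\<lambda>y. d y * npow (?b + 2) (y - x))"
  proof (rule bochner_bound)
   show "AE y in lborel. norm (d y * npow (?b + 2) (y - x)) \<le> norm ((1 / (2 * r)\<^sup>2) * (d y * npow ?b (y - x)))"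
    using d0'[OF Suc.prems]
   proof eventually_elim
    case (elim y)
    show ?case
    proof (cases "y \<in> ball x (2 * r)")
     case False
     then have y: "2 * r \<le> norm (y - x)" by (simp add: dist_norm norm_minus_commute)
     then have y0: "y - x \<noteq> 0" "0 < norm (y - x)" using r by auto
     have "npow (?b + 2) (y - x) = npow ?b (y - x) * (1 / (norm (y - x))\<^sup>2)"
     proof -
      have "- (?b + 2) = - ?b + - 2" by simp
      then have "npow (?b + 2) (y - x) = npow ?b (y - x) * norm (y - x) powr - 2"
       unfolding npow_norm[OF y0(1)] by (simp only: powr_add)
      then show ?thesis using y0 by (simp add: powr_minus_divide)
     qed
     also have "\<dots> \<le> npow ?b (y - x) * (1 / (2 * r)\<^sup>2)"
      using y r y0 by (intro mult_left_mono divide_left_mono power_mono) (auto simp: npow_def)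
     finally have "\<bar>d y\<bar> * npow (?b + 2) (y - x) \<le> \<bar>d y\<bar> * (npow ?b (y - x) * (1 / (2 * r)\<^sup>2))"
      by (intro mult_left_mono) auto
     moreover have "0 \<le> npow ?b (y - x)" "0 \<le> npow (?b + 2) (y - x)" by (auto simp: npow_def)
     ultimately show ?thesis by (simp add: abs_mult)
    qed (use elim in simp)
   qed
  qed measurable
  moreover have "(LBINT y. d y * npow (?b + 2) (y - x)) = 0"
  proof (rule uc_raise_power[OF r'(1)])
   show "real CARD('n) < ?b" using s by simp
   show "AE y in lborel. y \<in> ball x (2 * r') \<longrightarrow> d y = 0"
    using d0'[OF Suc.prems] by eventually_elim (use r' in auto)
   show "L1 (\<lambda>y. d y * npow ?b (y - x))" using Suc by auto
  qed (use Suc.IH sub in auto)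
  ultimately show ?case unfolding b2 by blast
 }
qed

section \<open>Unique continuation: from powers to Gaussians\<close>

lemma powr_exp_bound:
 fixes p \<mu> :: real
 assumes "0 < p" "0 < \<mu>" "0 < \<tau>"
 shows "\<tau> powr (- p) * exp (- \<mu> / \<tau>) \<le> ((p + 1) / \<mu>) powr (p + 1) * \<tau>"
proof -
 let ?q = "p + 1"
 have q: "0 < ?q" using assms by simp
 \<comment> \<open>The inequality 1 + x \<le> exp x, to be raised to the power p + 1: one more than
   p, so that a factor \<tau> is left over and the final bound tends to 0 with \<tau>.\<close>
 have "\<mu> / (?q * \<tau>) \<le> exp (\<mu> / (?q * \<tau>))" using exp_ge_add_one_self[of "\<mu> / (?q * \<tau>)"] by linarith
 then have "?q / \<mu> * (\<mu> / (?q * \<tau>)) \<le> ?q / \<mu> * exp (\<mu> / (?q * \<tau>))"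
  using assms q by (intro mult_left_mono) auto
 then have "1 / \<tau> \<le> ?q / \<mu> * exp (\<mu> / (?q * \<tau>))" using assms q by simp
 then have "(1 / \<tau>) powr ?q \<le> (?q / \<mu> * exp (\<mu> / (?q * \<tau>))) powr ?q"
  using assms q by (intro powr_mono2) auto
 also have "\<dots> = (?q / \<mu>) powr ?q * exp (\<mu> / \<tau>)"
 proof -
  have "X * (\<mu> / (X * \<tau>)) = \<mu> / \<tau>" if "0 < X" for X using that assms by simp
  then have "exp (\<mu> / (?q * \<tau>)) powr ?q = exp (\<mu> / \<tau>)" using q by (simp only: powr_def exp_not_eq_zero if_False ln_exp)
  then show ?thesis by (simp only: powr_mult)
 qed
 finally have "(1 / \<tau>) powr ?q * exp (- \<mu> / \<tau>) \<le> ((?q / \<mu>) powr ?q * exp (\<mu> / \<tau>)) * exp (- \<mu> / \<tau>)"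
  by (intro mult_right_mono) auto
 also have "\<dots> = (?q / \<mu>) powr ?q" by (simp add: mult.assoc exp_add[symmetric])
 finally have A: "\<tau> * ((1 / \<tau>) powr ?q * exp (- \<mu> / \<tau>)) \<le> \<tau> * (?q / \<mu>) powr ?q"
  using assms by (intro mult_left_mono) auto
 have B: "\<tau> * (1 / \<tau>) powr ?q = \<tau> powr (- p)"
 proof -
  have "(1 / \<tau>) powr ?q = \<tau> powr (- ?q)" unfolding powr_minus_divide using assms by (simp add: powr_divide)
  then have "\<tau> * (1 / \<tau>) powr ?q = \<tau> powr 1 * \<tau> powr (- ?q)" using assms by simp
  also have "\<dots> = \<tau> powr (- p)" by (simp only: powr_add[symmetric]) simp
  finally show ?thesis .
 qed
 show ?thesis unfolding B[symmetric] using A by (simp only: mult.assoc mult.commute[of "(?q / \<mu>) powr ?q" \<tau>])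
qed

text \<open>In the variable \<tau> = |y - x|^(-2) the hypothesis says that the integrable weight
  \<open>D\<close> has vanishing moments of every order. Since d vanishes near x, \<tau> ranges over
  the compact interval [0, 1/r^2], where polynomials are dense in the continuous functions.\<close>

lemma uc_gaussian_local:
 fixes d :: "real^'n \<Rightarrow> real"
 assumes r: "0 < r" and a: "0 < a" and [measurable]: "d \<in> borel_measurable borel"
  and d0: "AE y in lborel. y \<in> ball x r \<longrightarrow> d y = 0"
  and P: "\<And>k :: nat. L1 (\<lambda>y. d y * npow (a + 2 * real k) (y - x)) \<and> (LBINT y. d y * npow (a + 2 * real k) (y - x)) = 0"
  and l: "0 < \<mu>"
 shows "(LBINT y. d y * exp (- \<mu> * ((y - x) \<bullet> (y - x)))) = 0"
proof -
 define D where "D y = d y * npow a (y - x)" for y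
 have iD: "L1 D" using P[of 0] by (simp add: D_def[abs_def])
 then have [measurable]: "D \<in> borel_measurable borel" by simp
 define \<tau> where "\<tau> y = 1 / ((y - x) \<bullet> (y - x))" for y
 have [measurable]: "\<tau> \<in> borel_measurable borel" unfolding \<tau>_def by measurable
 have y0: "y - x \<noteq> 0 \<and> \<tau> y \<in> {0..1 / r\<^sup>2} \<and> 0 < \<tau> y" if "y \<notin> ball x r" for y
 proof -
  have n: "r \<le> norm (y - x)" using that by (simp add: dist_norm norm_minus_commute)
  then have "y - x \<noteq> 0" using r by auto
  moreover have "r\<^sup>2 \<le> (y - x) \<bullet> (y - x)" using n r by (auto simp flip: power2_norm_eq_inner intro: power_mono)
  ultimately show ?thesis using r by (auto simp: \<tau>_def intro!: divide_left_mono)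
 qed
 have pow: "AE y in lborel. d y * npow (a + 2 * real k) (y - x) = D y * \<tau> y ^ k" for k :: nat
  using d0
 proof eventually_elim
  case (elim y)
  show ?case
  proof (cases "y \<in> ball x r")
   case False
   have pos: "0 < (y - x) \<bullet> (y - x)" using y0[OF False] by simp
   have "- (a + 2 * real k) / 2 = - a / 2 + - real k" by (simp add: field_simps)
   then have "npow (a + 2 * real k) (y - x) = npow a (y - x) * ((y - x) \<bullet> (y - x)) powr (- real k)"
    unfolding npow_def by (simp only: powr_add)
   also have "((y - x) \<bullet> (y - x)) powr (- real k) = \<tau> y ^ k"
    using pos by (simp add: \<tau>_def powr_minus powr_realpow power_one_over inverse_eq_divide)
   finally show ?thesis by (simp add: D_def)
  qed (use elim in \<open>simp add: D_def\<close>)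
 qed
 have ik: "L1 (\<lambda>y. D y * \<tau> y ^ k)" and zk: "(LBINT y. D y * \<tau> y ^ k) = 0" for k
  using P[of k] integrable_cong_AE[OF _ _ pow[of k]] integral_cong_AE[OF _ _ pow[of k]] by auto
 \<comment> \<open>Chosen so that |y - x|^(-a) times \<phi> at \<tau> is the Gaussian. At t = 0,
   which stands for y at infinity, the convention \<open>0 powr p = 0\<close> gives the value 0, and
   this is the continuous extension.\<close>
 define \<phi> where "\<phi> t = t powr (- a / 2) * exp (- \<mu> / t)" for t
 have [measurable]: "\<phi> \<in> borel_measurable borel" unfolding \<phi>_def by measurable
 have cont: "continuous_on {0..1 / r\<^sup>2} \<phi>"
 proof (unfold continuous_on_eq_continuous_within, intro ballI)
  fix t assume t: "t \<in> {0..1 / r\<^sup>2}"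
  show "continuous (at t within {0..1 / r\<^sup>2}) \<phi>"
  proof (cases "t = 0")
   case False
   then show ?thesis using t unfolding \<phi>_def by (intro continuous_intros) auto
  next
   case True
   let ?C = "((a / 2 + 1) / \<mu>) powr (a / 2 + 1)"
   have "(\<phi> \<longlongrightarrow> 0) (at 0 within {0..1 / r\<^sup>2})"
   proof (rule Lim_null_comparison)
    show "\<forall>\<^sub>F t in at 0 within {0..1 / r\<^sup>2}. norm (\<phi> t) \<le> ?C * t"
     unfolding eventually_at_filter
    proof (intro always_eventually allI impI)
     fix t :: real assume "t \<noteq> 0" "t \<in> {0..1 / r\<^sup>2}"
     then show "norm (\<phi> t) \<le> ?C * t"
      using powr_exp_bound[of "a / 2" \<mu> t] a l by (simp add: \<phi>_def)
    qed
    have "((\<lambda>t. ?C * t) \<longlongrightarrow> ?C * 0) (at 0 within {0..1 / r\<^sup>2})" by (intro tendsto_intros)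
    then show "((\<lambda>t. ?C * t) \<longlongrightarrow> 0) (at 0 within {0..1 / r\<^sup>2})" by simp
   qed
   moreover have "\<phi> 0 = 0" by (simp add: \<phi>_def)
   ultimately show ?thesis using True by (simp add: continuous_within)
  qed
 qed
 have gauss: "AE y in lborel. d y * exp (- \<mu> * ((y - x) \<bullet> (y - x))) = D y * \<phi> (\<tau> y)"
  using d0
 proof eventually_elim
  case (elim y)
  show ?case
  proof (cases "y \<in> ball x r")
   case False
   have pos: "0 < (y - x) \<bullet> (y - x)" using y0[OF False] by simp
   have "npow a (y - x) * \<phi> (\<tau> y) = exp (- \<mu> * ((y - x) \<bullet> (y - x)))"
    using pos by (simp add: npow_def \<phi>_def \<tau>_def powr_divide powr_minus)
   then show ?thesis by (simp add: D_def mult.assoc)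
  qed (use elim in \<open>simp add: D_def\<close>)
 qed
 have small: "\<bar>LBINT y. D y * \<phi> (\<tau> y)\<bar> \<le> e * (LBINT y. \<bar>D y\<bar>)" if e: "0 < e" for e
 proof -
  obtain g where g: "real_polynomial_function g" "\<And>t. t \<in> {0..1 / r\<^sup>2} \<Longrightarrow> \<bar>\<phi> t - g t\<bar> < e"
   using Stone_Weierstrass_real_polynomial_function[OF compact_Icc cont e] by blast
  obtain c n where gs: "g = (\<lambda>t. \<Sum>i\<le>n. c i * t ^ i)" using g(1) real_polynomial_function_iff_sum by blast
  have hb: "has_bochner_integral lborel (\<lambda>y. \<Sum>i\<le>n. c i * (D y * \<tau> y ^ i)) (\<Sum>i\<le>n. c i * 0)"
   using ik zk by (intro has_bochner_integral_sum has_bochner_integral_mult_right) (auto simp: has_bochner_integral_iff)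
  have Dg: "(\<lambda>y. \<Sum>i\<le>n. c i * (D y * \<tau> y ^ i)) = (\<lambda>y. D y * g (\<tau> y))"
   unfolding gs sum_distrib_left by (simp add: mult.left_commute)
  have iDg: "L1 (\<lambda>y. D y * g (\<tau> y))" "(LBINT y. D y * g (\<tau> y)) = 0"
   using hb unfolding Dg by (auto simp: has_bochner_integral_iff)
  have bd: "AE y in lborel. \<bar>D y * \<phi> (\<tau> y) - D y * g (\<tau> y)\<bar> \<le> e * \<bar>D y\<bar>"
   using d0
  proof eventually_elim
   case (elim y)
   show ?case
   proof (cases "y \<in> ball x r")
    case False
    have "\<bar>\<phi> (\<tau> y) - g (\<tau> y)\<bar> \<le> e" using g(2)[of "\<tau> y"] y0[OF False] by simp
    then have "\<bar>D y\<bar> * \<bar>\<phi> (\<tau> y) - g (\<tau> y)\<bar> \<le> \<bar>D y\<bar> * e" by (intro mult_left_mono) auto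
    then show ?thesis by (simp add: abs_mult[symmetric] right_diff_distrib mult.commute)
   qed (use elim in \<open>simp add: D_def\<close>)
  qed
  have gm: "(\<lambda>y. D y * g (\<tau> y)) \<in> borel_measurable lborel" using iDg by auto
  have iDf: "L1 (\<lambda>y. D y * \<phi> (\<tau> y) - D y * g (\<tau> y))"
  proof (rule bochner_bound[OF integrable_mult_right[OF integrable_abs[OF iD], of e]])
   show "AE y in lborel. norm (D y * \<phi> (\<tau> y) - D y * g (\<tau> y)) \<le> norm (e * \<bar>D y\<bar>)"
    using bd by eventually_elim (use e in \<open>simp add: abs_mult\<close>)
  qed (use gm in measurable)
  have "(LBINT y. D y * \<phi> (\<tau> y)) = (LBINT y. (D y * \<phi> (\<tau> y) - D y * g (\<tau> y)) + D y * g (\<tau> y))" by simp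
  also have "\<dots> = (LBINT y. D y * \<phi> (\<tau> y) - D y * g (\<tau> y))"
   using bochner_add[OF iDf iDg(1)] iDg(2) by simp
  finally have "\<bar>LBINT y. D y * \<phi> (\<tau> y)\<bar> \<le> (LBINT y. \<bar>D y * \<phi> (\<tau> y) - D y * g (\<tau> y)\<bar>)"
   by (simp only: integral_abs_bound)
  also have "\<dots> \<le> (LBINT y. e * \<bar>D y\<bar>)"
   by (intro integral_mono_AE integrable_abs iDf integrable_mult_right iD bd)
  finally show ?thesis by simp
 qed
 have "\<bar>LBINT y. D y * \<phi> (\<tau> y)\<bar> \<le> 0"
 proof (rule field_le_epsilon)
  fix e :: real assume e: "0 < e"
  let ?I = "LBINT y. \<bar>D y\<bar>"
  have I: "0 \<le> ?I" by (intro integral_nonneg_AE AE_I2) auto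
  have "\<bar>LBINT y. D y * \<phi> (\<tau> y)\<bar> \<le> e / (?I + 1) * ?I" using e I by (intro small divide_pos_pos) linarith+
  also have "e / (J + 1) * J \<le> 0 + e" if "0 \<le> J" for J using that e by (simp add: field_simps)
  note this[OF I]
  finally show "\<bar>LBINT y. D y * \<phi> (\<tau> y)\<bar> \<le> 0 + e" .
 qed
 then show ?thesis using integral_cong_AE[OF _ _ gauss] by simp
qed

text \<open>(1 + r)^a \<le> exp(a r), followed by completing the square in -\<mu> r^2 + (\<beta> +
  a) r. The linear term \<beta> is there to absorb exponential and polynomial factors in later
  majorants.\<close>

lemma gauss_decay:
 fixes w :: "real^'n"
 assumes s: "0 < s" and m: "0 < \<mu>"
 shows "exp (- \<mu> * (w \<bullet> w) + \<beta> * norm w) \<le> exp ((\<beta> + (real CARD('n) + 2 * s))\<^sup>2 / (4 * \<mu>)) * decay s w"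
proof -
 let ?a = "real CARD('n) + 2 * s" and ?r = "norm w"
 have r: "0 < 1 + ?r" using norm_ge_zero[of w] by linarith
 have "(1 + ?r) powr ?a \<le> exp ?r powr ?a" using exp_ge_add_one_self[of ?r] r s by (intro powr_mono2) auto
 also have "\<dots> = exp (?a * ?r)" by (simp add: powr_def)
 finally have 1: "(1 + ?r) powr ?a \<le> exp (?a * ?r)" .
 have "exp (- \<mu> * (w \<bullet> w) + \<beta> * ?r) * (1 + ?r) powr ?a \<le> exp (- \<mu> * (w \<bullet> w) + \<beta> * ?r) * exp (?a * ?r)"
  using 1 by (intro mult_left_mono) auto
 also have "\<dots> = exp (- \<mu> * ?r\<^sup>2 + (\<beta> + ?a) * ?r)"
  by (simp add: exp_add[symmetric] power2_norm_eq_inner algebra_simps)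
 also have "\<dots> \<le> exp ((\<beta> + ?a)\<^sup>2 / (4 * \<mu>))"
 proof -
  have "0 \<le> (2 * \<mu> * ?r - (\<beta> + ?a))\<^sup>2 / (4 * \<mu>)" using m by simp
  also have "\<dots> = (\<beta> + ?a)\<^sup>2 / (4 * \<mu>) - (- \<mu> * ?r\<^sup>2 + (\<beta> + ?a) * ?r)"
   using m by (simp add: power2_eq_square field_simps)
  finally show ?thesis by simp
 qed
 finally show ?thesis using r unfolding decay_eq by (simp add: field_simps)
qed

text \<open>Restricted to a line through \<open>x0\<close> the Gaussian integral is, up to a nonvanishing factor, an everywhere
 convergent power series.\<close>

lemma uc_gaussian_global:
 fixes s :: real and d :: "real^'n \<Rightarrow> real"
 assumes s: "0 < s" and r: "0 < r" and [measurable]: "d \<in> borel_measurable borel" and d: "L2 d"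
  and l: "0 < \<mu>" and Z: "\<And>x. x \<in> ball x0 r \<Longrightarrow> (LBINT y. d y * exp (- \<mu> * ((y - x) \<bullet> (y - x)))) = 0"
 shows "(LBINT y. d y * exp (- \<mu> * ((y - x) \<bullet> (y - x)))) = 0"
proof -
 let ?v = "x - x0"
 \<comment> \<open>Expanding the square |y - x0 - t v|^2 with v = x - x0: the term t^2 |v|^2 does
   not depend on y and comes out, \<open>G\<close> carries the Gaussian centred at x0, and t enters
   only through \<open>exp (t * ell y)\<close>, which is expanded in powers of t.\<close>
 define G where "G y = d y * exp (- \<mu> * ((y - x0) \<bullet> (y - x0)))" for y
 define ell where "ell y = 2 * \<mu> * ((y - x0) \<bullet> ?v)" for y
 have [measurable]: "G \<in> borel_measurable borel" "ell \<in> borel_measurable borel" unfolding G_def ell_def by measurable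
 define f where "f t = (LBINT y. G y * exp (t * ell y))" for t
 have fG: "(LBINT y. d y * exp (- \<mu> * ((y - (x0 + t *\<^sub>R ?v)) \<bullet> (y - (x0 + t *\<^sub>R ?v))))) = exp (- \<mu> * (t\<^sup>2 * (?v \<bullet> ?v))) * f t" for t
 proof -
  have "d y * exp (- \<mu> * ((y - (x0 + t *\<^sub>R ?v)) \<bullet> (y - (x0 + t *\<^sub>R ?v)))) = exp (- \<mu> * (t\<^sup>2 * (?v \<bullet> ?v))) * (G y * exp (t * ell y))" for y
  proof -
   have sq: "(a - t *\<^sub>R b) \<bullet> (a - t *\<^sub>R b) = a \<bullet> a - 2 * t * (a \<bullet> b) + t\<^sup>2 * (b \<bullet> b)" for a b :: "real^'n"
    by (simp add: inner_diff_left inner_diff_right inner_commute power2_eq_square algebra_simps)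
   have e1: "y - (x0 + t *\<^sub>R ?v) = (y - x0) - t *\<^sub>R ?v" by simp
   have eqn: "- \<mu> * ((y - (x0 + t *\<^sub>R ?v)) \<bullet> (y - (x0 + t *\<^sub>R ?v)))
     = - \<mu> * (t\<^sup>2 * (?v \<bullet> ?v)) + (- \<mu> * ((y - x0) \<bullet> (y - x0)) + t * ell y)"
    unfolding e1 sq ell_def by algebra
   show ?thesis unfolding eqn exp_add G_def by (simp only: mult_ac)
  qed
  then show ?thesis unfolding f_def by (simp only: integral_mult_right_zero)
 qed
 have dom: "L1 (\<lambda>y. \<bar>G y\<bar> * exp \<bar>t * ell y\<bar>)" for t
 proof -
  let ?\<beta> = "\<bar>t\<bar> * (2 * \<mu> * norm ?v)"
  obtain C where C: "\<And>w :: real^'n. exp (- \<mu> * (w \<bullet> w) + ?\<beta> * norm w) \<le> C * decay s w"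
   using gauss_decay[OF s l, where \<beta>="?\<beta>"] by blast
  have "L1 (\<lambda>y. \<bar>d y\<bar> * exp (- \<mu> * (((x0 - y) /\<^sub>R 1) \<bullet> ((x0 - y) /\<^sub>R 1)) + ?\<beta> * norm ((x0 - y) /\<^sub>R 1)))"
  proof (rule L2_decay_integrable[OF s zero_less_one, where C=C])
   show "\<bar>exp (- \<mu> * (w \<bullet> w) + ?\<beta> * norm w)\<bar> \<le> C * decay s w" for w :: "real^'n"
    using C[of w] by (simp only: abs_exp_cancel)
  qed (use d in auto)
  then show ?thesis
  proof (rule bochner_bound)
   show "AE y in lborel. norm (\<bar>G y\<bar> * exp \<bar>t * ell y\<bar>)
     \<le> norm (\<bar>d y\<bar> * exp (- \<mu> * (((x0 - y) /\<^sub>R 1) \<bullet> ((x0 - y) /\<^sub>R 1)) + ?\<beta> * norm ((x0 - y) /\<^sub>R 1)))"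
   proof (rule AE_I2)
    fix y
    have "\<bar>(y - x0) \<bullet> ?v\<bar> \<le> norm (y - x0) * norm ?v" by (rule Cauchy_Schwarz_ineq2)
    then have "2 * \<mu> * \<bar>(y - x0) \<bullet> ?v\<bar> \<le> 2 * \<mu> * (norm (y - x0) * norm ?v)" using l by (intro mult_left_mono) auto
    then have "\<bar>t\<bar> * (2 * \<mu> * \<bar>(y - x0) \<bullet> ?v\<bar>) \<le> \<bar>t\<bar> * (2 * \<mu> * (norm (y - x0) * norm ?v))" by (rule mult_left_mono) simp
    then have "\<bar>t * ell y\<bar> \<le> ?\<beta> * norm (y - x0)" using l by (simp add: ell_def abs_mult mult_ac)
    then have "exp (- \<mu> * ((y - x0) \<bullet> (y - x0))) * exp \<bar>t * ell y\<bar> \<le> exp (- \<mu> * ((y - x0) \<bullet> (y - x0)) + ?\<beta> * norm (y - x0))"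
     by (simp add: exp_add[symmetric])
    then have "\<bar>d y\<bar> * (exp (- \<mu> * ((y - x0) \<bullet> (y - x0))) * exp \<bar>t * ell y\<bar>)
      \<le> \<bar>d y\<bar> * exp (- \<mu> * ((y - x0) \<bullet> (y - x0)) + ?\<beta> * norm (y - x0))" by (intro mult_left_mono) auto
    moreover have "(x0 - y) \<bullet> (x0 - y) = (y - x0) \<bullet> (y - x0)" "norm (x0 - y) = norm (y - x0)"
     by (simp_all add: norm_minus_commute flip: power2_norm_eq_inner)
    ultimately show "norm (\<bar>G y\<bar> * exp \<bar>t * ell y\<bar>)
     \<le> norm (\<bar>d y\<bar> * exp (- \<mu> * (((x0 - y) /\<^sub>R 1) \<bullet> ((x0 - y) /\<^sub>R 1)) + ?\<beta> * norm ((x0 - y) /\<^sub>R 1)))"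
     by (simp only: G_def abs_mult real_norm_def abs_exp_cancel abs_idempotent inverse_1 scaleR_one mult.assoc)
   qed
  qed measurable
 qed
 define c where "c j = (LBINT y. G y * ell y ^ j / fact j)" for j
 have sums: "(\<lambda>j. c j * t ^ j) sums f t" for t
 proof -
  let ?F = "\<lambda>j y. G y * ((t * ell y) ^ j / fact j)"
  have es: "(\<lambda>j. X ^ j / fact j) sums exp X" for X :: real
   using exp_converges[of X] by (simp add: scaleR_conv_of_real field_simps)
  have part: "(\<Sum>j<n. \<bar>?F j y\<bar>) \<le> \<bar>G y\<bar> * exp \<bar>t * ell y\<bar>" for n y
  proof -
   have "(\<Sum>j<n. \<bar>t * ell y\<bar> ^ j / fact j) \<le> exp \<bar>t * ell y\<bar>"
    unfolding sums_unique[OF es] by (intro sum_le_suminf sums_summable[OF es]) auto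
   then have "\<bar>G y\<bar> * (\<Sum>j<n. \<bar>t * ell y\<bar> ^ j / fact j) \<le> \<bar>G y\<bar> * exp \<bar>t * ell y\<bar>" by (intro mult_left_mono) auto
   then show ?thesis by (simp add: sum_distrib_left abs_mult power_abs)
  qed
  have iF: "L1 (?F j)" for j
  proof (rule bochner_bound[OF dom[of t]])
   show "AE y in lborel. norm (?F j y) \<le> norm (\<bar>G y\<bar> * exp \<bar>t * ell y\<bar>)"
   proof (rule AE_I2)
    fix y
    have "\<bar>?F j y\<bar> \<le> (\<Sum>j<Suc j. \<bar>?F j y\<bar>)" by (rule member_le_sum) auto
    then show "norm (?F j y) \<le> norm (\<bar>G y\<bar> * exp \<bar>t * ell y\<bar>)" using part[where n="Suc j" and y=y] by simp
   qed
  qed measurable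
  have "(\<lambda>j. LBINT y. ?F j y) sums (LBINT y. (\<Sum>j. ?F j y))"
  proof (rule sums_integral[OF iF])
   show "AE y in lborel. summable (\<lambda>j. norm (?F j y))"
    using part by (intro AE_I2 summableI_nonneg_bounded[where x="\<bar>G _\<bar> * exp \<bar>t * ell _\<bar>"]) auto
   show "summable (\<lambda>j. LBINT y. norm (?F j y))"
   proof (rule summableI_nonneg_bounded)
    fix n
    have "(\<Sum>j<n. LBINT y. norm (?F j y)) = (LBINT y. (\<Sum>j<n. norm (?F j y)))"
     by (intro Bochner_Integration.integral_sum[symmetric] integrable_norm iF)
    also have "\<dots> \<le> (LBINT y. \<bar>G y\<bar> * exp \<bar>t * ell y\<bar>)"
     by (intro bochner_mono dom Bochner_Integration.integrable_sum integrable_norm iF)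
       (use part in simp)
    finally show "(\<Sum>j<n. LBINT y. norm (?F j y)) \<le> (LBINT y. \<bar>G y\<bar> * exp \<bar>t * ell y\<bar>)" .
   qed simp
  qed
  moreover have "(\<Sum>j. ?F j y) = G y * exp (t * ell y)" for y
   using sums_unique[OF sums_mult[OF es[of "t * ell y"], of "G y"]] by simp
  moreover have "(LBINT y. ?F j y) = c j * t ^ j" for j
  proof -
   have "(\<lambda>y. ?F j y) = (\<lambda>y. (G y * ell y ^ j / fact j) * t ^ j)" by (simp add: fun_eq_iff power_mult_distrib mult_ac)
   then show ?thesis unfolding c_def by (simp only: integral_mult_left_zero)
  qed
  ultimately show ?thesis by (simp add: f_def)
 qed
 define \<rho> where "\<rho> = r / (norm ?v + 1)"
 have nv: "0 < norm ?v + 1" using norm_ge_zero[of ?v] by linarith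
 have \<rho>: "0 < \<rho>" using r nv by (simp add: \<rho>_def)
 have f0: "f t = 0" if "\<bar>t\<bar> < \<rho>" for t
 proof -
  have "norm (t *\<^sub>R ?v) \<le> \<bar>t\<bar> * (norm ?v + 1)" unfolding norm_scaleR by (intro mult_left_mono) auto
  also have "\<dots> < \<rho> * (norm ?v + 1)" using that nv by (intro mult_strict_right_mono)
  also have "\<dots> = r" using nv by (simp add: \<rho>_def)
  finally have "x0 + t *\<^sub>R ?v \<in> ball x0 r" by (simp add: dist_norm)
  from Z[OF this] show ?thesis unfolding fG by simp
 qed
 \<comment> \<open>A power series with a nonzero coefficient does not vanish in a punctured
   neighbourhood of 0, whereas \<open>f\<close> vanishes on an interval around 0.\<close>
 have c0: "c j = 0" for j
 proof (rule ccontr)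
  assume cj: "c j \<noteq> 0"
  have "c 0 = f 0" by (simp add: c_def f_def)
  then have "j \<noteq> 0" using f0[of 0] \<rho> cj by (cases j) auto
  then obtain q where q: "0 < q" "\<And>z. z \<in> cball 0 q - {0} \<Longrightarrow> f z \<noteq> 0"
   using powser_0_nonzero[OF \<rho>, of 0 c f j] sums f0[of 0] \<rho> cj by auto
  have "min q (\<rho> / 2) \<in> cball 0 q - {0}" using q \<rho> by auto
  moreover have "f (min q (\<rho> / 2)) = 0" using q \<rho> by (intro f0) auto
  ultimately show False using q(2) by blast
 qed
 have "f 1 = 0" using sums[of 1] c0 by (simp add: sums_iff)
 then show ?thesis using fG[of 1] by simp
qed

text \<open>The radius 3r leaves room: about every centre in the ball of radius r, the function
  vanishes up to distance 2r. The last passage, from vanishing Gaussian integrals to d = 0, is weak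
  because d is only in L^2: Fubini moves a shrinking Gaussian from d onto a bump, where it converges
  pointwise.\<close>

theorem unique_continuation:
 fixes d :: "real^'n \<Rightarrow> real"
 assumes s: "0 < s" "s < 1" and r: "0 < r"
  and [measurable]: "d \<in> borel_measurable borel" and d: "L2 d"
  and d0: "AE y in lborel. y \<in> ball x0 (3 * r) \<longrightarrow> d y = 0"
  and L: "\<And>x t. x \<in> ball x0 r \<Longrightarrow> 0 < t \<Longrightarrow> t < r \<Longrightarrow> (LBINT y. d y * lapb s ((y - x) /\<^sub>R t)) = 0"
 shows "AE y in lborel. d y = 0"
proof -
 have loc: "(LBINT y. d y * exp (- \<mu> * ((y - x) \<bullet> (y - x)))) = 0" if "x \<in> ball x0 r" "0 < \<mu>" for x \<mu>
 proof (rule uc_gaussian_local[OF r, where a="real CARD('n) + 2 * s"])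
  show "AE y in lborel. y \<in> ball x r \<longrightarrow> d y = 0"
   using d0
  proof eventually_elim
   case (elim y)
   have "y \<in> ball x0 (3 * r)" if "y \<in> ball x r"
    using that \<open>x \<in> ball x0 r\<close> dist_triangle[of x0 y x] r by (simp add: dist_commute)
   then show ?case using elim by blast
  qed
 qed (use s that uc_all_powers[OF s r _ d d0 L that(1)] in auto)
 have gl: "(LBINT y. d y * exp (- \<mu> * ((y - x) \<bullet> (y - x)))) = 0" if "0 < \<mu>" for x \<mu>
  by (rule uc_gaussian_global[OF s(1) r _ d that loc[OF _ that]]) auto
 define g where "g z = exp (- (z \<bullet> z))" for z :: "real^'n"
 have [measurable]: "g \<in> borel_measurable borel" unfolding g_def by measurable
 have g0: "0 \<le> g z" for z by (simp add: g_def)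
 let ?a = "real CARD('n) + 2 * s"
 obtain C where C: "\<And>z :: real^'n. exp (- 1 * (z \<bullet> z) + 0 * norm z) \<le> C * decay s z"
  using gauss_decay[OF s(1) zero_less_one, where \<beta>=0] by blast
 obtain C' where C': "\<And>z :: real^'n. exp (- 1 * (z \<bullet> z) + ?a * norm z) \<le> C' * decay s z"
  using gauss_decay[OF s(1) zero_less_one, where \<beta>="?a"] by blast
 have ig: "L1 g"
 proof (rule bochner_bound[OF integrable_mult_right[OF decay_integrable[OF s(1)], of C]])
  show "AE z in lborel. norm (g z) \<le> norm (C * decay s (z :: real^'n))"
   using C by (intro AE_I2) (auto simp: g_def intro: order_trans[OF _ abs_ge_self])
 qed measurable
 have ig': "L1 (\<lambda>z. g z * (1 + norm z) powr ?a)"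
 proof (rule bochner_bound[OF integrable_mult_right[OF decay_integrable[OF s(1)], of C']])
  have "g z * (1 + norm z) powr ?a \<le> C' * decay s z" for z :: "real^'n"
  proof -
   have "(1 + norm z) powr ?a \<le> exp (norm z) powr ?a"
    using exp_ge_add_one_self[of "norm z"] s norm_ge_zero[of z] by (intro powr_mono2) auto
   then have "g z * (1 + norm z) powr ?a \<le> g z * exp (?a * norm z)" using g0 by (intro mult_left_mono) (auto simp: powr_def)
   also have "\<dots> = exp (- 1 * (z \<bullet> z) + ?a * norm z)" by (simp add: g_def exp_add[symmetric])
   finally show ?thesis using C'[of z] by linarith
  qed
  moreover have "0 \<le> g z * (1 + norm z) powr ?a" for z using g0 by simp
  ultimately have "\<bar>g z * (1 + norm z) powr ?a\<bar> \<le> \<bar>C' * decay s z\<bar>" for z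
   by (smt (verit))
  then show "AE z in lborel. norm (g z * (1 + norm z) powr ?a) \<le> norm (C' * decay s (z :: real^'n))"
   by simp
 qed measurable
 have gpos: "(LBINT z. g z) \<noteq> 0"
 proof
  assume "(LBINT z. g z) = 0"
  then have "AE z in lborel. g z = 0" using integral_nonneg_eq_0_iff_AE[OF ig] g0 by simp
  then have "AE z :: real^'n in lborel. z \<notin> ball 0 1" by eventually_elim (simp add: g_def)
  then have "ball (0 :: real^'n) 1 \<in> null_sets lborel" by (subst AE_iff_null_sets) auto
  then show False using content_ball_pos[of 1 "0 :: real^'n"] by (simp add: null_sets_def measure_def)
 qed
 show ?thesis
 proof (rule AE_zero_of_bump_integrals[OF _ d])
  fix c :: "real^'n" and t :: real assume t: "0 < t"
  let ?b = "bumpd c t"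
  define e :: "nat \<Rightarrow> real" where "e k = inverse (real (Suc k))" for k
  have e: "0 < e k" "e k \<le> 1" for k by (auto simp: e_def inverse_le_1_iff)
  have e0: "e \<longlonglongrightarrow> 0" unfolding e_def using LIMSEQ_inverse_real_of_nat by simp
  have zero: "(LBINT y. d y * (LBINT z. g z * ?b (y - e k *\<^sub>R z))) = 0" for k
  proof -
   let ?k = "\<lambda>w. g (w /\<^sub>R e k)"
   have ik: "L1 ?k" using integrable_dilation_iff(1)[OF e(1)[of k], of g 0] ig by simp
   have sc: "(LBINT z. g z * ?b (y - e k *\<^sub>R z)) * e k ^ CARD('n) = (LBINT x. ?b x * ?k (y - x))" for y
    using integral_lborel_affine[of "- e k" "\<lambda>x. ?b x * ?k (y - x)" y] e(1)[of k] by (simp add: mult.commute)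
   have F: "integrable lborel2 (\<lambda>(y, x). d y * (?b x * ?k (y - x)))"
   proof -
    have "integrable lborel2 (\<lambda>p. d (fst p) * ?b (snd p) * ?k (fst p - snd p))"
     using integrable_convolution_pair(1)[OF d ik] integrable_convolution_pair(2)[OF bumpd_sq_integrable[OF t] ik, of c]
     by (intro integrable_mult_weight g0; simp add: case_prod_unfold)
    then show ?thesis by (simp add: case_prod_unfold mult.assoc)
   qed
   have "(LBINT y. d y * (LBINT z. g z * ?b (y - e k *\<^sub>R z))) * e k ^ CARD('n)
     = (LBINT y. d y * ((LBINT z. g z * ?b (y - e k *\<^sub>R z)) * e k ^ CARD('n)))"
    by (simp only: mult.assoc[symmetric] integral_mult_left_zero)
   also have "\<dots> = (LBINT y. LBINT x. d y * (?b x * ?k (y - x)))" unfolding sc by simp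
   also have "\<dots> = (LBINT x. LBINT y. d y * (?b x * ?k (y - x)))" using lborel_pair.Fubini_integral[OF F] by simp
   also have "\<dots> = 0"
   proof -
    have "?k w = exp (- (1 / (e k)\<^sup>2) * (w \<bullet> w))" for w
     using e(1)[of k] by (simp add: g_def power2_eq_square field_simps)
    then have "(LBINT y. d y * ?k (y - x)) = 0" for x using gl[of "1 / (e k)\<^sup>2" x] e(1)[of k] by simp
    then have "(LBINT y. d y * (?b x * ?k (y - x))) = 0" for x
     by (simp only: mult.left_commute[of "d _"] integral_mult_right_zero mult_zero_right)
    then show ?thesis by (simp only: Bochner_Integration.integral_zero)
   qed
   finally show ?thesis using e(1)[of k] by simp
  qed
  obtain C1 where C1: "\<And>y. ?b y \<le> C1 * decay s y" "0 < C1"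
  proof -
   let ?C = "(1 + (norm c + t)) powr ?a"
   have "?b y \<le> ?C * decay s y" for y
   proof (cases "y \<in> cball c t")
    case True
    then have "norm y \<le> norm c + t" using norm_triangle_ineq2[of y c] by (simp add: dist_norm norm_minus_commute)
    then have "(1 + norm y) powr ?a \<le> ?C" using s by (intro powr_mono2) auto
    moreover have "0 < 1 + norm y" using norm_ge_zero[of y] by linarith
    ultimately have "1 \<le> ?C * decay s y" unfolding decay_eq by (simp add: field_simps)
    then show ?thesis using bumpd_bounds(2)[of c t y] by linarith
   qed (use bumpd_outside[OF t, of y c] decay_pos[of s y] in simp)
   moreover have "0 < ?C" using t norm_ge_zero[of c] by (intro powr_gt_zero[THEN iffD2]) linarith
   ultimately show thesis using that by blast
  qed
  let ?I = "LBINT z. g z * (1 + norm z) powr ?a"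
  have "(\<lambda>k. LBINT y. d y * (LBINT z. g z * ?b (y - e k *\<^sub>R z))) \<longlonglongrightarrow> (LBINT y. d y * ((LBINT z. g z) * ?b y))"
  proof (rule integral_dominated_convergence[where w="\<lambda>y. C1 * ?I * \<bar>d y * decay s ((0 - y) /\<^sub>R 1)\<bar>"])
   show "L1 (\<lambda>y. C1 * ?I * \<bar>d y * decay s ((0 - y) /\<^sub>R 1)\<bar>)"
    by (intro integrable_mult_right integrable_abs L2_decay_integrable[OF s(1) _ _ d, where C=1])
      (auto simp: abs_of_pos[OF decay_pos])
   show "AE y in lborel. norm (d y * (LBINT z. g z * ?b (y - e k *\<^sub>R z))) \<le> C1 * ?I * \<bar>d y * decay s ((0 - y) /\<^sub>R 1)\<bar>" for k
   proof (rule AE_I2)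
    fix y
    \<comment> \<open>A shift by at most |z| costs a factor (1 + |z|)^(n+2s) in the decay, and the
      Gaussian absorbs it; the bound is therefore independent of k.\<close>
    have bd: "\<bar>g z * ?b (y - e k *\<^sub>R z)\<bar> \<le> C1 * decay s y * (g z * (1 + norm z) powr ?a)" for z
    proof -
     have "norm (- (e k *\<^sub>R z)) \<le> norm z" using e[of k] by (simp add: mult_left_le_one_le)
     then have "(1 + norm (- (e k *\<^sub>R z))) powr ?a \<le> (1 + norm z) powr ?a" using s by (intro powr_mono2) auto
     then have "decay s (y + - (e k *\<^sub>R z)) \<le> (1 + norm z) powr ?a * decay s y"
      using decay_translate[OF s(1), of y "- (e k *\<^sub>R z)"] decay_pos[of s y] by (meson mult_right_mono order_trans less_imp_le)
     then have "C1 * decay s (y - e k *\<^sub>R z) \<le> C1 * ((1 + norm z) powr ?a * decay s y)"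
      using C1(2) by (intro mult_left_mono) auto
     then have "?b (y - e k *\<^sub>R z) \<le> C1 * ((1 + norm z) powr ?a * decay s y)" using C1(1) order_trans by blast
     then have "g z * ?b (y - e k *\<^sub>R z) \<le> g z * (C1 * ((1 + norm z) powr ?a * decay s y))" by (intro mult_left_mono g0)
     then show ?thesis using g0[of z] bumpd_bounds(1)[of c t "y - e k *\<^sub>R z"] by (simp add: abs_mult mult_ac)
    qed
    have "\<bar>LBINT z. g z * ?b (y - e k *\<^sub>R z)\<bar> \<le> (LBINT z. \<bar>g z * ?b (y - e k *\<^sub>R z)\<bar>)" by (rule integral_abs_bound)
    also have "\<dots> \<le> (LBINT z. C1 * decay s y * (g z * (1 + norm z) powr ?a))"
    proof (rule bochner_mono[OF _ integrable_mult_right[OF ig'] bd])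
     show "L1 (\<lambda>z. \<bar>g z * ?b (y - e k *\<^sub>R z)\<bar>)"
      by (rule bochner_bound[OF integrable_mult_right[OF ig', of "C1 * decay s y"]])
        (use bd in \<open>auto intro: order_trans[OF _ abs_ge_self]\<close>)
    qed
    finally have "\<bar>d y\<bar> * \<bar>LBINT z. g z * ?b (y - e k *\<^sub>R z)\<bar> \<le> \<bar>d y\<bar> * (C1 * decay s y * ?I)"
     by (intro mult_left_mono) auto
    then show "norm (d y * (LBINT z. g z * ?b (y - e k *\<^sub>R z))) \<le> C1 * ?I * \<bar>d y * decay s ((0 - y) /\<^sub>R 1)\<bar>"
     by (simp add: abs_mult decay_minus abs_of_pos[OF decay_pos] mult_ac)
   qed
   show "AE y in lborel. (\<lambda>k. d y * (LBINT z. g z * ?b (y - e k *\<^sub>R z))) \<longlonglongrightarrow> d y * ((LBINT z. g z) * ?b y)"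
   proof (intro AE_I2 tendsto_mult tendsto_const)
    fix y
    have "continuous_on UNIV ?b" unfolding bumpd_def[abs_def]
     by (intro continuous_on_compose2[OF bump_continuous]) (auto intro!: continuous_intros)
    then have "isCont ?b y" by (simp add: continuous_on_eq_continuous_at)
    then show "(\<lambda>k. LBINT z. g z * ?b (y - e k *\<^sub>R z)) \<longlonglongrightarrow> (LBINT z. g z) * ?b y"
     using bumpd_bounds[of c t] by (intro approximate_identity[OF ig _ _ _ e0, of _ 1]) auto
   qed
  qed measurable
  then have "(LBINT y. d y * ((LBINT z. g z) * ?b y)) = 0" by (simp add: zero LIMSEQ_const_iff)
  moreover have "(LBINT y. d y * ((LBINT z. g z) * ?b y)) = (LBINT z. g z) * (LBINT y. d y * ?b y)"
   by (simp only: mult.left_commute[of "d _"] integral_mult_right_zero)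
  ultimately show "(LBINT y. d y * ?b y) = 0" using gpos by simp
 qed measurable
qed

subsection \<open>Continuity of weak solutions in the interior\<close>

lemma conv_bounded:
 fixes u F :: "real^'n \<Rightarrow> real"
 assumes s: "0 < s" and t: "0 < t" and [measurable]: "u \<in> borel_measurable borel" and u: "L2 u"
  and [measurable]: "F \<in> borel_measurable borel" and F: "\<And>y. \<bar>F y\<bar> \<le> C * decay s y"
 obtains M where "0 \<le> M" "\<And>x. \<bar>LBINT y. u y * F (x - y)\<bar> \<le> M"
proof
 have F2: "L2 F"
 proof (rule bochner_bound[OF integrable_mult_right[OF decay_sq_integrable[OF s], of "C\<^sup>2"]])
  have "(F y)\<^sup>2 \<le> C\<^sup>2 * (decay s y)\<^sup>2" for y
   using power_mono[OF F[of y], of 2] by (simp add: power_mult_distrib)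
  then show "AE y in lborel. norm ((F y)\<^sup>2) \<le> norm (C\<^sup>2 * (decay s (y::real^'n))\<^sup>2)" by simp
 qed measurable
 let ?M = "(LBINT y. (u y)\<^sup>2) + (LBINT y. (F y)\<^sup>2)"
 show "0 \<le> ?M" by (intro add_nonneg_nonneg integral_nonneg_AE AE_I2) auto
 fix x
 have F2x: "L1 (\<lambda>y. (F (x - y))\<^sup>2)" "(LBINT y. (F (x - y))\<^sup>2) = (LBINT y. (F y)\<^sup>2)"
  using F2 integrable_lborel_reflect[of "\<lambda>y. (F y)\<^sup>2" x] integral_lborel_reflect[of "\<lambda>y. (F y)\<^sup>2" x] by auto
 have "\<bar>LBINT y. u y * F (x - y)\<bar> \<le> (LBINT y. (u y)\<^sup>2 + (F (x - y))\<^sup>2)"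
 proof (rule dominated(2))
  show "\<bar>u y * F (x - y)\<bar> \<le> (u y)\<^sup>2 + (F (x - y))\<^sup>2" for y
   using sum_squares_bound[of "\<bar>u y\<bar>" "\<bar>F (x - y)\<bar>"] mult_nonneg_nonneg[OF abs_ge_zero[of "u y"] abs_ge_zero[of "F (x - y)"]]
   unfolding abs_mult power2_abs by linarith
 qed (use u F2x in auto)
 also have "\<dots> = ?M" using u F2x by simp
 finally show "\<bar>LBINT y. u y * F (x - y)\<bar> \<le> ?M" .
qed

text \<open>A convergent sequence of centres is bounded, so \<open>decay_translate\<close> provides
  one majorant for all of them. Continuity of \<open>F\<close> is required only at almost every
  point because the cut-off kernel \<open>kern s e\<close> jumps on a sphere.\<close>

lemma conv_continuous:
 fixes u F :: "real^'n \<Rightarrow> real"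
 assumes s: "0 < s" and [measurable]: "u \<in> borel_measurable borel" and u: "L2 u"
  and [measurable]: "F \<in> borel_measurable borel" and F: "\<And>y. \<bar>F y\<bar> \<le> C * decay s y"
  and cont: "AE y in lborel. isCont F (x - y)"
 shows "isCont (\<lambda>x. LBINT y. u y * F (x - y)) x"
proof (unfold continuous_at_sequentially comp_def, intro allI impI)
 let ?a = "real CARD('n) + 2 * s"
 fix X :: "nat \<Rightarrow> real^'n" assume X: "X \<longlonglongrightarrow> x"
 then obtain M where M: "\<And>k. dist (X k) x \<le> M"
  using convergent_imp_bounded[OF X] unfolding bounded_any_center[of "range X" x] by (auto simp: dist_commute)
 have C: "0 \<le> C" using F[of 0] decay_pos[of s "0 :: real^'n"] by (smt (verit) zero_le_mult_iff abs_ge_zero)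
 show "(\<lambda>k. LBINT y. u y * F (X k - y)) \<longlonglongrightarrow> (LBINT y. u y * F (x - y))"
 proof (rule integral_dominated_convergence[where w="\<lambda>y. (1 + M) powr ?a * C * \<bar>u y * decay s ((x - y) /\<^sub>R 1)\<bar>"])
  show "L1 (\<lambda>y. (1 + M) powr ?a * C * \<bar>u y * decay s ((x - y) /\<^sub>R 1)\<bar>)"
   by (intro integrable_mult_right integrable_abs L2_decay_integrable[OF s _ _ u, where C=1])
     (auto simp: abs_of_pos[OF decay_pos])
  show "AE y in lborel. norm (u y * F (X k - y)) \<le> (1 + M) powr ?a * C * \<bar>u y * decay s ((x - y) /\<^sub>R 1)\<bar>" for k
  proof (rule AE_I2)
   fix y
   have "decay s (X k - y) \<le> (1 + norm (X k - x)) powr ?a * decay s (x - y)"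
    using decay_translate[OF s, of "x - y" "X k - x"] by simp
   also have "\<dots> \<le> (1 + M) powr ?a * decay s (x - y)"
    using M[of k] s decay_pos[of s "x - y"] by (intro mult_right_mono powr_mono2) (auto simp: dist_norm)
   finally have "C * decay s (X k - y) \<le> C * ((1 + M) powr ?a * decay s (x - y))" using C by (intro mult_left_mono)
   then have "\<bar>F (X k - y)\<bar> \<le> C * ((1 + M) powr ?a * decay s (x - y))" using F[of "X k - y"] by linarith
   then have "\<bar>u y\<bar> * \<bar>F (X k - y)\<bar> \<le> \<bar>u y\<bar> * (C * ((1 + M) powr ?a * decay s (x - y)))" by (intro mult_left_mono) auto
   then show "norm (u y * F (X k - y)) \<le> (1 + M) powr ?a * C * \<bar>u y * decay s ((x - y) /\<^sub>R 1)\<bar>"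
    by (simp add: abs_mult abs_of_pos[OF decay_pos] mult_ac)
  qed
  show "AE y in lborel. (\<lambda>k. u y * F (X k - y)) \<longlonglongrightarrow> u y * F (x - y)"
   using cont
  proof eventually_elim
   case (elim y)
   have "(\<lambda>k. X k - y) \<longlonglongrightarrow> x - y" by (intro tendsto_intros X)
   then show ?case by (intro tendsto_mult_left isCont_tendsto_compose[OF elim])
  qed
 qed measurable
qed

lemma moll_minus: "moll s t (- x) = moll s t x"
proof -
 have "lapb s (- x /\<^sub>R r) = lapb s (x /\<^sub>R r)" for r by (rule lapb_radial) simp
 then show ?thesis by (simp add: moll_def)
qed

lemma moll_decay_t:
 assumes s: "0 < s" "s < 1" and t: "0 < t"
 obtains C where "0 < C" "\<And>x :: real^'n. \<bar>moll s t x\<bar> \<le> C * decay s x"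
proof -
 obtain C where C: "0 < C" "\<And>x :: real^'n. \<bar>moll s 1 x\<bar> \<le> C * decay s x" using moll_decay[OF s] by blast
 let ?C = "t powr (- real CARD('n)) * (C * max 1 t powr (real CARD('n) + 2 * s))"
 have "\<bar>moll s t x\<bar> \<le> ?C * decay s x" for x :: "real^'n"
 proof -
  have "\<bar>moll s 1 (x /\<^sub>R t)\<bar> \<le> C * (max 1 t powr (real CARD('n) + 2 * s) * decay s x)"
   using C(2)[of "x /\<^sub>R t"] decay_scale[OF s(1) t, of "max 1 t" x] C(1)
   by (meson max.cobounded1 max.cobounded2 mult_left_mono less_imp_le order_trans)
  then have "t powr (- real CARD('n)) * \<bar>moll s 1 (x /\<^sub>R t)\<bar> \<le> t powr (- real CARD('n)) * (C * (max 1 t powr (real CARD('n) + 2 * s) * decay s x))"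
   by (intro mult_left_mono) auto
  then show ?thesis by (simp add: moll_scale[OF t, of s x] abs_mult mult_ac)
 qed
 moreover have "0 < ?C" using C(1) t by simp
 ultimately show thesis using that by blast
qed

text \<open>What interior regularity uses of a weak solution: (-\<Delta>)^s u = g in \<Omega>,
  without the constant, tested with bumps only, where t^(2s) comes from the scaling of
  \<open>lapb\<close>; and |g| \<le> B|u|, through which every gain for u becomes a gain for
  g.\<close>

locale local_solution =
 fixes s B :: real and \<Omega> :: "(real^'n) set" and u g :: "real^'n \<Rightarrow> real"
 assumes s: "0 < s" "s < 1" and \<Omega>: "open \<Omega>" and B: "0 \<le> B"
  and u_meas [measurable]: "u \<in> borel_measurable borel" and u_L2: "L2 u"
  and g_meas [measurable]: "g \<in> borel_measurable borel" and u_int: "L1 (\<lambda>y. indicator \<Omega> y * u y)"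
  and g_le: "\<And>y. \<bar>g y\<bar> \<le> B * \<bar>indicator \<Omega> y * u y\<bar>"
  and eq: "\<And>x t. 0 < t \<Longrightarrow> cball x t \<subseteq> \<Omega> \<Longrightarrow> (LBINT y. u y * lapb s ((y - x) /\<^sub>R t)) = t powr (2 * s) * (LBINT y. g y * bumpd x t y)"
begin

text \<open>The slack \<open>e\<close> makes this set open, while membership still puts the closed
  ball of radius D inside \<Omega>.\<close>

definition inner_part :: "real \<Rightarrow> (real^'n) set" where
 "inner_part D = {x. \<exists>e>0. ball x (D + e) \<subseteq> \<Omega>}"

definition smooth_part :: "real \<Rightarrow> real^'n \<Rightarrow> real" where
 "smooth_part t x = (LBINT y. u y * moll s t (x - y))"

definition bump_avg :: "real \<Rightarrow> real^'n \<Rightarrow> real" where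
 "bump_avg r x = (LBINT y. g y * bumpd x r y)"

text \<open>The part between the scales d and R of a localised Riesz potential of g, of order 2s;
  only values of g within distance R of x enter.\<close>

definition potential :: "real \<Rightarrow> real \<Rightarrow> real^'n \<Rightarrow> real" where
 "potential d R x = (LBINT r. layer s d R r (bump_avg r) x)"

lemma inner_part_open: "open (inner_part D)"
proof (rule openI)
 fix x assume "x \<in> inner_part D"
 then obtain e where e: "0 < e" "ball x (D + e) \<subseteq> \<Omega>" by (auto simp: inner_part_def)
 have "y \<in> inner_part D" if "y \<in> ball x (e / 2)" for y
 proof -
  have "ball y (D + e / 2) \<subseteq> ball x (D + e)"
   using that dist_triangle[of x _ y] by (auto simp: subset_eq) (smt (verit) field_sum_of_halves)
  then show ?thesis using e by (auto simp: inner_part_def intro!: exI[of _ "e / 2"])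
 qed
 then show "\<exists>e>0. ball x e \<subseteq> inner_part D" using e(1) by (intro exI[of _ "e / 2"]) auto
qed

lemma inner_part_cball: "x \<in> inner_part D \<Longrightarrow> r \<le> D \<Longrightarrow> cball x r \<subseteq> \<Omega>"
 by (force simp: inner_part_def)

lemma inner_part_shift: "x \<in> inner_part D \<Longrightarrow> dist x y \<le> r \<Longrightarrow> y \<in> inner_part (D - r)"
proof -
 assume "x \<in> inner_part D" and xy: "dist x y \<le> r"
 then obtain e where e: "0 < e" "ball x (D + e) \<subseteq> \<Omega>" by (auto simp: inner_part_def)
 have "ball y (D - r + e) \<subseteq> ball x (D + e)"
  using xy dist_triangle[of x _ y] by (auto simp: subset_eq) (smt (verit))
 then show ?thesis using e by (auto simp: inner_part_def)
qed

lemma g_int: "L1 g"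
 by (rule bochner_bound[OF integrable_mult_right[OF integrable_abs[OF u_int], of B]])
   (use g_le B in \<open>auto simp: abs_mult\<close>)

lemma m_pos: "0 < moll_mass TYPE('n) s" by (rule moll_mass_pos[OF s])

lemma bump_avg_measurable [measurable (raw)]:
 assumes [measurable]: "a \<in> borel_measurable M" "b \<in> borel_measurable M"
 shows "(\<lambda>x. bump_avg (a x) (b x)) \<in> borel_measurable M"
proof -
 have [measurable]: "(\<lambda>p. bump_avg (fst p) (snd p)) \<in> borel_measurable (borel \<Otimes>\<^sub>M borel)"
  unfolding bump_avg_def bumpd_def by measurable
 have "(\<lambda>x. (a x, b x)) \<in> measurable M (borel \<Otimes>\<^sub>M borel)" by measurable
 from measurable_compose[OF this \<open>(\<lambda>p. bump_avg (fst p) (snd p)) \<in> _\<close>] show ?thesis by simp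
qed

lemma potential_measurable [measurable]: "potential d R \<in> borel_measurable borel"
 unfolding potential_def[abs_def] by measurable

lemma smooth_part_measurable [measurable]: "smooth_part t \<in> borel_measurable borel"
 unfolding smooth_part_def[abs_def] by measurable

lemma smooth_integrable: "0 < t \<Longrightarrow> L1 (\<lambda>y. u y * moll s t (x - y))"
proof -
 assume t: "0 < t"
 obtain C where C: "\<And>x :: real^'n. \<bar>moll s t x\<bar> \<le> C * decay s x" using moll_decay_t[OF s t] by blast
 have "L1 (\<lambda>y. u y * moll s t ((x - y) /\<^sub>R 1))"
  by (rule L2_decay_integrable[OF s(1) zero_less_one _ u_L2 _ C]) auto
 then show ?thesis by simp
qed

text \<open>\<open>moll s d - moll s R\<close> is an integral over d < r \<le> R of rescaled copies
  of \<open>lapb\<close>, and for each of them the equation trades u for r^(2s) times an average of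
  g. The two end scales remain as convolutions of u.\<close>

lemma representation_truncated:
 assumes x: "cball x R \<subseteq> \<Omega>" and d: "0 < d" "d \<le> R"
 shows "smooth_part d x = smooth_part R x + potential d R x"
proof -
 define T where "T = max 1 R"
 obtain C where C: "0 < C" "\<And>x :: real^'n. \<bar>lapb s x\<bar> \<le> C * decay s x" using lapb_decay[OF s] by blast
 define C' where "C' = C * T powr (real CARD('n) + 2 * s)"
 have iw: "L1 (\<lambda>r. indicator {d<..} r * r powr (- real CARD('n) - 1))"
  using powr_integral_at_top[OF card_pos[where 'n='n] d(1)] by (simp add: has_bochner_integral_iff)
 have iu: "L1 (\<lambda>y. C' * \<bar>u y * decay s ((x - y) /\<^sub>R 1)\<bar>)"
  by (intro integrable_mult_right integrable_abs L2_decay_integrable[OF s(1) _ _ u_L2, where C=1])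
    (auto simp: abs_of_pos[OF decay_pos])
 have F: "integrable lborel2 (\<lambda>(y, r). u y * (indicator {d<..R} r * (r powr (- real CARD('n) - 1) * lapb s ((x - y) /\<^sub>R r))))"
 proof (rule integrable_pair_bound[OF _ iu iw])
  show "\<bar>case (y, r) of (y, r) \<Rightarrow> u y * (indicator {d<..R} r * (r powr (- real CARD('n) - 1) * lapb s ((x - y) /\<^sub>R r)))\<bar>
    \<le> (C' * \<bar>u y * decay s ((x - y) /\<^sub>R 1)\<bar>) * (indicator {d<..} r * r powr (- real CARD('n) - 1))" for y r
  proof (cases "r \<in> {d<..R}")
   case True
   have "\<bar>lapb s ((x - y) /\<^sub>R r)\<bar> \<le> C * (T powr (real CARD('n) + 2 * s) * decay s (x - y))"
    using C(2)[of "(x - y) /\<^sub>R r"] decay_scale[OF s(1), of r T "x - y"] C(1) True d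
    by (auto simp: T_def intro: order_trans mult_left_mono)
   then have "(\<bar>u y\<bar> * r powr (- real CARD('n) - 1)) * \<bar>lapb s ((x - y) /\<^sub>R r)\<bar> \<le> (\<bar>u y\<bar> * r powr (- real CARD('n) - 1)) * (C * (T powr (real CARD('n) + 2 * s) * decay s (x - y)))"
    by (intro mult_left_mono) auto
   then show ?thesis using True by (simp add: C'_def abs_mult abs_of_pos[OF decay_pos] mult_ac)
  qed (use C(1) in \<open>auto simp: indicator_def C'_def T_def\<close>)
 qed measurable
 have "smooth_part d x - smooth_part R x = (LBINT y. u y * moll s d (x - y) - u y * moll s R (x - y))"
  unfolding smooth_part_def using smooth_integrable[of d x] smooth_integrable[of R x] d by simp
 also have "\<dots> = (LBINT y. u y * (moll s d (x - y) - moll s R (x - y)))" by (simp add: right_diff_distrib)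
 also have "\<dots> = (LBINT y. LBINT r. u y * (indicator {d<..R} r * (r powr (- real CARD('n) - 1) * lapb s ((x - y) /\<^sub>R r))))"
  unfolding moll_diff[OF s d, symmetric] by simp
 also have "\<dots> = (LBINT r. LBINT y. u y * (indicator {d<..R} r * (r powr (- real CARD('n) - 1) * lapb s ((x - y) /\<^sub>R r))))"
  using lborel_pair.Fubini_integral[OF F] by simp
 also have "\<dots> = potential d R x"
  unfolding potential_def
 proof (rule bochner_cong[OF refl])
  fix r :: real
  show "(LBINT y. u y * (indicator {d<..R} r * (r powr (- real CARD('n) - 1) * lapb s ((x - y) /\<^sub>R r))))
    = layer s d R r (bump_avg r) x"
  proof (cases "r \<in> {d<..R}")
   case True
   have lp: "lapb s ((x - y) /\<^sub>R r) = lapb s ((y - x) /\<^sub>R r)" for y by (rule lapb_radial) (simp add: norm_minus_commute)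
   have "cball x r \<subseteq> \<Omega>" using x True by auto
   then have "(LBINT y. u y * lapb s ((y - x) /\<^sub>R r)) = r powr (2 * s) * bump_avg r x"
    unfolding bump_avg_def using True d by (intro eq) auto
   moreover have "(LBINT y. u y * (indicator {d<..R} r * (r powr (- real CARD('n) - 1) * lapb s ((x - y) /\<^sub>R r))))
     = r powr (- real CARD('n) - 1) * (LBINT y. u y * lapb s ((y - x) /\<^sub>R r))"
    using True unfolding lp by (simp only: indicator_simps mult_1 mult.left_commute[of "u _"] integral_mult_right_zero)
   moreover have "r powr (- real CARD('n) - 1) * r powr (2 * s) = r powr (2 * s - 1 - real CARD('n))"
    by (simp only: powr_add[symmetric]) (simp add: algebra_simps)
   ultimately show ?thesis using True by (simp add: mult.assoc[symmetric])
  qed simp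
 qed
 finally show ?thesis by simp
qed

lemma bump_avg_integrable:
 assumes r: "0 < r"
 shows "L1 (bump_avg r)"
  and "(LBINT x. \<bar>bump_avg r x\<bar>) \<le> r ^ CARD('n) * ((LBINT x::real^'n. bump x) * (LBINT y. \<bar>g y\<bar>))"
proof -
 let ?k = "\<lambda>w :: real^'n. bump (w /\<^sub>R r)"
 have ik: "L1 ?k" using integrable_dilation_iff(1)[OF r, of bump "0 :: real^'n"] bump_integrable by simp
 have bk: "bumpd x r y = ?k (x - y)" for x y
  using bump_minus[of "(x - y) /\<^sub>R r"] by (simp add: bumpd_def algebra_simps)
 have F: "integrable lborel2 (\<lambda>(x, y). g y * bumpd x r y)"
  unfolding bk by (rule integrable_convolution_pair(2)[OF g_int ik])
 show "L1 (bump_avg r)"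
  using lborel_pair.integrable_fst[OF F] by (simp add: bump_avg_def[abs_def])
 have F': "integrable lborel2 (\<lambda>(x, y). \<bar>g y * bumpd x r y\<bar>)"
  using integrable_abs[OF F] by (simp add: case_prod_unfold)
 have "(LBINT x. \<bar>bump_avg r x\<bar>) \<le> (LBINT x. LBINT y. \<bar>g y * bumpd x r y\<bar>)"
  using lborel_pair.integrable_fst[OF F] lborel_pair.integrable_fst[OF F'] unfolding bump_avg_def
  by (intro bochner_mono integral_abs_bound) auto
 also have "\<dots> = (LBINT y. LBINT x. \<bar>g y * bumpd x r y\<bar>)"
  using lborel_pair.Fubini_integral[OF F'] by simp
 also have "\<dots> = (LBINT y. \<bar>g y\<bar> * (r ^ CARD('n) * (LBINT x::real^'n. bump x)))"
 proof (rule bochner_cong[OF refl])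
  fix y
  have "(LBINT x. \<bar>g y * bumpd x r y\<bar>) = (LBINT x. \<bar>g y\<bar> * bump ((x - y) /\<^sub>R r))"
   unfolding bk by (simp add: abs_mult abs_of_nonneg[OF bump_nonneg])
  then show "(LBINT x. \<bar>g y * bumpd x r y\<bar>) = \<bar>g y\<bar> * (r ^ CARD('n) * (LBINT x::real^'n. bump x))"
   using integral_dilation(1)[OF r, of bump y] by simp
 qed
 also have "\<dots> = r ^ CARD('n) * ((LBINT x::real^'n. bump x) * (LBINT y. \<bar>g y\<bar>))"
  by simp
 finally show "(LBINT x. \<bar>bump_avg r x\<bar>) \<le> r ^ CARD('n) * ((LBINT x::real^'n. bump x) * (LBINT y. \<bar>g y\<bar>))" .
qed

text \<open>At this stage g is only known to be in L^1, so the potential exists merely as an L^1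
  function: the average at radius r has L^1 norm O(r^n), which reduces the weight to
  r^(2s-1).\<close>

lemma potential_pair_integrable:
 assumes R: "0 < R"
 shows "integrable lborel2 (\<lambda>(r, x). layer s 0 R r (bump_avg r) x)"
proof (rule lborel_pair.Fubini_integrable)
 let ?c = "(LBINT x::real^'n. bump x) * (LBINT y. \<bar>g y\<bar>)"
 have "L1 (\<lambda>r. ?c * (indicator {0<..<R + 1} r * r powr (2 * s - 1)))"
  using powr_integral_at_0[of "2 * s" "R + 1"] s R by (intro integrable_mult_right) (auto simp: has_bochner_integral_iff)
 then show "L1 (\<lambda>r. LBINT x. norm (case (r, x) of (r, x) \<Rightarrow> layer s 0 R r (bump_avg r) x))"
 proof (rule bochner_bound)
  show "AE r in lborel. norm (LBINT x. norm (case (r, x) of (r, x) \<Rightarrow> layer s 0 R r (bump_avg r) x))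
    \<le> norm (?c * (indicator {0<..<R + 1} r * r powr (2 * s - 1)))"
  proof (rule AE_I2)
   fix r :: real
   show "norm (LBINT x. norm (case (r, x) of (r, x) \<Rightarrow> layer s 0 R r (bump_avg r) x))
    \<le> norm (?c * (indicator {0<..<R + 1} r * r powr (2 * s - 1)))"
   proof (cases "r \<in> {0<..R}")
    case True
    have c: "0 \<le> ?c" using bump_integral_pos[where 'n='n] by (intro mult_nonneg_nonneg integral_nonneg_AE AE_I2) (auto simp: bump_nonneg)
    have "r powr (2 * s - 1 - real CARD('n)) * (LBINT x. \<bar>bump_avg r x\<bar>) \<le> r powr (2 * s - 1 - real CARD('n)) * (r ^ CARD('n) * ?c)"
     using True by (intro mult_left_mono bump_avg_integrable(2)) auto
    also have "\<dots> = (r powr (2 * s - 1 - real CARD('n)) * r powr real CARD('n)) * ?c" using True by (simp add: powr_realpow)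
    also have "r powr (2 * s - 1 - real CARD('n)) * r powr real CARD('n) = r powr (2 * s - 1)" by (simp only: powr_add[symmetric]) simp
    finally have le: "r powr (2 * s - 1 - real CARD('n)) * (LBINT x. \<bar>bump_avg r x\<bar>) \<le> r powr (2 * s - 1) * ?c" .
    have "0 \<le> (LBINT x. \<bar>bump_avg r x\<bar>)" by (intro integral_nonneg_AE AE_I2) auto
    then show ?thesis using True le by (simp add: abs_mult abs_of_pos[OF bump_integral_pos] mult.commute)
   qed simp
  qed
 qed measurable
 show "AE r in lborel. L1 (\<lambda>x. case (r, x) of (r, x) \<Rightarrow> layer s 0 R r (bump_avg r) x)"
 proof (rule AE_I2)
  fix r :: real
  show "L1 (\<lambda>x. case (r, x) of (r, x) \<Rightarrow> layer s 0 R r (bump_avg r) x)"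
   using bump_avg_integrable(1)[of r] by (cases "r \<in> {0<..R}") auto
 qed
qed measurable

lemma potential_0_integrable: "0 < R \<Longrightarrow> L1 (potential 0 R)"
 using lborel_pair.integrable_snd[OF potential_pair_integrable] by (simp add: potential_def[abs_def])

lemma smooth_part_bounded:
 assumes "0 < t" obtains M where "0 \<le> M" "\<And>x. \<bar>smooth_part t x\<bar> \<le> M"
proof -
 obtain C where C: "\<And>x :: real^'n. \<bar>moll s t x\<bar> \<le> C * decay s x" using moll_decay_t[OF s assms] by blast
 show thesis using conv_bounded[OF s(1) zero_less_one u_meas u_L2 _ C] that unfolding smooth_part_def by auto
qed

lemma smooth_part_continuous:
 assumes "0 < t" shows "isCont (smooth_part t) x"
proof -
 obtain C where C: "\<And>x :: real^'n. \<bar>moll s t x\<bar> \<le> C * decay s x" using moll_decay_t[OF s assms] by blast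
 have "isCont (moll s t) (x - y)" for y :: "real^'n"
  using moll_continuous[OF s assms] unfolding continuous_on_eq_continuous_at[OF open_UNIV] by blast
 then show ?thesis unfolding smooth_part_def[abs_def] by (intro conv_continuous[OF s(1) u_meas u_L2 _ C]) auto
qed

text \<open>A majorant uniform in the scale d, for dominated convergence against u. Near the box the
  L^1 norm of \<open>moll s 1\<close> suffices; far from it, \<open>kern_le_abs\<close> bounds the
  rescaled tail by the kernel itself, whatever d \<le> 1 is.\<close>

lemma moll_box_bound:
 obtains K where "0 \<le> K" "\<And>d y. 0 < d \<Longrightarrow> d \<le> 1 \<Longrightarrow>
  \<bar>LBINT z. moll s 1 z * indicator (box a b) (y - d *\<^sub>R z :: real^'n)\<bar> \<le> K * decay s y"
proof -
 let ?a = "real CARD('n) + 2 * s" and ?i = "indicator (box a b) :: real^'n \<Rightarrow> real"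
 obtain C where C: "0 < C" "\<And>x :: real^'n. \<bar>moll s 1 x\<bar> \<le> C * decay s x" using moll_decay[OF s] by blast
 obtain M where M: "1 \<le> M" "box a b \<subseteq> ball 0 M"
 proof -
  obtain M where "0 < M" "box a b \<subseteq> ball 0 M" using bounded_box[of a b] bounded_subset_ballD by blast
  then show thesis using that[of "max 1 M"] by fastforce
 qed
 define V where "V = measure lborel (box a b)"
 have iV: "L1 ?i" using emeasure_lborel_box_finite[of a b] by (simp add: integrable_real_indicator)
 define I where "I = (LBINT z. \<bar>moll s 1 (z :: real^'n)\<bar>)"
 have I: "0 \<le> I" unfolding I_def by (intro integral_nonneg_AE AE_I2) auto
 define K1 where "K1 = (1 + 2 * M) powr ?a * I"
 define K2 where "K2 = V * (C * (2 powr ?a * (1 + M) powr ?a))"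
 have K: "0 \<le> K1" "0 \<le> K2" using I C(1) by (auto simp: K1_def K2_def V_def)
 have "\<bar>LBINT z. moll s 1 z * ?i (y - d *\<^sub>R z)\<bar> \<le> (K1 + K2) * decay s y" if d: "0 < d" "d \<le> 1" for d y
 proof (cases "norm y \<le> 2 * M")
  case True
  have "\<bar>LBINT z. moll s 1 z * ?i (y - d *\<^sub>R z)\<bar> \<le> (LBINT z. \<bar>moll s 1 z * ?i (y - d *\<^sub>R z)\<bar>)" by (rule integral_abs_bound)
  also have "\<dots> \<le> I"
   unfolding I_def
  proof (rule bochner_mono)
   show "L1 (\<lambda>z. \<bar>moll s 1 z * ?i (y - d *\<^sub>R z)\<bar>)"
    by (rule bochner_bound[OF moll_1_integrable[OF s]]) (auto simp: indicator_def)
  qed (auto simp: indicator_def intro!: integrable_abs moll_1_integrable[OF s])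
  also have "I \<le> K1 * decay s y"
  proof -
   have "(1 + norm y) powr ?a \<le> (1 + 2 * M) powr ?a" using True s by (intro powr_mono2) auto
   moreover have "0 < 1 + norm y" using norm_ge_zero[of y] by linarith
   ultimately have "1 \<le> (1 + 2 * M) powr ?a * decay s y" unfolding decay_eq by (simp add: field_simps)
   then have "I * 1 \<le> I * ((1 + 2 * M) powr ?a * decay s y)" using I by (intro mult_left_mono)
   then show ?thesis by (simp add: K1_def mult_ac)
  qed
  also have "\<dots> \<le> (K1 + K2) * decay s y" using K decay_pos[of s y] by (intro mult_right_mono) auto
  finally show ?thesis .
 next
  case False
  have bd: "\<bar>moll s d (y - x) * ?i x\<bar> \<le> C * (2 powr ?a * (1 + M) powr ?a) * decay s y * ?i x" for x
  proof (cases "x \<in> box a b")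
   case True
   then have x: "norm x < M" using M by auto
   have far: "1 \<le> norm (y - x)" using False x M norm_triangle_ineq2[of y x] by linarith
   then have ne: "y - x \<noteq> 0" by auto
   have "d powr - ?a * decay s ((y - x) /\<^sub>R d) \<le> kern s 1 (y - x)"
    using kern_le_abs[OF s(1) d(1) ne] far by (simp add: kern_def)
   also have "\<dots> \<le> 2 powr ?a * decay s (y - x)" using kern_le_decay[OF s(1), of 1 "y - x"] by simp
   also have "decay s (y - x) \<le> (1 + M) powr ?a * decay s y"
   proof -
    have "decay s (y + - x) \<le> (1 + norm (- x)) powr ?a * decay s y" by (rule decay_translate[OF s(1)])
    also have "\<dots> \<le> (1 + M) powr ?a * decay s y"
     using x s decay_pos[of s y] by (intro mult_right_mono powr_mono2) auto
    finally show ?thesis by simp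
   qed
   finally have 1: "d powr - ?a * decay s ((y - x) /\<^sub>R d) \<le> 2 powr ?a * ((1 + M) powr ?a * decay s y)" by simp
   have "\<bar>moll s d (y - x)\<bar> = d powr - real CARD('n) * \<bar>moll s 1 ((y - x) /\<^sub>R d)\<bar>"
    by (simp add: moll_scale[OF d(1), of s "y - x"] abs_mult)
   also have "\<dots> \<le> d powr - real CARD('n) * (C * decay s ((y - x) /\<^sub>R d))" by (intro mult_left_mono C) simp
   also have "\<dots> \<le> d powr - ?a * (C * decay s ((y - x) /\<^sub>R d))"
    using C(1) d s decay_pos[of s "(y - x) /\<^sub>R d"] by (intro mult_right_mono powr_mono' mult_nonneg_nonneg) auto
   also have "\<dots> = C * (d powr - ?a * decay s ((y - x) /\<^sub>R d))" by simp
   also have "\<dots> \<le> C * (2 powr ?a * ((1 + M) powr ?a * decay s y))" using C(1) 1 by (intro mult_left_mono) auto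
   finally show ?thesis using True by (simp add: mult_ac)
  qed simp
  have "\<bar>LBINT z. moll s 1 z * ?i (y - d *\<^sub>R z)\<bar> = \<bar>LBINT x. moll s d (y - x) * ?i x\<bar>"
   by (simp add: moll_convolution[OF d(1)])
  also have "\<dots> \<le> (LBINT x. \<bar>moll s d (y - x) * ?i x\<bar>)" by (rule integral_abs_bound)
  also have "\<dots> \<le> (LBINT x. C * (2 powr ?a * (1 + M) powr ?a) * decay s y * ?i x)"
  proof (rule bochner_mono[OF _ integrable_mult_right[OF iV] bd])
   show "L1 (\<lambda>x. \<bar>moll s d (y - x) * ?i x\<bar>)"
    by (rule bochner_bound[OF integrable_mult_right[OF iV, of "C * (2 powr ?a * (1 + M) powr ?a) * decay s y"]])
      (use bd in \<open>auto intro: order_trans[OF _ abs_ge_self]\<close>)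
  qed
  also have "\<dots> = K2 * decay s y" by (simp add: K2_def V_def mult_ac)
  also have "\<dots> \<le> (K1 + K2) * decay s y" using K decay_pos[of s y] by (intro mult_right_mono) auto
  finally show ?thesis .
 qed
 then show thesis using that[of "K1 + K2"] K by auto
qed

text \<open>The limit d to 0 of the truncated formula is taken against indicators of boxes, since u
  is only in L^2: the convolution at scale d is moved onto the indicator, where it converges almost
  everywhere to the mass times the indicator.\<close>

lemma representation_AE:
 assumes R: "0 < R"
 shows "AE x in lborel. x \<in> inner_part R \<longrightarrow> moll_mass TYPE('n) s * u x = smooth_part R x + potential 0 R x"
proof -
 have "AE x in lborel. x \<in> inner_part R \<longrightarrow> moll_mass TYPE('n) s * u x - (smooth_part R x + potential 0 R x) = 0"
 proof (rule AE_zero_on_open[OF inner_part_open])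
  fix a b assume sub: "box a b \<subseteq> inner_part R"
  let ?i = "indicator (box a b) :: real^'n \<Rightarrow> real"
  have fin: "emeasure lborel (box a b) < \<infinity>" by (rule emeasure_lborel_box_finite)
  have ii: "L1 ?i" using fin by (simp add: integrable_real_indicator)
  have iu: "L1 (\<lambda>x. ?i x * u x)" by (rule L2_set_integrable[OF _ u_L2 _ fin]) auto
  have ism: "L1 (\<lambda>x. ?i x * smooth_part t x)" if t: "0 < t" for t
  proof -
   obtain M where "0 \<le> M" and M: "\<And>x. \<bar>smooth_part t x\<bar> \<le> M" using smooth_part_bounded[OF t] by blast
   show ?thesis
    by (rule bochner_bound[OF integrable_mult_right[OF ii, of M]])
      (use M order_trans[OF M abs_ge_self] in \<open>auto simp: indicator_def\<close>)
  qed
  have ip: "L1 (\<lambda>x. ?i x * potential 0 R x)"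
   using integrable_mult_indicator[OF _ potential_0_integrable[OF R], of "box a b"] by simp
  show "L1 (\<lambda>x. ?i x * (moll_mass TYPE('n) s * u x - (smooth_part R x + potential 0 R x)))"
   using bochner_integrable_diff[OF integrable_mult_right[OF iu, of "moll_mass TYPE('n) s"] bochner_integrable_add[OF ism[OF R] ip]]
   by (simp add: algebra_simps)
  define e :: "nat \<Rightarrow> real" where "e k = min 1 R * inverse (real (Suc k))" for k
  have pos: "0 < e k" for k using R by (simp add: e_def)
  have le: "e k \<le> min 1 R * 1" for k unfolding e_def using R by (intro mult_left_mono) (auto simp: inverse_le_1_iff)
  have e: "0 < e k" "e k \<le> 1" "e k \<le> R" for k using pos[of k] le[of k] by auto
  have e0: "e \<longlonglongrightarrow> 0" unfolding e_def using LIMSEQ_inverse_real_of_nat by (intro tendsto_mult_right_zero) simp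
  define J where "J p = (case p of (r, x) \<Rightarrow> layer s 0 R r (bump_avg r) x * ?i x)" for p
  have iJ: "integrable lborel2 J"
  proof (rule bochner_bound[OF potential_pair_integrable[OF R]])
   show "AE p in lborel2. norm (J p) \<le> norm (case p of (r, x) \<Rightarrow> layer s 0 R r (bump_avg r) x)"
    by (intro AE_I2) (auto simp: J_def indicator_def)
   show "J \<in> borel_measurable lborel2" unfolding J_def[abs_def] by measurable
  qed
  have [measurable]: "J \<in> borel_measurable lborel2" using iJ by auto
  have pot: "(LBINT x. ?i x * potential d R x) = (\<integral>p. indicator {d<..} (fst p) * J p \<partial>lborel2)"
   "L1 (\<lambda>x. ?i x * potential d R x)" if "0 \<le> d" for d
  proof -
   have "integrable lborel2 (\<lambda>(r, x). indicator {d<..} r * J (r, x))"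
    by (rule bochner_bound[OF iJ]) (auto simp: indicator_def)
   note snd = lborel_pair.integral_snd[OF this] lborel_pair.integrable_snd[OF this]
   have eqx: "(LBINT r. indicator {d<..} r * J (r, x)) = ?i x * potential d R x" for x
   proof -
    have "(\<lambda>r. indicator {d<..} r * J (r, x)) = (\<lambda>r. ?i x * (layer s d R r (bump_avg r) x))"
     using that by (auto simp: J_def fun_eq_iff indicator_def)
    then show ?thesis by (simp only: potential_def integral_mult_right_zero)
   qed
   show "(LBINT x. ?i x * potential d R x) = (\<integral>p. indicator {d<..} (fst p) * J p \<partial>lborel2)"
    "L1 (\<lambda>x. ?i x * potential d R x)"
    using snd unfolding eqx by (auto simp: case_prod_unfold)
  qed
  have L1: "(\<lambda>k. LBINT x. ?i x * potential (e k) R x) \<longlonglongrightarrow> (LBINT x. ?i x * potential 0 R x)"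
   unfolding pot(1)[OF less_imp_le[OF e(1)]] pot(1)[OF order_refl]
  proof (rule integral_dominated_convergence[where w="\<lambda>p. \<bar>J p\<bar>"])
   show "AE p in lborel2. (\<lambda>k. indicator {e k<..} (fst p) * J p) \<longlonglongrightarrow> indicator {0<..} (fst p) * J p"
   proof (rule AE_I2)
    fix p
    show "(\<lambda>k. indicator {e k<..} (fst p) * J p) \<longlonglongrightarrow> indicator {0<..} (fst p) * J p"
    proof (cases "0 < fst p")
     case True
     then have "\<forall>\<^sub>F k in sequentially. e k < fst p" using e0 by (intro order_tendstoD) auto
     then have "\<forall>\<^sub>F k in sequentially. indicator {0<..} (fst p) * J p = indicator {e k<..} (fst p) * J p"
      by eventually_elim (use True in simp)
     then show ?thesis by (rule Lim_transform_eventually[OF tendsto_const])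
    next
     case False
     then have "(\<lambda>k. indicator {e k<..} (fst p) * J p) = (\<lambda>k. 0)" using e(1) by (auto simp: fun_eq_iff indicator_def intro: order.trans less_imp_le dest: order.strict_trans)
     then show ?thesis using False by simp
    qed
   qed
  qed (use iJ in \<open>auto simp: indicator_def\<close>)
  have L2: "(\<lambda>k. LBINT x. ?i x * smooth_part (e k) x) \<longlonglongrightarrow> (LBINT y. u y * (moll_mass TYPE('n) s * ?i y))"
  proof -
   have sw: "(LBINT x. ?i x * smooth_part d x) = (LBINT y. u y * (LBINT z. moll s 1 z * ?i (y - d *\<^sub>R z)))" if d: "0 < d" for d
   proof -
    obtain C where C: "0 < C" "\<And>x :: real^'n. \<bar>moll s d x\<bar> \<le> C * decay s x" using moll_decay_t[OF s d] by blast
    have im: "L1 (\<lambda>z :: real^'n. C * decay s z)" by (intro integrable_mult_right decay_integrable s)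
    have i2: "L2 ?i"
     using ii by (rule back_subst[where P="L1"]) (auto simp: fun_eq_iff indicator_def)
    have W: "integrable lborel2 (\<lambda>p. ?i (fst p) * u (snd p) * (C * decay s (fst p - snd p)))"
     using integrable_convolution_pair(1)[OF i2 im] integrable_convolution_pair(2)[OF u_L2 im] less_imp_le[OF C(1)]
     by (intro integrable_mult_weight mult_nonneg_nonneg less_imp_le[OF decay_pos]) (auto simp: case_prod_unfold)
    have F: "integrable lborel2 (\<lambda>(x, y). ?i x * (u y * moll s d (x - y)))"
    proof (rule bochner_bound[OF W])
     show "AE p in lborel2. norm (case p of (x, y) \<Rightarrow> ?i x * (u y * moll s d (x - y))) \<le> norm (?i (fst p) * u (snd p) * (C * decay s (fst p - snd p)))"
      using C abs_ge_self order_trans by (intro AE_I2) (auto simp: abs_mult abs_of_pos[OF decay_pos] indicator_def intro!: mult_left_mono)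
    qed measurable
    have "(LBINT x. ?i x * smooth_part d x) = (LBINT x. LBINT y. ?i x * (u y * moll s d (x - y)))"
     by (simp add: smooth_part_def)
    also have "\<dots> = (LBINT y. LBINT x. ?i x * (u y * moll s d (x - y)))"
     using lborel_pair.Fubini_integral[OF F] by simp
    also have "\<dots> = (LBINT y. u y * (LBINT z. moll s 1 z * ?i (y - d *\<^sub>R z)))"
    proof (rule bochner_cong[OF refl])
     fix y :: "real^'n"
     have "moll s d (x - y) = moll s d (y - x)" for x using moll_minus[of s d "x - y"] by simp
     then have "(LBINT x. ?i x * (u y * moll s d (x - y))) = u y * (LBINT x. moll s d (y - x) * ?i x)"
      by (simp only: mult.left_commute[of "?i _" "u y"] integral_mult_right_zero mult.commute[of "?i _" "moll s d _"])
     then show "(LBINT x. ?i x * (u y * moll s d (x - y))) = u y * (LBINT z. moll s 1 z * ?i (y - d *\<^sub>R z))"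
      by (simp only: moll_convolution[OF d])
    qed
    finally show ?thesis .
   qed
   obtain K where K: "0 \<le> K" "\<And>d y. 0 < d \<Longrightarrow> d \<le> 1 \<Longrightarrow> \<bar>LBINT z. moll s 1 z * ?i (y - d *\<^sub>R z :: real^'n)\<bar> \<le> K * decay s y"
    using moll_box_bound[of a b] by blast
   show ?thesis
    unfolding sw[OF e(1)]
   proof (rule integral_dominated_convergence[where w="\<lambda>y. K * \<bar>u y * decay s ((0 - y) /\<^sub>R 1)\<bar>"])
    show "L1 (\<lambda>y. K * \<bar>u y * decay s ((0 - y) /\<^sub>R 1)\<bar>)"
     by (intro integrable_mult_right integrable_abs L2_decay_integrable[OF s(1) _ _ u_L2, where C=1])
       (auto simp: abs_of_pos[OF decay_pos])
    show "AE y in lborel. norm (u y * (LBINT z. moll s 1 z * ?i (y - e k *\<^sub>R z))) \<le> K * \<bar>u y * decay s ((0 - y) /\<^sub>R 1)\<bar>" for k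
    proof (rule AE_I2)
     fix y
     have "\<bar>u y\<bar> * \<bar>LBINT z. moll s 1 z * ?i (y - e k *\<^sub>R z)\<bar> \<le> \<bar>u y\<bar> * (K * decay s y)"
      by (intro mult_left_mono K e) auto
     then show "norm (u y * (LBINT z. moll s 1 z * ?i (y - e k *\<^sub>R z))) \<le> K * \<bar>u y * decay s ((0 - y) /\<^sub>R 1)\<bar>"
      by (simp add: abs_mult decay_minus abs_of_pos[OF decay_pos] mult_ac)
    qed
    show "AE y in lborel. (\<lambda>k. u y * (LBINT z. moll s 1 z * ?i (y - e k *\<^sub>R z))) \<longlonglongrightarrow> u y * (moll_mass TYPE('n) s * ?i y)"
     using isCont_indicator_box[of a b]
    proof eventually_elim
     case (elim y)
     have "(\<lambda>k. LBINT z. moll s 1 z * ?i (y - e k *\<^sub>R z)) \<longlonglongrightarrow> moll_mass TYPE('n) s * ?i y"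
      unfolding moll_mass_def
      by (rule approximate_identity[OF moll_1_integrable[OF s] _ _ elim e0, of 1]) (auto simp: indicator_def)
     then show ?case by (intro tendsto_intros)
    qed
   qed measurable
  qed
  have step: "(LBINT x. ?i x * smooth_part (e k) x) = (LBINT x. ?i x * smooth_part R x) + (LBINT x. ?i x * potential (e k) R x)" for k
  proof -
   have "?i x * smooth_part (e k) x = ?i x * smooth_part R x + ?i x * potential (e k) R x" for x
   proof (cases "x \<in> box a b")
    case True
    then have "cball x R \<subseteq> \<Omega>" using sub inner_part_cball[of x R R] by auto
    from representation_truncated[OF this e(1,3)] show ?thesis by (simp add: distrib_left)
   qed simp
   then show ?thesis using bochner_add[OF ism[OF R] pot(2)[OF less_imp_le[OF e(1)]]] by simp
  qed
  have "(\<lambda>k. LBINT x. ?i x * smooth_part (e k) x) \<longlonglongrightarrow> (LBINT x. ?i x * smooth_part R x) + (LBINT x. ?i x * potential 0 R x)"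
   unfolding step by (intro tendsto_intros L1)
  from LIMSEQ_unique[OF this L2]
  have "(LBINT x. ?i x * smooth_part R x) + (LBINT x. ?i x * potential 0 R x) = moll_mass TYPE('n) s * (LBINT y. ?i y * u y)"
   by (simp only: mult.left_commute[of "u _" "moll_mass TYPE('n) s"] integral_mult_right_zero mult.commute[of "u _" "?i _"])
  moreover have "(\<lambda>x. ?i x * (moll_mass TYPE('n) s * u x - (smooth_part R x + potential 0 R x))) = (\<lambda>x. moll_mass TYPE('n) s * (?i x * u x) - (?i x * smooth_part R x + ?i x * potential 0 R x))"
   by (simp add: fun_eq_iff algebra_simps)
  ultimately show "(LBINT x. ?i x * (moll_mass TYPE('n) s * u x - (smooth_part R x + potential 0 R x))) = 0"
   using bochner_diff[OF integrable_mult_right[OF iu, of "moll_mass TYPE('n) s"] bochner_integrable_add[OF ism[OF R] ip]]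
    bochner_add[OF ism[OF R] ip] by simp
 qed
 then show ?thesis by eventually_elim auto
qed

end

section \<open>The Morrey bootstrap and the continuous representative\<close>

lemma powr_integral_at_0_closed:
 fixes p R :: real
 assumes "0 < p" "0 \<le> R"
 shows "has_bochner_integral lborel (\<lambda>t. indicator {0<..R} t * t powr (p - 1)) (R powr p / p)"
proof -
 have "AE t in lborel. indicator {0<..R} t * t powr (p - 1) = indicator {0<..<R} t * t powr (p - 1)"
  using AE_lborel_singleton[of R] by eventually_elim (auto simp: indicator_def)
 then show ?thesis using powr_integral_at_0[OF assms] by (subst has_bochner_integral_cong_AE) auto
qed

lemma continuous_AE_zero:
 fixes f :: "'a::euclidean_space \<Rightarrow> real"
 assumes U: "open U" and f: "continuous_on U f" and z: "AE x in lborel. x \<in> U \<longrightarrow> f x = 0" and x: "x \<in> U"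
 shows "f x = 0"
proof (rule ccontr)
 assume "f x \<noteq> 0"
 let ?A = "U \<inter> f -` (- {0})"
 have "open ?A" by (intro continuous_open_preimage f U) auto
 moreover have "?A \<noteq> {}" using x \<open>f x \<noteq> 0\<close> by auto
 ultimately have "\<not> negligible ?A" by (rule open_not_negligible)
 moreover have "?A \<in> null_sets lborel"
  using z \<open>open ?A\<close> by (subst AE_iff_null_sets) (auto elim!: eventually_mono)
 then have "negligible ?A" unfolding negligible_iff_null_sets by (rule null_sets_completionI)
 ultimately show False by simp
qed

text \<open>The trade-off behind the bootstrap: e powers of the layer radius r are given up for e
  powers of the ball radius \<rho>. After \<rho> + r \<le> 2 \<open>max \<rho> r\<close>, each of
  the two cases replaces the smaller radius by the larger one in a nonnegative power.\<close>

lemma min_max_powr: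
 fixes \<rho> r N \<sigma> e :: real
 assumes p: "0 < \<rho>" "0 < r" and e: "0 \<le> e" "e \<le> \<sigma>" "\<sigma> \<le> N"
 shows "min \<rho> r powr N * (\<rho> + r) powr (N - \<sigma>) \<le> 2 powr (N - \<sigma>) * (\<rho> powr (N - \<sigma> + e) * r powr (N - e))"
proof -
 have "min \<rho> r powr N * (\<rho> + r) powr (N - \<sigma>) \<le> min \<rho> r powr N * (2 * max \<rho> r) powr (N - \<sigma>)"
  using p e by (intro mult_left_mono powr_mono2) auto
 also have "\<dots> = 2 powr (N - \<sigma>) * (min \<rho> r powr N * max \<rho> r powr (N - \<sigma>))"
  using p by (simp add: powr_mult)
 also have "\<dots> \<le> 2 powr (N - \<sigma>) * (\<rho> powr (N - \<sigma> + e) * r powr (N - e))"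
 proof (rule mult_left_mono)
  show "min \<rho> r powr N * max \<rho> r powr (N - \<sigma>) \<le> \<rho> powr (N - \<sigma> + e) * r powr (N - e)"
  proof (cases "r \<le> \<rho>")
   case True
   have "r powr N * \<rho> powr (N - \<sigma>) = (r powr (N - e) * \<rho> powr (N - \<sigma>)) * r powr e"
    by (simp add: powr_add[symmetric])
   also have "\<dots> \<le> (r powr (N - e) * \<rho> powr (N - \<sigma>)) * \<rho> powr e" using True p e by (intro mult_left_mono powr_mono2) auto
   also have "\<dots> = \<rho> powr (N - \<sigma> + e) * r powr (N - e)" by (simp add: powr_add)
   finally show ?thesis using True by (simp add: min.absorb2 max.absorb1)
  next
   case False
   have "\<rho> powr N * r powr (N - \<sigma>) = (\<rho> powr (N - \<sigma> + e) * r powr (N - \<sigma>)) * \<rho> powr (\<sigma> - e)"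
    by (simp add: powr_add[symmetric] mult.assoc mult.left_commute)
   also have "\<dots> \<le> (\<rho> powr (N - \<sigma> + e) * r powr (N - \<sigma>)) * r powr (\<sigma> - e)" using False p e by (intro mult_left_mono powr_mono2) auto
   also have "\<dots> = \<rho> powr (N - \<sigma> + e) * r powr (N - e)" by (simp add: mult.assoc powr_add[symmetric])
   finally show ?thesis using False by (simp add: min.absorb1 max.absorb2)
  qed
 qed simp
 finally show ?thesis .
qed

context local_solution
begin

definition mass :: "real^'n \<Rightarrow> real \<Rightarrow> real" where
 "mass x \<rho> = (LBINT y. indicator (cball x \<rho>) y * \<bar>indicator \<Omega> y * u y\<bar>)"

lemma mass_integrable: "L1 (\<lambda>y. indicator (cball x \<rho>) y * \<bar>indicator \<Omega> y * u y\<bar>)"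
 using integrable_mult_indicator[OF _ integrable_abs[OF u_int], of "cball x \<rho>"] by simp

lemma mass_le: "mass x \<rho> \<le> (LBINT y. \<bar>indicator \<Omega> y * u y\<bar>)"
 unfolding mass_def
 by (rule bochner_mono[OF mass_integrable integrable_abs[OF u_int]]) (auto simp: indicator_def)

lemma bump_avg_le:
 assumes r: "0 < r"
 shows "\<bar>bump_avg r x\<bar> \<le> (LBINT y. \<bar>g y\<bar> * bumpd x r y)" and "\<bar>bump_avg r x\<bar> \<le> B * mass x r"
proof -
 have i: "L1 (\<lambda>y. \<bar>g y\<bar> * bumpd x r y)"
  by (rule bochner_bound[OF integrable_abs[OF g_int]]) (auto simp: abs_mult bumpd_bounds mult_left_le)
 show 1: "\<bar>bump_avg r x\<bar> \<le> (LBINT y. \<bar>g y\<bar> * bumpd x r y)"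
  unfolding bump_avg_def using integral_abs_bound[of lborel "\<lambda>y. g y * bumpd x r y"]
  by (simp add: abs_mult abs_of_nonneg[OF bumpd_bounds(1)])
 also have "\<dots> \<le> (LBINT y. B * (indicator (cball x r) y * \<bar>indicator \<Omega> y * u y\<bar>))"
 proof (rule bochner_mono[OF i integrable_mult_right[OF mass_integrable]])
  fix y
  show "\<bar>g y\<bar> * bumpd x r y \<le> B * (indicator (cball x r) y * \<bar>indicator \<Omega> y * u y\<bar>)"
  proof (cases "y \<in> cball x r")
   case True
   have "\<bar>g y\<bar> * bumpd x r y \<le> \<bar>g y\<bar> * 1" by (intro mult_left_mono bumpd_bounds) auto
   then show ?thesis using g_le[of y] True by simp
  qed (simp add: bumpd_outside[OF r])
 qed
 finally show "\<bar>bump_avg r x\<bar> \<le> B * mass x r" by (simp add: mass_def)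
qed

text \<open>By Fubini each y is weighted by at most the volume of the intersection of two balls, of
  radius \<rho> about x and r about y. This is bounded by the smaller of the two volumes, and the
  weight is 0 unless y lies within \<rho> + r of x.\<close>

lemma bump_avg_ball:
 assumes r: "0 < r" and \<rho>: "0 < \<rho>"
 shows "(LBINT x'. indicator (cball x \<rho>) x' * \<bar>bump_avg r x'\<bar>)
  \<le> unit_ball_vol (real CARD('n)) * min \<rho> r powr real CARD('n) * (B * mass x (\<rho> + r))"
proof -
 let ?i = "indicator (cball x \<rho>) :: real^'n \<Rightarrow> real" and ?V = "unit_ball_vol (real CARD('n))"
 have ii: "L1 ?i" by (rule integrable_real_indicator[OF _ emeasure_lborel_cball_finite]) simp
 have [measurable]: "cball x \<rho> \<in> sets borel" by simp
 have H: "integrable lborel2 (\<lambda>(x', y). ?i x' * (\<bar>g y\<bar> * bumpd x' r y))"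
 proof (rule integrable_pair_bound[OF _ ii integrable_abs[OF g_int]])
  show "(\<lambda>(x', y). ?i x' * (\<bar>g y\<bar> * bumpd x' r y)) \<in> borel_measurable lborel2"
   unfolding bumpd_def by measurable
  show "\<bar>case (x', y) of (x', y) \<Rightarrow> ?i x' * (\<bar>g y\<bar> * bumpd x' r y)\<bar> \<le> ?i x' * \<bar>g y\<bar>" for x' y
   by (auto simp: abs_mult indicator_def bumpd_bounds mult_left_le)
 qed
 have "(LBINT x'. ?i x' * \<bar>bump_avg r x'\<bar>) \<le> (LBINT x'. LBINT y. ?i x' * (\<bar>g y\<bar> * bumpd x' r y))"
 proof (rule bochner_mono)
  show "L1 (\<lambda>x'. ?i x' * \<bar>bump_avg r x'\<bar>)"
   using integrable_mult_indicator[OF _ integrable_abs[OF bump_avg_integrable(1)[OF r]], of "cball x \<rho>"] by simp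
  show "L1 (\<lambda>x'. LBINT y. ?i x' * (\<bar>g y\<bar> * bumpd x' r y))"
   using lborel_pair.integrable_fst[OF H] by simp
  show "?i x' * \<bar>bump_avg r x'\<bar> \<le> (LBINT y. ?i x' * (\<bar>g y\<bar> * bumpd x' r y))" for x'
   by (simp only: integral_mult_right_zero) (intro mult_left_mono bump_avg_le(1)[OF r] indicator_pos_le)
 qed
 also have "\<dots> = (LBINT y. LBINT x'. ?i x' * (\<bar>g y\<bar> * bumpd x' r y))"
  using lborel_pair.Fubini_integral[OF H] by simp
 also have "\<dots> \<le> (LBINT y. (?V * min \<rho> r powr real CARD('n) * B) * (indicator (cball x (\<rho> + r)) y * \<bar>indicator \<Omega> y * u y\<bar>))"
 proof (rule bochner_mono[OF _ integrable_mult_right[OF mass_integrable]])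
  show "L1 (\<lambda>y. LBINT x'. ?i x' * (\<bar>g y\<bar> * bumpd x' r y))"
   using lborel_pair.integrable_snd[OF H] by simp
  fix y
  have vol: "(LBINT x'. indicator (cball c d) x') = ?V * d powr real CARD('n)" if "0 < d" for d and c :: "real^'n"
   using that by (simp add: content_cball powr_realpow)
  have ib: "L1 (\<lambda>x'. ?i x' * bumpd x' r y)"
   by (rule bochner_bound[OF ii]) (auto simp: abs_mult indicator_def bumpd_bounds bumpd_def bump_nonneg bump_le_1)
  have "(LBINT x'. ?i x' * (\<bar>g y\<bar> * bumpd x' r y)) = \<bar>g y\<bar> * (LBINT x'. ?i x' * bumpd x' r y)"
   by (simp only: mult.left_commute[of "?i _" "\<bar>g y\<bar>"] integral_mult_right_zero)
  also have "\<dots> \<le> (B * \<bar>indicator \<Omega> y * u y\<bar>) * (?V * min \<rho> r powr real CARD('n) * indicator (cball x (\<rho> + r)) y)"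
  proof (rule mult_mono[OF g_le])
   show "(LBINT x'. ?i x' * bumpd x' r y) \<le> ?V * min \<rho> r powr real CARD('n) * indicator (cball x (\<rho> + r)) y"
   proof (cases "y \<in> cball x (\<rho> + r)")
    case True
    have "(LBINT x'. ?i x' * bumpd x' r y) \<le> (LBINT x'. ?i x')"
     by (rule bochner_mono[OF ib ii]) (auto simp: indicator_def bumpd_bounds)
    moreover have "(LBINT x'. ?i x' * bumpd x' r y) \<le> (LBINT x'. indicator (cball y r) x')"
    proof (rule bochner_mono[OF ib])
     show "L1 (indicator (cball y r) :: real^'n \<Rightarrow> real)"
      by (rule integrable_real_indicator[OF _ emeasure_lborel_cball_finite]) simp
     show "?i x' * bumpd x' r y \<le> indicator (cball y r) x'" for x'
      using bumpd_outside[OF r, of y x'] bumpd_bounds[of x' r y] by (auto simp: indicator_def dist_commute)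
    qed
    ultimately have "(LBINT x'. ?i x' * bumpd x' r y) \<le> ?V * \<rho> powr real CARD('n)"
     "(LBINT x'. ?i x' * bumpd x' r y) \<le> ?V * r powr real CARD('n)"
     by (simp_all only: vol[OF \<rho>] vol[OF r])
    then show ?thesis using True by (cases "\<rho> \<le> r") (simp_all add: min.absorb1 min.absorb2)
   next
    case False
    have z: "?i x' * bumpd x' r y = 0" for x'
    proof (cases "x' \<in> cball x \<rho>")
     case True
     then have "y \<notin> cball x' r" using False dist_triangle[of x y x'] by auto
     then show ?thesis by (simp add: bumpd_outside[OF r])
    qed simp
    have "(LBINT x'. ?i x' * bumpd x' r y) = 0" unfolding z by simp
    then show ?thesis using False by simp
   qed
  qed (auto intro!: mult_nonneg_nonneg B integral_nonneg_AE AE_I2 bumpd_bounds)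
  finally show "(LBINT x'. ?i x' * (\<bar>g y\<bar> * bumpd x' r y)) \<le> (?V * min \<rho> r powr real CARD('n) * B) * (indicator (cball x (\<rho> + r)) y * \<bar>indicator \<Omega> y * u y\<bar>)"
   by (simp add: mult_ac)
 qed
 also have "\<dots> = ?V * min \<rho> r powr real CARD('n) * (B * mass x (\<rho> + r))" by (simp add: mass_def)
 finally show ?thesis .
qed

text \<open>Layer by layer, \<open>bump_avg_ball\<close> is combined with the Morrey hypothesis at
  radius \<rho> + r and rebalanced by \<open>min_max_powr\<close>. The remaining power r^(2s-e-1) is
  integrable at 0 because e \<le> s.\<close>

lemma potential_ball:
 assumes R: "0 < R" and A: "0 \<le> A" and \<rho>: "0 < \<rho>" and e: "0 \<le> e" "e \<le> s" "e \<le> \<sigma>" "\<sigma> \<le> real CARD('n)"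
  and H: "\<And>d. 0 < d \<Longrightarrow> mass x d \<le> A * d powr (real CARD('n) - \<sigma>)"
 shows "(LBINT x'. indicator (cball x \<rho>) x' * \<bar>potential 0 R x'\<bar>)
  \<le> unit_ball_vol (real CARD('n)) * B * A * 2 powr (real CARD('n) - \<sigma>) * (R powr (2 * s - e) / (2 * s - e)) * \<rho> powr (real CARD('n) - (\<sigma> - e))"
proof -
 let ?i = "indicator (cball x \<rho>) :: real^'n \<Rightarrow> real" and ?V = "unit_ball_vol (real CARD('n))" and ?n = "real CARD('n)"
 let ?K = "?V * B * A * 2 powr (?n - \<sigma>) * \<rho> powr (?n - (\<sigma> - e))"
 define P where "P r x' = ?i x' * (layer s 0 R r (bump_avg r) x')" for r x'
 have [measurable]: "cball x \<rho> \<in> sets borel" by simp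
 have iP: "integrable lborel2 (\<lambda>(r, x'). \<bar>P r x'\<bar>)"
 proof (rule bochner_bound[OF potential_pair_integrable[OF R]])
  show "AE p in lborel2. norm (case p of (r, x') \<Rightarrow> \<bar>P r x'\<bar>)
    \<le> norm (case p of (r, x) \<Rightarrow> layer s 0 R r (bump_avg r) x)"
   by (intro AE_I2) (auto simp: P_def indicator_def)
  show "(\<lambda>(r, x'). \<bar>P r x'\<bar>) \<in> borel_measurable lborel2" unfolding P_def by measurable
 qed
 have "(LBINT x'. ?i x' * \<bar>potential 0 R x'\<bar>) \<le> (LBINT x'. LBINT r. \<bar>P r x'\<bar>)"
 proof (rule bochner_mono)
  show "L1 (\<lambda>x'. ?i x' * \<bar>potential 0 R x'\<bar>)"
   using integrable_mult_indicator[OF _ integrable_abs[OF potential_0_integrable[OF R]], of "cball x \<rho>"] by simp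
  show "L1 (\<lambda>x'. LBINT r. \<bar>P r x'\<bar>)" using lborel_pair.integrable_snd[OF iP] by simp
  show "?i x' * \<bar>potential 0 R x'\<bar> \<le> (LBINT r. \<bar>P r x'\<bar>)" for x'
  proof -
   have "?i x' * potential 0 R x' = (LBINT r. P r x')" by (simp only: P_def potential_def integral_mult_right_zero)
   then have "\<bar>?i x' * potential 0 R x'\<bar> \<le> (LBINT r. \<bar>P r x'\<bar>)" using integral_abs_bound[of lborel "\<lambda>r. P r x'"] by simp
   then show ?thesis by (simp add: abs_mult)
  qed
 qed
 also have "\<dots> = (LBINT r. LBINT x'. \<bar>P r x'\<bar>)"
  using lborel_pair.Fubini_integral[OF iP] by simp
 also have "\<dots> \<le> (LBINT r. ?K * (indicator {0<..R} r * r powr (2 * s - e - 1)))"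
 proof (rule bochner_mono)
  show "L1 (\<lambda>r. LBINT x'. \<bar>P r x'\<bar>)" using lborel_pair.integrable_fst[OF iP] by simp
  show "L1 (\<lambda>r. ?K * (indicator {0<..R} r * r powr (2 * s - e - 1)))"
   using powr_integral_at_0_closed[of "2 * s - e" R] e s R by (intro integrable_mult_right) (auto simp: has_bochner_integral_iff)
  fix r :: real
  show "(LBINT x'. \<bar>P r x'\<bar>) \<le> ?K * (indicator {0<..R} r * r powr (2 * s - e - 1))"
  proof (cases "r \<in> {0<..R}")
   case True
   then have r: "0 < r" by simp
   have "(LBINT x'. \<bar>P r x'\<bar>) = (LBINT x'. r powr (2 * s - 1 - ?n) * (?i x' * \<bar>bump_avg r x'\<bar>))"
    using True by (intro bochner_cong[OF refl]) (simp add: P_def abs_mult)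
   also have "\<dots> = r powr (2 * s - 1 - ?n) * (LBINT x'. ?i x' * \<bar>bump_avg r x'\<bar>)" by (rule integral_mult_right_zero)
   also have "\<dots> \<le> r powr (2 * s - 1 - ?n) * (?V * min \<rho> r powr ?n * (B * (A * (\<rho> + r) powr (?n - \<sigma>))))"
    using r \<rho> B by (intro mult_left_mono order_trans[OF bump_avg_ball] H) auto
   also have "\<dots> = (r powr (2 * s - 1 - ?n) * (?V * B * A)) * (min \<rho> r powr ?n * (\<rho> + r) powr (?n - \<sigma>))" by (simp add: mult_ac)
   also have "\<dots> \<le> (r powr (2 * s - 1 - ?n) * (?V * B * A)) * (2 powr (?n - \<sigma>) * (\<rho> powr (?n - \<sigma> + e) * r powr (?n - e)))"
    using r \<rho> e A B by (intro mult_left_mono min_max_powr mult_nonneg_nonneg) auto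
   also have "\<dots> = ?K * (r powr (2 * s - 1 - ?n) * r powr (?n - e))" by (simp add: mult_ac algebra_simps)
   also have "r powr (2 * s - 1 - ?n) * r powr (?n - e) = r powr (2 * s - e - 1)" by (simp only: powr_add[symmetric]) (simp add: algebra_simps)
   finally show ?thesis using True by simp
  qed (simp add: P_def)
 qed
 also have "\<dots> = ?K * (R powr (2 * s - e) / (2 * s - e))"
  using powr_integral_at_0_closed[of "2 * s - e" R] e s R by (simp add: has_bochner_integral_iff)
 finally show ?thesis by (simp add: mult_ac)
qed

text \<open>The Morrey bound \<open>\<integral>\<^bsub>B(x,\<rho>)\<^esub> |u| = O(\<rho>\<^bsup>n-\<sigma>\<^esup>)\<close> improves itself through the representation.\<close>

lemma morrey_step:
 assumes R: "0 < R" and A: "0 \<le> A" and e: "0 \<le> e" "e \<le> s" "e \<le> \<sigma>" "\<sigma> \<le> real CARD('n)"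
  and H: "\<And>x d. x \<in> inner_part (2 * R) \<Longrightarrow> 0 < d \<Longrightarrow> mass x d \<le> A * d powr (real CARD('n) - \<sigma>)"
 shows "\<exists>A'\<ge>0. \<forall>x\<in>inner_part (2 * R). \<forall>d>0. mass x d \<le> A' * d powr (real CARD('n) - (\<sigma> - e))"
proof -
 let ?n = "real CARD('n)" and ?m = "moll_mass TYPE('n) s" and ?V = "unit_ball_vol (real CARD('n))"
 let ?p = "?n - (\<sigma> - e)"
 obtain K where K: "0 \<le> K" "\<And>x. \<bar>smooth_part R x\<bar> \<le> K" using smooth_part_bounded[OF R] by blast
 define M0 where "M0 = (LBINT y. \<bar>indicator \<Omega> y * u y\<bar>)"
 have M0: "0 \<le> M0" unfolding M0_def by (intro integral_nonneg_AE AE_I2) auto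
 define Q where "Q = ?V * B * A * 2 powr (?n - \<sigma>) * (R powr (2 * s - e) / (2 * s - e))"
 have Q: "0 \<le> Q" unfolding Q_def using A B e s by (intro mult_nonneg_nonneg divide_nonneg_pos) auto
 define A' where "A' = M0 * R powr (- ?p) + (K * ?V * R powr (\<sigma> - e) + Q) / ?m"
 have A': "0 \<le> M0 * R powr (- ?p)" "0 \<le> (K * ?V * R powr (\<sigma> - e) + Q) / ?m"
  using M0 K(1) Q m_pos by (auto intro!: mult_nonneg_nonneg divide_nonneg_pos add_nonneg_nonneg)
 have "mass x d \<le> A' * d powr ?p" if x: "x \<in> inner_part (2 * R)" and d: "0 < d" for x d
 \<comment> \<open>Beyond radius R the total mass is bound enough. Up to R the ball about x stays
   inside \<open>inner_part R\<close>, where the representation of u applies.\<close>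
 proof (cases "d \<le> R")
  case False
  have "mass x d \<le> M0 * 1" using mass_le by (simp add: M0_def)
  also have "1 \<le> R powr (- ?p) * d powr ?p"
  proof -
   have "R powr ?p \<le> d powr ?p" using False R e by (intro powr_mono2) auto
   then have "R powr (- ?p) * R powr ?p \<le> R powr (- ?p) * d powr ?p" by (intro mult_left_mono) auto
   moreover have "R powr (- ?p) * R powr ?p = 1" using R by (simp only: powr_add[symmetric]) simp
   ultimately show ?thesis by simp
  qed
  finally have "mass x d \<le> M0 * (R powr (- ?p) * d powr ?p)" using M0 by (simp add: mult_left_mono)
  also have "\<dots> \<le> A' * d powr ?p" using mult_nonneg_nonneg[OF A'(2) powr_ge_zero[of d ?p]] unfolding A'_def distrib_right by linarith
  finally show ?thesis .
 next
  case True
  let ?i = "indicator (cball x d) :: real^'n \<Rightarrow> real"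
  have ii: "L1 ?i" by (rule integrable_real_indicator[OF _ emeasure_lborel_cball_finite]) simp
  have sub: "y \<in> inner_part R" "y \<in> \<Omega>" if "y \<in> cball x d" for y
  proof -
   show "y \<in> inner_part R" using inner_part_shift[OF x, of y R] that True by simp
   then show "y \<in> \<Omega>" using inner_part_cball[of y R 0] R by auto
  qed
  have ip: "L1 (\<lambda>y. ?i y * \<bar>potential 0 R y\<bar>)"
   using integrable_mult_indicator[OF _ integrable_abs[OF potential_0_integrable[OF R]], of "cball x d"] by simp
  have "?m * mass x d = (LBINT y. ?m * (?i y * \<bar>indicator \<Omega> y * u y\<bar>))" unfolding mass_def by simp
  also have "\<dots> \<le> (LBINT y. K * ?i y + ?i y * \<bar>potential 0 R y\<bar>)"
  proof (rule integral_mono_AE)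
   show "AE y in lborel. ?m * (?i y * \<bar>indicator \<Omega> y * u y\<bar>) \<le> K * ?i y + ?i y * \<bar>potential 0 R y\<bar>"
    using representation_AE[OF R]
   proof eventually_elim
    case (elim y)
    show ?case
    proof (cases "y \<in> cball x d")
     case True
     then have "?m * u y = smooth_part R y + potential 0 R y" using elim sub by auto
     then have "\<bar>?m * u y\<bar> \<le> K + \<bar>potential 0 R y\<bar>" using K(2)[of y] by linarith
     then show ?thesis using True sub[OF True] m_pos by (simp add: abs_mult)
    qed simp
   qed
  qed (auto intro!: integrable_mult_right mass_integrable ii ip)
  also have "\<dots> = K * (LBINT y. ?i y) + (LBINT y. ?i y * \<bar>potential 0 R y\<bar>)" using ii ip by simp
  also have "(LBINT y. ?i y) = ?V * d powr ?n" using d by (simp add: content_cball powr_realpow)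
  also have "(LBINT y. ?i y * \<bar>potential 0 R y\<bar>) \<le> Q * d powr ?p"
   unfolding Q_def by (rule potential_ball[OF R A d e H[OF x]])
  also have "d powr ?n = d powr ?p * d powr (\<sigma> - e)" by (simp add: powr_add[symmetric])
  finally have "?m * mass x d \<le> K * (?V * (d powr ?p * d powr (\<sigma> - e))) + Q * d powr ?p" by simp
  also have "K * (?V * (d powr ?p * d powr (\<sigma> - e))) \<le> K * (?V * (d powr ?p * R powr (\<sigma> - e)))"
   using K(1) d True e by (intro mult_left_mono powr_mono2) auto
  finally have "?m * mass x d \<le> (K * ?V * R powr (\<sigma> - e) + Q) * d powr ?p" by (simp add: algebra_simps)
  then have "mass x d \<le> (K * ?V * R powr (\<sigma> - e) + Q) / ?m * d powr ?p" using m_pos by (simp add: field_simps)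
  also have "\<dots> \<le> A' * d powr ?p" unfolding A'_def using A'(1) by (intro mult_right_mono) auto
  finally show ?thesis .
 qed
 moreover have "0 \<le> A'" unfolding A'_def using A' by linarith
 ultimately show ?thesis by blast
qed

text \<open>The start \<sigma> = n is mere integrability, and each step lowers \<sigma> by s; the
  step \<open>min s (\<sigma> - s)\<close> makes the last one land exactly on s. Reaching s is
  enough, because the layers then add up like r^(s-1).\<close>

lemma mass_decay:
 assumes R: "0 < R"
 obtains A where "0 \<le> A" "\<And>x d. x \<in> inner_part (2 * R) \<Longrightarrow> 0 < d \<Longrightarrow> mass x d \<le> A * d powr (real CARD('n) - s)"
proof -
 let ?n = "real CARD('n)"
 have "1 \<le> CARD('n)" using zero_less_card_finite[where 'a='n] by linarith
 then have n: "s \<le> ?n" using s by linarith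
 have "\<exists>A\<ge>0. \<forall>x\<in>inner_part (2 * R). \<forall>d>0. mass x d \<le> A * d powr (?n - max (?n - real k * s) s)" for k
 proof (induction k)
  case 0
  have "0 \<le> (LBINT y. \<bar>indicator \<Omega> y * u y\<bar>)" by (intro integral_nonneg_AE AE_I2) auto
  then show ?case using mass_le n by (intro exI[of _ "LBINT y. \<bar>indicator \<Omega> y * u y\<bar>"]) auto
 next
  case (Suc k)
  let ?\<sigma> = "max (?n - real k * s) s" let ?e = "min s (?\<sigma> - s)"
  obtain A where A: "0 \<le> A" "\<And>x d. x \<in> inner_part (2 * R) \<Longrightarrow> 0 < d \<Longrightarrow> mass x d \<le> A * d powr (?n - ?\<sigma>)"
   using Suc by blast
  have "?\<sigma> - ?e = max (?n - real (Suc k) * s) s" using s by (auto simp: min_def max_def algebra_simps)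
  moreover have "\<exists>A'\<ge>0. \<forall>x\<in>inner_part (2 * R). \<forall>d>0. mass x d \<le> A' * d powr (?n - (?\<sigma> - ?e))"
   by (rule morrey_step[OF R A(1) _ _ _ _ A(2)]) (use s n in auto)
  ultimately show ?case by simp
 qed
 moreover obtain k where "?n < real k * s" using reals_Archimedean3[OF s(1)] by blast
 then have "max (?n - real k * s) s = s" using s by simp
 ultimately show thesis using that by metis
qed

text \<open>With the Morrey exponent n - s the layer at radius r is O(r^(s-1)), so the layers below
  d sum to O(d^s) uniformly in x. The potential is now given by an absolutely convergent integral at
  every point, not only almost everywhere.\<close>

lemma potential_tail:
 assumes R: "0 < R"
 obtains K where "0 \<le> K" "\<And>x d. x \<in> inner_part (2 * R) \<Longrightarrow> 0 < d \<Longrightarrow> d \<le> R \<Longrightarrow> \<bar>potential 0 R x - potential d R x\<bar> \<le> K * d powr s"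
  "\<And>x. x \<in> inner_part (2 * R) \<Longrightarrow> L1 (\<lambda>r. layer s 0 R r (bump_avg r) x)"
proof -
 let ?n = "real CARD('n)"
 obtain A where A: "0 \<le> A" "\<And>x d. x \<in> inner_part (2 * R) \<Longrightarrow> 0 < d \<Longrightarrow> mass x d \<le> A * d powr (?n - s)"
  using mass_decay[OF R] by blast
 define J where "J x r = r powr (2 * s - 1 - ?n) * bump_avg r x" for x r
 have [measurable]: "J x \<in> borel_measurable borel" for x unfolding J_def[abs_def] by measurable
 have J: "\<bar>indicator {0<..d} r * J x r\<bar> \<le> B * A * (indicator {0<..d} r * r powr (s - 1))" if x: "x \<in> inner_part (2 * R)" for x r d
 proof (cases "r \<in> {0<..d}")
  case True
  then have r: "0 < r" by simp
  have "\<bar>bump_avg r x\<bar> \<le> B * (A * r powr (?n - s))"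
   using bump_avg_le(2)[OF r, of x] mult_left_mono[OF A(2)[OF x r] B] by linarith
  then have "r powr (2 * s - 1 - ?n) * \<bar>bump_avg r x\<bar> \<le> r powr (2 * s - 1 - ?n) * (B * (A * r powr (?n - s)))" by (intro mult_left_mono) auto
  also have "\<dots> = B * A * (r powr (2 * s - 1 - ?n) * r powr (?n - s))" by simp
  also have "r powr (2 * s - 1 - ?n) * r powr (?n - s) = r powr (s - 1)" by (simp only: powr_add[symmetric]) (simp add: algebra_simps)
  finally show ?thesis using True by (simp add: J_def abs_mult)
 qed simp
 have ib: "L1 (\<lambda>r. B * A * (indicator {0<..d} r * r powr (s - 1)))"
  "(LBINT r. B * A * (indicator {0<..d} r * r powr (s - 1))) = B * A * (d powr s / s)" if "0 < d" for d
  using powr_integral_at_0_closed[OF s(1), of d] that by (auto simp: has_bochner_integral_iff)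
 have iJ: "L1 (\<lambda>r. indicator {0<..d} r * J x r)" if x: "x \<in> inner_part (2 * R)" and d: "0 < d" for x d
  by (rule dominated(1)[OF ib(1)[OF d] _ J[OF x]]) measurable
 show thesis
 proof (rule that[of "B * A / s"])
  show "0 \<le> B * A / s" using A B s by simp
  fix x assume x: "x \<in> inner_part (2 * R)"
  show "L1 (\<lambda>r. layer s 0 R r (bump_avg r) x)"
   using iJ[OF x R] by (simp only: J_def)
  fix d assume d: "0 < d" "d \<le> R"
  have i2: "L1 (\<lambda>r. indicator {d<..R} r * J x r)"
  proof (rule bochner_bound[OF iJ[OF x R]])
   show "AE r in lborel. norm (indicator {d<..R} r * J x r) \<le> norm (indicator {0<..R} r * J x r)"
    using d by (intro AE_I2) (auto simp: indicator_def)
  qed measurable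
  have "potential 0 R x - potential d R x = (LBINT r. indicator {0<..R} r * J x r - indicator {d<..R} r * J x r)"
   unfolding potential_def J_def[symmetric] using bochner_diff[OF iJ[OF x R] i2] by simp
  also have "\<dots> = (LBINT r. indicator {0<..d} r * J x r)"
   using d by (intro bochner_cong[OF refl]) (auto simp: indicator_def)
  also have "\<bar>\<dots>\<bar> \<le> (LBINT r. B * A * (indicator {0<..d} r * r powr (s - 1)))"
   by (rule dominated(2)[OF ib(1)[OF d(1)] _ J[OF x]]) measurable
  finally show "\<bar>potential 0 R x - potential d R x\<bar> \<le> B * A / s * d powr s" using ib(2)[OF d(1)] by simp
 qed
qed

text \<open>For d > 0 the truncated potential is a difference of two continuous convolutions of u,
  by the representation read backwards; the tail bound makes the limit d to 0 uniform.\<close>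

lemma potential_continuous:
 assumes R: "0 < R"
 shows "continuous_on (inner_part (2 * R)) (potential 0 R)"
proof -
 obtain K where K: "0 \<le> K" "\<And>x d. x \<in> inner_part (2 * R) \<Longrightarrow> 0 < d \<Longrightarrow> d \<le> R \<Longrightarrow> \<bar>potential 0 R x - potential d R x\<bar> \<le> K * d powr s"
  "\<And>x. x \<in> inner_part (2 * R) \<Longrightarrow> L1 (\<lambda>r. layer s 0 R r (bump_avg r) x)"
  by (rule potential_tail[OF R], rule that)
 have lim: "uniform_limit (inner_part (2 * R)) (\<lambda>d x. smooth_part d x - smooth_part R x) (potential 0 R) (at_right 0)"
 proof (rule uniform_limitI)
  fix e :: real assume e: "0 < e"
  have "((\<lambda>d. K * d powr s) \<longlongrightarrow> K * 0) (at_right 0)"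
   using s by (intro tendsto_mult_left tendsto_zero_powrI tendsto_ident_at tendsto_const) (auto simp: eventually_at_filter)
  then have "\<forall>\<^sub>F d in at_right 0. K * d powr s < e" using e by (intro order_tendstoD) auto
  moreover have "\<forall>\<^sub>F d in at_right 0. d \<in> {0<..<R}" using R by (rule eventually_at_right_real)
  ultimately show "\<forall>\<^sub>F d in at_right 0. \<forall>x\<in>inner_part (2 * R). dist (smooth_part d x - smooth_part R x) (potential 0 R x) < e"
  proof eventually_elim
   case (elim d)
   show ?case
   proof
    fix x assume x: "x \<in> inner_part (2 * R)"
    have "smooth_part d x - smooth_part R x = potential d R x"
     using representation_truncated[of x R d] inner_part_cball[OF x, of R] elim R by simp
    then show "dist (smooth_part d x - smooth_part R x) (potential 0 R x) < e"
     using K(2)[OF x, of d] elim by (simp add: dist_real_def abs_minus_commute)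
   qed
  qed
 qed
 have "\<forall>\<^sub>F d in at_right (0::real). continuous_on (inner_part (2 * R)) (\<lambda>x. smooth_part d x - smooth_part R x)"
  using eventually_at_right_less[of "0::real"]
  by eventually_elim (intro continuous_intros continuous_at_imp_continuous_on ballI smooth_part_continuous R)
 then show ?thesis by (rule uniform_limit_theorem[OF _ lim]) simp
qed

lemma continuous_representative:
 obtains w where "w \<in> borel_measurable borel" "continuous_on \<Omega> w" "AE x in lborel. w x = u x"
proof -
 let ?m = "moll_mass TYPE('n) s"
 define rep where "rep R x = (smooth_part R x + potential 0 R x) / ?m" for R x
 have cont: "continuous_on (inner_part (2 * R)) (rep R)" if "0 < R" for R
  unfolding rep_def using m_pos
  by (intro continuous_intros potential_continuous continuous_at_imp_continuous_on ballI smooth_part_continuous that) auto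
 have ae: "AE x in lborel. x \<in> inner_part (2 * R) \<longrightarrow> rep R x = u x" if "0 < R" for R
  using representation_AE[OF that]
 proof eventually_elim
  case (elim x)
  show ?case using elim inner_part_shift[of x "2 * R" x R] m_pos that by (auto simp: rep_def field_simps)
 qed
 have eq: "rep R x = rep R' x" if R: "0 < R" "0 < R'" and x: "x \<in> inner_part (2 * R)" "x \<in> inner_part (2 * R')" for R R' x
 proof -
  have "rep R x - rep R' x = 0"
  proof (rule continuous_AE_zero[where U="inner_part (2 * R) \<inter> inner_part (2 * R')"])
   show "continuous_on (inner_part (2 * R) \<inter> inner_part (2 * R')) (\<lambda>x. rep R x - rep R' x)"
    by (intro continuous_intros continuous_on_subset[OF cont[OF R(1)]] continuous_on_subset[OF cont[OF R(2)]]) auto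
   show "AE x in lborel. x \<in> inner_part (2 * R) \<inter> inner_part (2 * R') \<longrightarrow> rep R x - rep R' x = 0"
    using ae[OF R(1)] ae[OF R(2)] by eventually_elim auto
  qed (use x in \<open>auto intro: inner_part_open\<close>)
  then show ?thesis by simp
 qed
 have ex: "\<exists>k. x \<in> inner_part (2 * inverse (real (Suc k)))" if "x \<in> \<Omega>" for x
 proof -
  obtain e where e: "0 < e" "ball x e \<subseteq> \<Omega>" using \<Omega> \<open>x \<in> \<Omega>\<close> open_contains_ball by blast
  obtain k where k: "inverse (real (Suc k)) < e / 4" using reals_Archimedean[of "e / 4"] e by auto
  have "x \<in> inner_part (2 * inverse (real (Suc k)))" unfolding inner_part_def
  proof (intro CollectI exI[of _ "e / 2"] conjI)
   have "2 * inverse (real (Suc k)) + e / 2 \<le> e" using k by linarith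
   then show "ball x (2 * inverse (real (Suc k)) + e / 2) \<subseteq> \<Omega>" using e(2) subset_ball by blast
  qed (use e in auto)
  then show ?thesis by blast
 qed
 \<comment> \<open>Representatives for different R are continuous and almost everywhere equal on
   overlaps, hence equal there, so the choice of R is immaterial. Outside \<Omega> the function u is
   kept.\<close>
 define w where "w x = (if x \<in> \<Omega> then rep (SOME R. 0 < R \<and> x \<in> inner_part (2 * R)) x else u x)" for x
 have w: "w x = rep R x" if "0 < R" "x \<in> inner_part (2 * R)" for R x
 proof -
  have "x \<in> \<Omega>" using inner_part_cball[OF that(2), of 0] that(1) by auto
  moreover have S: "0 < (SOME R. 0 < R \<and> x \<in> inner_part (2 * R)) \<and> x \<in> inner_part (2 * (SOME R. 0 < R \<and> x \<in> inner_part (2 * R)))"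
   by (rule someI[of _ R]) (use that in auto)
  ultimately show ?thesis unfolding w_def using eq[OF conjunct1[OF S] that(1) conjunct2[OF S] that(2)] by simp
 qed
 have wc: "continuous_on \<Omega> w"
 proof (rule continuous_at_imp_continuous_on, rule ballI)
  fix x assume "x \<in> \<Omega>"
  then obtain k where k: "x \<in> inner_part (2 * inverse (real (Suc k)))" using ex by blast
  have "continuous_on (inner_part (2 * inverse (real (Suc k)))) w"
   using cont[of "inverse (real (Suc k))"] by (subst continuous_on_cong[OF refl w[of "inverse (real (Suc k))"]]) auto
  then show "isCont w x" using k continuous_on_eq_continuous_at[OF inner_part_open] by blast
 qed
 show thesis
 proof
  show "continuous_on \<Omega> w" by fact
  have "(\<lambda>x. indicator \<Omega> x *\<^sub>R w x) \<in> borel_measurable borel"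
   by (rule borel_measurable_continuous_on_indicator[OF _ wc]) (use \<Omega> in simp)
  moreover have "(\<lambda>x. indicator (- \<Omega>) x * u x) \<in> borel_measurable borel" using \<Omega> by measurable
  ultimately have "(\<lambda>x. indicator \<Omega> x *\<^sub>R w x + indicator (- \<Omega>) x * u x) \<in> borel_measurable borel" by (rule borel_measurable_add)
  moreover have "(\<lambda>x. indicator \<Omega> x *\<^sub>R w x + indicator (- \<Omega>) x * u x) = w" by (auto simp: fun_eq_iff w_def indicator_def)
  ultimately show "w \<in> borel_measurable borel" by simp
  have "AE x in lborel. \<forall>k. x \<in> inner_part (2 * inverse (real (Suc k))) \<longrightarrow> rep (inverse (real (Suc k))) x = u x"
   unfolding AE_all_countable by (intro allI ae) simp
  then show "AE x in lborel. w x = u x"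
  proof eventually_elim
   case (elim x)
   show ?case
   proof (cases "x \<in> \<Omega>")
    case True
    then obtain k where k: "x \<in> inner_part (2 * inverse (real (Suc k)))" using ex by blast
    then show ?thesis using elim w[of "inverse (real (Suc k))" x] by simp
   qed (simp add: w_def)
  qed
 qed
qed

end

subsection \<open>Convergence of the principal value\<close>

lemma tlap_conv:
 fixes u :: "real^'n \<Rightarrow> real"
 assumes s: "0 < s" and e: "0 < e" "e \<le> 1" and [measurable]: "u \<in> borel_measurable borel" and u: "L2 u"
 shows "L1 (\<lambda>y. u y * kern s e (x - y))" and "L1 (\<lambda>z. u (x + z) * kern s e z)"
  and "tlap s e u x = (LBINT z::real^'n. kern s e z) * u x - (LBINT y. u y * kern s e (x - y))"
proof -
 have "L1 (\<lambda>y. u y * kern s e ((x - y) /\<^sub>R 1))"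
  by (rule L2_decay_integrable[OF s zero_less_one _ u]) (use kern_le_decay[OF s e] in \<open>auto simp: abs_kern\<close>)
 then show i: "L1 (\<lambda>y. u y * kern s e (x - y))" by simp
 have sh: "(\<lambda>z. u (x + z) * kern s e z) = (\<lambda>z. (\<lambda>y. u y * kern s e (x - y)) (x + z))"
  by (simp add: kern_minus)
 show i2: "L1 (\<lambda>z. u (x + z) * kern s e z)"
  unfolding sh using i by (subst integrable_lborel_translate)
 have "tlap s e u x = (LBINT z. (u x - u (x + z)) * kern s e z)" by (rule tlap_eq[OF s e(1) i2])
 also have "\<dots> = (LBINT z. u x * kern s e z - u (x + z) * kern s e z)" by (simp add: left_diff_distrib)
 also have "\<dots> = u x * (LBINT z::real^'n. kern s e z) - (LBINT z. u (x + z) * kern s e z)"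
  using kern_integrable[OF s e(1), where 'n='n] i2 by simp
 also have "(LBINT z. u (x + z) * kern s e z) = (LBINT y. u y * kern s e (x - y))"
  unfolding sh by (rule integral_lborel_translate)
 finally show "tlap s e u x = (LBINT z::real^'n. kern s e z) * u x - (LBINT y. u y * kern s e (x - y))"
  by (simp add: mult.commute)
qed

text \<open>The truncated operator is a multiple of the identity minus convolution with an even
  integrable kernel, hence symmetric.\<close>

lemma tlap_bumpd_symmetric:
 fixes u :: "real^'n \<Rightarrow> real"
 assumes s: "0 < s" and e: "0 < e" "e \<le> 1" and t: "0 < t" and [measurable]: "u \<in> borel_measurable borel" and u: "L2 u"
 shows "L1 (\<lambda>x. bumpd c t x * tlap s e u x)"
  and "(LBINT x. bumpd c t x * tlap s e u x) = (LBINT x. u x * tlap s e (bumpd c t) x)"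
proof -
 let ?b = "bumpd c t" and ?M = "LBINT z::real^'n. kern s e z"
 note b2 = bumpd_sq_integrable[OF t, of c] and k = kern_integrable[OF s e(1), where 'n='n]
 have bu: "L1 (\<lambda>x. ?b x * u x)" by (rule L2_mult_integrable) (use b2 u in auto)
 have P: "integrable lborel2 (\<lambda>(x, y). ?b x * u y * kern s e (x - y))"
  using integrable_mult_weight[of "\<lambda>p. ?b (fst p)" "lborel2" "\<lambda>p. u (snd p)" "\<lambda>p. kern s e (fst p - snd p)"]
   integrable_convolution_pair(1)[OF b2 k] integrable_convolution_pair(2)[OF u k]
  by (simp add: case_prod_unfold kern_nonneg)
 have q1: "(LBINT y. ?b x * u y * kern s e (x - y)) = ?b x * (LBINT y. u y * kern s e (x - y))" for x
  by (simp add: mult.assoc)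
 have q2: "(LBINT x. ?b x * u y * kern s e (x - y)) = u y * (LBINT x. ?b x * kern s e (y - x))" for y
 proof -
  have "kern s e (x - y) = kern s e (y - x)" for x using kern_minus[of s e "x - y"] by simp
  then have "(\<lambda>x. ?b x * u y * kern s e (x - y)) = (\<lambda>x. u y * (?b x * kern s e (y - x)))" by (simp add: fun_eq_iff)
  then show ?thesis by simp
 qed
 have i1: "L1 (\<lambda>x. ?b x * (LBINT y. u y * kern s e (x - y)))"
  using lborel_pair.integrable_fst[OF P] by (simp add: q1)
 have i2: "L1 (\<lambda>y. u y * (LBINT x. ?b x * kern s e (y - x)))"
  using lborel_pair.integrable_snd[OF P] by (simp add: q2)
 have e1: "?b x * tlap s e u x = ?M * (?b x * u x) - ?b x * (LBINT y. u y * kern s e (x - y))" for x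
  unfolding tlap_conv(3)[OF s e _ u, simplified] by (simp add: algebra_simps)
 have e2: "u x * tlap s e ?b x = ?M * (?b x * u x) - u x * (LBINT y. ?b y * kern s e (x - y))" for x
  unfolding tlap_conv(3)[OF s e _ b2, simplified] by (simp add: algebra_simps)
 show "L1 (\<lambda>x. ?b x * tlap s e u x)"
  unfolding e1 by (intro bochner_integrable_diff integrable_mult_right bu i1)
 have "(LBINT x. ?b x * (LBINT y. u y * kern s e (x - y))) = (LBINT y. u y * (LBINT x. ?b x * kern s e (y - x)))"
  using lborel_pair.Fubini_integral[OF P] by (simp add: q1 q2)
 then show "(LBINT x. ?b x * tlap s e u x) = (LBINT x. u x * tlap s e ?b x)"
  unfolding e1 e2
  using bochner_diff[OF integrable_mult_right[OF bu, of ?M] i1]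
   bochner_diff[OF integrable_mult_right[OF bu, of ?M] i2] by simp
qed

lemma bumpd_sym: "bumpd x r y = bumpd y r x"
 using bump_minus[of "(y - x) /\<^sub>R r"] by (simp add: bumpd_def algebra_simps)

lemma sdiff_bumpd: "sdiff (bumpd c t) z x = sdiff bump (z /\<^sub>R t) ((x - c) /\<^sub>R t)"
 by (simp add: sdiff_def bumpd_def algebra_simps)

text \<open>The second moment of the part of the kernel that truncation at e removes; rescaling to e
  = 1 produces the factor e^(2-2s).\<close>

lemma near_moment:
 assumes s: "0 < s" "s < 1" and e: "0 < e"
 shows "L1 (\<lambda>z :: real^'n. (norm z)\<^sup>2 * (kern s 0 z - kern s e z))"
  and "(LBINT z::real^'n. (norm z)\<^sup>2 * (kern s 0 z - kern s e z))
   \<le> e powr (2 - 2 * s) * (LBINT z::real^'n. min 1 ((norm z)\<^sup>2) * kern s 0 z)"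
proof -
 let ?a = "real CARD('n) + 2 * s"
 define f :: "real^'n \<Rightarrow> real" where "f w = (norm w)\<^sup>2 * (kern s 0 w - kern s 1 w)" for w
 have f: "\<bar>f w\<bar> \<le> min 1 ((norm w)\<^sup>2) * kern s 0 w" for w
 proof (cases "norm w < 1")
  case True
  then have "(norm w)\<^sup>2 \<le> 1" by (simp add: power_le_one)
  then show ?thesis using True kern_nonneg[of s 0 w] by (simp add: f_def kern_def)
 qed (use kern_nonneg[of s 0 w] in \<open>simp add: f_def kern_def\<close>)
 have fi: "L1 f"
 proof (rule bochner_bound[OF kern_min_integrable[OF s]])
  show "f \<in> borel_measurable lborel" unfolding f_def[abs_def] by measurable
 qed (use f order_trans[OF f abs_ge_self] in auto)
 have eq: "(norm z)\<^sup>2 * (kern s 0 z - kern s e z) = e powr (2 - ?a) * f ((z - 0) /\<^sub>R e)" for z :: "real^'n"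
 proof -
  have "kern s d z = e powr - ?a * kern s (d / e) (z /\<^sub>R e)" for d
   using kern_scale[OF e, of s d "z /\<^sub>R e"] e by simp
  from this[of 0] this[of e] have "kern s 0 z - kern s e z = e powr - ?a * (kern s 0 (z /\<^sub>R e) - kern s 1 (z /\<^sub>R e))"
   using e by (simp add: right_diff_distrib)
  moreover have "(norm z)\<^sup>2 = e powr 2 * (norm (z /\<^sub>R e))\<^sup>2" using e unfolding norm_dilate[OF e] by (simp add: power_divide)
  moreover have "e powr (2 - ?a) = e powr 2 * e powr - ?a" by (simp only: powr_add[symmetric] diff_conv_add_uminus)
  ultimately show ?thesis by (simp add: f_def)
 qed
 show "L1 (\<lambda>z :: real^'n. (norm z)\<^sup>2 * (kern s 0 z - kern s e z))"
  unfolding eq by (intro integrable_mult_right) (use fi integrable_dilation_iff(1)[OF e, of f 0] in simp)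
 have "(LBINT z::real^'n. (norm z)\<^sup>2 * (kern s 0 z - kern s e z)) = e powr (2 - ?a) * (e ^ CARD('n) * (LBINT w. f w))"
  unfolding eq integral_mult_right_zero integral_dilation(1)[OF e] by simp
 also have "\<dots> = (e powr (2 - ?a) * e powr real CARD('n)) * (LBINT w. f w)" using e by (simp add: powr_realpow)
 also have "e powr (2 - ?a) * e powr real CARD('n) = e powr (2 - 2 * s)" by (simp only: powr_add[symmetric]) simp
 also have "e powr (2 - 2 * s) * (LBINT w. f w) \<le> e powr (2 - 2 * s) * (LBINT z::real^'n. min 1 ((norm z)\<^sup>2) * kern s 0 z)"
  by (intro mult_left_mono bochner_mono fi kern_min_integrable s) (use f abs_ge_self order_trans in \<open>blast, simp\<close>)
 finally show "(LBINT z::real^'n. (norm z)\<^sup>2 * (kern s 0 z - kern s e z))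
   \<le> e powr (2 - 2 * s) * (LBINT z::real^'n. min 1 ((norm z)\<^sup>2) * kern s 0 z)" .
qed

lemma moll_norm1:
 assumes s: "0 < s" "s < 1" and t: "0 < t"
 shows "L1 (\<lambda>y :: real^'n. \<bar>moll s t (x - y)\<bar>)"
  and "(LBINT y. \<bar>moll s t (x - y)\<bar>) = (LBINT y::real^'n. \<bar>moll s 1 y\<bar>)"
proof -
 have eq: "\<bar>moll s t (x - y)\<bar> = t powr (- real CARD('n)) * (\<lambda>w. \<bar>moll s 1 w\<bar>) ((x - y) /\<^sub>R t)" for y :: "real^'n"
  by (simp add: moll_scale[OF t, of s "x - y"] abs_mult)
 have i: "L1 (\<lambda>w :: real^'n. \<bar>moll s 1 w\<bar>)" by (intro integrable_abs moll_1_integrable s)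
 show "L1 (\<lambda>y :: real^'n. \<bar>moll s t (x - y)\<bar>)"
  unfolding eq by (intro integrable_mult_right integrable_dilation_iff(2)[OF t, THEN iffD2] i)
 show "(LBINT y. \<bar>moll s t (x - y)\<bar>) = (LBINT y::real^'n. \<bar>moll s 1 y\<bar>)"
  unfolding eq integral_mult_right_zero using t integral_dilation(2)[OF t, of "\<lambda>w :: real^'n. \<bar>moll s 1 w\<bar>" x]
  by (simp add: powr_minus powr_realpow)
qed

text \<open>
 The potential of a bounded density: its truncated fractional Laplacians are bounded uniformly in
 the truncation, since its kernel is a truncated fundamental solution.
\<close>

locale bounded_density =
 fixes s G R C1 :: real and h :: "real^'n \<Rightarrow> real"
 assumes s: "0 < s" "s < 1" and R: "0 < R" and h_meas [measurable]: "h \<in> borel_measurable borel" and h_int: "L1 h"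
  and h_le: "\<And>y. \<bar>h y\<bar> \<le> G" and C1: "0 < C1" "\<And>z :: real^'n. (LBINT x. \<bar>sdiff bump z x\<bar>) \<le> C1 * min 1 ((norm z)\<^sup>2)"
begin

text \<open>\<open>avg\<close> and \<open>pot\<close> repeat \<open>bump_avg\<close> and
  \<open>potential\<close> for a bounded density. They are kept apart from the solution because the
  density will be an increment of g, not g itself.\<close>

definition avg :: "real \<Rightarrow> real^'n \<Rightarrow> real" where
 "avg r x = (LBINT y. h y * bumpd x r y)"

definition pot :: "real^'n \<Rightarrow> real" where
 "pot x = (LBINT r. layer s 0 R r (avg r) x)"

lemma avg_measurable [measurable (raw)]:
 assumes [measurable]: "a \<in> borel_measurable M" "b \<in> borel_measurable M"
 shows "(\<lambda>x. avg (a x) (b x)) \<in> borel_measurable M"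
proof -
 have [measurable]: "(\<lambda>p. avg (fst p) (snd p)) \<in> borel_measurable (borel \<Otimes>\<^sub>M borel)"
  unfolding avg_def bumpd_def by measurable
 have "(\<lambda>x. (a x, b x)) \<in> measurable M (borel \<Otimes>\<^sub>M borel)" by measurable
 from measurable_compose[OF this \<open>(\<lambda>p. avg (fst p) (snd p)) \<in> _\<close>] show ?thesis by simp
qed

lemma pot_measurable [measurable]: "pot \<in> borel_measurable borel"
 unfolding pot_def[abs_def] by measurable

lemma G_nonneg: "0 \<le> G" using h_le[of 0] by linarith

lemma h_bumpd_integrable: "L1 (\<lambda>y. h y * bumpd y r x)"
proof (rule bochner_bound[OF h_int])
 show "(\<lambda>y. h y * bumpd y r x) \<in> borel_measurable lborel" unfolding bumpd_def by measurable
qed (auto simp: abs_mult bumpd_bounds mult_left_le)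

lemma avg_eq: "avg r x = (LBINT y. h y * bumpd y r x)"
 unfolding avg_def by (simp only: bumpd_sym[of x])

lemma avg_sdiff: "sdiff (avg r) z x = (LBINT y. h y * sdiff (bumpd y r) z x)"
proof -
 have "(\<lambda>y. h y * sdiff (bumpd y r) z x) = (\<lambda>y. (h y * bumpd y r (x + z) + h y * bumpd y r (x - z)) - 2 * (h y * bumpd y r x))"
  by (simp add: sdiff_def fun_eq_iff algebra_simps)
 then show ?thesis using h_bumpd_integrable by (simp add: sdiff_def avg_eq)
qed

text \<open>All smoothness is taken from the bump, measured in L^1; the density enters only through
  its supremum.\<close>

lemma avg_sdiff_bound:
 assumes r: "0 < r"
 shows "\<bar>sdiff (avg r) z x\<bar> \<le> G * C1 * r powr real CARD('n) * min 1 ((norm z / r)\<^sup>2)"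
proof -
 have i: "L1 (\<lambda>y :: real^'n. \<bar>sdiff bump (z /\<^sub>R r) ((x - y) /\<^sub>R r)\<bar>)"
  using integrable_dilation_iff(2)[OF r, of "\<lambda>w. \<bar>sdiff bump (z /\<^sub>R r) w\<bar>" x] sdiff_integrable[OF bump_integrable, of "z /\<^sub>R r"] by simp
 have le: "\<bar>h y * sdiff (bumpd y r) z x\<bar> \<le> G * \<bar>sdiff bump (z /\<^sub>R r) ((x - y) /\<^sub>R r)\<bar>" for y
  unfolding abs_mult sdiff_bumpd by (intro mult_right_mono h_le) auto
 have "(\<lambda>y. h y * sdiff (bumpd y r) z x) \<in> borel_measurable lborel" unfolding sdiff_bumpd by measurable
 then have "\<bar>sdiff (avg r) z x\<bar> \<le> (LBINT y. G * \<bar>sdiff bump (z /\<^sub>R r) ((x - y) /\<^sub>R r)\<bar>)"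
  unfolding avg_sdiff by (rule dominated(2)[OF integrable_mult_right[OF i] _ le])
 also have "\<dots> = G * (r ^ CARD('n) * (LBINT w::real^'n. \<bar>sdiff bump (z /\<^sub>R r) w\<bar>))"
  using integral_dilation(2)[OF r, of "\<lambda>w. \<bar>sdiff bump (z /\<^sub>R r) w\<bar>" x] by simp
 also have "\<dots> \<le> G * (r ^ CARD('n) * (C1 * min 1 ((norm (z /\<^sub>R r))\<^sup>2)))"
  using G_nonneg r by (intro mult_left_mono C1(2)) auto
 finally show ?thesis using r unfolding norm_dilate[OF r] by (simp add: powr_realpow mult_ac)
qed

lemma avg_bound:
 assumes r: "0 < r"
 shows "\<bar>avg r x\<bar> \<le> G * (LBINT w::real^'n. bump w) * r powr real CARD('n)"
proof -
 have "\<bar>avg r x\<bar> \<le> (LBINT y. G * bumpd x r y)"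
  unfolding avg_def
 proof (rule dominated(2))
  show "\<bar>h y * bumpd x r y\<bar> \<le> G * bumpd x r y" for y
   unfolding abs_mult abs_of_nonneg[OF bumpd_bounds(1)] by (intro mult_right_mono h_le bumpd_bounds)
 qed (auto intro: bumpd_integrable[OF r])
 also have "\<dots> = G * (r ^ CARD('n) * (LBINT w::real^'n. bump w))"
  unfolding bumpd_def using integral_dilation(1)[OF r, of bump x] by simp
 finally show ?thesis using r by (simp add: powr_realpow mult_ac)
qed

lemma powr_R_integral:
 "L1 (\<lambda>r. indicator {0<..d} r * r powr (2 * s - 1))" (is ?A)
 "(LBINT r. indicator {0<..d} r * r powr (2 * s - 1)) = d powr (2 * s) / (2 * s)" (is ?B) if "0 < d"
 using powr_integral_at_0_closed[of "2 * s" d] s that by (auto simp: has_bochner_integral_iff)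

lemma pot_integrable: "L1 (\<lambda>r. layer s 0 R r (avg r) x)" (is ?I)
 and pot_bounded: "\<bar>pot x\<bar> \<le> G * (LBINT w::real^'n. bump w) * (R powr (2 * s) / (2 * s))" (is ?P)
proof -
 let ?V = "G * (LBINT w::real^'n. bump w)"
 have le: "\<bar>layer s 0 R r (avg r) x\<bar> \<le> ?V * (indicator {0<..R} r * r powr (2 * s - 1))" for r
 proof (cases "r \<in> {0<..R}")
  case True
  then have "r powr (2 * s - 1 - real CARD('n)) * \<bar>avg r x\<bar> \<le> r powr (2 * s - 1 - real CARD('n)) * (?V * r powr real CARD('n))"
   by (intro mult_left_mono avg_bound) auto
  also have "\<dots> = ?V * (r powr (2 * s - 1 - real CARD('n)) * r powr real CARD('n))" by (simp add: mult_ac)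
  also have "r powr (2 * s - 1 - real CARD('n)) * r powr real CARD('n) = r powr (2 * s - 1)" by (simp only: powr_add[symmetric]) simp
  finally show ?thesis using True by (simp add: abs_mult)
 qed simp
 note dom = dominated[OF integrable_mult_right[OF powr_R_integral(1)[OF R], of ?V] _ le]
 show ?I by (rule dom(1)) measurable
 have "\<bar>pot x\<bar> \<le> (LBINT r. ?V * (indicator {0<..R} r * r powr (2 * s - 1)))"
  unfolding pot_def by (rule dom(2)) measurable
 then show ?P by (simp add: powr_R_integral(2)[OF R])
qed

lemma pot_sdiff: "sdiff pot z x = (LBINT r. indicator {0<..R} r * (r powr (2 * s - 1 - real CARD('n)) * sdiff (avg r) z x))"
proof -
 let ?J = "\<lambda>x r. layer s 0 R r (avg r) x"
 have "(\<lambda>r. indicator {0<..R} r * (r powr (2 * s - 1 - real CARD('n)) * sdiff (avg r) z x)) = (\<lambda>r. (?J (x + z) r + ?J (x - z) r) - 2 * ?J x r)"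
  by (simp add: sdiff_def fun_eq_iff algebra_simps)
 then show ?thesis using pot_integrable by (simp add: sdiff_def pot_def)
qed

lemma tlap_pot:
 assumes e: "0 < e"
 shows "L1 (\<lambda>r. layer s 0 R r (tlap s e (avg r)) x)"
  and "tlap s e pot x = (LBINT r. layer s 0 R r (tlap s e (avg r)) x)"
proof -
 let ?w = "\<lambda>r. indicator {0<..R} r * r powr (2 * s - 1 - real CARD('n))"
 have F: "integrable lborel2 (\<lambda>(r, z). ?w r * (sdiff (avg r) z x * kern s e z))"
 proof (rule integrable_pair_bound[OF _ integrable_mult_right[OF powr_R_integral(1)[OF R], of "G * C1"] kern_integrable[OF s(1) e]])
  show "(\<lambda>(r, z). ?w r * (sdiff (avg r) z x * kern s e z)) \<in> borel_measurable lborel2"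
   unfolding sdiff_def by measurable
  show "\<bar>case (r, z) of (r, z) \<Rightarrow> ?w r * (sdiff (avg r) z x * kern s e z)\<bar> \<le> G * C1 * (indicator {0<..R} r * r powr (2 * s - 1)) * kern s e z" for r and z :: "real^'n"
  proof (cases "r \<in> {0<..R}")
   case True
   then have r: "0 < r" by simp
   have "\<bar>sdiff (avg r) z x\<bar> \<le> G * C1 * r powr real CARD('n) * 1"
    using G_nonneg C1(1) by (intro order_trans[OF avg_sdiff_bound[OF r]] mult_left_mono) auto
   then have "(r powr (2 * s - 1 - real CARD('n)) * kern s e z) * \<bar>sdiff (avg r) z x\<bar> \<le> (r powr (2 * s - 1 - real CARD('n)) * kern s e z) * (G * C1 * r powr real CARD('n))"
    by (intro mult_left_mono mult_nonneg_nonneg kern_nonneg) auto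
   also have "\<dots> = G * C1 * (r powr (2 * s - 1 - real CARD('n)) * r powr real CARD('n)) * kern s e z" by (simp add: mult_ac)
   also have "r powr (2 * s - 1 - real CARD('n)) * r powr real CARD('n) = r powr (2 * s - 1)" by (simp only: powr_add[symmetric]) simp
   finally show ?thesis using True by (simp add: abs_mult abs_kern mult_ac)
  qed simp
 qed
 have z: "(LBINT z. ?w r * (sdiff (avg r) z x * kern s e z)) = - 2 * (layer s 0 R r (tlap s e (avg r)) x)" for r
  by (simp add: tlap_def)
 have "L1 (\<lambda>r. - 2 * (layer s 0 R r (tlap s e (avg r)) x))"
  using lborel_pair.integrable_fst[OF F] by (simp only: z)
 from integrable_mult_right[OF this, of "- (1 / 2)"]
 show "L1 (\<lambda>r. layer s 0 R r (tlap s e (avg r)) x)" by simp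
 have "(LBINT r. LBINT z. ?w r * (sdiff (avg r) z x * kern s e z)) = (LBINT z. LBINT r. ?w r * (sdiff (avg r) z x * kern s e z))"
  using lborel_pair.Fubini_integral[OF F] by simp
 moreover have "(LBINT r. ?w r * (sdiff (avg r) z x * kern s e z)) = sdiff pot z x * kern s e z" for z
  unfolding pot_sdiff by (simp only: integral_mult_left_zero[symmetric] mult.assoc)
 ultimately have "tlap s e pot x = - (1 / 2) * (LBINT r. - 2 * (layer s 0 R r (tlap s e (avg r)) x))"
  unfolding tlap_def[of s e pot] by (simp only: z)
 then show "tlap s e pot x = (LBINT r. layer s 0 R r (tlap s e (avg r)) x)"
  by simp
qed

lemma tlap_avg_small:
 assumes r: "0 < r" and e: "0 < e"
 shows "\<bar>tlap s e (avg r) x\<bar> \<le> G * C1 * r powr real CARD('n) * (e powr (- 2 * s) * (LBINT z::real^'n. kern s 1 z))"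
proof -
 let ?K = "G * C1 * r powr real CARD('n)"
 have K: "0 \<le> ?K" using G_nonneg C1(1) by simp
 have le: "\<bar>sdiff (avg r) z x * kern s e z\<bar> \<le> ?K * kern s e z" for z
 proof -
  have "\<bar>sdiff (avg r) z x\<bar> \<le> ?K * 1" using K by (intro order_trans[OF avg_sdiff_bound[OF r]] mult_left_mono) auto
  then show ?thesis by (simp add: abs_mult abs_kern mult_right_mono kern_nonneg)
 qed
 have i: "L1 (\<lambda>z. ?K * kern s e (z :: real^'n))" by (intro integrable_mult_right kern_integrable s e)
 have "\<bar>tlap s e (avg r) x\<bar> \<le> \<bar>LBINT z. sdiff (avg r) z x * kern s e z\<bar>" by (simp add: tlap_def)
 also have "\<dots> \<le> (LBINT z::real^'n. ?K * kern s e z)"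
  by (rule dominated(2)[OF i _ le]) (unfold sdiff_def, measurable)
 finally show ?thesis using kern_mass[OF e, of s, where 'n='n] by simp
qed

lemma tlap_avg_0:
 assumes r: "0 < r"
 shows "tlap s 0 (avg r) x = r powr (- 2 * s) * (LBINT y. h y * lapb s ((x - y) /\<^sub>R r))"
proof -
 let ?K = "720 * max 1 (1 / r\<^sup>2)"
 have sb: "\<bar>sdiff (bumpd y r) z x\<bar> \<le> ?K * min 1 ((norm z)\<^sup>2)" for y z :: "real^'n"
 proof -
  have "\<bar>sdiff (bumpd y r) z x\<bar> \<le> 720 * min 1 ((norm (z /\<^sub>R r))\<^sup>2)" unfolding sdiff_bumpd by (rule bump_sdiff_min)
  also have "(norm (z /\<^sub>R r))\<^sup>2 = 1 / r\<^sup>2 * (norm z)\<^sup>2" unfolding norm_dilate[OF r] by (simp add: power_divide)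
  also have "min 1 (1 / r\<^sup>2 * (norm z)\<^sup>2) \<le> max 1 (1 / r\<^sup>2) * min 1 ((norm z)\<^sup>2)"
  proof (cases "(norm z)\<^sup>2 \<le> 1")
   case True
   have "1 / r\<^sup>2 * (norm z)\<^sup>2 \<le> max 1 (1 / r\<^sup>2) * (norm z)\<^sup>2" by (intro mult_right_mono) auto
   then show ?thesis using True by (simp add: min.absorb2)
  qed auto
  finally show ?thesis by simp
 qed
 have F: "integrable lborel2 (\<lambda>(y, z). h y * (sdiff (bumpd y r) z x * kern s 0 z))"
 proof (rule integrable_pair_bound[OF _ integrable_abs[OF h_int] integrable_mult_right[OF kern_min_integrable[OF s], of ?K]])
  show "(\<lambda>(y, z). h y * (sdiff (bumpd y r) z x * kern s 0 z)) \<in> borel_measurable lborel2"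
   unfolding sdiff_bumpd by measurable
  show "\<bar>case (y, z) of (y, z) \<Rightarrow> h y * (sdiff (bumpd y r) z x * kern s 0 z)\<bar> \<le> \<bar>h y\<bar> * (?K * (min 1 ((norm z)\<^sup>2) * kern s 0 z))" for y z :: "real^'n"
   using mult_right_mono[OF sb[of y z] kern_nonneg[of s 0 z]] by (simp add: abs_mult abs_kern mult_left_mono mult.assoc)
 qed
 have "(LBINT z. sdiff (avg r) z x * kern s 0 z) = (LBINT z. LBINT y. h y * (sdiff (bumpd y r) z x * kern s 0 z))"
  unfolding avg_sdiff by (simp only: integral_mult_left_zero[symmetric] mult.assoc)
 also have "\<dots> = (LBINT y. LBINT z. h y * (sdiff (bumpd y r) z x * kern s 0 z))"
  using lborel_pair.Fubini_integral[OF F] by simp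
 also have "\<dots> = (LBINT y. - 2 * r powr (- 2 * s) * (h y * lapb s ((x - y) /\<^sub>R r)))"
 proof (rule bochner_cong[OF refl])
  fix y
  have "tlap s 0 (bumpd y r) x = r powr (- 2 * s) * lapb s ((x - y) /\<^sub>R r)"
   unfolding bumpd_def[abs_def] tlap_scale[OF r] by (simp add: lapb_def)
  then have "(LBINT z. sdiff (bumpd y r) z x * kern s 0 z) = - 2 * (r powr (- 2 * s) * lapb s ((x - y) /\<^sub>R r))"
   by (simp add: tlap_def)
  then show "(LBINT z. h y * (sdiff (bumpd y r) z x * kern s 0 z)) = - 2 * r powr (- 2 * s) * (h y * lapb s ((x - y) /\<^sub>R r))"
   by (simp only: integral_mult_right_zero) simp
 qed
 finally show ?thesis by (simp add: tlap_def)
qed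

lemma tlap_avg_near:
 assumes r: "0 < r" and e: "0 < e"
 shows "\<bar>tlap s e (avg r) x - tlap s 0 (avg r) x\<bar> \<le> G * C1 * r powr (real CARD('n) - 2) * (e powr (2 - 2 * s) * (LBINT z::real^'n. min 1 ((norm z)\<^sup>2) * kern s 0 z))"
proof -
 let ?K = "G * C1 * r powr (real CARD('n) - 2)"
 have K: "0 \<le> ?K" using G_nonneg C1(1) by simp
 have sb: "\<bar>sdiff (avg r) z x\<bar> \<le> ?K * (norm z)\<^sup>2" for z
 proof -
  have "\<bar>sdiff (avg r) z x\<bar> \<le> G * C1 * r powr real CARD('n) * (norm z / r)\<^sup>2"
   using G_nonneg C1(1) by (intro order_trans[OF avg_sdiff_bound[OF r]] mult_left_mono) auto
  also have "\<dots> = G * C1 * (r powr real CARD('n) * r powr (- 2)) * (norm z)\<^sup>2" using r by (simp add: power_divide powr_minus powr_numeral field_simps)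
  also have "r powr real CARD('n) * r powr (- 2) = r powr (real CARD('n) - 2)" by (simp only: powr_add[symmetric]) simp
  finally show ?thesis .
 qed
 have sb2: "\<bar>sdiff (avg r) z x\<bar> \<le> G * C1 * r powr real CARD('n)" for z
  using G_nonneg C1(1) by (intro order_trans[OF avg_sdiff_bound[OF r]] mult_left_le) auto
 have mb: "\<bar>sdiff (avg r) z x\<bar> \<le> max ?K (G * C1 * r powr real CARD('n)) * min 1 ((norm z)\<^sup>2)" for z
 proof (cases "(norm z)\<^sup>2 \<le> 1")
  case True
  have "?K * (norm z)\<^sup>2 \<le> max ?K (G * C1 * r powr real CARD('n)) * (norm z)\<^sup>2" by (intro mult_right_mono) auto
  then show ?thesis using True sb[of z] by (simp add: min.absorb2)
 next
  case False
  then show ?thesis using sb2[of z] by (simp add: min.absorb1)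
 qed
 note ski = sdiff_kern_integrable(1)[OF s _ _ mb]
 have ik: "L1 (\<lambda>z. sdiff (avg r) z x * kern s d z)" if "0 \<le> d" for d by (rule ski[OF that]) measurable
 have le: "\<bar>sdiff (avg r) z x * (kern s 0 z - kern s e z)\<bar> \<le> ?K * ((norm z)\<^sup>2 * (kern s 0 z - kern s e z))" for z
  using mult_right_mono[OF sb[of z], of "kern s 0 z - kern s e z"] kern_antimono[OF less_imp_le[OF e], of s z] by (simp add: abs_mult mult_ac)
 have "tlap s e (avg r) x - tlap s 0 (avg r) x = 1 / 2 * (LBINT z. sdiff (avg r) z x * (kern s 0 z - kern s e z))"
  using bochner_diff[OF ik[of 0] ik[of e]] e by (simp add: tlap_def right_diff_distrib)
 then have "\<bar>tlap s e (avg r) x - tlap s 0 (avg r) x\<bar> \<le> \<bar>LBINT z. sdiff (avg r) z x * (kern s 0 z - kern s e z)\<bar>" by simp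
 also have "\<dots> \<le> (LBINT z::real^'n. ?K * ((norm z)\<^sup>2 * (kern s 0 z - kern s e z)))"
  by (rule dominated(2)[OF integrable_mult_right[OF near_moment(1)[OF s e]] _ le]) (unfold sdiff_def, measurable)
 also have "\<dots> \<le> ?K * (e powr (2 - 2 * s) * (LBINT z::real^'n. min 1 ((norm z)\<^sup>2) * kern s 0 z))"
  unfolding integral_mult_right_zero by (rule mult_left_mono[OF near_moment(2)[OF s e] K])
 finally show ?thesis .
qed

text \<open>The untruncated operator turns the layers into rescaled copies of \<open>lapb\<close>,
  which telescope to \<open>moll s e - moll s R\<close>. Both have the same L^1 norm; adding up the
  layers in absolute value would cost a logarithm of R/e.\<close>

lemma tlap_avg_main:
 assumes e: "0 < e" "e \<le> R"
 shows "L1 (\<lambda>r. layer s e R r (tlap s 0 (avg r)) x)"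
  and "\<bar>LBINT r. layer s e R r (tlap s 0 (avg r)) x\<bar>
   \<le> G * (2 * (LBINT y::real^'n. \<bar>moll s 1 y\<bar>))"
proof -
 obtain C where C: "0 < C" "\<And>x :: real^'n. \<bar>lapb s x\<bar> \<le> C * decay s x" using lapb_decay[OF s] by blast
 let ?w = "\<lambda>r. indicator {e<..R} r * (r powr (- real CARD('n) - 1))"
 have iw: "L1 (\<lambda>r. indicator {e<..} r * r powr (- real CARD('n) - 1))"
  using powr_integral_at_top[OF card_pos[where 'n='n] e(1)] by (simp add: has_bochner_integral_iff)
 have F: "integrable lborel2 (\<lambda>(r, y). ?w r * (h y * lapb s ((x - y) /\<^sub>R r)))"
 proof (rule integrable_pair_bound[OF _ integrable_mult_right[OF iw, of C] integrable_abs[OF h_int]])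
  show "\<bar>case (r, y) of (r, y) \<Rightarrow> ?w r * (h y * lapb s ((x - y) /\<^sub>R r))\<bar> \<le> C * (indicator {e<..} r * r powr (- real CARD('n) - 1)) * \<bar>h y\<bar>" for r y
  proof (cases "r \<in> {e<..R}")
   case True
   have "(r powr (- real CARD('n) - 1) * \<bar>h y\<bar>) * \<bar>lapb s ((x - y) /\<^sub>R r)\<bar> \<le> (r powr (- real CARD('n) - 1) * \<bar>h y\<bar>) * C"
    by (intro mult_left_mono lapb_le[OF s(1) C]) auto
   then show ?thesis using True by (simp add: abs_mult mult_ac)
  qed (use C(1) in \<open>auto simp: indicator_def\<close>)
 qed measurable
 have z: "(LBINT y. ?w r * (h y * lapb s ((x - y) /\<^sub>R r))) = layer s e R r (tlap s 0 (avg r)) x" for r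
 proof (cases "r \<in> {e<..R}")
  case True
  then have r: "0 < r" using e by simp
  have "r powr (2 * s - 1 - real CARD('n)) * r powr (- 2 * s) = r powr (- real CARD('n) - 1)"
   by (simp only: powr_add[symmetric], rule arg_cong[where f="\<lambda>p. r powr p"], simp)
  then show ?thesis using True unfolding tlap_avg_0[OF r] integral_mult_right_zero by (simp add: mult.assoc[symmetric])
 qed simp
 show "L1 (\<lambda>r. layer s e R r (tlap s 0 (avg r)) x)"
  using lborel_pair.integrable_fst[OF F] by (simp only: z)
 have "(LBINT r. layer s e R r (tlap s 0 (avg r)) x)
   = (LBINT y. LBINT r. ?w r * (h y * lapb s ((x - y) /\<^sub>R r)))"
  unfolding z[symmetric] using lborel_pair.Fubini_integral[OF F] by simp
 also have "\<dots> = (LBINT y. h y * (moll s e (x - y) - moll s R (x - y)))"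
  unfolding moll_diff[OF s e, symmetric] by (simp only: integral_mult_right_zero[symmetric] mult.assoc mult.left_commute[of "h _"])
 also have "\<bar>\<dots>\<bar> \<le> (LBINT y. G * (\<bar>moll s e (x - y)\<bar> + \<bar>moll s R (x - y)\<bar>))"
 proof -
  have b: "\<bar>h y * (moll s e (x - y) - moll s R (x - y))\<bar> \<le> G * (\<bar>moll s e (x - y)\<bar> + \<bar>moll s R (x - y)\<bar>)" for y
   unfolding abs_mult by (intro mult_mono h_le G_nonneg) auto
  have i: "L1 (\<lambda>y. G * (\<bar>moll s e (x - y)\<bar> + \<bar>moll s R (x - y)\<bar>))"
   by (intro integrable_mult_right bochner_integrable_add moll_norm1(1) s e R)
  show ?thesis by (rule dominated(2)[OF i _ b]) measurable
 qed
 also have "\<dots> = G * (2 * (LBINT y::real^'n. \<bar>moll s 1 y\<bar>))"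
  using moll_norm1[OF s e(1), of x] moll_norm1[OF s R, of x] by simp
 finally show "\<bar>LBINT r. layer s e R r (tlap s 0 (avg r)) x\<bar>
   \<le> G * (2 * (LBINT y::real^'n. \<bar>moll s 1 y\<bar>))" .
qed

text \<open>Layers with r \<le> e are estimated by the mass of the cut-off kernel. Coarser ones are
  compared with the untruncated operator, at the price of a second moment over |z| < e, and
  \<open>tlap_avg_main\<close> handles the latter. In both error terms the powers of e
  cancel.\<close>

lemma tlap_pot_bound:
 assumes e: "0 < e" "e \<le> R"
 shows "\<bar>tlap s e pot x\<bar> \<le> G * (C1 * (LBINT z::real^'n. kern s 1 z) / (2 * s) + 2 * (LBINT y::real^'n. \<bar>moll s 1 y\<bar>)
   + C1 * (LBINT z::real^'n. min 1 ((norm z)\<^sup>2) * kern s 0 z) / (2 - 2 * s))"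
proof -
 let ?M = "LBINT z::real^'n. kern s 1 z" and ?N = "LBINT z::real^'n. min 1 ((norm z)\<^sup>2) * kern s 0 z"
 let ?p = "2 * s - 1 - real CARD('n)"
 define J where "J d r = r powr ?p * tlap s d (avg r) x" for d r
 note iJ = tlap_pot(1)[OF e(1), of x, folded J_def] and tp = tlap_pot(2)[OF e(1), of x, folded J_def]
  and iM = tlap_avg_main(1)[OF e, of x, folded J_def] and M = tlap_avg_main(2)[OF e, of x, folded J_def]
 have i1: "L1 (\<lambda>r. indicator {0<..e} r * J e r)" and i2: "L1 (\<lambda>r. indicator {e<..R} r * J e r)"
 proof -
  have eq: "indicator {0<..e} r * J e r = indicator {0<..e} r *\<^sub>R (indicator {0<..R} r * J e r)"
   "indicator {e<..R} r * J e r = indicator {e<..R} r *\<^sub>R (indicator {0<..R} r * J e r)" for r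
   using e by (auto simp: indicator_def)
  show "L1 (\<lambda>r. indicator {0<..e} r * J e r)" "L1 (\<lambda>r. indicator {e<..R} r * J e r)"
   unfolding eq by (intro integrable_mult_indicator iJ; simp)+
 qed
 have i3: "L1 (\<lambda>r. indicator {e<..R} r * (J e r - J 0 r))"
  using bochner_integrable_diff[OF i2 iM] by (simp add: right_diff_distrib)
 have "tlap s e pot x = (LBINT r. indicator {0<..e} r * J e r + (indicator {e<..R} r * J 0 r + indicator {e<..R} r * (J e r - J 0 r)))"
  unfolding tp using e by (intro bochner_cong[OF refl]) (auto simp: indicator_def)
 also have "\<dots> = (LBINT r. indicator {0<..e} r * J e r) + ((LBINT r. indicator {e<..R} r * J 0 r) + (LBINT r. indicator {e<..R} r * (J e r - J 0 r)))"
  using i1 iM i3 by simp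
 finally have split: "tlap s e pot x = (LBINT r. indicator {0<..e} r * J e r) + ((LBINT r. indicator {e<..R} r * J 0 r) + (LBINT r. indicator {e<..R} r * (J e r - J 0 r)))" .
 have B1: "\<bar>LBINT r. indicator {0<..e} r * J e r\<bar> \<le> G * (C1 * ?M / (2 * s))"
 proof -
  let ?K = "G * C1 * (e powr (- 2 * s) * ?M)"
  have b: "\<bar>indicator {0<..e} r * J e r\<bar> \<le> ?K * (indicator {0<..e} r * r powr (2 * s - 1))" for r
  proof (cases "r \<in> {0<..e}")
   case True
   then have r: "0 < r" by simp
   have "r powr ?p * \<bar>tlap s e (avg r) x\<bar> \<le> r powr ?p * (G * C1 * r powr real CARD('n) * (e powr (- 2 * s) * ?M))"
    by (intro mult_left_mono tlap_avg_small[OF r e(1)]) simp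
   also have "\<dots> = ?K * (r powr ?p * r powr real CARD('n))" by (simp add: mult_ac)
   also have "r powr ?p * r powr real CARD('n) = r powr (2 * s - 1)" by (simp only: powr_add[symmetric]) simp
   finally show ?thesis using True by (simp add: J_def abs_mult)
  qed simp
  have "\<bar>LBINT r. indicator {0<..e} r * J e r\<bar> \<le> (LBINT r. ?K * (indicator {0<..e} r * r powr (2 * s - 1)))"
   by (rule dominated(2)[OF integrable_mult_right[OF powr_R_integral(1)[OF e(1)]] _ b]) (use i1 in auto)
  also have "\<dots> = G * (C1 * ?M / (2 * s)) * (e powr (- 2 * s) * e powr (2 * s))"
   unfolding integral_mult_right_zero powr_R_integral(2)[OF e(1)] by (simp add: mult_ac)
  also have "e powr (- 2 * s) * e powr (2 * s) = 1" using e by (simp only: powr_add[symmetric]) simp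
  finally show ?thesis by simp
 qed
 have B3: "\<bar>LBINT r. indicator {e<..R} r * (J e r - J 0 r)\<bar> \<le> G * (C1 * ?N / (2 - 2 * s))"
 proof -
  let ?K = "G * C1 * (e powr (2 - 2 * s) * ?N)"
  have K: "0 \<le> ?K" using G_nonneg C1(1)
   by (intro mult_nonneg_nonneg integral_nonneg_AE AE_I2) (auto simp: kern_nonneg)
  have "has_bochner_integral lborel (\<lambda>t. indicator {e<..} t * t powr (- (2 - 2 * s) - 1)) (e powr - (2 - 2 * s) / (2 - 2 * s))"
   by (rule powr_integral_at_top) (use s e in auto)
  then have it: "L1 (\<lambda>r. ?K * (indicator {e<..} r * r powr (- (2 - 2 * s) - 1)))"
   "(LBINT r. indicator {e<..} r * r powr (- (2 - 2 * s) - 1)) = e powr - (2 - 2 * s) / (2 - 2 * s)"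
   by (auto simp: has_bochner_integral_iff)
  have b: "\<bar>indicator {e<..R} r * (J e r - J 0 r)\<bar> \<le> ?K * (indicator {e<..} r * r powr (- (2 - 2 * s) - 1))" for r
  proof (cases "r \<in> {e<..R}")
   case True
   then have r: "0 < r" using e by simp
   have "r powr ?p * \<bar>tlap s e (avg r) x - tlap s 0 (avg r) x\<bar> \<le> r powr ?p * (G * C1 * r powr (real CARD('n) - 2) * (e powr (2 - 2 * s) * ?N))"
    by (intro mult_left_mono tlap_avg_near[OF r e(1)]) simp
   also have "\<dots> = ?K * (r powr ?p * r powr (real CARD('n) - 2))" by (simp add: mult_ac)
   also have "r powr ?p * r powr (real CARD('n) - 2) = r powr (- (2 - 2 * s) - 1)" by (simp only: powr_add[symmetric]) simp
   finally have "\<bar>r powr ?p * (tlap s e (avg r) x - tlap s 0 (avg r) x)\<bar> \<le> ?K * r powr (- (2 - 2 * s) - 1)" by (simp add: abs_mult)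
   then show ?thesis using True by (simp add: J_def right_diff_distrib)
  next
   case False
   then have "indicator {e<..R} r * (J e r - J 0 r) = 0" by simp
   moreover have "0 \<le> ?K * (indicator {e<..} r * r powr (- (2 - 2 * s) - 1))" using mult_nonneg_nonneg[OF K, of "indicator {e<..} r * r powr (- (2 - 2 * s) - 1)"] by simp
   ultimately show ?thesis by (simp only: abs_zero)
  qed
  have "\<bar>LBINT r. indicator {e<..R} r * (J e r - J 0 r)\<bar> \<le> (LBINT r. ?K * (indicator {e<..} r * r powr (- (2 - 2 * s) - 1)))"
   by (rule dominated(2)[OF it(1) _ b]) (use i3 in auto)
  also have "\<dots> = G * (C1 * ?N / (2 - 2 * s)) * (e powr (2 - 2 * s) * e powr - (2 - 2 * s))"
   unfolding integral_mult_right_zero it(2) by (simp add: mult_ac)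
  also have "e powr (2 - 2 * s) * e powr - (2 - 2 * s) = 1" using e by (simp only: powr_add[symmetric]) simp
  finally show ?thesis by simp
 qed
 have "\<bar>tlap s e pot x\<bar> \<le> G * (C1 * ?M / (2 * s)) + (G * (2 * (LBINT y::real^'n. \<bar>moll s 1 y\<bar>)) + G * (C1 * ?N / (2 - 2 * s)))"
  using B1 B3 M unfolding split by linarith
 then show ?thesis by (simp add: distrib_left)
qed

end

section \<open>Equicontinuity of the truncated integrals and their pointwise limit\<close>

lemma (in local_solution) smooth_part_sdiff:
 assumes R: "0 < R"
 obtains K where "\<And>z x. \<bar>sdiff (smooth_part R) z x\<bar> \<le> K * min 1 ((norm z)\<^sup>2)"
proof -
 let ?n = "real CARD('n)"
 obtain M where M: "0 \<le> M" "\<And>x. \<bar>smooth_part R x\<bar> \<le> M" using smooth_part_bounded[OF R] by blast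
 obtain C where C: "0 < C" "\<And>z x :: real^'n. norm z \<le> 1 \<Longrightarrow> \<bar>sdiff (moll s 1) z x\<bar> \<le> C * (norm z)\<^sup>2 * decay s x"
  using moll_sdiff_bound[OF s] by blast
 define D where "D y = C * R powr (- ?n) / R\<^sup>2 * decay s (y /\<^sub>R R)" for y :: "real^'n"
 have [measurable]: "D \<in> borel_measurable borel" unfolding D_def[abs_def] by measurable
 have D0: "0 \<le> D y" for y unfolding D_def using C(1) decay_pos[of s "y /\<^sub>R R"] by simp
 have Dle: "\<bar>D y\<bar> \<le> C * R powr (- ?n) / R\<^sup>2 * max 1 R powr (?n + 2 * s) * decay s y" for y
  using mult_left_mono[OF decay_scale[OF s(1) R, of "max 1 R" y], of "C * R powr (- ?n) / R\<^sup>2"] C(1) D0[of y] by (simp add: D_def mult.assoc)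
 have u2: "(\<lambda>y. \<bar>u y\<bar>) \<in> borel_measurable borel" "L1 (\<lambda>y. (\<bar>u y\<bar>)\<^sup>2)" using u_L2 by simp_all
 obtain M' where M': "0 \<le> M'" "\<And>x. \<bar>LBINT y. \<bar>u y\<bar> * D (x - y)\<bar> \<le> M'"
  by (rule conv_bounded[OF s(1) zero_less_one u2 \<open>D \<in> borel_measurable borel\<close> Dle], rule that)
 have near: "\<bar>sdiff (smooth_part R) z x\<bar> \<le> M' * (norm z)\<^sup>2" if z: "norm z \<le> R" for z x
 proof -
  have sm: "\<bar>sdiff (moll s R) z w\<bar> \<le> (norm z)\<^sup>2 * D w" for w
  proof -
   have "sdiff (moll s R) z w = R powr - ?n * sdiff (moll s 1) (z /\<^sub>R R) (w /\<^sub>R R)"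
    unfolding sdiff_def moll_scale[OF R, of s "w + z"] moll_scale[OF R, of s "w - z"] moll_scale[OF R, of s w] by (simp add: algebra_simps)
   moreover have "\<bar>sdiff (moll s 1) (z /\<^sub>R R) (w /\<^sub>R R)\<bar> \<le> C * (norm (z /\<^sub>R R))\<^sup>2 * decay s (w /\<^sub>R R)"
    using z R by (intro C(2)) (unfold norm_dilate[OF R], simp)
   ultimately have "\<bar>sdiff (moll s R) z w\<bar> \<le> R powr - ?n * (C * (norm (z /\<^sub>R R))\<^sup>2 * decay s (w /\<^sub>R R))" by (simp add: abs_mult mult_left_mono)
   then show ?thesis unfolding norm_dilate[OF R] by (simp add: D_def power_divide mult_ac)
  qed
  note i = smooth_integrable[OF R]
  have eq: "u y * sdiff (moll s R) z (x - y) = (u y * moll s R ((x + z) - y) + u y * moll s R ((x - z) - y)) - 2 * (u y * moll s R (x - y))" for y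
   by (simp add: sdiff_def algebra_simps)
  have ism: "L1 (\<lambda>y. u y * sdiff (moll s R) z (x - y))"
   unfolding eq by (intro bochner_integrable_diff bochner_integrable_add integrable_mult_right i)
  have iD: "L1 (\<lambda>y. \<bar>u y\<bar> * D (x - y))"
  proof -
   have "L1 (\<lambda>y. C * R powr (- ?n) / R\<^sup>2 * \<bar>u y * decay s ((x - y) /\<^sub>R R)\<bar>)"
    by (intro integrable_mult_right integrable_abs L2_decay_integrable[OF s(1) R _ u_L2, where C=1]) (auto simp: abs_of_pos[OF decay_pos])
   then show ?thesis by (simp add: D_def abs_mult abs_of_pos[OF decay_pos] mult_ac)
  qed
  have "sdiff (smooth_part R) z x = (LBINT y. u y * sdiff (moll s R) z (x - y))"
   unfolding eq using i by (simp add: sdiff_def smooth_part_def)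
  also have "\<bar>\<dots>\<bar> \<le> (LBINT y. (norm z)\<^sup>2 * (\<bar>u y\<bar> * D (x - y)))"
   by (rule dominated(2)[OF integrable_mult_right[OF iD]])
     (use ism mult_left_mono[OF sm abs_ge_zero] in \<open>auto simp: abs_mult mult.left_commute\<close>)
  also have "\<dots> \<le> (norm z)\<^sup>2 * M'" unfolding integral_mult_right_zero using M'(2)[of x] by (intro mult_left_mono) auto
  finally show ?thesis by (simp add: mult.commute)
 qed
 have far: "\<bar>sdiff (smooth_part R) z x\<bar> \<le> 4 * M" for z x
  unfolding sdiff_def using M(2)[of "x + z"] M(2)[of "x - z"] M(2)[of x] by linarith
 let ?A = "max M (max M' (4 * M / R\<^sup>2))"
 have A: "\<bar>sdiff (smooth_part R) z x\<bar> \<le> ?A * (norm z)\<^sup>2" for z x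
 proof (cases "norm z \<le> R")
  case True
  have "M' * (norm z)\<^sup>2 \<le> ?A * (norm z)\<^sup>2" by (intro mult_right_mono) auto
  then show ?thesis using near[OF True, of x] by linarith
 next
  case False
  then have "R\<^sup>2 \<le> (norm z)\<^sup>2" using R by (intro power_mono) auto
  then have "4 * M / R\<^sup>2 * R\<^sup>2 \<le> ?A * (norm z)\<^sup>2" using M(1) R by (intro mult_mono) (auto simp: max_def)
  then show ?thesis using far[of z x] R by simp
 qed
 have "\<bar>smooth_part R x\<bar> \<le> ?A" for x using M(2)[of x] by simp
 then show thesis using sdiff_min_bound[of "smooth_part R" ?A, OF _ A] that by blast
qed

locale continuous_local_solution = local_solution s B \<Omega> u g
 for s B :: real and \<Omega> :: "(real^'n) set" and u g :: "real^'n \<Rightarrow> real" +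
 assumes u_cont: "continuous_on \<Omega> u" and g_cont: "continuous_on \<Omega> g"
begin

lemma inner_part_subset: "0 \<le> D \<Longrightarrow> inner_part D \<subseteq> \<Omega>"
 using inner_part_cball[of _ D 0] by auto

lemma representation:
 assumes R: "0 < R" and x: "x \<in> inner_part (2 * R)"
 shows "moll_mass TYPE('n) s * u x = smooth_part R x + potential 0 R x"
proof -
 have "moll_mass TYPE('n) s * u x - (smooth_part R x + potential 0 R x) = 0"
 proof (rule continuous_AE_zero[OF inner_part_open _ _ x])
  show "continuous_on (inner_part (2 * R)) (\<lambda>x. moll_mass TYPE('n) s * u x - (smooth_part R x + potential 0 R x))"
   using R by (intro continuous_intros continuous_on_subset[OF u_cont] inner_part_subset potential_continuous
     continuous_at_imp_continuous_on ballI smooth_part_continuous) auto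
  show "AE x in lborel. x \<in> inner_part (2 * R) \<longrightarrow> moll_mass TYPE('n) s * u x - (smooth_part R x + potential 0 R x) = 0"
   using representation_AE[OF R]
  proof eventually_elim
   case (elim x)
   show ?case using elim inner_part_shift[of x "2 * R" x R] R by auto
  qed
 qed
 then show ?thesis by simp
qed

lemma tlap_isCont:
 assumes e: "0 < e" "e \<le> 1" and x: "x \<in> \<Omega>"
 shows "isCont (tlap s e u) x"
proof -
 have "AE y in lborel. isCont (kern s e) (x - y)"
 proof -
  have "AE y in lborel. y \<notin> sphere x e"
   using negligible_sphere[of x e] by (intro AE_not_in) (simp add: negligible_iff_null_sets null_sets_completion_iff)
  then show ?thesis
  proof eventually_elim
   case (elim y)
   then have "norm (x - y) \<noteq> e" by (simp add: dist_norm)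
   then consider "e < norm (x - y)" | "norm (x - y) < e" by linarith
   then show ?case
   proof cases
    case 1
    then show ?thesis using e by (intro kern_isCont) auto
   next
    case 2
    have "\<forall>\<^sub>F z in nhds (x - y). norm z < e"
     using order_tendstoD(2)[OF tendsto_norm[OF filterlim_ident], of "x - y" e] 2 by simp
    then have "\<forall>\<^sub>F z in nhds (x - y). kern s e z = 0" by eventually_elim (simp add: kern_def)
    then show ?thesis by (subst isCont_cong) auto
   qed
  qed
 qed
 then have c: "isCont (\<lambda>x. LBINT y. u y * kern s e (x - y)) x"
  by (intro conv_continuous[OF s(1) u_meas u_L2 kern_measurable, where C="(2 / e) powr (real CARD('n) + 2 * s)"])
    (simp add: abs_kern kern_le_decay[OF s(1) e])
 have "isCont u x" using u_cont x continuous_on_eq_continuous_at[OF \<Omega>] by blast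
 then have "isCont (\<lambda>x. (LBINT z::real^'n. kern s e z) * u x - (LBINT y. u y * kern s e (x - y))) x"
  using c by (intro continuous_intros)
 moreover have "tlap s e u = (\<lambda>x. (LBINT z::real^'n. kern s e z) * u x - (LBINT y. u y * kern s e (x - y)))"
  using tlap_conv(3)[OF s(1) e u_meas u_L2] by (simp add: fun_eq_iff)
 ultimately show ?thesis by simp
qed

lemma sdiff_u_integrable:
 assumes e: "0 < e" "e \<le> 1"
 shows "L1 (\<lambda>z. sdiff u z x * kern s e z)"
proof -
 have i: "L1 (\<lambda>z. u (x + z) * kern s e z)" by (rule tlap_conv(2)[OF s(1) e u_meas u_L2])
 have "L1 (\<lambda>z. (\<lambda>z. u (x + z) * kern s e z) (0 - z))" using i by (subst integrable_lborel_reflect)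
 then have i2: "L1 (\<lambda>z. u (x - z) * kern s e z)" by (simp add: kern_minus)
 have "(\<lambda>z. sdiff u z x * kern s e z) = (\<lambda>z. (u (x + z) * kern s e z + u (x - z) * kern s e z) - 2 * u x * kern s e z)"
  by (simp add: sdiff_def fun_eq_iff algebra_simps)
 then show ?thesis using i i2 kern_integrable[OF s(1) e(1)]
  by (simp only:) (intro bochner_integrable_diff bochner_integrable_add integrable_mult_right)
qed

text \<open>Absolute values inside the integral and the full kernel \<open>kern s 0\<close> make the
  bound valid for all truncations at once. Second differences of the smooth part are O(min 1 |z|^2)
  uniformly in the centre, so dominated convergence applies as y tends to 0.\<close>

lemma smooth_part_modulus:
 assumes R: "0 < R" and \<eta>: "0 < \<eta>"
 shows "\<exists>\<delta>>0. \<forall>y. norm y \<le> \<delta> \<longrightarrow> L1 (\<lambda>z. \<bar>sdiff (smooth_part R) z x - sdiff (smooth_part R) z (x - y)\<bar> * kern s 0 z)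
  \<and> (LBINT z. \<bar>sdiff (smooth_part R) z x - sdiff (smooth_part R) z (x - y)\<bar> * kern s 0 z) \<le> \<eta>"
proof -
 obtain K where K: "\<And>z x. \<bar>sdiff (smooth_part R) z x\<bar> \<le> K * min 1 ((norm z)\<^sup>2)" using smooth_part_sdiff[OF R] by blast
 define D where "D y z = \<bar>sdiff (smooth_part R) z x - sdiff (smooth_part R) z (x - y)\<bar> * kern s 0 z" for y z
 have [measurable]: "D y \<in> borel_measurable borel" for y unfolding D_def[abs_def] by measurable
 have iK: "L1 (\<lambda>z :: real^'n. 2 * K * (min 1 ((norm z)\<^sup>2) * kern s 0 z))" by (intro integrable_mult_right kern_min_integrable s)
 have DK: "\<bar>D y z\<bar> \<le> 2 * K * (min 1 ((norm z)\<^sup>2) * kern s 0 z)" for y z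
 proof -
  have "\<bar>sdiff (smooth_part R) z x - sdiff (smooth_part R) z (x - y)\<bar> \<le> 2 * K * min 1 ((norm z)\<^sup>2)"
   using K[of z x] K[of z "x - y"] by linarith
  then show ?thesis using mult_right_mono[OF _ kern_nonneg[of s 0 z]] by (simp add: D_def abs_mult abs_kern mult.assoc[symmetric])
 qed
 have iD: "L1 (D y)" for y
  by (rule dominated(1)[OF iK _ DK]) measurable
 have "isCont (\<lambda>y. LBINT z. D y z) 0"
 proof (unfold continuous_at_sequentially comp_def, intro allI impI)
  fix X :: "nat \<Rightarrow> real^'n" assume X: "X \<longlonglongrightarrow> 0"
  show "(\<lambda>k. LBINT z. D (X k) z) \<longlonglongrightarrow> (LBINT z. D 0 z)"
  proof (rule integral_dominated_convergence[where w="\<lambda>z. 2 * K * (min 1 ((norm z)\<^sup>2) * kern s 0 z)"])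
   show "AE z in lborel. (\<lambda>k. D (X k) z) \<longlonglongrightarrow> D 0 z"
    unfolding D_def sdiff_def
    by (intro AE_I2 tendsto_intros isCont_tendsto_compose[OF smooth_part_continuous[OF R]] X)
  qed (use iK DK in auto)
 qed
 moreover have "(LBINT z. D 0 z) = 0" by (simp add: D_def)
 ultimately obtain d where d: "0 < d" "\<And>y. norm y < d \<Longrightarrow> \<bar>LBINT z. D y z\<bar> < \<eta>"
  using \<eta> by (auto simp: continuous_at_eps_delta dist_norm)
 show ?thesis unfolding D_def[symmetric]
 proof (intro exI[of _ "d / 2"] conjI allI impI iD)
  fix y :: "real^'n" assume "norm y \<le> d / 2"
  then show "(LBINT z. D y z) \<le> \<eta>" using d(1) d(2)[of y] by auto
 qed (use d in auto)
qed

text \<open>The order of quantifiers is the point: C is fixed before the density and its bound G, so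
  a uniformly small density has uniformly small truncated Laplacians. The locale constant
  \<open>C1\<close> is pinned to \<open>c1\<close> because C depends on it.\<close>

lemma bounded_density_integral:
 assumes R: "0 < R"
 obtains C where "0 \<le> C" "\<And>h G C1 e x. bounded_density s G R C1 (h :: real^'n \<Rightarrow> real) \<Longrightarrow> C1 = c1 \<Longrightarrow> 0 < e \<Longrightarrow> e \<le> R \<Longrightarrow> \<bar>tlap s e (bounded_density.pot s R h) x\<bar> \<le> C * G"
proof -
 let ?C = "\<bar>c1 * (LBINT z::real^'n. kern s 1 z) / (2 * s) + 2 * (LBINT y::real^'n. \<bar>moll s 1 y\<bar>)
   + c1 * (LBINT z::real^'n. min 1 ((norm z)\<^sup>2) * kern s 0 z) / (2 - 2 * s)\<bar>"
 have "\<bar>tlap s e (bounded_density.pot s R h) x\<bar> \<le> ?C * G"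
  if h: "bounded_density s G R C1 h" "C1 = c1" "0 < e" "e \<le> R" for h :: "real^'n \<Rightarrow> real" and G C1 e x
  using bounded_density.tlap_pot_bound[OF h(1,3,4), of x]
   mult_left_mono[OF abs_ge_self bounded_density.G_nonneg[OF h(1)]] unfolding h(2) by (simp add: mult.commute[of _ G]) (meson order_trans)
 then show thesis using that[of ?C] by simp
qed

text \<open>Near x0 the increment u(x) - u(x - y) consists of an increment of the smooth part and
  the potential of g(z) - g(z - y), up to the mass of the mollifier. This density is uniformly small
  because g is uniformly continuous on a compact ball. Bounds for bounded densities alone give no
  convergence; applied to increments, they give equicontinuity.\<close>

lemma tlap_modulus:
 assumes R: "0 < R" "R \<le> 1" and x0: "x0 \<in> inner_part (4 * R)" and \<eta>: "0 < \<eta>"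
 shows "\<exists>\<delta>>0. \<forall>y e. norm y \<le> \<delta> \<longrightarrow> 0 < e \<longrightarrow> e \<le> R \<longrightarrow> \<bar>tlap s e u x0 - tlap s e u (x0 - y)\<bar> \<le> \<eta>"
proof -
 let ?m = "moll_mass TYPE('n) s"
 obtain c1 where c1: "0 < c1" "\<And>z :: real^'n. (LBINT x. \<bar>sdiff bump z x\<bar>) \<le> c1 * min 1 ((norm z)\<^sup>2)"
  using sdiff_bump_norm1 by blast
 obtain C where C: "0 \<le> C" "\<And>h G C1 e x. bounded_density s G R C1 (h :: real^'n \<Rightarrow> real) \<Longrightarrow> C1 = c1 \<Longrightarrow> 0 < e \<Longrightarrow> e \<le> R \<Longrightarrow> \<bar>tlap s e (bounded_density.pot s R h) x\<bar> \<le> C * G"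
  using bounded_density_integral[OF R(1), of c1] by blast
 note R1 = R(2)
 define \<eta>1 where "\<eta>1 = \<eta> / 3"
 have \<eta>1: "0 < \<eta>1" using \<eta> by (simp add: \<eta>1_def)
 \<comment> \<open>Sized so that the potential of a density bounded by \<gamma> has truncated
   Laplacians of size at most \<open>?m * \<eta>1 / 2\<close>; adding 1 keeps the denominator
   positive.\<close>
 define \<gamma> where "\<gamma> = \<eta>1 * ?m / (2 * C + 1)"
 have \<gamma>: "0 < \<gamma>" using \<eta>1 m_pos C(1) by (simp add: \<gamma>_def)
 have in\<Omega>: "cball x0 (3 * R) \<subseteq> \<Omega>" using inner_part_cball[OF x0, of "3 * R"] R by simp
 have inn: "x \<in> inner_part (2 * R)" if "dist x0 x \<le> 2 * R" for x
  using inner_part_shift[OF x0 that] by simp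
 have "uniformly_continuous_on (cball x0 (3 * R)) g"
  by (intro compact_uniformly_continuous continuous_on_subset[OF g_cont in\<Omega>]) simp
 then obtain d1 where d1: "0 < d1" "\<And>a b. a \<in> cball x0 (3 * R) \<Longrightarrow> b \<in> cball x0 (3 * R) \<Longrightarrow> dist b a < d1 \<Longrightarrow> \<bar>g b - g a\<bar> < \<gamma>"
  using \<gamma> unfolding uniformly_continuous_on_def dist_real_def by metis
 obtain d2 where d2: "0 < d2" "\<And>y. norm y \<le> d2 \<Longrightarrow> L1 (\<lambda>z. \<bar>sdiff (smooth_part R) z x0 - sdiff (smooth_part R) z (x0 - y)\<bar> * kern s 0 z)"
  "\<And>y. norm y \<le> d2 \<Longrightarrow> (LBINT z. \<bar>sdiff (smooth_part R) z x0 - sdiff (smooth_part R) z (x0 - y)\<bar> * kern s 0 z) \<le> ?m * \<eta>1"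
  using smooth_part_modulus[OF R(1) mult_pos_pos[OF m_pos \<eta>1], of x0] by blast
 have "x0 \<in> \<Omega>" using in\<Omega> R by auto
 then obtain d3 where d3: "0 < d3" "\<And>y. dist y x0 < d3 \<Longrightarrow> \<bar>tlap s R u y - tlap s R u x0\<bar> < \<eta>1"
  using tlap_isCont[OF R] \<eta>1 unfolding continuous_at_eps_delta dist_real_def by blast
 define \<delta> where "\<delta> = min (min (d1 / 2) d2) (min (d3 / 2) R)"
 have \<delta>: "0 < \<delta>" "\<delta> < d1" "\<delta> \<le> d2" "\<delta> < d3" "\<delta> \<le> R" using d1 d2 d3 R by (auto simp: \<delta>_def min_def)
 have "\<bar>tlap s e u x0 - tlap s e u (x0 - y)\<bar> \<le> \<eta>" if y: "norm y \<le> \<delta>" and e: "0 < e" "e \<le> R" for y e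
 proof -
  \<comment> \<open>The cut at 2R is invisible to averages of radius at most R about points within R
    of x0. On the ball of radius 2R both z and z - y stay within 3R of x0, where g is uniformly
    continuous.\<close>
  define h where "h z = indicator (cball x0 (2 * R)) z * (g z - g (z - y))" for z
  have [measurable]: "cball x0 (2 * R) \<in> sets borel" by simp
  have [measurable]: "h \<in> borel_measurable borel" unfolding h_def[abs_def] by measurable
  have ig: "L1 (\<lambda>z. g (z - y))" using g_int integrable_lborel_translate[of g "- y"] by (simp add: add.commute)
  have h_le: "\<bar>h z\<bar> \<le> \<gamma>" for z
  proof (cases "z \<in> cball x0 (2 * R)")
   case True
   have "dist x0 (z - y) \<le> dist x0 z + norm y" using norm_triangle_ineq[of "x0 - z" y] by (simp add: dist_norm algebra_simps)
   then have "z - y \<in> cball x0 (3 * R)" "z \<in> cball x0 (3 * R)" using True y \<delta> R by auto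
   then show ?thesis using True d1(2)[of "z - y" z] y \<delta> by (simp add: h_def dist_norm)
  qed (use \<gamma> in \<open>simp add: h_def\<close>)
  interpret bounded_density s \<gamma> R c1 h
  proof
   show "L1 h" unfolding h_def[abs_def]
    using integrable_mult_indicator[OF _ bochner_integrable_diff[OF g_int ig], of "cball x0 (2 * R)"] by simp
  qed (use s R c1 h_le in auto)
  have avg_h: "avg r x = bump_avg r x - bump_avg r (x - y)" if r: "0 < r" "r \<le> R" and x: "dist x0 x \<le> R" for r x
  proof -
   have i1: "L1 (\<lambda>z. g z * bumpd x r z)"
    by (rule bochner_bound[OF g_int]) (auto simp: abs_mult bumpd_bounds mult_left_le)
   have i2: "L1 (\<lambda>z. g (z - y) * bumpd x r z)"
    by (rule bochner_bound[OF ig]) (auto simp: abs_mult bumpd_bounds mult_left_le)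
   have "h z * bumpd x r z = g z * bumpd x r z - g (z - y) * bumpd x r z" for z
   proof (cases "z \<in> cball x r")
    case True
    then have "z \<in> cball x0 (2 * R)" using x r dist_triangle[of x0 z x] by simp
    then show ?thesis by (simp add: h_def algebra_simps)
   qed (simp add: bumpd_outside[OF r(1)])
   then have "avg r x = (LBINT z. g z * bumpd x r z) - (LBINT z. g (z - y) * bumpd x r z)"
    using i1 i2 by (simp add: avg_def)
   also have "(LBINT z. g (z - y) * bumpd x r z) = (LBINT z. g z * bumpd (x - y) r z)"
    using integral_lborel_translate[of "\<lambda>z. g (z - y) * bumpd x r z" y, symmetric] by (simp add: bumpd_def algebra_simps)
   finally show ?thesis by (simp add: bump_avg_def)
  qed
  obtain K where K: "0 \<le> K" "\<And>x d. x \<in> inner_part (2 * R) \<Longrightarrow> 0 < d \<Longrightarrow> d \<le> R \<Longrightarrow> \<bar>potential 0 R x - potential d R x\<bar> \<le> K * d powr s"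
   "\<And>x. x \<in> inner_part (2 * R) \<Longrightarrow> L1 (\<lambda>r. layer s 0 R r (bump_avg r) x)"
   by (rule potential_tail[OF R(1)], rule that)
  have rep: "?m * (u x - u (x - y)) = smooth_part R x - smooth_part R (x - y) + pot x" if x: "dist x0 x \<le> R" for x
  proof -
   have "dist x0 (x - y) \<le> dist x0 x + norm y" using norm_triangle_ineq[of "x0 - x" y] by (simp add: dist_norm algebra_simps)
   then have xi: "x \<in> inner_part (2 * R)" "x - y \<in> inner_part (2 * R)" using x y \<delta> R by (auto intro!: inn)
   have "pot x = (LBINT r. layer s 0 R r (bump_avg r) x
     - layer s 0 R r (bump_avg r) (x - y))"
    unfolding pot_def by (intro bochner_cong[OF refl]) (auto simp: indicator_def avg_h x algebra_simps)
   then have "pot x = potential 0 R x - potential 0 R (x - y)"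
    using K(3)[OF xi(1)] K(3)[OF xi(2)] by (simp add: potential_def)
   then show ?thesis using representation[OF R(1) xi(1)] representation[OF R(1) xi(2)] by (simp add: algebra_simps)
  qed
  define \<kappa> where "\<kappa> z = sdiff (smooth_part R) z x0 - sdiff (smooth_part R) z (x0 - y)" for z
  \<comment> \<open>This kernel is supported in |z| < R, where the representation is available at
    all points involved. What lies beyond is the truncation at R, whose continuity at x0 is known
    separately.\<close>
  define k where "k z = kern s e z - kern s R z" for z :: "real^'n"
  have e1: "e \<le> 1" using e R1 by simp
  have k0: "0 \<le> k z" "k z \<le> kern s 0 z" for z
   using kern_antimono[OF e(2), of s z] kern_antimono[OF less_imp_le[OF e(1)], of s z] kern_nonneg[of s R z] unfolding k_def by linarith+
  have main: "?m * ((sdiff u z x0 - sdiff u z (x0 - y)) * k z) = \<kappa> z * k z + (sdiff pot z x0 * kern s e z - sdiff pot z x0 * kern s R z)" for z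
  proof (cases "norm z < R")
   case True
   have "?m * (sdiff u z x0 - sdiff u z (x0 - y)) = \<kappa> z + sdiff pot z x0"
    using rep[of "x0 + z"] rep[of "x0 - z"] rep[of x0] True R
    by (simp add: sdiff_def \<kappa>_def dist_norm algebra_simps)
   then have "?m * ((sdiff u z x0 - sdiff u z (x0 - y)) * k z) = (\<kappa> z + sdiff pot z x0) * k z" by (simp only: mult.assoc[symmetric])
   then show ?thesis by (simp add: k_def algebra_simps)
  next
   case False
   then have "kern s e z = kern s R z" using e by (simp add: kern_def)
   then show ?thesis by (simp add: k_def)
  qed
  have isu: "L1 (\<lambda>z. (sdiff u z x0 - sdiff u z (x0 - y)) * k z)"
  proof -
   have "(\<lambda>z. (sdiff u z x0 - sdiff u z (x0 - y)) * k z) = (\<lambda>z. (sdiff u z x0 * kern s e z - sdiff u z x0 * kern s R z) - (sdiff u z (x0 - y) * kern s e z - sdiff u z (x0 - y) * kern s R z))"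
    by (simp add: k_def fun_eq_iff algebra_simps)
   then show ?thesis by (simp only:) (intro bochner_integrable_diff sdiff_u_integrable e e1 R R1)
  qed
  have ipot: "L1 (\<lambda>z. sdiff pot z x0 * kern s d z)" if d: "0 < d" for d
  proof -
   let ?P = "\<gamma> * (LBINT w::real^'n. bump w) * (R powr (2 * s) / (2 * s))"
   have "\<bar>sdiff pot z x0\<bar> \<le> 4 * ?P" for z
    using pot_bounded[of "x0 + z"] pot_bounded[of "x0 - z"] pot_bounded[of x0] unfolding sdiff_def by linarith
   then have b: "\<bar>sdiff pot z x0 * kern s d z\<bar> \<le> 4 * ?P * kern s d z" for z
    unfolding abs_mult abs_kern by (intro mult_right_mono kern_nonneg)
   show ?thesis
    by (rule dominated(1)[OF integrable_mult_right[OF kern_integrable[OF s(1) d], of "4 * ?P"] _ b]) measurable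
  qed
  have ikap: "L1 (\<lambda>z. \<kappa> z * k z)" and kap: "\<bar>LBINT z. \<kappa> z * k z\<bar> \<le> ?m * \<eta>1"
  proof -
   have d: "norm y \<le> d2" using y \<delta> by simp
   have [measurable]: "\<kappa> \<in> borel_measurable borel" "k \<in> borel_measurable borel" unfolding \<kappa>_def[abs_def] k_def[abs_def] by measurable
   have b: "\<bar>\<kappa> z * k z\<bar> \<le> \<bar>\<kappa> z\<bar> * kern s 0 z" for z
    unfolding abs_mult using k0[of z] by (intro mult_left_mono) auto
   note dom = dominated[OF d2(2)[OF d, folded \<kappa>_def] _ b]
   show "L1 (\<lambda>z. \<kappa> z * k z)" by (rule dom(1)) measurable
   have "\<bar>LBINT z. \<kappa> z * k z\<bar> \<le> (LBINT z. \<bar>\<kappa> z\<bar> * kern s 0 z)" by (rule dom(2)) measurable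
   then show "\<bar>LBINT z. \<kappa> z * k z\<bar> \<le> moll_mass TYPE('n) s * \<eta>1" using d2(3)[OF d, folded \<kappa>_def] by linarith
  qed
  have tl: "(tlap s e u x0 - tlap s e u (x0 - y)) - (tlap s R u x0 - tlap s R u (x0 - y))
    = - (1 / 2) * (LBINT z. (sdiff u z x0 - sdiff u z (x0 - y)) * k z)"
  proof -
   note I = sdiff_u_integrable[OF e(1) e1] sdiff_u_integrable[OF R(1) R1]
   have "(\<lambda>z. (sdiff u z x0 - sdiff u z (x0 - y)) * k z) = (\<lambda>z. (sdiff u z x0 * kern s e z - sdiff u z x0 * kern s R z) - (sdiff u z (x0 - y) * kern s e z - sdiff u z (x0 - y) * kern s R z))"
    by (simp add: k_def fun_eq_iff algebra_simps)
   then show ?thesis unfolding tlap_def using I by (simp add: diff_divide_distrib)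
  qed
  have "?m * (LBINT z. (sdiff u z x0 - sdiff u z (x0 - y)) * k z)
    = (LBINT z. \<kappa> z * k z + (sdiff pot z x0 * kern s e z - sdiff pot z x0 * kern s R z))"
   unfolding main[symmetric] by simp
  also have "\<dots> = (LBINT z. \<kappa> z * k z) + ((LBINT z. sdiff pot z x0 * kern s e z) - (LBINT z. sdiff pot z x0 * kern s R z))"
   using ikap ipot[OF e(1)] ipot[OF R(1)] by simp
  also have "\<dots> = (LBINT z. \<kappa> z * k z) - 2 * (tlap s e pot x0 - tlap s R pot x0)" by (simp add: tlap_def)
  finally have eqm: "?m * (LBINT z. (sdiff u z x0 - sdiff u z (x0 - y)) * k z) = (LBINT z. \<kappa> z * k z) - 2 * (tlap s e pot x0 - tlap s R pot x0)" .
  have bd: "bounded_density s \<gamma> R c1 h" by unfold_locales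
  have "\<bar>tlap s e pot x0\<bar> \<le> C * \<gamma>" "\<bar>tlap s R pot x0\<bar> \<le> C * \<gamma>"
   using C(2)[OF bd refl e, of x0] C(2)[OF bd refl R(1) order_refl, of x0] by auto
  then have "\<bar>?m * (LBINT z. (sdiff u z x0 - sdiff u z (x0 - y)) * k z)\<bar> \<le> ?m * \<eta>1 + 4 * (C * \<gamma>)"
   using kap unfolding eqm by (simp add: abs_le_iff)
  moreover have "2 * (C * \<gamma>) \<le> ?m * \<eta>1"
  proof -
   have "2 * (C * \<gamma>) \<le> (2 * C + 1) * \<gamma>" using \<gamma> by (simp add: algebra_simps)
   also have "\<dots> = ?m * \<eta>1" using C(1) by (simp add: \<gamma>_def)
   finally show ?thesis .
  qed
  ultimately have "\<bar>?m * (LBINT z. (sdiff u z x0 - sdiff u z (x0 - y)) * k z)\<bar> \<le> ?m * (3 * \<eta>1)" by linarith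
  then have "?m * \<bar>LBINT z. (sdiff u z x0 - sdiff u z (x0 - y)) * k z\<bar> \<le> ?m * (3 * \<eta>1)"
   using m_pos by (simp add: abs_mult)
  then have "\<bar>LBINT z. (sdiff u z x0 - sdiff u z (x0 - y)) * k z\<bar> \<le> 3 * \<eta>1" using m_pos by simp
  moreover have "\<bar>tlap s R u x0 - tlap s R u (x0 - y)\<bar> \<le> \<eta>1"
   using d3(2)[of "x0 - y"] y \<delta> by (simp add: dist_norm abs_minus_commute)
  ultimately show ?thesis using tl \<eta> unfolding \<eta>1_def by linarith
 qed
 then show ?thesis using \<delta>(1) by blast
qed

text \<open>By symmetry of the truncated operator, testing with a small bump at x0 shows that bump
  averages of the truncated integrals converge to the bump average of g. Equicontinuity and
  continuity of g replace both averages by the values at x0. Each replacement and the weak limit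
  cost \<eta>, and 3\<eta> < \<epsilon>.\<close>

theorem tlap_tendsto_source:
 assumes x0: "x0 \<in> \<Omega>" and e: "\<And>k. 0 < e k" "e \<longlonglongrightarrow> 0"
 shows "(\<lambda>k. tlap s (e k) u x0) \<longlonglongrightarrow> g x0"
proof (rule LIMSEQ_I)
 fix \<epsilon> :: real assume \<epsilon>: "0 < \<epsilon>"
 define \<eta> where "\<eta> = \<epsilon> / 4"
 have \<eta>: "0 < \<eta>" using \<epsilon> by (simp add: \<eta>_def)
 obtain r0 where r0: "0 < r0" "ball x0 r0 \<subseteq> \<Omega>" using \<Omega> x0 open_contains_ball by blast
 define R where "R = min 1 (r0 / 8)"
 have R: "0 < R" "R \<le> 1" "8 * R \<le> r0" using r0 by (auto simp: R_def min_def)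
 have "ball x0 (4 * R + R) \<subseteq> \<Omega>" using r0(2) R subset_ball[of "4 * R + R" r0 x0] by auto
 then have xi: "x0 \<in> inner_part (4 * R)" unfolding inner_part_def using R(1) by blast
 obtain d where d: "0 < d" "\<And>y e. norm y \<le> d \<Longrightarrow> 0 < e \<Longrightarrow> e \<le> R \<Longrightarrow> \<bar>tlap s e u x0 - tlap s e u (x0 - y)\<bar> \<le> \<eta>"
  using tlap_modulus[OF R(1,2) xi \<eta>] by blast
 have "isCont g x0" using g_cont x0 continuous_on_eq_continuous_at[OF \<Omega>] by blast
 then obtain d' where d': "0 < d'" "\<And>y. dist y x0 < d' \<Longrightarrow> \<bar>g y - g x0\<bar> < \<eta>"
  using \<eta> unfolding continuous_at_eps_delta dist_real_def by blast
 define \<delta> where "\<delta> = min (min d (d' / 2)) R"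
 have \<delta>: "0 < \<delta>" "\<delta> \<le> d" "\<delta> < d'" "\<delta> \<le> R" using d d' R by (auto simp: \<delta>_def min_def)
 let ?b = "bumpd x0 \<delta>"
 define I where "I = (LBINT x. ?b x)"
 have ib: "L1 ?b" by (rule bumpd_integrable[OF \<delta>(1)])
 have I: "0 < I"
  unfolding I_def bumpd_def using integral_dilation(1)[OF \<delta>(1), of bump x0] \<delta>(1) bump_integral_pos[where 'n='n] by simp
 have dist_avg: "\<bar>a * I - (LBINT x. ?b x * F x)\<bar> \<le> \<eta> * I"
  if iF: "L1 (\<lambda>x. ?b x * F x)" and F: "\<And>x. x \<in> cball x0 \<delta> \<Longrightarrow> \<bar>a - F x\<bar> \<le> \<eta>" for a and F :: "real^'n \<Rightarrow> real"
 proof -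
  have iD: "L1 (\<lambda>x. ?b x * (a - F x))"
   using bochner_integrable_diff[OF integrable_mult_right[OF ib, of a] iF] by (simp add: algebra_simps)
  have le: "\<bar>?b x * (a - F x)\<bar> \<le> \<eta> * ?b x" for x
  proof (cases "x \<in> cball x0 \<delta>")
   case True
   show ?thesis using mult_left_mono[OF F[OF True] bumpd_bounds(1)[of x0 \<delta> x]]
    by (simp add: abs_mult abs_of_nonneg[OF bumpd_bounds(1)] mult.commute)
  qed (simp add: bumpd_outside[OF \<delta>(1)])
  have "a * I - (LBINT x. ?b x * F x) = (LBINT x. ?b x * (a - F x))"
   using bochner_diff[OF integrable_mult_right[OF ib, of a] iF] by (simp add: I_def algebra_simps)
  also have "\<bar>\<dots>\<bar> \<le> (LBINT x. \<eta> * ?b x)"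
   by (rule dominated(2)[OF integrable_mult_right[OF ib] _ le]) (use iD in auto)
  finally show ?thesis by (simp add: I_def)
 qed
 have igb: "L1 (\<lambda>x. ?b x * g x)"
  by (rule bochner_bound[OF g_int]) (auto simp: abs_mult bumpd_bounds mult_left_le_one_le)
 have G: "\<bar>g x0 * I - (LBINT x. ?b x * g x)\<bar> \<le> \<eta> * I"
 proof (rule dist_avg[OF igb])
  fix x assume "x \<in> cball x0 \<delta>"
  then show "\<bar>g x0 - g x\<bar> \<le> \<eta>" using d'(2)[of x] \<delta> by (simp add: dist_commute abs_minus_commute)
 qed
 have "(\<lambda>k. LBINT x. u x * tlap s (e k) ?b x) \<longlonglongrightarrow> \<delta> powr (- 2 * s) * (LBINT x. u x * lapb s ((x - x0) /\<^sub>R \<delta>))"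
  by (intro tlap_bumpd_weak_tendsto s \<delta> u_meas u_L2 less_imp_le[OF e(1)] e(2))
 also have "(LBINT x. u x * lapb s ((x - x0) /\<^sub>R \<delta>)) = \<delta> powr (2 * s) * (LBINT x. g x * ?b x)"
 proof (rule eq[OF \<delta>(1)])
  have "cball x0 \<delta> \<subseteq> ball x0 r0" using \<delta> R by auto
  then show "cball x0 \<delta> \<subseteq> \<Omega>" using r0(2) by blast
 qed
 also have "\<delta> powr (- 2 * s) * (\<delta> powr (2 * s) * (LBINT x. g x * ?b x)) = (LBINT x. ?b x * g x)"
  using \<delta>(1) by (simp add: powr_minus mult.commute)
 finally have lim: "(\<lambda>k. LBINT x. u x * tlap s (e k) ?b x) \<longlonglongrightarrow> (LBINT x. ?b x * g x)" .
 have "\<forall>\<^sub>F k in sequentially. \<bar>(LBINT x. u x * tlap s (e k) ?b x) - (LBINT x. ?b x * g x)\<bar> < \<eta> * I"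
  using tendstoD[OF lim, of "\<eta> * I"] \<eta> I by (simp add: dist_real_def)
 moreover have "\<forall>\<^sub>F k in sequentially. e k < R" using order_tendstoD(2)[OF e(2)] R by blast
 ultimately have "\<forall>\<^sub>F k in sequentially. \<bar>tlap s (e k) u x0 - g x0\<bar> < \<epsilon>"
 proof eventually_elim
  case (elim k)
  have ek: "0 < e k" "e k \<le> R" "e k \<le> 1" using e(1)[of k] elim(2) R by auto
  note sym = tlap_bumpd_symmetric[OF s(1) ek(1,3) \<delta>(1) u_meas u_L2, of x0]
  have "\<bar>tlap s (e k) u x0 * I - (LBINT x. ?b x * tlap s (e k) u x)\<bar> \<le> \<eta> * I"
  proof (rule dist_avg[OF sym(1)])
   fix x assume "x \<in> cball x0 \<delta>"
   then show "\<bar>tlap s (e k) u x0 - tlap s (e k) u x\<bar> \<le> \<eta>" using d(2)[OF _ ek(1,2), of "x0 - x"] \<delta> by (simp add: dist_norm)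
  qed
  then have "\<bar>tlap s (e k) u x0 * I - g x0 * I\<bar> \<le> 3 * \<eta> * I" using G elim(1) unfolding sym(2) by linarith
  then have "\<bar>tlap s (e k) u x0 - g x0\<bar> * I \<le> 3 * \<eta> * I" using I by (simp add: abs_mult left_diff_distrib[symmetric])
  then have "\<bar>tlap s (e k) u x0 - g x0\<bar> \<le> 3 * \<eta>" using I by simp
  then show ?case using \<epsilon> by (simp add: \<eta>_def)
 qed
 then show "\<exists>n0. \<forall>n\<ge>n0. norm (tlap s (e n) u x0 - g x0) < \<epsilon>" by (simp add: eventually_sequentially)
qed

end

subsection \<open>Reconstruction\<close>

lemma frac_integral_eq_tlap:
 fixes w :: "real^'n \<Rightarrow> real"
 assumes s: "0 < s" and e: "0 < e" "e \<le> 1" and w: "w \<in> borel_measurable borel" "L2 w"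
 shows "(LINT y:(- ball x e)|lborel. (w x - w y) / norm (x - y) powr (real CARD('n) + 2 * s)) = tlap s e w x"
proof -
 have "(LINT y:(- ball x e)|lborel. (w x - w y) / norm (x - y) powr (real CARD('n) + 2 * s)) = (LBINT y. (w x - w y) * kern s e (x - y))"
  unfolding set_lebesgue_integral_def
  by (intro bochner_cong[OF refl]) (auto simp: kern_def indicator_def dist_norm)
 also have "\<dots> = (LBINT z. (w x - w (x + z)) * kern s e (x - (x + z)))"
  by (rule integral_lborel_translate[symmetric])
 also have "\<dots> = tlap s e w x"
  using tlap_eq[OF s e(1) tlap_conv(2)[OF s e w]] by (simp add: kern_minus)
 finally show ?thesis .
qed

lemma has_frac_laplacianI:
 fixes w :: "real^'n \<Rightarrow> real"
 assumes s: "0 < s" and w: "w \<in> borel_measurable borel" "L2 w"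
  and lim: "\<And>e. (\<And>k. 0 < e k) \<Longrightarrow> e \<longlonglongrightarrow> 0 \<Longrightarrow> (\<lambda>k. tlap s (e k) w x) \<longlonglongrightarrow> l"
 shows "has_frac_laplacian s w x (frac_const CARD('n) s * l)"
proof -
 have "((\<lambda>e. tlap s e w x) \<longlongrightarrow> l) (at_right 0)"
  unfolding tendsto_at_iff_sequentially comp_def using lim by auto
 then have "((\<lambda>e. frac_const CARD('n) s * tlap s e w x) \<longlongrightarrow> frac_const CARD('n) s * l) (at_right 0)"
  by (rule tendsto_mult_left)
 moreover have "\<forall>\<^sub>F e in at_right (0::real). e \<in> {0<..<1}" by (rule eventually_at_right_real) simp
 then have "\<forall>\<^sub>F e in at_right 0. frac_const CARD('n) s * tlap s e w x
   = frac_const CARD('n) s * (LINT y:(- ball x e)|lborel. (w x - w y) / norm (x - y) powr (real CARD('n) + 2 * s))"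
  by eventually_elim (simp add: frac_integral_eq_tlap[OF s _ _ w])
 ultimately show ?thesis unfolding has_frac_laplacian_def by (rule Lim_transform_eventually)
qed

lemma frac_laplacian_eq: "has_frac_laplacian s w x l \<Longrightarrow> frac_laplacian s w x = l"
 unfolding frac_laplacian_def has_frac_laplacian_def
 by (rule the_equality) (auto intro: tendsto_unique[OF trivial_limit_at_right_real])

lemma energy_space_cong_AE:
 assumes \<Omega>: "open \<Omega>" and u: "u \<in> energy_space s \<Omega>" and [measurable]: "w \<in> borel_measurable borel" and eq: "AE x in lborel. w x = u x"
 shows "w \<in> energy_space s \<Omega>"
proof -
 note [measurable] = eweight_measurable[OF \<Omega>]
 have [measurable]: "u \<in> borel_measurable borel" and u2: "L2 u"
  and ue: "integrable lborel2 (\<lambda>p. (u (fst p) - u (snd p))\<^sup>2 * eweight s \<Omega> p)"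
  using u by (auto simp: energy_space_iff)
 have "L2 w = L2 u"
  by (rule integrable_cong_AE) (use eq in \<open>auto elim: eventually_mono\<close>)
 moreover have "integrable lborel2 (\<lambda>p. (w (fst p) - w (snd p))\<^sup>2 * eweight s \<Omega> p)
   = integrable lborel2 (\<lambda>p. (u (fst p) - u (snd p))\<^sup>2 * eweight s \<Omega> p)"
 proof (rule integrable_cong_AE)
  show "AE p in lborel2. (w (fst p) - w (snd p))\<^sup>2 * eweight s \<Omega> p = (u (fst p) - u (snd p))\<^sup>2 * eweight s \<Omega> p"
   using AE_lborel_pair_both[OF eq] by eventually_elim simp
 qed measurable
 ultimately show ?thesis using u2 ue by (simp add: energy_space_iff)
qed

lemma potential_bounded_measurable:
 fixes q :: "real^'n \<Rightarrow> real"
 assumes "bounded \<Omega>" "open \<Omega>" and q: "continuous_on (closure \<Omega>) q"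
 shows "(\<lambda>x. indicator \<Omega> x * q x) \<in> borel_measurable borel" and "\<exists>B\<ge>0. \<forall>x. \<bar>indicator \<Omega> x * q x\<bar> \<le> B"
proof -
 have "continuous_on \<Omega> q" using q closure_subset by (rule continuous_on_subset)
 then have "(\<lambda>x. indicator \<Omega> x *\<^sub>R q x) \<in> borel_measurable borel"
  using assms(2) by (intro borel_measurable_continuous_on_indicator) auto
 then show "(\<lambda>x. indicator \<Omega> x * q x) \<in> borel_measurable borel" by simp
 have "compact (q ` closure \<Omega>)" using assms(1) q by (intro compact_continuous_image) simp_all
 then obtain B where B: "\<And>x. x \<in> closure \<Omega> \<Longrightarrow> \<bar>q x\<bar> \<le> B"
  using compact_imp_bounded[of "q ` closure \<Omega>"] unfolding bounded_iff by (auto simp: real_norm_def)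
 have "\<bar>indicator \<Omega> x * q x\<bar> \<le> \<bar>B\<bar>" for x
  using B[of x] closure_subset[of \<Omega>] by (cases "x \<in> \<Omega>") auto
 then show "\<exists>B\<ge>0. \<forall>x. \<bar>indicator \<Omega> x * q x\<bar> \<le> B" by (intro exI[of _ "\<bar>B\<bar>"]) auto
qed

text \<open>The equation enters as a \<open>local_solution\<close> with source -q u divided by
  \<open>frac_const\<close>. It is used twice: for u, to obtain the continuous representative w, and
  then for w, whose source is now continuous as well, to evaluate the principal value.\<close>

lemma interior_regularity:
 fixes u q :: "real^'n \<Rightarrow> real"
 assumes s: "0 < s" "s < 1" and \<Omega>: "bounded \<Omega>" "open \<Omega>" and q: "continuous_on (closure \<Omega>) q"
  and u: "robin_weak_solution s \<Omega> q \<theta> f u"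
 obtains w where "w \<in> energy_space s \<Omega>" "AE x in lborel. w x = u x" "continuous_on \<Omega> w"
  "\<And>x. x \<in> \<Omega> \<Longrightarrow> has_frac_laplacian s w x (- q x * w x)"
proof -
 let ?C = "frac_const CARD('n) s" and ?Q = "\<lambda>x. indicator \<Omega> x * q x"
 have C: "0 < ?C" by (rule frac_const_pos[OF s])
 have Qm [measurable]: "?Q \<in> borel_measurable borel" by (rule potential_bounded_measurable[OF \<Omega> q])
 obtain B where B: "0 \<le> B" "\<And>x. \<bar>?Q x\<bar> \<le> B" using potential_bounded_measurable(2)[OF \<Omega> q] by blast
 note uw = u[unfolded robin_weak_solution_wsol]
 have ue: "u \<in> energy_space s \<Omega>" using u by (simp add: robin_weak_solution_def)
 then have um [measurable]: "u \<in> borel_measurable borel" and u2: "L2 u" by (auto simp: energy_space_iff)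
 have [measurable]: "\<Omega> \<in> sets borel" using \<Omega> by simp
 have loc: "local_solution s (B / ?C) \<Omega> v (\<lambda>x. - (?Q x * v x) / ?C)"
  if vm [measurable]: "v \<in> borel_measurable borel" and vu: "AE x in lborel. v x = u x" for v
 proof
  have "L2 v = L2 u"
   by (rule integrable_cong_AE) (use vu in \<open>auto elim: eventually_mono\<close>)
  then show v2: "L2 v" using u2 by simp
  show "L1 (\<lambda>y. indicator \<Omega> y * v y)"
   using emeasure_bounded_finite[OF \<Omega>(1)] by (intro L2_set_integrable v2) auto
  show "\<bar>- (?Q y * v y) / ?C\<bar> \<le> B / ?C * \<bar>indicator \<Omega> y * v y\<bar>" for y
  proof -
   have "\<bar>?Q y\<bar> * \<bar>indicator \<Omega> y * v y\<bar> \<le> B * \<bar>indicator \<Omega> y * v y\<bar>" by (intro mult_right_mono B) simp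
   moreover have "\<bar>?Q y * v y\<bar> = \<bar>?Q y\<bar> * \<bar>indicator \<Omega> y * v y\<bar>" by (auto simp: abs_mult indicator_def)
   ultimately show ?thesis using C by (simp add: divide_right_mono)
  qed
  fix c :: "real^'n" and t :: real assume t: "0 < t" and c: "cball c t \<subseteq> \<Omega>"
  have "?C * t powr (- 2 * s) * (LBINT x. u x * lapb s ((x - c) /\<^sub>R t)) = - (LBINT x. ?Q x * u x * bumpd c t x)"
   by (rule wsol_interior[OF s \<Omega>(2) t c _ _ uw]) auto
  moreover have "(LBINT x. u x * lapb s ((x - c) /\<^sub>R t)) = (LBINT x. v x * lapb s ((x - c) /\<^sub>R t))"
   by (rule integral_cong_AE) (use vu in \<open>auto elim: eventually_mono\<close>)
  moreover have "(LBINT x. ?Q x * u x * bumpd c t x) = (LBINT x. ?Q x * v x * bumpd c t x)"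
   by (rule integral_cong_AE) (use vu in \<open>auto elim: eventually_mono\<close>)
  ultimately have eq: "?C * t powr (- 2 * s) * (LBINT x. v x * lapb s ((x - c) /\<^sub>R t)) = - (LBINT x. ?Q x * v x * bumpd c t x)"
   by simp
  have "(LBINT x. - (?Q x * v x) / ?C * bumpd c t x) = (LBINT x. (- 1 / ?C) * (?Q x * v x * bumpd c t x))"
   by (simp add: mult.assoc)
  also have "\<dots> = (- 1 / ?C) * (LBINT x. ?Q x * v x * bumpd c t x)" by (rule integral_mult_right_zero)
  also have "\<dots> = t powr (- 2 * s) * (LBINT x. v x * lapb s ((x - c) /\<^sub>R t))" using eq C by (simp add: field_simps)
  finally have "t powr (2 * s) * (LBINT x. - (?Q x * v x) / ?C * bumpd c t x)
    = (t powr (2 * s) * t powr (- 2 * s)) * (LBINT x. v x * lapb s ((x - c) /\<^sub>R t))" by simp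
  also have "t powr (2 * s) * t powr (- 2 * s) = 1" using t by (simp only: powr_add[symmetric]) simp
  finally show "(LBINT x. v x * lapb s ((x - c) /\<^sub>R t)) = t powr (2 * s) * (LBINT x. - (?Q x * v x) / ?C * bumpd c t x)" by simp
 qed (use s \<Omega> B C in auto)
 obtain w where wm: "w \<in> borel_measurable borel" and wc: "continuous_on \<Omega> w" and wu: "AE x in lborel. w x = u x"
  using local_solution.continuous_representative[OF loc[OF um]] by auto
 have "continuous_on \<Omega> (\<lambda>x. - (q x * w x) / ?C)"
  using C by (intro continuous_intros wc continuous_on_subset[OF q closure_subset]) auto
 then have gc: "continuous_on \<Omega> (\<lambda>x. - (?Q x * w x) / ?C)" by (rule continuous_on_eq) simp
 interpret W: continuous_local_solution s "B / ?C" \<Omega> w "\<lambda>x. - (?Q x * w x) / ?C"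
  by (intro continuous_local_solution.intro continuous_local_solution_axioms.intro loc wm wu wc gc)
 show thesis
 proof
  show "w \<in> energy_space s \<Omega>" by (rule energy_space_cong_AE[OF \<Omega>(2) ue wm wu])
  fix x assume x: "x \<in> \<Omega>"
  have "has_frac_laplacian s w x (?C * (- (?Q x * w x) / ?C))"
   by (rule has_frac_laplacianI[OF s(1) wm W.u_L2 W.tlap_tendsto_source[OF x]])
  then show "has_frac_laplacian s w x (- q x * w x)" using C x by simp
 qed (use wu wc in auto)
qed

text \<open>Where u vanishes so does q u, hence the equation makes (-\<Delta>)^s u vanish there too.
  Unique continuation gives u = 0 almost everywhere, and the weak formulation then leaves f
  orthogonal to all bumps.\<close>

lemma solution_unique_continuation:
 fixes u q :: "real^'n \<Rightarrow> real"
 assumes s: "0 < s" "s < 1" and \<Omega>: "open \<Omega>" and f: "L2_fun (- \<Omega>) f"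
  and u: "robin_weak_solution s \<Omega> q \<theta> f u" and x: "x \<in> \<Omega>"
  and r: "0 < r" and z: "AE y in lborel. y \<in> ball x r \<longrightarrow> u y = 0"
 shows "AE y in lborel. y \<in> - \<Omega> \<longrightarrow> f y = 0"
proof -
 note uw = u[unfolded robin_weak_solution_wsol]
 have um [measurable]: "u \<in> borel_measurable borel" and u2: "L2 u"
  using u by (auto simp: robin_weak_solution_def energy_space_iff)
 obtain r' where r': "0 < r'" "ball x r' \<subseteq> \<Omega>" using \<Omega> x open_contains_ball by blast
 define \<rho> where "\<rho> = min r r' / 3"
 have \<rho>: "0 < \<rho>" "3 * \<rho> \<le> r" "3 * \<rho> \<le> r'" using r r' by (auto simp: \<rho>_def)
 have u0: "AE y in lborel. u y = 0"
 proof (rule unique_continuation[OF s \<rho>(1) um u2])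
  show "AE y in lborel. y \<in> ball x (3 * \<rho>) \<longrightarrow> u y = 0"
   using z by eventually_elim (use \<rho> in auto)
  fix c t assume c: "c \<in> ball x \<rho>" and t: "0 < t" "t < \<rho>"
  have sub: "y \<in> ball x r \<and> y \<in> ball x r'" if "y \<in> cball c t" for y
   using c t \<rho> that dist_triangle[of x y c] by auto
  then have "cball c t \<subseteq> \<Omega>" using r'(2) by blast
  then have "frac_const CARD('n) s * t powr (- 2 * s) * (LBINT y. u y * lapb s ((y - c) /\<^sub>R t)) = - (LBINT y. indicator \<Omega> y * q y * u y * bumpd c t y)"
   by (intro wsol_interior[OF s \<Omega> t(1) _ _ _ uw]) auto
  also have "(LBINT y. indicator \<Omega> y * q y * u y * bumpd c t y) = 0"
  proof (rule integral_eq_zero_AE)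
   show "AE y in lborel. indicator \<Omega> y * q y * u y * bumpd c t y = 0"
    using z by eventually_elim (use sub bumpd_outside[OF t(1)] in auto)
  qed
  finally show "(LBINT y. u y * lapb s ((y - c) /\<^sub>R t)) = 0"
   using frac_const_pos[OF s, of "CARD('n)"] t by simp
 qed
 have "AE y in lborel. indicator (- \<Omega>) y * f y = 0"
 proof (rule wsol_zero_data[OF s \<Omega> _ _ uw u0])
  show "(\<lambda>y. indicator (- \<Omega>) y * f y) \<in> borel_measurable borel"
   using f by (simp add: L2_fun_def set_borel_measurable_def)
  have "(\<lambda>y. (indicator (- \<Omega>) y * f y)\<^sup>2) = (\<lambda>y. indicator (- \<Omega>) y *\<^sub>R (f y)\<^sup>2)" by (auto simp: fun_eq_iff indicator_def)
  then show "L1 (\<lambda>y. (indicator (- \<Omega>) y * f y)\<^sup>2)"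
   using f by (simp add: L2_fun_def set_integrable_def)
 qed
 then show ?thesis by eventually_elim auto
qed

lemma robin_solution_unique:
 fixes u v q :: "real^'n \<Rightarrow> real"
 assumes s: "0 < s" "s < 1" and \<Omega>: "bounded \<Omega>" "open \<Omega>"
  and \<theta>: "\<theta>\<^sub>0 > 0" "Linf_fun (- \<Omega>) \<theta>" "AE x in lborel. x \<in> - \<Omega> \<longrightarrow> \<theta> x \<ge> \<theta>\<^sub>0"
  and q: "continuous_on (closure \<Omega>) q" "q\<^sub>0 > 0" "\<forall>x\<in>closure \<Omega>. q x \<ge> q\<^sub>0"
  and uv: "robin_weak_solution s \<Omega> q \<theta> f u" "robin_weak_solution s \<Omega> q \<theta> f v"
 shows "AE x in lborel. u x = v x"
proof -
 let ?Q = "\<lambda>x. indicator \<Omega> x * q x" and ?T = "\<lambda>x. indicator (- \<Omega>) x * \<theta> x"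
 obtain B where B: "0 \<le> B" "\<And>x. \<bar>?Q x\<bar> \<le> B" using potential_bounded_measurable(2)[OF \<Omega> q(1)] by blast
 obtain M where M: "AE x in lborel. x \<in> - \<Omega> \<longrightarrow> \<bar>\<theta> x\<bar> \<le> M" using \<theta>(2) by (auto simp: Linf_fun_def)
 have qpos: "x \<in> \<Omega> \<Longrightarrow> 0 < q x" for x using q closure_subset[of \<Omega>] by force
 show ?thesis
 proof (rule wsol_unique[OF s \<Omega>(2) potential_bounded_measurable(1)[OF \<Omega> q(1)] _ _ _ _ _ _ uv[unfolded robin_weak_solution_wsol], where B="max B \<bar>M\<bar>"])
  show "?T \<in> borel_measurable borel" using \<theta>(2) by (simp add: Linf_fun_def set_borel_measurable_def)
  show "AE x in lborel. \<bar>?Q x\<bar> \<le> max B \<bar>M\<bar>" using B by (intro AE_I2) (simp add: le_max_iff_disj)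
  show "AE x in lborel. \<bar>?T x\<bar> \<le> max B \<bar>M\<bar>" using M by eventually_elim (use B(1) in \<open>auto simp: indicator_def\<close>)
  show "AE x in lborel. 0 \<le> ?Q x" using qpos by (intro AE_I2) (auto simp: indicator_def less_imp_le)
  show "AE x in lborel. 0 \<le> ?T x" using \<theta>(3) by eventually_elim (use \<theta>(1) in \<open>auto simp: indicator_def\<close>)
  show "AE x in lborel. ?Q x \<noteq> 0 \<or> ?T x \<noteq> 0" using \<theta>(3)
  proof eventually_elim
   case (elim x)
   show ?case using elim \<theta>(1) qpos[of x] by (cases "x \<in> \<Omega>") auto
  qed
 qed
qed

lemma robin_data_determine:
 fixes u\<^sub>1 u\<^sub>2 q\<^sub>1 q\<^sub>2 :: "real^'n \<Rightarrow> real"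
 assumes s: "0 < s" "s < 1" and \<Omega>: "bounded \<Omega>" "open \<Omega>" and \<theta>: "Linf_fun (- \<Omega>) \<theta>"
  and u: "robin_weak_solution s \<Omega> q\<^sub>1 \<theta> f u\<^sub>1" "robin_weak_solution s \<Omega> q\<^sub>2 \<theta> f u\<^sub>2"
  and eq: "AE x in lborel. x \<notin> \<Omega> \<longrightarrow> u\<^sub>1 x = u\<^sub>2 x"
 shows "AE x in lborel. u\<^sub>1 x = u\<^sub>2 x"
proof -
 have ue: "u\<^sub>1 \<in> energy_space s \<Omega>" "u\<^sub>2 \<in> energy_space s \<Omega>" using u by (auto simp: robin_weak_solution_def)
 have "(\<lambda>x. u\<^sub>1 x - u\<^sub>2 x) \<in> energy_space s \<Omega>" by (rule energy_space_diff[OF \<Omega>(2) ue])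
 then have d: "(\<lambda>x. u\<^sub>1 x - u\<^sub>2 x) \<in> borel_measurable borel" "L1 (\<lambda>x. (u\<^sub>1 x - u\<^sub>2 x)\<^sup>2)" by (auto simp: energy_space_iff)
 obtain M where M: "\<And>x. x \<in> \<Omega> \<Longrightarrow> norm x \<le> M" using \<Omega>(1) by (auto simp: bounded_iff)
 \<comment> \<open>At norm |M| + 3 the ball of radius 3 about x0 misses \<Omega>. It contains all
   the test bumps, whose centres are within 1 of x0 and whose radii are below 1.\<close>
 obtain x0 :: "real^'n" where x0: "norm x0 = \<bar>M\<bar> + 3" using vector_choose_size[of "\<bar>M\<bar> + 3"] by auto
 have far: "y \<notin> \<Omega>" if "dist x0 y < 3" for y
 proof
  assume "y \<in> \<Omega>"
  then show False using M[of y] that x0 norm_triangle_sub[of x0 y] by (simp add: dist_norm)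
 qed
 have "AE y in lborel. u\<^sub>1 y - u\<^sub>2 y = 0"
 proof (rule unique_continuation[OF s zero_less_one d])
  show "AE y in lborel. y \<in> ball x0 (3 * 1) \<longrightarrow> u\<^sub>1 y - u\<^sub>2 y = 0"
   using eq by eventually_elim (use far in auto)
  fix c t assume c: "c \<in> ball x0 1" and t: "0 < t" "t < (1::real)"
  have "cball c t \<inter> \<Omega> = {}"
  proof -
   have "y \<notin> \<Omega>" if "y \<in> cball c t" for y
    using far[of y] that c t dist_triangle[of x0 y c] by auto
   then show ?thesis by blast
  qed
  then show "(LBINT y. (u\<^sub>1 y - u\<^sub>2 y) * lapb s ((y - c) /\<^sub>R t)) = 0"
   using \<theta> by (intro wsol_exterior[OF s \<Omega>(2) t(1) _ _ _ _ u[unfolded robin_weak_solution_wsol] eq])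
    (auto simp: Linf_fun_def set_borel_measurable_def)
 qed
 then show ?thesis by eventually_elim simp
qed

theorem theorem3p14:
 fixes \<Omega> :: "(real^'n) set" and s \<theta>\<^sub>0 :: real and \<theta> \<theta>' :: "real^'n \<Rightarrow> real"
 assumes "0 < s" "s < 1"
  and "\<Omega> \<noteq> {}" "bounded \<Omega>" "open \<Omega>" "lipschitz_boundary \<Omega>"
  and "\<theta>\<^sub>0 > 0" "Linf_fun (- \<Omega>) \<theta>" "AE x in lborel. x \<in> - \<Omega> \<longrightarrow> \<theta> x \<ge> \<theta>\<^sub>0"
  and "Linf_fun (- \<Omega>) \<theta>'" "AE x in lborel. x \<in> - \<Omega> \<longrightarrow> \<theta> x - \<theta>' x \<noteq> 0"
 shows "\<exists>\<Phi> :: (real^'n \<Rightarrow> real) \<Rightarrow> (real^'n \<Rightarrow> real) \<Rightarrow> (real^'n \<Rightarrow> real).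
  \<forall>(q :: real^'n \<Rightarrow> real) q\<^sub>0 f u Rf.
   continuous_on (closure \<Omega>) q \<and> q\<^sub>0 > 0 \<and> (\<forall>x\<in>closure \<Omega>. q x \<ge> q\<^sub>0) \<and>
   L2_fun (- \<Omega>) f \<and> robin_weak_solution s \<Omega> q \<theta> f u \<and> robin_to_robin s \<Omega> q \<theta> \<theta>' f Rf \<and>
   (s < 1/2 \<or> 1/2 \<le> s \<and> robin_data_regular s \<Omega> \<theta> \<theta>' f Rf)
   \<longrightarrow>
   (AE x in lborel. x \<in> \<Omega> \<longrightarrow> u x = \<Phi> f Rf x) \<and>
   (\<exists>w \<in> energy_space s \<Omega>. (AE x in lborel. w x = u x) \<and> continuous_on \<Omega> w \<and>
     (\<forall>x\<in>\<Omega>. (\<exists>l. has_frac_laplacian s w x l) \<and>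
         (w x \<noteq> 0 \<longrightarrow> q x = - frac_laplacian s w x / w x)) \<and>
     (\<not> (AE x in lborel. x \<in> - \<Omega> \<longrightarrow> f x = 0) \<longrightarrow> \<Omega> \<subseteq> closure {x \<in> \<Omega>. w x \<noteq> 0}))"
proof -
 note s = assms(1,2) and \<Omega> = assms(4,5) and \<theta> = assms(7-9) and \<theta>' = assms(11)
 \<comment> \<open>The map has to depend on (f, Rf) alone and to serve every q, so q becomes one
   more unknown, quantified inside the choice of u below.\<close>
 define adm where "adm q f Rf u \<longleftrightarrow> continuous_on (closure \<Omega>) q \<and> (\<exists>q\<^sub>0>0. \<forall>x\<in>closure \<Omega>. q x \<ge> q\<^sub>0) \<and>
   robin_weak_solution s \<Omega> q \<theta> f u \<and> robin_to_robin s \<Omega> q \<theta> \<theta>' f Rf" for q f Rf u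
 \<comment> \<open>\<open>robin_to_robin\<close> only asserts that some weak solution produces the
   data; uniqueness for the given q identifies it with u.\<close>
 have data: "AE x in lborel. x \<in> - \<Omega> \<longrightarrow> Rf x = f x + (\<theta>' x - \<theta> x) * u x" if a: "adm q f Rf u" for q f Rf u
 proof -
  obtain q\<^sub>0 where q: "continuous_on (closure \<Omega>) q" "q\<^sub>0 > 0" "\<forall>x\<in>closure \<Omega>. q x \<ge> q\<^sub>0"
   using a by (auto simp: adm_def)
  obtain v where v: "robin_weak_solution s \<Omega> q \<theta> f v" and d: "AE x in lborel. x \<in> - \<Omega> \<longrightarrow> Rf x = f x + (\<theta>' x - \<theta> x) * v x"
   using a by (auto simp: adm_def robin_to_robin_def)
  have "AE x in lborel. u x = v x" by (rule robin_solution_unique[OF s \<Omega> \<theta> q _ v]) (use a in \<open>simp add: adm_def\<close>)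
  with d show ?thesis by eventually_elim simp
 qed
 have unique: "AE x in lborel. u x = u' x" if a: "adm q f Rf u" "adm q' f Rf u'" for q q' f Rf u u'
 proof (rule robin_data_determine[OF s \<Omega> \<theta>(2)])
  show "robin_weak_solution s \<Omega> q \<theta> f u" "robin_weak_solution s \<Omega> q' \<theta> f u'" using a by (auto simp: adm_def)
  show "AE x in lborel. x \<notin> \<Omega> \<longrightarrow> u x = u' x"
   using data[OF a(1)] data[OF a(2)] \<theta>'
  proof eventually_elim
   case (elim x)
   show ?case
   proof
    assume "x \<notin> \<Omega>"
    then have "(\<theta>' x - \<theta> x) * u x = (\<theta>' x - \<theta> x) * u' x" "\<theta>' x - \<theta> x \<noteq> 0" using elim by auto
    then show "u x = u' x" by simp
   qed
  qed
 qed
 show ?thesis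
 \<comment> \<open>The chosen function solves the problem for some potential q', possibly different
   from q; \<open>unique\<close> shows that equal data still give the same function almost
   everywhere.\<close>
 proof (intro exI[of _ "\<lambda>f Rf. SOME u. \<exists>q. adm q f Rf u"] allI impI, elim conjE)
  fix q :: "real^'n \<Rightarrow> real" and q\<^sub>0 :: real and f u Rf :: "real^'n \<Rightarrow> real"
  assume q: "continuous_on (closure \<Omega>) q" "q\<^sub>0 > 0" "\<forall>x\<in>closure \<Omega>. q x \<ge> q\<^sub>0"
   and f: "L2_fun (- \<Omega>) f" and u: "robin_weak_solution s \<Omega> q \<theta> f u" and Rf: "robin_to_robin s \<Omega> q \<theta> \<theta>' f Rf"
  have a: "adm q f Rf u" unfolding adm_def using q u Rf by blast
  then have "\<exists>u q. adm q f Rf u" by (intro exI)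
  then have "\<exists>q. adm q f Rf (SOME u. \<exists>q. adm q f Rf u)" by (rule someI_ex)
  then obtain q' where a': "adm q' f Rf (SOME u. \<exists>q. adm q f Rf u)" by (rule exE)
  have 1: "AE x in lborel. x \<in> \<Omega> \<longrightarrow> u x = (SOME u. \<exists>q. adm q f Rf u) x"
   using unique[OF a a'] by eventually_elim simp
  obtain w where w: "w \<in> energy_space s \<Omega>" "AE x in lborel. w x = u x" "continuous_on \<Omega> w"
   "\<And>x. x \<in> \<Omega> \<Longrightarrow> has_frac_laplacian s w x (- q x * w x)"
   by (rule interior_regularity[OF s \<Omega> q(1) u], rule that)
  have dense: "\<Omega> \<subseteq> closure {x \<in> \<Omega>. w x \<noteq> 0}" if nz: "\<not> (AE x in lborel. x \<in> - \<Omega> \<longrightarrow> f x = 0)"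
  proof
   fix x assume x: "x \<in> \<Omega>"
   show "x \<in> closure {x \<in> \<Omega>. w x \<noteq> 0}"
   proof (rule ccontr)
    assume "x \<notin> closure {x \<in> \<Omega>. w x \<noteq> 0}"
    then obtain e where e: "0 < e" "\<And>y. y \<in> \<Omega> \<Longrightarrow> w y \<noteq> 0 \<Longrightarrow> e \<le> dist y x"
     unfolding closure_approachable by force
    obtain e' where e': "0 < e'" "ball x e' \<subseteq> \<Omega>" using \<Omega>(2) x open_contains_ball by blast
    have "w y = 0" if "y \<in> ball x (min e e')" for y
     using that e(2)[of y] e'(2) by (force simp: dist_commute)
    then have "AE y in lborel. y \<in> ball x (min e e') \<longrightarrow> u y = 0"
     using w(2) by (auto elim!: eventually_mono)
    with nz show False using solution_unique_continuation[OF s \<Omega>(2) f u x, of "min e e'"] e(1) e'(1) by simp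
   qed
  qed
  have "\<forall>x\<in>\<Omega>. (\<exists>l. has_frac_laplacian s w x l) \<and> (w x \<noteq> 0 \<longrightarrow> q x = - frac_laplacian s w x / w x)"
   using w(4) frac_laplacian_eq[OF w(4)] by auto
  then show "(AE x in lborel. x \<in> \<Omega> \<longrightarrow> u x = (SOME u. \<exists>q. adm q f Rf u) x) \<and>
   (\<exists>w \<in> energy_space s \<Omega>. (AE x in lborel. w x = u x) \<and> continuous_on \<Omega> w \<and>
     (\<forall>x\<in>\<Omega>. (\<exists>l. has_frac_laplacian s w x l) \<and> (w x \<noteq> 0 \<longrightarrow> q x = - frac_laplacian s w x / w x)) \<and>
     (\<not> (AE x in lborel. x \<in> - \<Omega> \<longrightarrow> f x = 0) \<longrightarrow> \<Omega> \<subseteq> closure {x \<in> \<Omega>. w x \<noteq> 0}))"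
   by (intro conjI bexI[OF _ w(1)] impI 1 w(2,3) dense)
 qed
qed

end
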